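(* For every fixed $\lambda>0$, as $d\to\infty$, \begin{align*} \lim_{d\to\infty}\mathrm{Bias}^2(\lambda)&=\alpha^2(1-\pi+\lambda\pi\theta_1)^2,\\ \lim_{d\to\infty}\mathrm{Var}(\lambda)&=\alpha^2\pi\left[1-\pi+(\pi-1)(2\lambda-\delta)\theta_1-\pi\lambda^2\theta_1^2+\lambda(\lambda-\delta+\pi\delta)\theta_2\right]+\sigma^2\pi\delta(\theta_1-\lambda\theta_2),\\ \lim_{d\to\infty}\Sigma_{\mathrm{label}}(\lambda)&=\sigma^2\pi\delta(\theta_1-\lambda\theta_2),\\ \lim_{d\to\infty}\Sigma_{\mathrm{sample}}(\lambda)&=\alpha^2\pi\left[-\lambda^2\theta_1^2+\lambda^2\theta_2+(1-\pi)\delta(\theta_1-\lambda\theta_2)\right],\\ \lim_{d\to\infty}\Sigma_{\mathrm{init}}(\lambda)&=\alpha^2\pi(1-\pi)(1-\lambda\theta_1)^2, \end{align*} where $\theta_i=\theta_i(\pi\delta,\lambda)$, and therefore $$\lim_{d\to\infty}\mathrm{MSE}(\lambda)=\alpha^2\left\{1-\pi+\pi\delta\left(1-\pi+\tfrac{\sigma^2}{\alpha^2}\right)\theta_1+\left[\lambda-\delta\left(1-\pi+\tfrac{\sigma^2}{\alpha^2}\right)\right]\lambda\pi\theta_2\right\}+\sigma^2 .$$ Moreover, for any fixed $\delta>0$ and $\pi\in(0,1]$, except when both $\pi=1$ and $\sigma=0$, the limiting MSE as a function of $\lambda\in(0,\infty)$ has a unique minimum, at $\lambda^*=\delta(1-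\pi+\sigma^2/\alpha^2)$.
   Context: Setting. $\alpha>0$, $\sigma\ge 0$ are fixed. For each $d$ let $p=p_d\le d$ and $n=n_d$, with $p/d\to\pi\in(0,1]$ and $d/n\to\delta\in(0,\infty)$. $X\in\mathbb{R}^{n\times d}$ has i.i.d. entries (from a fixed distribution) with mean $0$, variance $1$ and finite $(8+\eta)$-th moment for some $\eta>0$. $\theta\sim N(0,\alpha^2 I_d/d)$, $\mathcal{E}\sim N(0,\sigma^2 I_n)$, $Y=X\theta+\mathcal{E}$. $W$ is a $p\times d$ random matrix uniformly distributed on $\{W:WW^\top=I_p\}$. The test point $x\in\mathbb{R}^d$ is distributed as a row of $X$. $X,\mathcal{E},W,\theta,x$ are independent. The predictor is $$\hat f(x)=x^\top W^\top\left(\tfrac{1}{n}WX^\top XW^\top+\lambda I_p\right)^{-1}\tfrac1n WX^\top Y .$$ Quantities. $\mathrm{MSE}(\lambda)=\mathbb{E}_{\theta,x,X,\mathcal{E},W}(\hat f(x)-x^\top\theta)^2+\sigma^2$; $\mathrm{Bias}^2(\lambda)=\mathbb{E}_{\theta,x}(\mathbb{E}_{X,\mathcal{E},W}\hat f(x)-x^\top\theta)^2$; $\mathrm{Var}(\lambda)=\mathbb{E}_{\theta,x}\mathbb{E}_{X,\mathcal{E},W}(\hat f(x)-\mathbb{E}_{X,\mathcal{E},W}\hat f(x))^2$; $\Sigma_{\mathrm{label}}=\mathbb{E}_{\theta,x}\mathbb{E}_{X,W,\mathcal{E}}(\hat f(x)-\mathbb{E}_{\mathcal{E}}\hat f(x))^2$;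 $\Sigma_{\mathrm{sample}}=\mathbb{E}_{\theta,x}\mathbb{E}_{X,W}(\mathbb{E}_{\mathcal{E}}\hat f(x)-\mathbb{E}_{X,\mathcal{E}}\hat f(x))^2$; $\Sigma_{\mathrm{init}}=\mathbb{E}_{\theta,x}\mathbb{E}_{W}(\mathbb{E}_{X,\mathcal{E}}\hat f(x)-\mathbb{E}_{W,X,\mathcal{E}}\hat f(x))^2$. Resolvent moments. $F_\gamma$ is the Marchenko–Pastur distribution with parameter $\gamma$ (the limiting eigenvalue distribution of $n^{-1}Z^\top Z$ for $Z\in\mathbb{R}^{n\times p}$ with i.i.d. mean $0$, variance $1$ entries, $p/n\to\gamma$); $\theta_1(\gamma,\lambda)=\int (x+\lambda)^{-1}dF_\gamma(x)$, $\theta_2(\gamma,\lambda)=\int (x+\lambda)^{-2}dF_\gamma(x)$. (The symbol $\theta$ without subscript is the true parameter vector.) *)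

theory Defs
  imports "HOL-Probability.Probability" "Jordan_Normal_Form.Gauss_Jordan_Elimination"
begin
definition mp_density :: "real \<Rightarrow> real \<Rightarrow> real" where
  "mp_density \<gamma> x =
     (let a = (1 - sqrt \<gamma>)^2; b = (1 + sqrt \<gamma>)^2
      in if a < x \<and> x < b then sqrt ((b - x) * (x - a)) / (2 * pi * \<gamma> * x) else 0)"

text \<open>
  Limiting eigenvalue distribution of \<open>Z\<^sup>T Z / n\<close> for an \<open>n \<times> p\<close> matrix \<open>Z\<close> with i.i.d. entries
  of mean 0 and variance 1, where \<open>p / n \<longlonglongrightarrow> \<gamma>\<close>. If \<open>\<gamma> > 1\<close> there is an atom at 0, because
  \<open>Z\<^sup>T Z\<close> is then rank deficient.
\<close>

definition mp_law :: "real \<Rightarrow> real measure" where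
  "mp_law \<gamma> = measure_of UNIV (sets borel)
     (\<lambda>A. ennreal (max 0 (1 - 1 / \<gamma>)) * indicator A 0
          + (\<integral>\<^sup>+ x. ennreal (mp_density \<gamma> x) * indicator A x \<partial>lborel))"

lemma measurable_mp_density [measurable]: "mp_density \<gamma> \<in> borel_measurable borel"
  unfolding mp_density_def Let_def by measurable

lemma sets_mp_law [measurable_cong, simp]: "sets (mp_law \<gamma>) = sets borel"
  using sets.sets_measure_of_eq[of borel] by (simp add: mp_law_def)

lemma space_mp_law [simp]: "space (mp_law \<gamma>) = UNIV"
  by (simp add: mp_law_def space_measure_of_conv)

lemma emeasure_mp_law:
  assumes "A \<in> sets borel"
  shows "emeasure (mp_law \<gamma>) A = ennreal (max 0 (1 - 1 / \<gamma>)) * indicator A 0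
          + (\<integral>\<^sup>+ x. ennreal (mp_density \<gamma> x) * indicator A x \<partial>lborel)"
proof -
  let ?c = "ennreal (max 0 (1 - 1 / \<gamma>))"
  let ?D = "density lborel (\<lambda>x. ennreal (mp_density \<gamma> x))"
  let ?R = "return borel (0::real)"
  have D: "(\<integral>\<^sup>+ x. ennreal (mp_density \<gamma> x) * indicator B x \<partial>lborel) = emeasure ?D B"
    if "B \<in> sets borel" for B
    using that by (subst emeasure_density) auto
  have R: "indicator B 0 = emeasure ?R B" if "B \<in> sets borel" for B
    using that by simp
  show ?thesis
    unfolding mp_law_def
  proof (rule emeasure_measure_of_sigma)
    show "sigma_algebra UNIV (sets borel :: real set set)"
      using sets.sigma_algebra_axioms[of borel] by simp
    show "positive (sets borel) (\<lambda>A. ?c * indicator A 0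
            + (\<integral>\<^sup>+ x. ennreal (mp_density \<gamma> x) * indicator A x \<partial>lborel))"
      by (simp add: positive_def)
    show "countably_additive (sets borel) (\<lambda>A. ?c * indicator A 0
            + (\<integral>\<^sup>+ x. ennreal (mp_density \<gamma> x) * indicator A x \<partial>lborel))"
    proof (rule countably_additiveI)
      fix F :: "nat \<Rightarrow> real set"
      assume F: "range F \<subseteq> sets borel" "disjoint_family F" "\<Union> (range F) \<in> sets borel"
      have Fi: "F i \<in> sets borel" for i using F(1) by auto
      have "(\<Sum>i. ?c * emeasure ?R (F i) + emeasure ?D (F i))
              = ?c * (\<Sum>i. emeasure ?R (F i)) + (\<Sum>i. emeasure ?D (F i))"
        by (simp add: suminf_add[symmetric] ennreal_suminf_cmult)
      also have "\<dots> = ?c * emeasure ?R (\<Union> (range F)) + emeasure ?D (\<Union> (range F))"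
        using F by (simp only: suminf_emeasure sets_return sets_density sets_lborel)
      finally show "(\<Sum>i. ?c * indicator (F i) 0
            + (\<integral>\<^sup>+ x. ennreal (mp_density \<gamma> x) * indicator (F i) x \<partial>lborel))
          = ?c * indicator (\<Union> (range F)) 0
            + (\<integral>\<^sup>+ x. ennreal (mp_density \<gamma> x) * indicator (\<Union> (range F)) x \<partial>lborel)"
        by (simp only: D[OF Fi] D[OF F(3)] R[OF Fi] R[OF F(3)])
    qed
    show "A \<in> sets borel" by fact
  qed
qed

definition theta1 :: "real \<Rightarrow> real \<Rightarrow> real" where
  "theta1 \<gamma> l = (\<integral>x. 1 / (x + l) \<partial>mp_law \<gamma>)"

definition theta2 :: "real \<Rightarrow> real \<Rightarrow> real" where
  "theta2 \<gamma> l = (\<integral>x. 1 / (x + l)^2 \<partial>mp_law \<gamma>)"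

text \<open>
  Random vectors in \<open>\<real>\<^sup>d\<close> and random \<open>m \<times> d\<close> matrices are given by their entries, that is, as points
  of the finite product spaces over \<open>{..<d}\<close> and \<open>{..<m} \<times> {..<d}\<close>; product measures
  make the entries independent. The centred normal law with standard deviation \<open>s\<close> is an image
  of the standard one, so that \<open>s = 0\<close> gives the point mass at 0.
\<close>

definition centred_normal :: "real \<Rightarrow> real measure" where
  "centred_normal s = distr (density lborel std_normal_density) borel (\<lambda>z. s * z)"

definition iid_vec_law :: "real measure \<Rightarrow> nat \<Rightarrow> (nat \<Rightarrow> real) measure" where
  "iid_vec_law \<mu> d = PiM {..<d} (\<lambda>_. \<mu>)"

definition iid_mat_law :: "real measure \<Rightarrow> nat \<Rightarrow> nat \<Rightarrow> (nat \<times> nat \<Rightarrow> real) measure" where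
  "iid_mat_law \<mu> n d = PiM ({..<n} \<times> {..<d}) (\<lambda>_. \<mu>)"

definition mat_entries :: "real mat \<Rightarrow> nat \<times> nat \<Rightarrow> real" where
  "mat_entries A = restrict (\<lambda>ij. A $$ ij) ({..<dim_row A} \<times> {..<dim_col A})"

text \<open>
  The uniform distribution on \<open>{W \<in> \<real>\<^bsup>p \<times> d\<^esup>. W W\<^sup>T = I\<^sub>p}\<close>, \<open>p \<le> d\<close>: the orthogonal group of
  \<open>\<real>\<^sup>d\<close> acts transitively on this compact set by right multiplication, and the uniform distribution is
  the unique probability measure on it that is invariant under this action.
\<close>

definition uniform_orthonormal_rows ::
    "nat \<Rightarrow> nat \<Rightarrow> (nat \<times> nat \<Rightarrow> real) measure \<Rightarrow> bool" where
  "uniform_orthonormal_rows p d \<nu> \<longleftrightarrow>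
     prob_space \<nu> \<and>
     sets \<nu> = sets (PiM ({..<p} \<times> {..<d}) (\<lambda>_. borel)) \<and>
     (AE W in \<nu>. Matrix.mat p d W * (Matrix.mat p d W)\<^sup>T = 1\<^sub>m p) \<and>
     (\<forall>Q \<in> carrier_mat d d. Q * Q\<^sup>T = 1\<^sub>m d \<longrightarrow>
        distr \<nu> \<nu> (\<lambda>W. mat_entries (Matrix.mat p d W * Q)) = \<nu>)"

definition predictor ::
    "real \<Rightarrow> real mat \<Rightarrow> real mat \<Rightarrow> real Matrix.vec \<Rightarrow> real Matrix.vec \<Rightarrow> real" where
  "predictor l W X Y x =
     (let n = real (dim_row X); p = dim_row W;
          R = the (mat_inverse ((1 / n) \<cdot>\<^sub>m (W * X\<^sup>T * X * W\<^sup>T) + l \<cdot>\<^sub>m 1\<^sub>m p))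
      in scalar_prod x (W\<^sup>T *\<^sub>v (R *\<^sub>v ((1 / n) \<cdot>\<^sub>v (W * X\<^sup>T *\<^sub>v Y)))))"

definition fhat ::
    "nat \<Rightarrow> nat \<Rightarrow> nat \<Rightarrow> real \<Rightarrow> (nat \<Rightarrow> real) \<Rightarrow> (nat \<Rightarrow> real) \<Rightarrow> (nat \<times> nat \<Rightarrow> real) \<Rightarrow>
     (nat \<Rightarrow> real) \<Rightarrow> (nat \<times> nat \<Rightarrow> real) \<Rightarrow> real" where
  "fhat n p d l \<theta> x X e W =
     predictor l (Matrix.mat p d W) (Matrix.mat n d X)
       (Matrix.mat n d X *\<^sub>v Matrix.vec d \<theta> + Matrix.vec n e) (Matrix.vec d x)"

definition signal :: "nat \<Rightarrow> (nat \<Rightarrow> real) \<Rightarrow> (nat \<Rightarrow> real) \<Rightarrow> real" where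
  "signal d \<theta> x = scalar_prod (Matrix.vec d x) (Matrix.vec d \<theta>)"

text \<open>
  Parameters: \<open>\<mu>\<close> is the law of the entries of \<open>X\<close> and \<open>x\<close>, \<open>\<nu>\<close> the law of \<open>W\<close>.
  Independence of the random objects makes every (iterated) expectation an (iterated) integral with
  respect to products of their laws.
\<close>

definition theta_x_law ::
    "real measure \<Rightarrow> real \<Rightarrow> nat \<Rightarrow> ((nat \<Rightarrow> real) \<times> (nat \<Rightarrow> real)) measure" where
  "theta_x_law \<mu> \<alpha> d =
     iid_vec_law (centred_normal (\<alpha> / sqrt (real d))) d \<Otimes>\<^sub>M iid_vec_law \<mu> d"

definition noise_law :: "real \<Rightarrow> nat \<Rightarrow> (nat \<Rightarrow> real) measure" where
  "noise_law \<sigma> n = iid_vec_law (centred_normal \<sigma>) n"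

definition mean_noise ::
    "real \<Rightarrow> nat \<Rightarrow> nat \<Rightarrow> nat \<Rightarrow> real \<Rightarrow> (nat \<Rightarrow> real) \<Rightarrow> (nat \<Rightarrow> real) \<Rightarrow>
     (nat \<times> nat \<Rightarrow> real) \<Rightarrow> (nat \<times> nat \<Rightarrow> real) \<Rightarrow> real" where
  "mean_noise \<sigma> n p d l \<theta> x X W = (\<integral>e. fhat n p d l \<theta> x X e W \<partial>noise_law \<sigma> n)"

definition mean_sample_noise ::
    "real measure \<Rightarrow> real \<Rightarrow> nat \<Rightarrow> nat \<Rightarrow> nat \<Rightarrow> real \<Rightarrow> (nat \<Rightarrow> real) \<Rightarrow> (nat \<Rightarrow> real) \<Rightarrow>
     (nat \<times> nat \<Rightarrow> real) \<Rightarrow> real" where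
  "mean_sample_noise \<mu> \<sigma> n p d l \<theta> x W =
     (\<integral>(X, e). fhat n p d l \<theta> x X e W \<partial>(iid_mat_law \<mu> n d \<Otimes>\<^sub>M noise_law \<sigma> n))"

definition mean_all ::
    "real measure \<Rightarrow> (nat \<times> nat \<Rightarrow> real) measure \<Rightarrow> real \<Rightarrow> nat \<Rightarrow> nat \<Rightarrow> nat \<Rightarrow> real \<Rightarrow>
     (nat \<Rightarrow> real) \<Rightarrow> (nat \<Rightarrow> real) \<Rightarrow> real" where
  "mean_all \<mu> \<nu> \<sigma> n p d l \<theta> x =
     (\<integral>(X, e, W). fhat n p d l \<theta> x X e W \<partial>(iid_mat_law \<mu> n d \<Otimes>\<^sub>M noise_law \<sigma> n \<Otimes>\<^sub>M \<nu>))"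

definition MSE ::
    "real measure \<Rightarrow> (nat \<times> nat \<Rightarrow> real) measure \<Rightarrow> real \<Rightarrow> real \<Rightarrow> nat \<Rightarrow> nat \<Rightarrow> nat \<Rightarrow> real \<Rightarrow> real" where
  "MSE \<mu> \<nu> \<alpha> \<sigma> n p d l =
     (\<integral>((\<theta>, x), X, e, W). (fhat n p d l \<theta> x X e W - signal d \<theta> x)^2
        \<partial>(theta_x_law \<mu> \<alpha> d \<Otimes>\<^sub>M iid_mat_law \<mu> n d \<Otimes>\<^sub>M noise_law \<sigma> n \<Otimes>\<^sub>M \<nu>)) + \<sigma>^2"

definition Bias2 ::
    "real measure \<Rightarrow> (nat \<times> nat \<Rightarrow> real) measure \<Rightarrow> real \<Rightarrow> real \<Rightarrow> nat \<Rightarrow> nat \<Rightarrow> nat \<Rightarrow> real \<Rightarrow> real" where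
  "Bias2 \<mu> \<nu> \<alpha> \<sigma> n p d l =
     (\<integral>(\<theta>, x). (mean_all \<mu> \<nu> \<sigma> n p d l \<theta> x - signal d \<theta> x)^2 \<partial>theta_x_law \<mu> \<alpha> d)"

definition Var ::
    "real measure \<Rightarrow> (nat \<times> nat \<Rightarrow> real) measure \<Rightarrow> real \<Rightarrow> real \<Rightarrow> nat \<Rightarrow> nat \<Rightarrow> nat \<Rightarrow> real \<Rightarrow> real" where
  "Var \<mu> \<nu> \<alpha> \<sigma> n p d l =
     (\<integral>(\<theta>, x). (\<integral>(X, e, W). (fhat n p d l \<theta> x X e W - mean_all \<mu> \<nu> \<sigma> n p d l \<theta> x)^2
        \<partial>(iid_mat_law \<mu> n d \<Otimes>\<^sub>M noise_law \<sigma> n \<Otimes>\<^sub>M \<nu>)) \<partial>theta_x_law \<mu> \<alpha> d)"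

definition Sigma_label ::
    "real measure \<Rightarrow> (nat \<times> nat \<Rightarrow> real) measure \<Rightarrow> real \<Rightarrow> real \<Rightarrow> nat \<Rightarrow> nat \<Rightarrow> nat \<Rightarrow> real \<Rightarrow> real" where
  "Sigma_label \<mu> \<nu> \<alpha> \<sigma> n p d l =
     (\<integral>(\<theta>, x). (\<integral>(X, W, e). (fhat n p d l \<theta> x X e W - mean_noise \<sigma> n p d l \<theta> x X W)^2
        \<partial>(iid_mat_law \<mu> n d \<Otimes>\<^sub>M \<nu> \<Otimes>\<^sub>M noise_law \<sigma> n)) \<partial>theta_x_law \<mu> \<alpha> d)"

definition Sigma_sample ::
    "real measure \<Rightarrow> (nat \<times> nat \<Rightarrow> real) measure \<Rightarrow> real \<Rightarrow> real \<Rightarrow> nat \<Rightarrow> nat \<Rightarrow> nat \<Rightarrow> real \<Rightarrow> real" where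
  "Sigma_sample \<mu> \<nu> \<alpha> \<sigma> n p d l =
     (\<integral>(\<theta>, x). (\<integral>(X, W). (mean_noise \<sigma> n p d l \<theta> x X W - mean_sample_noise \<mu> \<sigma> n p d l \<theta> x W)^2
        \<partial>(iid_mat_law \<mu> n d \<Otimes>\<^sub>M \<nu>)) \<partial>theta_x_law \<mu> \<alpha> d)"

definition Sigma_init ::
    "real measure \<Rightarrow> (nat \<times> nat \<Rightarrow> real) measure \<Rightarrow> real \<Rightarrow> real \<Rightarrow> nat \<Rightarrow> nat \<Rightarrow> nat \<Rightarrow> real \<Rightarrow> real" where
  "Sigma_init \<mu> \<nu> \<alpha> \<sigma> n p d l =
     (\<integral>(\<theta>, x). (\<integral>W. (mean_sample_noise \<mu> \<sigma> n p d l \<theta> x W - mean_all \<mu> \<nu> \<sigma> n p d l \<theta> x)^2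
        \<partial>\<nu>) \<partial>theta_x_law \<mu> \<alpha> d)"

definition limit_MSE :: "real \<Rightarrow> real \<Rightarrow> real \<Rightarrow> real \<Rightarrow> real \<Rightarrow> real" where
  "limit_MSE \<alpha> \<sigma> \<pi> \<delta> l =
     \<alpha>^2 * (1 - \<pi> + \<pi> * \<delta> * (1 - \<pi> + \<sigma>^2 / \<alpha>^2) * theta1 (\<pi> * \<delta>) l
            + (l - \<delta> * (1 - \<pi> + \<sigma>^2 / \<alpha>^2)) * l * \<pi> * theta2 (\<pi> * \<delta>) l) + \<sigma>^2"

end

theory Submission
  imports Defs "Jordan_Normal_Form.Determinant"
begin

text \<open>
  Conditionally on \<open>W\<close>, put \<open>P = W\<^sup>T W\<close>, let \<open>G = W\<^sup>T (n\<inverse> W X\<^sup>T X W\<^sup>T + l)\<inverse> W\<close> be the projected resolvent and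
  \<open>S = n\<inverse> X\<^sup>T X\<close>. Then the predictor is \<open>x\<^sup>T G S \<theta>\<close> plus a term linear in the noise, and integrating
  out \<open>\<theta>\<close>, \<open>x\<close> and the noise expresses all six quantities exactly through the second moments of \<open>G S\<close> and
  of its conditional means, and through the traces of \<open>G\<close> and \<open>G\<^sup>2\<close>. Deleting one row of \<open>X\<close>
  makes the quadratic forms \<open>n\<inverse> x\<^sub>i\<^sup>T H\<^sub>i x\<^sub>i\<close> concentrate around \<open>T = n\<inverse> tr G\<close>, which yields the approximate
  equation \<open>l T + T / (1 + T) = p / n\<close>. The same argument tested against a fixed matrix shows
  \<open>E[G S | W] \<approx> (1 - l \<theta>\<^sub>1) P\<close> in Frobenius norm, and applied to \<open>|G S (1 - P)|\<^sup>2\<close> it gives the remaining second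
  moment. The limit of \<open>n\<inverse> tr G\<^sup>2\<close> follows from that of \<open>n\<inverse> tr G\<close> because it is squeezed between difference
  quotients in \<open>l\<close>. Of \<open>W\<close> only \<open>E[W\<^sup>T W] = (p / d) I\<close> is used, which is obtained from invariance
  under signed permutations.

  With \<open>c = \<delta> (1 - \<pi> + \<sigma>\<^sup>2 / \<alpha>\<^sup>2)\<close> the limiting MSE is, up to constants, \<open>\<pi> \<alpha>\<^sup>2\<close> times the integral of
  \<open>(c x + l\<^sup>2) / (x + l)\<^sup>2\<close> against the Marchenko--Pastur law, and pointwise this integrand is minimal at \<open>l = c\<close>.
\<close>

section \<open>Finitely supported matrices\<close>

text \<open>The entries of \<open>X * tp W\<close> need not be independent, so the Marchenko--Pastur
  theorem does not apply to that matrix directly. Lifting the resolvent from the p-dimensional to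
  the d-dimensional space makes the rows of \<open>X\<close> itself the vectors of the rank one
  updates, and each row meets a matrix independent of it. In mean square, a quadratic form x^T B x
  in independent entries deviates from tr B by at most a constant times the Frobenius norm of B.
  This is where fourth moments enter and why errors are measured in that norm. The second moments of
  \<open>G S\<close> are of order d and are divided by d, so a Frobenius error of order o(sqrt d) is
  negligible; this matters because p / n tends to \<gamma> without a rate. Convergence of spectral
  distributions is bypassed: the limits see the law only through its Stieltjes transform at positive
  arguments and the derivative of that transform. The conditional error bounds involve the
  projection only through its rank, so they are uniform in \<open>W\<close> and can be
  averaged.\<close>

text \<open>A single type holds matrices of all sizes, so that dimensions may vary with \<open>d\<close>; its norm is
  the Frobenius norm, and \<open>idm m\<close> is the identity on the first \<open>m\<close> coordinates.\<close>

typedef fmat = "{A :: nat \<Rightarrow> nat \<Rightarrow> real. \<exists>N. \<forall>i j. N \<le> i \<or> N \<le> j \<longrightarrow> A i j = 0}"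
  morphisms entry Fmat
  by (rule exI[of _ "\<lambda>_ _. 0"]) simp

setup_lifting type_definition_fmat

lemma fmat_eqI: "(\<And>i j. entry A i j = entry B i j) \<Longrightarrow> A = B"
  by (metis entry_inject ext)

definition supp_in :: "nat \<Rightarrow> nat \<Rightarrow> fmat \<Rightarrow> bool" where
  "supp_in m k A \<longleftrightarrow> (\<forall>i j. m \<le> i \<or> k \<le> j \<longrightarrow> entry A i j = 0)"

lemma supp_inD: "supp_in m k A \<Longrightarrow> m \<le> i \<or> k \<le> j \<Longrightarrow> entry A i j = 0"
  by (auto simp: supp_in_def)

lemma supp_in_mono: "supp_in m k A \<Longrightarrow> m \<le> m' \<Longrightarrow> k \<le> k' \<Longrightarrow> supp_in m' k' A"
  unfolding supp_in_def by (meson le_trans)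

text \<open>The filter form lets common bounds for several matrices be combined as eventualities. It
  also presents entries of products and traces as eventually constant limits of sums over fixed
  ranges.\<close>

lemma ev_supp_in: "\<forall>\<^sub>F N in sequentially. supp_in N N A"
proof -
  obtain N where "\<forall>i j. N \<le> i \<or> N \<le> j \<longrightarrow> entry A i j = 0" using entry[of A] by auto
  then have "supp_in N N A" by (auto simp: supp_in_def)
  then show ?thesis
    unfolding eventually_sequentially using supp_in_mono by blast
qed

instantiation fmat :: "{zero, plus, minus, uminus, times, scaleR}"
begin

lift_definition zero_fmat :: fmat is "\<lambda>_ _. 0" by simp

lift_definition plus_fmat :: "fmat \<Rightarrow> fmat \<Rightarrow> fmat" is "\<lambda>A B i j. A i j + B i j"
proof -
  fix A B :: "nat \<Rightarrow> nat \<Rightarrow> real"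
  assume "\<exists>N. \<forall>i j. N \<le> i \<or> N \<le> j \<longrightarrow> A i j = 0" "\<exists>N. \<forall>i j. N \<le> i \<or> N \<le> j \<longrightarrow> B i j = 0"
  then obtain N M where "\<forall>i j. N \<le> i \<or> N \<le> j \<longrightarrow> A i j = 0" "\<forall>i j. M \<le> i \<or> M \<le> j \<longrightarrow> B i j = 0"
    by blast
  then show "\<exists>N. \<forall>i j. N \<le> i \<or> N \<le> j \<longrightarrow> A i j + B i j = 0"
    by (intro exI[of _ "max N M"]) auto
qed

lift_definition minus_fmat :: "fmat \<Rightarrow> fmat \<Rightarrow> fmat" is "\<lambda>A B i j. A i j - B i j"
proof -
  fix A B :: "nat \<Rightarrow> nat \<Rightarrow> real"
  assume "\<exists>N. \<forall>i j. N \<le> i \<or> N \<le> j \<longrightarrow> A i j = 0" "\<exists>N. \<forall>i j. N \<le> i \<or> N \<le> j \<longrightarrow> B i j = 0"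
  then obtain N M where "\<forall>i j. N \<le> i \<or> N \<le> j \<longrightarrow> A i j = 0" "\<forall>i j. M \<le> i \<or> M \<le> j \<longrightarrow> B i j = 0"
    by blast
  then show "\<exists>N. \<forall>i j. N \<le> i \<or> N \<le> j \<longrightarrow> A i j - B i j = 0"
    by (intro exI[of _ "max N M"]) auto
qed

lift_definition uminus_fmat :: "fmat \<Rightarrow> fmat" is "\<lambda>A i j. - A i j" by simp

lift_definition scaleR_fmat :: "real \<Rightarrow> fmat \<Rightarrow> fmat" is "\<lambda>c A i j. c * A i j" by auto

text \<open>Summing over the nonzero entries of a row of the left factor gives a finite sum without
  naming a size; \<open>entry_mult\<close> exchanges this set for any bound on the columns of that
  factor.\<close>

lift_definition times_fmat :: "fmat \<Rightarrow> fmat \<Rightarrow> fmat" is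
  "\<lambda>A B i j. \<Sum>k | A i k \<noteq> 0. A i k * B k j"
proof -
  fix A B :: "nat \<Rightarrow> nat \<Rightarrow> real"
  assume "\<exists>N. \<forall>i j. N \<le> i \<or> N \<le> j \<longrightarrow> A i j = 0" "\<exists>N. \<forall>i j. N \<le> i \<or> N \<le> j \<longrightarrow> B i j = 0"
  then obtain N M where "\<forall>i j. N \<le> i \<or> N \<le> j \<longrightarrow> A i j = 0" "\<forall>i j. M \<le> i \<or> M \<le> j \<longrightarrow> B i j = 0"
    by blast
  then show "\<exists>N. \<forall>i j. N \<le> i \<or> N \<le> j \<longrightarrow> (\<Sum>k | A i k \<noteq> 0. A i k * B k j) = 0"
    by (intro exI[of _ "max N M"]) auto
qed

instance ..

end

lemmas entry_simps [simp] =
  zero_fmat.rep_eq plus_fmat.rep_eq minus_fmat.rep_eq uminus_fmat.rep_eq scaleR_fmat.rep_eq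

lemma entry_mult:
  assumes "supp_in m N A"
  shows "entry (A * B) i j = (\<Sum>k<N. entry A i k * entry B k j)"
proof -
  have "{k. entry A i k \<noteq> 0} \<subseteq> {..<N}"
    using assms by (force simp: supp_in_def not_less[symmetric])
  then show ?thesis
    unfolding times_fmat.rep_eq by (intro sum.mono_neutral_left) auto
qed

instance fmat :: real_algebra
proof
  fix A B C :: fmat and a b :: real
  show "A + B + C = A + (B + C)" "A + B = B + A" "0 + A = A" "- A + A = 0" "A - B = A + - B"
    "a *\<^sub>R (A + B) = a *\<^sub>R A + a *\<^sub>R B" "(a + b) *\<^sub>R A = a *\<^sub>R A + b *\<^sub>R A"
    "a *\<^sub>R b *\<^sub>R A = (a * b) *\<^sub>R A" "1 *\<^sub>R A = A"
    by (rule fmat_eqI; simp add: algebra_simps)+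
  obtain N where N: "supp_in N N A" "supp_in N N B" "supp_in N N C" "supp_in N N (A * B)" "supp_in N N (A + B)"
      "supp_in N N (a *\<^sub>R A)"
    using eventually_happens'[OF _ eventually_conj[OF ev_supp_in[of A] eventually_conj[OF ev_supp_in[of B]
      eventually_conj[OF ev_supp_in[of C] eventually_conj[OF ev_supp_in[of "A * B"]
      eventually_conj[OF ev_supp_in[of "A + B"] ev_supp_in[of "a *\<^sub>R A"]]]]]]] by auto
  note e = entry_mult[OF N(1)] entry_mult[OF N(2)] entry_mult[OF N(4)] entry_mult[OF N(5)] entry_mult[OF N(6)]
  show "(A + B) * C = A * C + B * C" "A * (B + C) = A * B + A * C"
    "a *\<^sub>R A * B = a *\<^sub>R (A * B)" "A * a *\<^sub>R B = a *\<^sub>R (A * B)"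
    by (rule fmat_eqI; simp add: e algebra_simps sum.distrib sum_distrib_left)+
  show "A * B * C = A * (B * C)"
  proof (rule fmat_eqI)
    fix i j
    have "entry (A * B * C) i j = (\<Sum>k<N. (\<Sum>l<N. entry A i l * entry B l k) * entry C k j)"
      by (simp add: e)
    also have "\<dots> = (\<Sum>l<N. entry A i l * (\<Sum>k<N. entry B l k * entry C k j))"
      unfolding sum_distrib_left sum_distrib_right by (subst sum.swap) (simp add: mult.assoc)
    finally show "entry (A * B * C) i j = entry (A * (B * C)) i j" by (simp add: e)
  qed
qed

instantiation fmat :: real_inner
begin

definition inner_fmat :: "fmat \<Rightarrow> fmat \<Rightarrow> real" where
  "inner_fmat A B = (\<Sum>(i,j) | entry A i j \<noteq> 0. entry A i j * entry B i j)"

definition norm_fmat :: "fmat \<Rightarrow> real" where "norm_fmat A = sqrt (inner A A)"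
definition dist_fmat :: "fmat \<Rightarrow> fmat \<Rightarrow> real" where "dist_fmat A B = norm (A - B)"
definition sgn_fmat :: "fmat \<Rightarrow> fmat" where "sgn_fmat A = A /\<^sub>R norm A"
definition uniformity_fmat :: "(fmat \<times> fmat) filter" where
  "uniformity_fmat = (INF e\<in>{0 <..}. principal {(x, y). dist x y < e})"
definition open_fmat :: "fmat set \<Rightarrow> bool" where
  "open_fmat U = (\<forall>x\<in>U. eventually (\<lambda>(x', y). x' = x \<longrightarrow> y \<in> U) uniformity)"

lemma inner_fmat_eq:
  assumes "supp_in m k A"
  shows "inner A B = (\<Sum>i<m. \<Sum>j<k. entry A i j * entry B i j)"
proof -
  have "{(i,j). entry A i j \<noteq> 0} \<subseteq> {..<m} \<times> {..<k}"
    using assms by (force simp: supp_in_def not_less[symmetric])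
  then have "inner A B = (\<Sum>(i,j)\<in>{..<m} \<times> {..<k}. entry A i j * entry B i j)"
    unfolding inner_fmat_def by (intro sum.mono_neutral_left) auto
  then show ?thesis by (simp add: sum.cartesian_product)
qed

instance
proof
  fix A B C :: fmat and a :: real
  show "dist A B = norm (A - B)" "sgn A = A /\<^sub>R norm A"
    "uniformity = (INF e\<in>{0 <..}. principal {(x, y). dist (x::fmat) y < e})"
    "norm A = sqrt (inner A A)"
    by (rule dist_fmat_def sgn_fmat_def uniformity_fmat_def norm_fmat_def)+
  show "open U = (\<forall>x\<in>U. eventually (\<lambda>(x', y). x' = x \<longrightarrow> y \<in> U) uniformity)" for U :: "fmat set"
    by (rule open_fmat_def)
  obtain N where N: "supp_in N N A" "supp_in N N B" "supp_in N N (A + B)" "supp_in N N (a *\<^sub>R A)"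
    using eventually_happens'[OF _ eventually_conj[OF ev_supp_in[of A] eventually_conj[OF ev_supp_in[of B]
      eventually_conj[OF ev_supp_in[of "A + B"] ev_supp_in[of "a *\<^sub>R A"]]]]] by auto
  note e = inner_fmat_eq[OF N(1)] inner_fmat_eq[OF N(2)] inner_fmat_eq[OF N(3)] inner_fmat_eq[OF N(4)]
  show "inner A B = inner B A" "inner (A + B) C = inner A C + inner B C"
    "inner (a *\<^sub>R A) B = a * inner A B" "0 \<le> inner A A"
    by (simp_all add: e algebra_simps sum.distrib sum_distrib_left sum_nonneg)
  show "inner A A = 0 \<longleftrightarrow> A = 0"
  proof
    assume "inner A A = 0"
    then have "\<forall>i<N. \<forall>j<N. entry A i j = 0"
      by (simp add: e sum_nonneg_eq_0_iff sum_nonneg Ball_def)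
    with N(1) have "entry A i j = 0" for i j
      by (metis supp_inD not_le)
    then show "A = 0" by (intro fmat_eqI) simp
  next
    assume "A = 0" then show "inner A A = 0" by (simp add: inner_fmat_def)
  qed
qed

end

section \<open>Transpose, trace and the Frobenius inner product\<close>

lift_definition tp :: "fmat \<Rightarrow> fmat" is "\<lambda>A i j. A j i" by blast

lemma entry_tp [simp]: "entry (tp A) i j = entry A j i"
  by (simp add: tp.rep_eq)

definition tr :: "fmat \<Rightarrow> real" where
  "tr A = (\<Sum>k | entry A k k \<noteq> 0. entry A k k)"

lemma tr_eq:
  assumes "supp_in m N A"
  shows "tr A = (\<Sum>k<N. entry A k k)"
proof -
  have "{k. entry A k k \<noteq> 0} \<subseteq> {..<N}"
    using assms by (force simp: supp_in_def not_less[symmetric])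
  then show ?thesis
    unfolding tr_def by (intro sum.mono_neutral_left) auto
qed

lemma obtain_supp_in2:
  obtains N where "supp_in N N A" "supp_in N N B"
  using eventually_happens'[OF _ eventually_conj[OF ev_supp_in[of A] ev_supp_in[of B]]] by auto

lemma supp_in_add: "supp_in m k A \<Longrightarrow> supp_in m k B \<Longrightarrow> supp_in m k (A + B)"
  by (simp add: supp_in_def)

lemma supp_in_diff: "supp_in m k A \<Longrightarrow> supp_in m k B \<Longrightarrow> supp_in m k (A - B)"
  by (simp add: supp_in_def)

lemma supp_in_scaleR: "supp_in m k A \<Longrightarrow> supp_in m k (c *\<^sub>R A)"
  by (simp add: supp_in_def)

lemma supp_in_tp: "supp_in m k A \<Longrightarrow> supp_in k m (tp A)"
  by (auto simp: supp_in_def)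

lemma supp_in_mult:
  assumes "supp_in m l A" "supp_in l' k B"
  shows "supp_in m k (A * B)"
  using assms unfolding supp_in_def times_fmat.rep_eq by auto

lemma tp_add [simp]: "tp (A + B) = tp A + tp B"
  and tp_diff [simp]: "tp (A - B) = tp A - tp B"
  and tp_scaleR [simp]: "tp (c *\<^sub>R A) = c *\<^sub>R tp A"
  and tp_tp [simp]: "tp (tp A) = A"
  and tp_0 [simp]: "tp 0 = 0"
  by (rule fmat_eqI; simp)+

lemma tp_mult [simp]: "tp (A * B) = tp B * tp A"
proof -
  obtain N where N: "supp_in N N A" "supp_in N N B" by (rule obtain_supp_in2)
  show ?thesis
    by (rule fmat_eqI) (simp add: entry_mult[OF N(1)] entry_mult[OF supp_in_tp[OF N(2)]] mult.commute)
qed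

lemma tr_add: "tr (A + B) = tr A + tr B"
proof -
  obtain N where N: "supp_in N N A" "supp_in N N B" by (rule obtain_supp_in2)
  show ?thesis
    by (simp add: tr_eq[OF N(1)] tr_eq[OF N(2)] tr_eq[OF supp_in_add[OF N]] sum.distrib)
qed

lemma tr_scaleR: "tr (c *\<^sub>R A) = c * tr A"
proof -
  obtain N where N: "supp_in N N A" "supp_in N N A" by (rule obtain_supp_in2)
  show ?thesis
    by (simp add: tr_eq[OF N(1)] tr_eq[OF supp_in_scaleR[OF N(1)]] sum_distrib_left)
qed

lemma tr_diff: "tr (A - B) = tr A - tr B"
  using tr_add[of "A - B" B] by simp

lemma inner_tr: "inner A B = tr (tp A * B)"
proof -
  obtain N where N: "supp_in N N A" "supp_in N N B" by (rule obtain_supp_in2)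
  show ?thesis
    unfolding tr_eq[OF supp_in_mult[OF supp_in_tp[OF N(1)] N(2)]] entry_mult[OF supp_in_tp[OF N(1)]]
      inner_fmat_eq[OF N(1)] entry_tp
    by (rule sum.swap)
qed

lemma inner_tp [simp]: "inner (tp A) (tp B) = inner A B"
proof -
  obtain N where N: "supp_in N N A" "supp_in N N B" by (rule obtain_supp_in2)
  show ?thesis
    unfolding inner_fmat_eq[OF N(1)] inner_fmat_eq[OF supp_in_tp[OF N(1)]] entry_tp
    by (rule sum.swap)
qed

lemma norm_tp [simp]: "norm (tp A) = norm A"
  by (simp add: norm_eq_sqrt_inner)

lemma tr_mult_commute: "tr (A * B) = tr (B * A)"
  using inner_tr[of "tp A" B] inner_tr[of "tp B" A] inner_tp[of A "tp B"]
  by (simp add: inner_commute)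

lemma inner_mult_left: "inner (A * B) C = inner B (tp A * C)"
  by (simp add: inner_tr mult.assoc)

lemma inner_mult_right: "inner (A * B) C = inner A (C * tp B)"
  by (simp add: inner_tr mult.assoc tr_mult_commute[of "tp B"])

lemma power2_norm_fmat: "(norm (A::fmat))\<^sup>2 = inner A A"
  by (simp add: power2_norm_eq_inner)

lemma power2_norm_supp_in:
  "supp_in m k A \<Longrightarrow> (norm A)\<^sup>2 = (\<Sum>i<m. \<Sum>j<k. (entry A i j)\<^sup>2)"
  unfolding power2_norm_fmat by (simp add: inner_fmat_eq power2_eq_square)

lemma abs_entry_le_norm: "\<bar>entry A i j\<bar> \<le> norm A"
proof -
  obtain N where N: "supp_in N N A" "supp_in N N A" by (rule obtain_supp_in2)
  show ?thesis
  proof (cases "i < N \<and> j < N")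
    case True
    have "(entry A i j)\<^sup>2 \<le> (\<Sum>j<N. (entry A i j)\<^sup>2)"
      using True by (intro member_le_sum) auto
    also have "\<dots> \<le> (\<Sum>i<N. \<Sum>j<N. (entry A i j)\<^sup>2)"
      using True by (intro member_le_sum[of i]) (auto intro: sum_nonneg)
    finally have "(entry A i j)\<^sup>2 \<le> (norm A)\<^sup>2"
      by (simp add: power2_norm_supp_in[OF N(1)])
    then show ?thesis by (rule abs_le_square_iff[of "entry A i j" "norm A", THEN iffD2, THEN order_trans]) simp
  next
    case False
    then show ?thesis using N(1) by (metis supp_inD abs_zero norm_ge_zero not_le)
  qed
qed

instance fmat :: real_normed_algebra
proof
  fix A B :: fmat
  obtain N where N: "supp_in N N A" "supp_in N N B" by (rule obtain_supp_in2)
  have "(norm (A * B))\<^sup>2 = (\<Sum>i<N. \<Sum>j<N. (\<Sum>k<N. entry A i k * entry B k j)\<^sup>2)"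
    by (simp add: power2_norm_supp_in[OF supp_in_mult[OF N]] entry_mult[OF N(1)])
  also have "\<dots> \<le> (\<Sum>i<N. \<Sum>j<N. (\<Sum>k<N. (entry A i k)\<^sup>2) * (\<Sum>k<N. (entry B k j)\<^sup>2))"
    by (intro sum_mono Cauchy_Schwarz_ineq_sum)
  also have "\<dots> = (\<Sum>i<N. \<Sum>k<N. (entry A i k)\<^sup>2) * (\<Sum>j<N. \<Sum>k<N. (entry B k j)\<^sup>2)"
    by (simp add: sum_product)
  also have "(\<Sum>j<N. \<Sum>k<N. (entry B k j)\<^sup>2) = (\<Sum>k<N. \<Sum>j<N. (entry B k j)\<^sup>2)"
    by (rule sum.swap)
  finally have "(norm (A * B))\<^sup>2 \<le> (norm A * norm B)\<^sup>2"
    by (simp add: power2_norm_supp_in[OF N(1)] power2_norm_supp_in[OF N(2)] power_mult_distrib)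
  then show "norm (A * B) \<le> norm A * norm B"
    by (rule power2_le_imp_le) simp
qed

section \<open>Matrices with given entries, identities and diagonal units\<close>

lift_definition fm :: "nat \<Rightarrow> nat \<Rightarrow> (nat \<times> nat \<Rightarrow> real) \<Rightarrow> fmat" is
  "\<lambda>m k f i j. if i < m \<and> j < k then f (i, j) else 0"
proof -
  fix m k :: nat and f :: "nat \<times> nat \<Rightarrow> real"
  show "\<exists>N. \<forall>i j. N \<le> i \<or> N \<le> j \<longrightarrow> (if i < m \<and> j < k then f (i, j) else 0) = 0"
    by (rule exI[of _ "max m k"]) auto
qed

lemma entry_fm [simp]: "entry (fm m k f) i j = (if i < m \<and> j < k then f (i, j) else 0)"
  by (simp add: fm.rep_eq)

lemma supp_in_fm [simp, intro]: "supp_in m k (fm m k f)"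
  by (simp add: supp_in_def)

definition idm :: "nat \<Rightarrow> fmat" where
  "idm m = fm m m (\<lambda>(i, j). if i = j then 1 else 0)"

text \<open>The rank one projection e_i e_i^T. Multiplication by it cuts out a column or a row while
  staying in the same type, so row vectors x_i and their outer products need no type of their
  own.\<close>

definition unit_diag :: "nat \<Rightarrow> fmat" where
  "unit_diag i = fm (Suc i) (Suc i) (\<lambda>(a, b). if a = i \<and> b = i then 1 else 0)"

lemma entry_idm: "entry (idm m) i j = (if i = j \<and> i < m then 1 else 0)"
  by (simp add: idm_def)

lemma supp_in_idm [simp, intro]: "supp_in m m (idm m)"
  by (simp add: idm_def)

lemma tp_idm [simp]: "tp (idm m) = idm m"
  by (rule fmat_eqI) (auto simp: entry_idm)

lemma idm_mult:
  assumes "supp_in m k A"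
  shows "idm m * A = A"
proof (rule fmat_eqI)
  fix i j
  have "entry (idm m * A) i j = (\<Sum>k<m. if k = i then entry A k j else 0)"
    unfolding entry_mult[OF supp_in_idm] by (intro sum.cong) (auto simp: entry_idm)
  then show "entry (idm m * A) i j = entry A i j"
    using supp_inD[OF assms, of i j] by auto
qed

lemma mult_idm:
  assumes "supp_in m k A"
  shows "A * idm k = A"
  using idm_mult[OF supp_in_tp[OF assms]] by (metis tp_idm tp_mult tp_tp)

lemma tr_idm [simp]: "tr (idm m) = real m"
  by (simp add: tr_eq[OF supp_in_idm] entry_idm)

lemma entry_unit_diag: "entry (unit_diag i) a b = (if a = i \<and> b = i then 1 else 0)"
  by (simp add: unit_diag_def)

lemma entry_mult_unit_diag_right: "entry (A * unit_diag i) a b = (if b = i then entry A a i else 0)"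
proof -
  obtain N where N: "supp_in N N A" "supp_in N N (unit_diag i)" by (rule obtain_supp_in2)
  have "entry (A * unit_diag i) a b = (\<Sum>k<N. if k = i then entry A a k * entry (unit_diag i) k b else 0)"
    unfolding entry_mult[OF N(1)] by (intro sum.cong) (auto simp: entry_unit_diag)
  then show ?thesis using supp_inD[OF N(1), of a i] by (auto simp: entry_unit_diag)
qed

lemma entry_mult_unit_diag: "entry (A * unit_diag i * B) a b = entry A a i * entry B i b"
proof -
  obtain N where N: "supp_in N N A" "supp_in N N (A * unit_diag i)" by (rule obtain_supp_in2)
  have "entry (A * unit_diag i * B) a b = (\<Sum>k<N. if k = i then entry A a k * entry B k b else 0)"
    unfolding entry_mult[OF N(2)] by (intro sum.cong) (auto simp: entry_mult_unit_diag_right)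
  then show ?thesis using supp_inD[OF N(1), of a i] by auto
qed

lemma tr_mult_unit_diag: "tr (A * unit_diag i) = entry A i i"
proof -
  obtain N where N: "supp_in N N A" "supp_in N N (A * unit_diag i)" by (rule obtain_supp_in2)
  show ?thesis
    using supp_inD[OF N(1), of i i] by (auto simp: tr_eq[OF N(2)] entry_mult_unit_diag_right)
qed

lemma tp_unit_diag [simp]: "tp (unit_diag i) = unit_diag i"
  by (rule fmat_eqI) (auto simp: entry_unit_diag)

lemma unit_diag_idem [simp]: "unit_diag i * unit_diag i = unit_diag i"
  by (rule fmat_eqI) (simp add: entry_mult_unit_diag_right entry_unit_diag)

lemma unit_diag_mult: "unit_diag i * (unit_diag i * A) = unit_diag i * A"
  by (simp add: mult.assoc[symmetric])

lemma tr_unit_diag_middle: "tr (A * unit_diag i * B) = entry (B * A) i i"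
  using tr_mult_commute[of "A * unit_diag i" B] by (simp add: tr_mult_unit_diag flip: mult.assoc)

lemma inner_columns: "inner (A * unit_diag i) (B * unit_diag i) = entry (tp A * B) i i"
proof -
  have "inner (A * unit_diag i) (B * unit_diag i) = inner A (B * unit_diag i)"
    unfolding inner_mult_right by (simp add: mult.assoc)
  then show ?thesis
    unfolding inner_tr by (simp add: tr_mult_unit_diag flip: mult.assoc)
qed

section \<open>Resolvents and removal of one row\<close>

text \<open>The divisor is a parameter and not the number of rows, so removing a row of
  \<open>X\<close> leaves the normalisation unchanged.\<close>

definition gram :: "nat \<Rightarrow> fmat \<Rightarrow> fmat" where
  "gram n X = (1 / real n) *\<^sub>R (tp X * X)"

lemma tp_gram [simp]: "tp (gram n X) = gram n X"
  by (simp add: gram_def)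

lemma supp_in_gram: "supp_in n d X \<Longrightarrow> supp_in d d (gram m X)"
  unfolding gram_def by (intro supp_in_scaleR supp_in_mult supp_in_tp)

lemma entry_sum_rows:
  assumes "supp_in n d X"
  shows "tr (X * A * tp X) = (\<Sum>i<n. entry (X * A * tp X) i i)"
proof -
  obtain N where "supp_in N N A" "supp_in N N A" by (rule obtain_supp_in2)
  then have "supp_in n n (X * A * tp X)"
    by (intro supp_in_mult[OF supp_in_mult] supp_in_tp) (use assms in auto)
  then show ?thesis by (rule tr_eq)
qed

text \<open>\<open>G\<close> inverts \<open>P S P + l\<close> on the range of the projection \<open>P\<close> and vanishes on its orthogonal complement.\<close>

locale resolvent =
  fixes P G X :: fmat and n :: nat and l :: real
  assumes PP: "P * P = P" and tpP: "tp P = P" and GP: "G * P = G" and PG: "P * G = G"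
    and right: "G * gram n X * P + l *\<^sub>R G = P"
    and left: "P * gram n X * G + l *\<^sub>R G = P"
    and l_pos: "l > 0" and n_pos: "n > 0"
begin

text \<open>Multiplying the left equation by \<open>tp G\<close> writes \<open>tp G\<close> as a
  manifestly symmetric matrix; symmetry of \<open>G\<close> is thus a consequence of the inverse
  equations.\<close>

lemma G_split: "tp G * gram n X * G + l *\<^sub>R (tp G * G) = tp G"
  and tp_G: "tp G = G"
proof -
  have a: "tp G * P = tp G" using arg_cong[OF PG, of tp] by (simp add: tpP)
  have "tp G * P = tp G * (P * gram n X * G + l *\<^sub>R G)" using left by simp
  then show s: "tp G * gram n X * G + l *\<^sub>R (tp G * G) = tp G"
    using a by (simp add: algebra_simps flip: mult.assoc)
  have "tp (tp G * gram n X * G + l *\<^sub>R (tp G * G)) = tp G * gram n X * G + l *\<^sub>R (tp G * G)"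
    by (simp add: mult.assoc)
  then show "tp G = G" using s by simp
qed

text \<open>The identity G = G S G + l G G splits the form into two squares. The second square
  bounds the operator norm of \<open>G\<close> by 1 / l, the first that of \<open>X * G\<close> by
  sqrt (n / l). Both operator bounds are expressed below as Frobenius bounds on products with an
  arbitrary \<open>B\<close>.\<close>

lemma G_quadratic: "inner B (G * B) = (norm (X * G * B))\<^sup>2 / n + l * (norm (G * B))\<^sup>2"
proof -
  have "inner B (G * B) = inner B ((G * gram n X * G + l *\<^sub>R (G * G)) * B)"
    using G_split tp_G by simp
  also have "\<dots> = inner B (G * (tp X * (X * (G * B)))) / n + l * inner B (G * (G * B))"
    by (simp add: gram_def algebra_simps inner_add_right mult.assoc)
  also have "inner B (G * (G * B)) = (norm (G * B))\<^sup>2"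
    unfolding power2_norm_fmat by (simp add: inner_mult_left tp_G)
  also have "inner B (G * (tp X * (X * (G * B)))) = (norm (X * G * B))\<^sup>2"
    unfolding power2_norm_fmat by (simp add: inner_mult_left tp_G mult.assoc)
  finally show ?thesis .
qed

lemma G_quadratic_ge: "l * (norm (G * B))\<^sup>2 \<le> inner B (G * B)"
  unfolding G_quadratic by simp

lemma norm_G_mult: "norm (G * B) \<le> norm B / l"
proof (cases "norm (G * B) = 0")
  case False
  have "l * (norm (G * B))\<^sup>2 \<le> norm B * norm (G * B)"
    by (rule order_trans[OF G_quadratic_ge norm_cauchy_schwarz])
  with False have "l * norm (G * B) \<le> norm B"
    by (simp add: power2_eq_square)
  then show ?thesis using l_pos by (simp add: field_simps)
qed (use l_pos in simp)

lemma norm_mult_G: "norm (B * G) \<le> norm B / l"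
  using norm_G_mult[of "tp B"] by (metis norm_tp tp_G tp_mult tp_tp)

lemma norm_G: "norm G \<le> norm P / l"
  using norm_G_mult[of P] by (simp add: GP)

lemma norm_P_square: "(norm P)\<^sup>2 = tr P"
  by (simp add: power2_norm_fmat inner_tr PP tpP)

lemma tr_G: "tr G = inner P (G * P)"
  by (simp add: inner_tr tpP GP PG)

lemma tr_G_nonneg: "0 \<le> tr G"
proof -
  have "0 \<le> l * (norm (G * P))\<^sup>2" using l_pos by simp
  also have "\<dots> \<le> tr G" unfolding tr_G by (rule G_quadratic_ge)
  finally show ?thesis .
qed

lemma tr_G_le: "tr G \<le> tr P / l"
proof -
  have "tr G \<le> norm P * norm (G * P)"
    unfolding tr_G by (rule norm_cauchy_schwarz)
  also have "\<dots> \<le> norm P * (norm P / l)"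
    by (intro mult_left_mono norm_G_mult) simp
  also have "\<dots> = tr P / l" using norm_P_square by (simp add: power2_eq_square)
  finally show ?thesis .
qed

lemma norm_G_square: "(norm G)\<^sup>2 = tr (G * G)"
  by (simp add: power2_norm_fmat inner_tr tp_G)

lemma norm_G_square_le: "(norm G)\<^sup>2 \<le> tr P / l\<^sup>2"
  using power_mono[OF norm_G, of 2] by (simp add: power_divide norm_P_square)

lemma inner_G_le: "\<bar>inner D G\<bar> \<le> norm D * norm P / l"
  using Cauchy_Schwarz_ineq2[of D G] mult_left_mono[OF norm_G, of "norm D"] by simp

lemma tr_G_gram: "tr (G * gram n X) = tr P - l * tr G"
proof -
  have "tr (G * gram n X * P) + l * tr G = tr P"
    using arg_cong[OF right, of tr] by (simp add: tr_add tr_scaleR)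
  moreover have "tr (G * gram n X * P) = tr (G * gram n X)"
    by (metis PG mult.assoc tr_mult_commute)
  ultimately show ?thesis by simp
qed

lemma tr_GG_gram: "tr (G * G * gram n X) = tr G - l * tr (G * G)"
proof -
  have "tr (G * G * gram n X) = tr (G * (G * gram n X * P))"
    by (metis PG mult.assoc tr_mult_commute)
  also have "G * gram n X * P = P - l *\<^sub>R G" using right by (simp add: algebra_simps)
  finally show ?thesis by (simp add: algebra_simps GP tr_diff tr_scaleR)
qed

lemma norm_X_G: "norm (X * G * B) \<le> sqrt (n / l) * norm B"
proof -
  have "(norm (X * G * B))\<^sup>2 / n \<le> inner B (G * B)"
    unfolding G_quadratic using l_pos by simp
  also have "\<dots> \<le> norm B * norm (G * B)" by (rule norm_cauchy_schwarz)
  also have "\<dots> \<le> norm B * (norm B / l)" by (intro mult_left_mono norm_G_mult) simp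
  finally have "(norm (X * G * B))\<^sup>2 \<le> n / l * (norm B)\<^sup>2"
    using n_pos l_pos by (simp add: field_simps power2_eq_square)
  also have "\<dots> = (sqrt (n / l) * norm B)\<^sup>2" using l_pos by (simp add: power_mult_distrib)
  finally show ?thesis by (rule power2_le_imp_le) (use l_pos in simp)
qed

lemma norm_G_tpX: "norm (G * tp X * B) \<le> sqrt (n / l) * norm B"
proof (cases "norm (G * tp X * B) = 0")
  case False
  let ?V = "G * tp X * B"
  have "(norm ?V)\<^sup>2 = inner B (X * G * ?V)"
    unfolding power2_norm_fmat by (simp add: inner_mult_left tp_G mult.assoc)
  also have "\<dots> \<le> norm B * norm (X * G * ?V)" by (rule norm_cauchy_schwarz)
  also have "\<dots> \<le> norm B * (sqrt (n / l) * norm ?V)" by (intro mult_left_mono norm_X_G) simp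
  finally show ?thesis using False by (simp add: power2_eq_square mult_ac)
qed (use l_pos in simp)

text \<open>For standardised independent entries the right side has expectation d / l. So
  \<open>G S\<close> has the expected size in the Frobenius norm, without control of the largest
  eigenvalue of S.\<close>

lemma norm_G_gram_square: "(norm (G * gram n X))\<^sup>2 \<le> (norm X)\<^sup>2 / (n * l)"
proof -
  have "norm (G * gram n X) = norm (G * tp X * X) / n"
    by (simp add: gram_def mult.assoc)
  also have "\<dots> \<le> sqrt (n / l) * norm X / n"
    by (intro divide_right_mono norm_G_tpX) simp
  finally have "(norm (G * gram n X))\<^sup>2 \<le> (sqrt (n / l) * norm X / n)\<^sup>2"
    by (intro power_mono) auto
  also have "\<dots> = (norm X)\<^sup>2 / (n * l)"
    using l_pos n_pos by (simp add: power_mult_distrib power_divide) (simp add: field_simps power2_eq_square)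
  finally show ?thesis .
qed

end

section \<open>Comparison of two ridge parameters\<close>

lemma resolvent_difference:
  assumes "resolvent P G X n l" "resolvent P H X n l'"
  shows "G - H = (l' - l) *\<^sub>R (G * H)"
proof -
  interpret G: resolvent P G X n l by fact
  interpret H: resolvent P H X n l' by fact
  have "G = G * (P * gram n X * H + l' *\<^sub>R H)" using H.left G.GP by simp
  also have "\<dots> = (G * P) * gram n X * H + l' *\<^sub>R (G * H)" by (simp add: distrib_left mult.assoc)
  finally have 1: "G = G * gram n X * H + l' *\<^sub>R (G * H)" by (simp only: G.GP)
  have "H = (G * gram n X * P + l *\<^sub>R G) * H" using G.right H.PG by simp
  also have "\<dots> = G * gram n X * (P * H) + l *\<^sub>R (G * H)" by (simp add: distrib_right mult.assoc)
  finally have 2: "H = G * gram n X * H + l *\<^sub>R (G * H)" by (simp only: H.PG)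
  have "G - H = (G * gram n X * H + l' *\<^sub>R (G * H)) - (G * gram n X * H + l *\<^sub>R (G * H))"
    using 1 2 by argo
  then show ?thesis by (simp add: scaleR_left_diff_distrib)
qed

text \<open>The difference quotient of the trace in the ridge parameter is - tr (G H). It is caught
  between the two traces of squares because \<open>(G - H) * H\<close> and
  \<open>(G - H) * G\<close> have nonnegative trace, each being a nonnegative multiple of a
  quadratic form of a resolvent. This is the finite version of the fact that the derivative of tr G
  is - tr (G G).\<close>

lemma resolvent_trace_difference:
  assumes "resolvent P G X n l" "resolvent P H X n l'" "l \<le> l'"
  shows "tr G - tr H = (l' - l) * tr (G * H)" "tr (H * H) \<le> tr (G * H)" "tr (G * H) \<le> tr (G * G)"
proof -
  interpret G: resolvent P G X n l by fact
  interpret H: resolvent P H X n l' by fact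
  note d = resolvent_difference[OF assms(1,2)]
  have comm: "G * H = H * G"
  proof (cases "l = l'")
    case False
    \<comment> \<open>Transposition exchanges the factors on the right of the resolvent identity,
      while \<open>G - H\<close> is symmetric.\<close>
    have "(l' - l) *\<^sub>R (H * G) = tp (G - H)" unfolding d by (simp add: G.tp_G H.tp_G)
    also have "\<dots> = (l' - l) *\<^sub>R (G * H)" by (simp add: G.tp_G H.tp_G flip: d)
    finally show ?thesis using False by simp
  qed (use d in simp)
  show "tr G - tr H = (l' - l) * tr (G * H)"
    using arg_cong[OF d, of tr] by (simp add: tr_diff tr_scaleR)
  have "tr ((G - H) * H) = (l' - l) * inner H (G * H)"
    unfolding d by (simp add: tr_scaleR inner_tr H.tp_G mult.assoc) (metis tr_mult_commute mult.assoc)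
  also have "\<dots> \<ge> 0"
    using assms(3) order_trans[OF _ G.G_quadratic_ge[of H]] G.l_pos by (intro mult_nonneg_nonneg) auto
  finally show "tr (H * H) \<le> tr (G * H)" by (simp add: algebra_simps tr_diff)
  have "tr ((G - H) * G) = (l' - l) * inner G (H * G)"
    unfolding d by (simp add: tr_scaleR inner_tr G.tp_G mult.assoc)
  also have "\<dots> \<ge> 0"
    using assms(3) order_trans[OF _ H.G_quadratic_ge[of G]] H.l_pos by (intro mult_nonneg_nonneg) auto
  finally show "tr (G * H) \<le> tr (G * G)" by (simp add: algebra_simps tr_diff comm)
qed

text \<open>The row is set to zero instead of being deleted, so both resolvents share the shape of
  \<open>X\<close>, the projection and the divisor n.\<close>

locale leave_one_out =
  G: resolvent P G X n l + H: resolvent P H "X - unit_diag i * X" n l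
  for P G H X n l i
begin

text \<open>With x_i the i-th row of \<open>X\<close>, these are x_i^T H x_i / n and x_i^T H H x_i /
  n. Since \<open>H\<close> belongs to the matrix without that row, they become quadratic forms in a
  matrix independent of x_i once \<open>X\<close> is random.\<close>

definition "q = entry (X * H * tp X) i i / n"
definition "s = entry (X * H * H * tp X) i i / n"

lemma gram_row: "gram n X = gram n (X - unit_diag i * X) + (1 / n) *\<^sub>R (tp X * unit_diag i * X)"
  by (simp add: gram_def algebra_simps unit_diag_mult scaleR_right_diff_distrib)

lemma difference: "H - G = (1 / n) *\<^sub>R (H * tp X * unit_diag i * X * G)"
proof -
  let ?S = "gram n X" and ?S' = "gram n (X - unit_diag i * X)"
  have "H = H * (P * ?S * G + l *\<^sub>R G)" using G.left H.GP by simp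
  also have "\<dots> = (H * P) * ?S * G + l *\<^sub>R (H * G)" by (simp add: distrib_left mult.assoc)
  finally have 1: "H = H * ?S * G + l *\<^sub>R (H * G)" by (simp only: H.GP)
  have "G = (H * ?S' * P + l *\<^sub>R H) * G" using H.right G.PG by simp
  also have "\<dots> = H * ?S' * (P * G) + l *\<^sub>R (H * G)" by (simp add: distrib_right mult.assoc)
  finally have 2: "G = H * ?S' * G + l *\<^sub>R (H * G)" by (simp only: G.PG)
  have "H - G = (H * ?S * G + l *\<^sub>R (H * G)) - (H * ?S' * G + l *\<^sub>R (H * G))"
    using 1 2 by argo
  then show ?thesis unfolding gram_row by (simp add: algebra_simps)
qed

lemma norm_column: "(norm (H * tp X * unit_diag i))\<^sup>2 = n * s"
  using G.n_pos inner_columns[of "H * tp X" i "H * tp X"]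
  by (simp add: power2_norm_fmat s_def H.tp_G mult.assoc)

lemma s_nonneg: "0 \<le> s"
  using norm_column zero_le_power2[of "norm (H * tp X * unit_diag i)"] G.n_pos
  by (simp add: zero_le_mult_iff)

lemma s_le: "l * s \<le> q"
proof -
  let ?B = "tp X * unit_diag i"
  have "inner ?B (H * ?B) = n * q"
    using G.n_pos inner_columns[of "tp X" i "H * tp X"] by (simp add: q_def mult.assoc)
  then show ?thesis
    using H.G_quadratic_ge[of ?B] norm_column G.n_pos by (simp add: mult.assoc)
qed

lemma q_nonneg: "0 \<le> q"
  using s_le s_nonneg G.l_pos by (meson mult_nonneg_nonneg less_imp_le order_trans)

text \<open>The Sherman--Morrison formula in the form x_i^T G = x_i^T H / (1 + q): applied to the
  row itself, the rank one difference becomes a scalar equation.\<close>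

lemma row_G: "entry (X * G * B) i b = entry (X * H * B) i b / (1 + q)"
proof -
  have "H - (1 / n) *\<^sub>R (H * tp X * unit_diag i * X * G) = G"
    using difference by (simp add: algebra_simps)
  then have "entry (X * G * B) i b = entry (X * (H - (1 / n) *\<^sub>R (H * tp X * unit_diag i * X * G)) * B) i b"
    by metis
  also have "\<dots> = entry (X * H * B) i b - entry (X * H * tp X * unit_diag i * (X * G * B)) i b / n"
    by (simp add: algebra_simps)
  also have "\<dots> = entry (X * H * B) i b - q * entry (X * G * B) i b"
    by (simp add: entry_mult_unit_diag q_def)
  finally show ?thesis using q_nonneg by (simp add: field_simps)
qed

lemma col_G: "entry (B * G * tp X) a i = entry (B * H * tp X) a i / (1 + q)"
proof -
  have "entry (B * M * tp X) a i = entry (X * tp M * tp B) i a" for M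
    by (metis entry_tp mult.assoc tp_mult tp_tp)
  then show ?thesis using row_G[of "tp B" a] by (simp add: G.tp_G H.tp_G)
qed

lemma entry_XGX: "entry (X * G * tp X) i i / n = q / (1 + q)"
  by (simp add: row_G) (simp add: q_def)

lemma entry_XGHX: "entry (X * G * H * tp X) i i / n = s / (1 + q)"
  using row_G[of "H * tp X" i] by (simp add: s_def mult.assoc)

lemma entry_XGGX: "entry (X * G * G * tp X) i i / n = s / (1 + q)\<^sup>2"
  using row_G[of "H * tp X" i] col_G[of "X * G" i] by (simp add: s_def mult.assoc power2_eq_square)

text \<open>Although \<open>q\<close> and \<open>s\<close> are unbounded, these ratios are bounded
  for every \<open>X\<close>, because l s \<le> q. They can therefore multiply error terms inside an
  expectation at no cost in moments.\<close>

lemma s_over_le: "s / (1 + q) \<le> 1 / l" "s / (1 + q)\<^sup>2 \<le> 1 / l" "0 \<le> s / (1 + q)"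
proof -
  have "l * s \<le> 1 + q" using s_le by simp
  then show 1: "s / (1 + q) \<le> 1 / l" using q_nonneg G.l_pos by (simp add: field_simps)
  show 2: "0 \<le> s / (1 + q)" using s_nonneg q_nonneg by simp
  have "s / (1 + q)\<^sup>2 = s / (1 + q) / (1 + q)" by (simp add: power2_eq_square)
  also have "\<dots> \<le> s / (1 + q) / 1" using 2 q_nonneg by (intro divide_left_mono) auto
  finally show "s / (1 + q)\<^sup>2 \<le> 1 / l" using 1 by simp
qed

text \<open>The rank one difference has trace \<open>s / (1 + q)\<close>, of order 1, whereas the
  traces themselves are of order n.\<close>

lemma tr_difference: "\<bar>tr H - tr G\<bar> \<le> 1 / l"
proof -
  have "tr H - tr G = tr (H * tp X * unit_diag i * (X * G)) / n"
    by (simp add: difference tr_scaleR mult.assoc flip: tr_diff)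
  also have "\<dots> = s / (1 + q)"
    by (simp add: tr_unit_diag_middle) (simp add: entry_XGHX flip: mult.assoc)
  finally show ?thesis using s_over_le by (simp only: abs_of_nonneg)
qed

text \<open>The difference equals u u^T / (n (1 + q)) with u = H x_i. Having rank one, it has
  Frobenius norm equal to its trace, so the bound for the trace carries over to all test matrices
  \<open>D\<close>.\<close>

lemma inner_difference: "\<bar>inner D H - inner D G\<bar> \<le> norm D / l"
proof -
  let ?u = "H * tp X * unit_diag i"
  have "inner D H - inner D G = tr (tp D * H * tp X * unit_diag i * (X * G)) / n"
    by (simp only: inner_diff_right[symmetric] difference) (simp add: inner_tr tr_scaleR mult.assoc)
  also have "\<dots> = entry (X * G * (tp D * H * tp X)) i i / n"
    by (simp add: tr_unit_diag_middle)
  also have "\<dots> = entry (X * H * (tp D * H * tp X)) i i / n / (1 + q)"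
    by (simp add: row_G)
  also have "entry (X * H * (tp D * H * tp X)) i i = inner D (?u * tp ?u)"
    using tr_unit_diag_middle[of "tp D * H * tp X" i "X * H"]
    by (simp add: inner_tr mult.assoc H.tp_G unit_diag_mult)
  finally have "\<bar>inner D H - inner D G\<bar> = \<bar>inner D (?u * tp ?u)\<bar> / n / (1 + q)"
    using q_nonneg by (simp add: abs_divide)
  also have "\<bar>inner D (?u * tp ?u)\<bar> \<le> norm D * norm (?u * tp ?u)"
    by (rule Cauchy_Schwarz_ineq2)
  also have "norm (?u * tp ?u) \<le> norm ?u * norm (tp ?u)" by (rule norm_mult_ineq)
  also have "\<dots> = n * s" using norm_column by (simp only: norm_tp power2_eq_square)
  finally have "\<bar>inner D H - inner D G\<bar> \<le> norm D * (n * s) / n / (1 + q)"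
    using q_nonneg by (simp add: divide_right_mono mult_left_mono)
  also have "\<dots> = norm D * (s / (1 + q))" using G.n_pos by simp
  also have "\<dots> \<le> norm D * (1 / l)" by (intro mult_left_mono s_over_le) simp
  finally show ?thesis by simp
qed

text \<open>Besides the outer rows, row i is hidden in \<open>gram n X\<close> and in both factors
  \<open>G\<close>. The rank one part of \<open>gram n X\<close> gives the first term. In the
  remaining part \<open>col_G\<close> removes one factor \<open>G\<close> and
  \<open>difference\<close> the other, until only matrices of the reduced problem stand between the
  rows. For the complementary projection, which satisfies H Q = 0, these remaining matrices have
  trace zero.\<close>

lemma entry_off_diagonal:
  "entry (X * Q * gram n X * G * G * tp X) i i =
     entry (X * Q * tp X) i i * (s / (1 + q)\<^sup>2) +
     (entry (X * (Q * gram n (X - unit_diag i * X) * H * H) * tp X) i i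
       - s / (1 + q) * entry (X * (Q * gram n (X - unit_diag i * X) * H) * tp X) i i) / (1 + q)"
proof -
  let ?S' = "gram n (X - unit_diag i * X)"
  have "entry (X * Q * gram n X * G * G * tp X) i i =
      entry (X * Q * ?S' * G * G * tp X) i i + entry (X * Q * tp X * unit_diag i * (X * G * G * tp X)) i i / n"
    by (subst gram_row) (simp add: algebra_simps)
  also have "entry (X * Q * tp X * unit_diag i * (X * G * G * tp X)) i i / n
      = entry (X * Q * tp X) i i * (s / (1 + q)\<^sup>2)"
    unfolding entry_mult_unit_diag using entry_XGGX by (metis times_divide_eq_right)
  also have "entry (X * Q * ?S' * G * G * tp X) i i = entry (X * Q * ?S' * G * H * tp X) i i / (1 + q)"
    by (rule col_G)
  also have "entry (X * Q * ?S' * G * H * tp X) i i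
      = entry (X * Q * ?S' * (H - (H - G)) * H * tp X) i i"
    by simp
  also have "\<dots> = entry (X * Q * ?S' * (H - (1 / n) *\<^sub>R (H * tp X * unit_diag i * X * G)) * H * tp X) i i"
    by (simp only: difference)
  also have "\<dots> = entry (X * Q * ?S' * H * H * tp X) i i
      - entry (X * Q * ?S' * H * tp X * unit_diag i * (X * G * H * tp X)) i i / n"
    by (simp add: algebra_simps)
  also have "entry (X * Q * ?S' * H * tp X * unit_diag i * (X * G * H * tp X)) i i / n
      = entry (X * Q * ?S' * H * tp X) i i * (s / (1 + q))"
    unfolding entry_mult_unit_diag using entry_XGHX by (metis times_divide_eq_right)
  finally show ?thesis by (simp add: mult.assoc mult.commute add.commute)
qed

end

section \<open>Concentration of quadratic forms\<close>

definition fmat_measurable :: "'a measure \<Rightarrow> ('a \<Rightarrow> fmat) \<Rightarrow> bool" where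
  "fmat_measurable M A \<longleftrightarrow> (\<forall>i j. (\<lambda>\<omega>. entry (A \<omega>) i j) \<in> borel_measurable M)"

lemma measurable_entry: "fmat_measurable M A \<Longrightarrow> (\<lambda>\<omega>. entry (A \<omega>) i j) \<in> borel_measurable M"
  by (simp add: fmat_measurable_def)

lemma fmat_measurable_const: "fmat_measurable M (\<lambda>_. A)"
  by (simp add: fmat_measurable_def)

lemma fmat_measurable_add: "fmat_measurable M A \<Longrightarrow> fmat_measurable M B \<Longrightarrow> fmat_measurable M (\<lambda>\<omega>. A \<omega> + B \<omega>)"
  unfolding fmat_measurable_def by (auto intro: borel_measurable_add)

lemma fmat_measurable_diff: "fmat_measurable M A \<Longrightarrow> fmat_measurable M B \<Longrightarrow> fmat_measurable M (\<lambda>\<omega>. A \<omega> - B \<omega>)"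
  unfolding fmat_measurable_def by (auto intro: borel_measurable_diff)

lemma fmat_measurable_scaleR: "fmat_measurable M A \<Longrightarrow> fmat_measurable M (\<lambda>\<omega>. c *\<^sub>R A \<omega>)"
  unfolding fmat_measurable_def by (auto intro: borel_measurable_times)

lemma fmat_measurable_tp: "fmat_measurable M A \<Longrightarrow> fmat_measurable M (\<lambda>\<omega>. tp (A \<omega>))"
  by (simp add: fmat_measurable_def)

lemma fmat_measurable_fm:
  assumes "\<And>i j. i < m \<Longrightarrow> j < k \<Longrightarrow> (\<lambda>\<omega>. f \<omega> (i, j)) \<in> borel_measurable M"
  shows "fmat_measurable M (\<lambda>\<omega>. fm m k (f \<omega>))"
  unfolding fmat_measurable_def
proof (intro allI)
  fix i j
  show "(\<lambda>\<omega>. entry (fm m k (f \<omega>)) i j) \<in> borel_measurable M"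
    using assms by (cases "i < m \<and> j < k") auto
qed

text \<open>The support of the matrix may vary with \<omega>, so there is no fixed finite sum; the
  entry is instead a pointwise limit of sums over fixed ranges.\<close>

lemma fmat_measurable_mult:
  assumes A: "fmat_measurable M A" and B: "fmat_measurable M B"
  shows "fmat_measurable M (\<lambda>\<omega>. A \<omega> * B \<omega>)"
  unfolding fmat_measurable_def
proof (intro allI)
  fix i j
  show "(\<lambda>\<omega>. entry (A \<omega> * B \<omega>) i j) \<in> borel_measurable M"
  proof (rule borel_measurable_LIMSEQ_real)
    show "(\<lambda>N. \<Sum>k<N. entry (A \<omega>) i k * entry (B \<omega>) k j) \<longlonglongrightarrow> entry (A \<omega> * B \<omega>) i j" for \<omega>
      by (rule tendsto_eventually, rule eventually_mono[OF ev_supp_in[of "A \<omega>"]]) (simp add: entry_mult)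
    show "(\<lambda>\<omega>. \<Sum>k<N. entry (A \<omega>) i k * entry (B \<omega>) k j) \<in> borel_measurable M" for N
      using A B by (intro borel_measurable_sum borel_measurable_times measurable_entry)
  qed
qed

lemma measurable_tr:
  assumes A: "fmat_measurable M A"
  shows "(\<lambda>\<omega>. tr (A \<omega>)) \<in> borel_measurable M"
proof (rule borel_measurable_LIMSEQ_real)
  show "(\<lambda>N. \<Sum>k<N. entry (A \<omega>) k k) \<longlonglongrightarrow> tr (A \<omega>)" for \<omega>
    by (rule tendsto_eventually, rule eventually_mono[OF ev_supp_in[of "A \<omega>"]]) (simp add: tr_eq)
  show "(\<lambda>\<omega>. \<Sum>k<N. entry (A \<omega>) k k) \<in> borel_measurable M" for N
    using A by (intro borel_measurable_sum measurable_entry)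
qed

lemma measurable_inner_fmat:
  "fmat_measurable M A \<Longrightarrow> fmat_measurable M B \<Longrightarrow> (\<lambda>\<omega>. inner (A \<omega>) (B \<omega>)) \<in> borel_measurable M"
  unfolding inner_tr by (intro measurable_tr fmat_measurable_mult fmat_measurable_tp)

lemma measurable_norm_fmat:
  "fmat_measurable M A \<Longrightarrow> (\<lambda>\<omega>. norm (A \<omega>)) \<in> borel_measurable M"
  unfolding norm_eq_sqrt_inner
  by (rule measurable_compose[OF measurable_inner_fmat borel_measurable_sqrt])

lemma fmat_measurable_gram: "fmat_measurable M A \<Longrightarrow> fmat_measurable M (\<lambda>\<omega>. gram n (A \<omega>))"
  unfolding gram_def by (intro fmat_measurable_scaleR fmat_measurable_mult fmat_measurable_tp)

lemmas fmat_measurable_intros =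
  fmat_measurable_const fmat_measurable_add fmat_measurable_diff fmat_measurable_scaleR
  fmat_measurable_tp fmat_measurable_mult fmat_measurable_gram
  measurable_entry measurable_tr measurable_inner_fmat measurable_norm_fmat

section \<open>Second moments of linear and quadratic forms in independent entries\<close>

locale standard_law = prob_space \<mu> for \<mu> :: "real measure" +
  assumes sets_mu [measurable_cong, simp]: "sets \<mu> = sets borel"
    and mean: "(\<integral>t. t \<partial>\<mu>) = 0" and second: "(\<integral>t. t\<^sup>2 \<partial>\<mu>) = 1"
    and fourth: "integrable \<mu> (\<lambda>t. t ^ 4)"
begin

text \<open>The squared third moment completes a square in \<open>integral_quartic_le\<close>. The
  summand 4 makes the constant dominate the factor in 2 (u + v)^2 \<le> 4 (u^2 + v^2), which occurs
  in the induction for quadratic forms.\<close>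

definition quad_const :: real where
  "quad_const = (\<integral>t. t ^ 4 \<partial>\<mu>) + (\<integral>t. t ^ 3 \<partial>\<mu>)\<^sup>2 + 4"

lemma integrable_power: "k \<le> 4 \<Longrightarrow> integrable \<mu> (\<lambda>t. t ^ k)"
proof (rule Bochner_Integration.integrable_bound[of _ "\<lambda>t. 1 + t ^ 4"])
  assume k: "k \<le> 4"
  show "AE t in \<mu>. norm (t ^ k) \<le> norm (1 + t ^ 4)"
  proof (rule AE_I2)
    fix t :: real
    have "\<bar>t\<bar> ^ k \<le> 1 + \<bar>t\<bar> ^ 4"
    proof (cases "\<bar>t\<bar> \<le> 1")
      case True
      then have "\<bar>t\<bar> ^ k \<le> 1" by (simp add: power_le_one)
      then show ?thesis by (simp add: add_increasing2)
    next
      case False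
      then have "\<bar>t\<bar> ^ k \<le> \<bar>t\<bar> ^ 4" using k by (intro power_increasing) auto
      then show ?thesis by simp
    qed
    then show "norm (t ^ k) \<le> norm (1 + t ^ 4)" by (simp add: power_abs)
  qed
qed (use fourth in auto)

lemma mu_space [simp]: "space \<mu> = UNIV"
  using sets_eq_imp_space_eq[OF sets_mu] by simp

lemma measure_UNIV [simp]: "measure \<mu> UNIV = 1"
  using prob_space by simp

lemma integral_quadratic:
  "(\<integral>\<^sup>+y. ennreal ((a + b * y)\<^sup>2) \<partial>\<mu>) = ennreal (a\<^sup>2 + b\<^sup>2)"
proof -
  note i = integrable_power[of 1, simplified] integrable_power[of 2, simplified]
  have eq: "(a + b * y)\<^sup>2 = a\<^sup>2 + (2 * a * b) * y + b\<^sup>2 * y\<^sup>2" for y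
    by (simp add: power2_eq_square algebra_simps)
  have "integrable \<mu> (\<lambda>y. (a + b * y)\<^sup>2)" unfolding eq using i by auto
  moreover have "(\<integral>y. (a + b * y)\<^sup>2 \<partial>\<mu>) = a\<^sup>2 + b\<^sup>2"
    unfolding eq using i by (simp add: mean second)
  ultimately show ?thesis by (subst nn_integral_eq_integral) auto
qed

text \<open>The integrand has the shape of a centred quadratic form to which one coordinate y is
  added: \<open>a\<close> is the old form, \<open>b\<close> the coupling of y with the old
  coordinates, and \<open>c\<close> the new diagonal entry.\<close>

lemma integral_quartic_le:
  "(\<integral>\<^sup>+y. ennreal ((a + b * y + c * (y\<^sup>2 - 1))\<^sup>2) \<partial>\<mu>) \<le> ennreal (a\<^sup>2 + 2 * b\<^sup>2 + quad_const * c\<^sup>2)"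
proof -
  note i = integrable_power[of 1, simplified] integrable_power[of 2, simplified]
    integrable_power[of 3, simplified] integrable_power[of 4, simplified]
  let ?m3 = "\<integral>t. t ^ 3 \<partial>\<mu>" and ?m4 = "\<integral>t. t ^ 4 \<partial>\<mu>"
  have eq: "(a + b * y + c * (y\<^sup>2 - 1))\<^sup>2 = (a - c)\<^sup>2 + (2 * (a - c) * b) * y
      + (b\<^sup>2 + 2 * (a - c) * c) * y\<^sup>2 + (2 * b * c) * y ^ 3 + c\<^sup>2 * y ^ 4" for y
    by (simp add: power2_eq_square power3_eq_cube power4_eq_xxxx algebra_simps)
  have "integrable \<mu> (\<lambda>y. (a + b * y + c * (y\<^sup>2 - 1))\<^sup>2)" unfolding eq using i by auto
  moreover have "(\<integral>y. (a + b * y + c * (y\<^sup>2 - 1))\<^sup>2 \<partial>\<mu>)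
      = (a - c)\<^sup>2 + (b\<^sup>2 + 2 * (a - c) * c) + 2 * b * c * ?m3 + c\<^sup>2 * ?m4"
    unfolding eq using i by (simp add: mean second)
  moreover have "(a - c)\<^sup>2 + (b\<^sup>2 + 2 * (a - c) * c) + 2 * b * c * ?m3 + c\<^sup>2 * ?m4
      \<le> a\<^sup>2 + 2 * b\<^sup>2 + quad_const * c\<^sup>2"
  proof -
    have "a\<^sup>2 + 2 * b\<^sup>2 + quad_const * c\<^sup>2
        - ((a - c)\<^sup>2 + (b\<^sup>2 + 2 * (a - c) * c) + 2 * b * c * ?m3 + c\<^sup>2 * ?m4) = (b - c * ?m3)\<^sup>2 + 5 * c\<^sup>2"
      unfolding quad_const_def power2_eq_square by (simp add: algebra_simps)
    moreover have "\<dots> \<ge> 0" by simp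
    ultimately show ?thesis by linarith
  qed
  ultimately show ?thesis by (subst nn_integral_eq_integral) (auto intro: ennreal_leI)
qed

lemma quad_const_ge: "quad_const \<ge> 4"
proof -
  have "(\<integral>t. t ^ 4 \<partial>\<mu>) \<ge> 0" by (intro integral_nonneg_AE) auto
  then show ?thesis unfolding quad_const_def by simp
qed

sublocale prod: product_prob_space "\<lambda>_. \<mu>" UNIV
  by standard

lemma sigma_finite_prod: "product_sigma_finite (\<lambda>_. \<mu>)"
  by standard

lemma linear_form_second_moment:
  assumes "finite J"
  shows "(\<integral>\<^sup>+x. ennreal ((\<Sum>a\<in>J. c a * x a)\<^sup>2) \<partial>PiM J (\<lambda>_. \<mu>)) = ennreal (\<Sum>a\<in>J. (c a)\<^sup>2)"
  using assms
proof (induction J)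
  case empty
  then show ?case by (simp add: PiM_empty)
next
  case (insert i J)
  have "(\<integral>\<^sup>+x. ennreal ((\<Sum>a\<in>insert i J. c a * x a)\<^sup>2) \<partial>PiM (insert i J) (\<lambda>_. \<mu>))
     = (\<integral>\<^sup>+x. (\<integral>\<^sup>+y. ennreal ((\<Sum>a\<in>insert i J. c a * (x(i := y)) a)\<^sup>2) \<partial>\<mu>) \<partial>PiM J (\<lambda>_. \<mu>))"
    using insert by (intro product_sigma_finite.product_nn_integral_insert[OF sigma_finite_prod]) auto
  also have "\<dots> = (\<integral>\<^sup>+x. (\<integral>\<^sup>+y. ennreal (((\<Sum>a\<in>J. c a * x a) + c i * y)\<^sup>2) \<partial>\<mu>) \<partial>PiM J (\<lambda>_. \<mu>))"
  proof -
    have "(\<Sum>a\<in>insert i J. c a * (x(i := y)) a) = (\<Sum>a\<in>J. c a * x a) + c i * y" for x y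
    proof -
      have "(\<Sum>a\<in>J. c a * (x(i := y)) a) = (\<Sum>a\<in>J. c a * x a)"
        using insert.hyps by (intro sum.cong) auto
      then show ?thesis using insert.hyps by simp
    qed
    then show ?thesis by simp
  qed
  also have "\<dots> = (\<integral>\<^sup>+x. ennreal ((\<Sum>a\<in>J. c a * x a)\<^sup>2) + ennreal ((c i)\<^sup>2) \<partial>PiM J (\<lambda>_. \<mu>))"
    by (simp add: integral_quadratic ennreal_plus)
  also have "\<dots> = ennreal (\<Sum>a\<in>J. (c a)\<^sup>2) + ennreal ((c i)\<^sup>2)"
    by (subst nn_integral_add) (auto simp: insert.IH prob_space.emeasure_space_1[OF prob_space_PiM[OF prob_space_axioms]])
  finally show ?case using insert.hyps by (simp add: ennreal_plus[symmetric] sum_nonneg add.commute del: ennreal_plus)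
qed

text \<open>Induction on the coordinates. A new coordinate contributes a linear form in the old
  ones, whose second moment is known exactly, and one diagonal entry. As \<open>B\<close> is not
  symmetric, the coupling is through \<open>B a i + B i a\<close>. Nonnegative integrals keep
  integrability out of the induction.\<close>

lemma quadratic_form_variance:
  assumes "finite J"
  shows "(\<integral>\<^sup>+x. ennreal (((\<Sum>a\<in>J. \<Sum>b\<in>J. B a b * x a * x b) - (\<Sum>a\<in>J. B a a))\<^sup>2) \<partial>PiM J (\<lambda>_. \<mu>))
    \<le> ennreal (quad_const * (\<Sum>a\<in>J. \<Sum>b\<in>J. (B a b)\<^sup>2))"
  using assms
proof (induction J)
  case empty
  then show ?case by (simp add: PiM_empty)
next
  case (insert i J)
  let ?psi = "\<lambda>J x. (\<Sum>a\<in>J. \<Sum>b\<in>J. B a b * x a * x b) - (\<Sum>a\<in>J. B a a)"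
  let ?lin = "\<lambda>x. \<Sum>a\<in>J. (B a i + B i a) * x a"
  let ?M = "PiM J (\<lambda>_. \<mu>)"
  have split: "(\<Sum>a\<in>insert i J. \<Sum>b\<in>insert i J. f a b)
      = (\<Sum>a\<in>J. \<Sum>b\<in>J. f a b) + (\<Sum>a\<in>J. f a i + f i a) + f i i" for f :: "_ \<Rightarrow> _ \<Rightarrow> real"
    using insert.hyps by (simp add: sum.distrib)
  have psi: "?psi (insert i J) (x(i := y)) = ?psi J x + ?lin x * y + B i i * (y\<^sup>2 - 1)" for x y
  proof -
    have "(\<Sum>a\<in>J. \<Sum>b\<in>J. B a b * (x(i := y)) a * (x(i := y)) b) = (\<Sum>a\<in>J. \<Sum>b\<in>J. B a b * x a * x b)"
      using insert.hyps by (intro sum.cong refl) auto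
    moreover have "(\<Sum>a\<in>J. B a i * (x(i := y)) a * (x(i := y)) i + B i a * (x(i := y)) i * (x(i := y)) a) = ?lin x * y"
      unfolding sum_distrib_right using insert.hyps by (intro sum.cong refl) (auto simp: algebra_simps)
    ultimately show ?thesis
      unfolding split using insert.hyps by (simp add: power2_eq_square algebra_simps)
  qed
  have "(\<integral>\<^sup>+x. ennreal ((?psi (insert i J) x)\<^sup>2) \<partial>PiM (insert i J) (\<lambda>_. \<mu>))
     = (\<integral>\<^sup>+x. (\<integral>\<^sup>+y. ennreal ((?psi (insert i J) (x(i := y)))\<^sup>2) \<partial>\<mu>) \<partial>?M)"
    using insert by (intro product_sigma_finite.product_nn_integral_insert[OF sigma_finite_prod]) auto
  also have "\<dots> \<le> (\<integral>\<^sup>+x. ennreal ((?psi J x)\<^sup>2 + 2 * (?lin x)\<^sup>2 + quad_const * (B i i)\<^sup>2) \<partial>?M)"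
    unfolding psi by (intro nn_integral_mono integral_quartic_le)
  also have "\<dots> = (\<integral>\<^sup>+x. ennreal ((?psi J x)\<^sup>2) + 2 * ennreal ((?lin x)\<^sup>2) + ennreal (quad_const * (B i i)\<^sup>2) \<partial>?M)"
    using quad_const_ge by (simp add: ennreal_plus ennreal_mult)
  also have "\<dots> = (\<integral>\<^sup>+x. ennreal ((?psi J x)\<^sup>2) \<partial>?M) + 2 * ennreal (\<Sum>a\<in>J. (B a i + B i a)\<^sup>2) + ennreal (quad_const * (B i i)\<^sup>2)"
    using insert.hyps
    by (simp add: nn_integral_add nn_integral_cmult linear_form_second_moment
        prob_space.emeasure_space_1[OF prob_space_PiM[OF prob_space_axioms]])
  also have "\<dots> \<le> ennreal (quad_const * (\<Sum>a\<in>J. \<Sum>b\<in>J. (B a b)\<^sup>2)) + 2 * ennreal (\<Sum>a\<in>J. (B a i + B i a)\<^sup>2) + ennreal (quad_const * (B i i)\<^sup>2)"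
    by (intro add_mono insert.IH order_refl)
  also have "\<dots> = ennreal (quad_const * (\<Sum>a\<in>J. \<Sum>b\<in>J. (B a b)\<^sup>2) + 2 * (\<Sum>a\<in>J. (B a i + B i a)\<^sup>2) + quad_const * (B i i)\<^sup>2)"
    using quad_const_ge by (simp add: ennreal_plus ennreal_mult sum_nonneg)
  also have "\<dots> \<le> ennreal (quad_const * (\<Sum>a\<in>insert i J. \<Sum>b\<in>insert i J. (B a b)\<^sup>2))"
  proof (rule ennreal_leI)
    have "2 * (\<Sum>a\<in>J. (B a i + B i a)\<^sup>2) \<le> 4 * (\<Sum>a\<in>J. (B a i)\<^sup>2 + (B i a)\<^sup>2)"
      unfolding sum_distrib_left
    proof (rule sum_mono)
      fix a show "2 * (B a i + B i a)\<^sup>2 \<le> 4 * ((B a i)\<^sup>2 + (B i a)\<^sup>2)"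
        using zero_le_power2[of "B a i - B i a"] by (simp add: power2_eq_square algebra_simps)
    qed
    also have "\<dots> \<le> quad_const * (\<Sum>a\<in>J. (B a i)\<^sup>2 + (B i a)\<^sup>2)"
      using quad_const_ge by (intro mult_right_mono sum_nonneg) auto
    finally show "quad_const * (\<Sum>a\<in>J. \<Sum>b\<in>J. (B a b)\<^sup>2) + 2 * (\<Sum>a\<in>J. (B a i + B i a)\<^sup>2) + quad_const * (B i i)\<^sup>2
      \<le> quad_const * (\<Sum>a\<in>insert i J. \<Sum>b\<in>insert i J. (B a b)\<^sup>2)"
      unfolding split by (simp add: algebra_simps)
  qed
  finally show ?case .
qed

text \<open>Conditioning on the other rows: the product measure factors into row i and the rest, and
  under the inner integral \<open>B\<close> is a constant matrix, to which
  \<open>quadratic_form_variance\<close> applies.\<close>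

lemma row_quadratic_form_variance:
  fixes B :: "(nat \<times> nat \<Rightarrow> real) \<Rightarrow> fmat"
  assumes i: "i < n" and supp: "\<And>X. supp_in d d (B X)"
    and dep: "\<And>X X'. \<forall>a<n. \<forall>b<d. a \<noteq> i \<longrightarrow> X (a, b) = X' (a, b) \<Longrightarrow> B X = B X'"
    and meas: "fmat_measurable (iid_mat_law \<mu> n d) B"
    and int: "integrable (iid_mat_law \<mu> n d) (\<lambda>X. (norm (B X))\<^sup>2)"
  defines "Z \<equiv> \<lambda>X. entry (fm n d X * B X * tp (fm n d X)) i i - tr (B X)"
  shows "integrable (iid_mat_law \<mu> n d) (\<lambda>X. (Z X)\<^sup>2)"
    and "(\<integral>X. (Z X)\<^sup>2 \<partial>iid_mat_law \<mu> n d) \<le> quad_const * (\<integral>X. (norm (B X))\<^sup>2 \<partial>iid_mat_law \<mu> n d)"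
proof -
  let ?M = "iid_mat_law \<mu> n d"
  let ?J = "{i} \<times> {..<d}" and ?I = "({..<n} - {i}) \<times> {..<d}"
  have IJ: "?I \<union> ?J = {..<n} \<times> {..<d}" "?I \<inter> ?J = {}" using i by auto
  have fm_meas: "fmat_measurable ?M (\<lambda>X. fm n d X)"
    unfolding iid_mat_law_def by (rule fmat_measurable_fm) (auto intro: measurable_component_singleton)
  have Z_meas [measurable]: "Z \<in> borel_measurable ?M"
    unfolding Z_def by (intro borel_measurable_diff fmat_measurable_intros fm_meas meas)
  have norm_meas [measurable]: "(\<lambda>X. norm (B X)) \<in> borel_measurable ?M"
    by (intro fmat_measurable_intros meas)
  have fold: "(\<integral>\<^sup>+X. f X \<partial>?M) = (\<integral>\<^sup>+x. (\<integral>\<^sup>+y. f (merge ?I ?J (x, y)) \<partial>PiM ?J (\<lambda>_. \<mu>)) \<partial>PiM ?I (\<lambda>_. \<mu>))"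
    if "f \<in> borel_measurable ?M" for f
    using that unfolding iid_mat_law_def IJ(1)[symmetric]
    by (intro product_sigma_finite.product_nn_integral_fold[OF sigma_finite_prod]) (use IJ(2) in auto)
  \<comment> \<open>The partial array \<open>x\<close> carries no meaningful values on row i, but
    \<open>B\<close> does not look at them.\<close>
  have B_merge: "B (merge ?I ?J (x, y)) = B x" for x y
    by (rule dep) (auto simp: merge_def)
  have bij: "(\<Sum>a\<in>?J. f a) = (\<Sum>a<d. f (i, a))" for f :: "_ \<Rightarrow> real"
    by (rule sum.reindex_bij_witness[where i = "\<lambda>a. (i, a)" and j = snd]) auto
  have Z_merge: "Z (merge ?I ?J (x, y)) = (\<Sum>a\<in>?J. \<Sum>b\<in>?J. entry (B x) (snd a) (snd b) * y a * y b) - (\<Sum>a\<in>?J. entry (B x) (snd a) (snd a))" for x y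
  proof -
    let ?X = "merge ?I ?J (x, y)"
    have X: "?X (i, b) = y (i, b)" if "b < d" for b using that by (auto simp: merge_def)
    have "entry (fm n d ?X * B ?X * tp (fm n d ?X)) i i
       = (\<Sum>b<d. (\<Sum>a<d. y (i, a) * entry (B x) a b) * y (i, b))"
      using i X unfolding B_merge
      by (subst entry_mult[OF supp_in_mult[OF supp_in_fm supp]], subst entry_mult[OF supp_in_fm])
        (auto intro!: sum.cong arg_cong2[of _ _ _ _ times])
    also have "\<dots> = (\<Sum>a<d. \<Sum>b<d. entry (B x) a b * y (i, a) * y (i, b))"
      unfolding sum_distrib_right by (subst sum.swap) (simp add: mult_ac)
    finally show ?thesis unfolding Z_def B_merge bij by (simp add: tr_eq[OF supp])
  qed
  have norm_B: "(\<Sum>a\<in>?J. \<Sum>b\<in>?J. (entry (B x) (snd a) (snd b))\<^sup>2) = (norm (B x))\<^sup>2" for x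
    by (simp add: power2_norm_supp_in[OF supp] bij)
  have "(\<integral>\<^sup>+X. ennreal ((Z X)\<^sup>2) \<partial>?M)
      \<le> (\<integral>\<^sup>+x. ennreal (quad_const * (norm (B x))\<^sup>2) \<partial>PiM ?I (\<lambda>_. \<mu>))"
    unfolding fold[OF measurable_compose[OF borel_measurable_power[OF Z_meas] measurable_ennreal]] Z_merge norm_B[symmetric]
    by (intro nn_integral_mono quadratic_form_variance) auto
  also have "\<dots> = (\<integral>\<^sup>+X. ennreal (quad_const * (norm (B X))\<^sup>2) \<partial>?M)"
    by (subst fold) (auto simp: B_merge prob_space.emeasure_space_1[OF prob_space_PiM[OF prob_space_axioms]])
  also have "\<dots> = ennreal (quad_const * (\<integral>X. (norm (B X))\<^sup>2 \<partial>?M))"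
    using int quad_const_ge by (subst nn_integral_eq_integral) auto
  finally have le: "(\<integral>\<^sup>+X. ennreal ((Z X)\<^sup>2) \<partial>?M) \<le> ennreal (quad_const * (\<integral>X. (norm (B X))\<^sup>2 \<partial>?M))" .
  then show int_Z: "integrable ?M (\<lambda>X. (Z X)\<^sup>2)"
    by (intro integrableI_nonneg) (auto intro: le_less_trans)
  from le show "(\<integral>X. (Z X)\<^sup>2 \<partial>?M) \<le> quad_const * (\<integral>X. (norm (B X))\<^sup>2 \<partial>?M)"
    using quad_const_ge unfolding nn_integral_eq_integral[OF int_Z AE_I2[OF zero_le_power2]]
    by (subst (asm) ennreal_le_iff) (auto intro!: mult_nonneg_nonneg integral_nonneg_AE)
qed

end

lemma (in standard_law) component_function:
  fixes f :: "real \<Rightarrow> real"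
  assumes "i < n" "a < d" "integrable \<mu> f"
  shows "integrable (iid_mat_law \<mu> n d) (\<lambda>X. f (X (i, a)))"
    and "(\<integral>X. f (X (i, a)) \<partial>iid_mat_law \<mu> n d) = (\<integral>t. f t \<partial>\<mu>)"
proof -
  have D: "distr (iid_mat_law \<mu> n d) \<mu> (\<lambda>X. X (i, a)) = \<mu>"
    unfolding iid_mat_law_def using assms prob_space_axioms by (intro distr_PiM_component) auto
  have m: "(\<lambda>X. X (i, a)) \<in> measurable (iid_mat_law \<mu> n d) \<mu>"
    unfolding iid_mat_law_def using assms by (intro measurable_component_singleton) auto
  show "integrable (iid_mat_law \<mu> n d) (\<lambda>X. f (X (i, a)))"
    using integrable_distr[OF m, of f] assms(3) unfolding D by simp
  show "(\<integral>X. f (X (i, a)) \<partial>iid_mat_law \<mu> n d) = (\<integral>t. f t \<partial>\<mu>)"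
    using integral_distr[OF m, of f] borel_measurable_integrable[OF assms(3)] unfolding D by simp
qed

section \<open>Cauchy--Schwarz and Lipschitz estimates\<close>

lemma integral_abs_mult_le:
  fixes f g :: "'a \<Rightarrow> real"
  assumes [measurable]: "f \<in> borel_measurable M" "g \<in> borel_measurable M"
    and f: "integrable M (\<lambda>x. (f x)\<^sup>2)" and g: "integrable M (\<lambda>x. (g x)\<^sup>2)"
  shows "integrable M (\<lambda>x. f x * g x)"
    and "(\<integral>x. \<bar>f x * g x\<bar> \<partial>M) \<le> sqrt (\<integral>x. (f x)\<^sup>2 \<partial>M) * sqrt (\<integral>x. (g x)\<^sup>2 \<partial>M)"
proof -
  show int: "integrable M (\<lambda>x. f x * g x)"
  proof (rule Bochner_Integration.integrable_bound)
    show "integrable M (\<lambda>x. (f x)\<^sup>2 + (g x)\<^sup>2)" using f g by simp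
    show "AE x in M. norm (f x * g x) \<le> norm ((f x)\<^sup>2 + (g x)\<^sup>2)"
    proof (rule AE_I2)
      fix x
      have "2 * \<bar>f x\<bar> * \<bar>g x\<bar> \<le> \<bar>f x\<bar>\<^sup>2 + \<bar>g x\<bar>\<^sup>2" by (rule sum_squares_bound)
      moreover have "0 \<le> \<bar>f x\<bar> * \<bar>g x\<bar>" by simp
      ultimately have "\<bar>f x\<bar> * \<bar>g x\<bar> \<le> (f x)\<^sup>2 + (g x)\<^sup>2" unfolding power2_abs by linarith
      then show "norm (f x * g x) \<le> norm ((f x)\<^sup>2 + (g x)\<^sup>2)" by (simp add: abs_mult)
    qed
  qed simp
  have "(\<integral>\<^sup>+x. ennreal \<bar>f x\<bar> * ennreal \<bar>g x\<bar> \<partial>M)\<^sup>2 \<le> (\<integral>\<^sup>+x. (ennreal \<bar>f x\<bar>)\<^sup>2 \<partial>M) * (\<integral>\<^sup>+x. (ennreal \<bar>g x\<bar>)\<^sup>2 \<partial>M)"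
    by (rule Cauchy_Schwarz_nn_integral) auto
  also have "(\<integral>\<^sup>+x. ennreal \<bar>f x\<bar> * ennreal \<bar>g x\<bar> \<partial>M) = ennreal (\<integral>x. \<bar>f x * g x\<bar> \<partial>M)"
    using integrable_abs[OF int] by (subst nn_integral_eq_integral[symmetric]) (simp_all add: abs_mult ennreal_mult)
  also have "(\<integral>\<^sup>+x. (ennreal \<bar>f x\<bar>)\<^sup>2 \<partial>M) = ennreal (\<integral>x. (f x)\<^sup>2 \<partial>M)"
    using f by (subst nn_integral_eq_integral[symmetric]) (auto simp: ennreal_power)
  also have "(\<integral>\<^sup>+x. (ennreal \<bar>g x\<bar>)\<^sup>2 \<partial>M) = ennreal (\<integral>x. (g x)\<^sup>2 \<partial>M)"
    using g by (subst nn_integral_eq_integral[symmetric]) (auto simp: ennreal_power)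
  finally have "(\<integral>x. \<bar>f x * g x\<bar> \<partial>M)\<^sup>2 \<le> (\<integral>x. (f x)\<^sup>2 \<partial>M) * (\<integral>x. (g x)\<^sup>2 \<partial>M)"
    by (simp add: ennreal_power ennreal_mult[symmetric] integral_nonneg_AE)
  from real_le_rsqrt[OF this]
  show "(\<integral>x. \<bar>f x * g x\<bar> \<partial>M) \<le> sqrt (\<integral>x. (f x)\<^sup>2 \<partial>M) * sqrt (\<integral>x. (g x)\<^sup>2 \<partial>M)"
    by (simp add: real_sqrt_mult)
qed

lemma (in prob_space) expectation_abs_le:
  fixes f :: "'a \<Rightarrow> real"
  assumes "f \<in> borel_measurable M" "integrable M (\<lambda>x. (f x)\<^sup>2)"
  shows "integrable M f" "(\<integral>x. \<bar>f x\<bar> \<partial>M) \<le> sqrt (\<integral>x. (f x)\<^sup>2 \<partial>M)"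
  using integral_abs_mult_le[of f M "\<lambda>_. 1"] assms by (simp_all add: prob_space)

lemma square_sum_le: "(a + b)\<^sup>2 \<le> 2 * a\<^sup>2 + 2 * (b::real)\<^sup>2"
  using zero_le_power2[of "a - b"] by (simp add: power2_eq_square algebra_simps)

lemma abs_inverse_diff_le:
  fixes x y :: real
  assumes "0 \<le> x" "0 \<le> y"
  shows "\<bar>1 / (1 + x) - 1 / (1 + y)\<bar> \<le> \<bar>x - y\<bar>"
proof -
  have "1 / (1 + x) - 1 / (1 + y) = (y - x) / ((1 + x) * (1 + y))"
    using assms by (simp add: divide_simps)
  then have "\<bar>1 / (1 + x) - 1 / (1 + y)\<bar> = \<bar>x - y\<bar> / ((1 + x) * (1 + y))"
    using assms by (simp add: abs_divide abs_mult abs_minus_commute)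
  also have "\<dots> \<le> \<bar>x - y\<bar> / 1"
    using assms mult_mono[of 1 "1 + x" 1 "1 + y"] by (intro divide_left_mono) auto
  finally show ?thesis by simp
qed

lemma abs_fraction_diff_le:
  fixes x y :: real
  assumes "0 \<le> x" "0 \<le> y"
  shows "\<bar>x / (1 + x) - y / (1 + y)\<bar> \<le> \<bar>x - y\<bar>"
proof -
  have "x / (1 + x) - y / (1 + y) = - (1 / (1 + x) - 1 / (1 + y))"
    using assms by (simp add: divide_simps) (simp add: algebra_simps)
  then show ?thesis using abs_inverse_diff_le[OF assms] by simp
qed

section \<open>The resolvent for a fixed projection\<close>

text \<open>The model conditionally on \<open>W\<close>: the projection is deterministic and only
  \<open>X\<close> is random. The error bounds derived here involve \<open>P\<close> only through
  its rank p.\<close>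

locale ridge = standard_law \<mu> for \<mu> :: "real measure" +
  fixes n d p :: nat and l :: real and P :: fmat and G :: "(nat \<times> nat \<Rightarrow> real) \<Rightarrow> fmat"
  assumes res: "\<And>X. resolvent P (G X) (fm n d X) n l"
    and supp_P: "supp_in d d P" and tr_P: "tr P = real p" and p_le_d: "p \<le> d"
    and dep: "\<And>X X'. fm n d X = fm n d X' \<Longrightarrow> G X = G X'"
    and meas_G: "fmat_measurable (iid_mat_law \<mu> n d) G"
begin

abbreviation "M \<equiv> iid_mat_law \<mu> n d"

text \<open>The restriction keeps the array in the product space, whose elements are
  \<open>undefined\<close> off the index set; this makes \<open>zero_row i\<close> a measurable map
  of that space to itself.\<close>

definition zero_row :: "nat \<Rightarrow> (nat \<times> nat \<Rightarrow> real) \<Rightarrow> nat \<times> nat \<Rightarrow> real" where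
  "zero_row i X = restrict (\<lambda>(a, b). if a = i then 0 else X (a, b)) ({..<n} \<times> {..<d})"

definition H :: "nat \<Rightarrow> (nat \<times> nat \<Rightarrow> real) \<Rightarrow> fmat" where "H i X = G (zero_row i X)"
definition q :: "nat \<Rightarrow> (nat \<times> nat \<Rightarrow> real) \<Rightarrow> real" where
  "q i X = entry (fm n d X * H i X * tp (fm n d X)) i i / n"
definition s :: "nat \<Rightarrow> (nat \<times> nat \<Rightarrow> real) \<Rightarrow> real" where
  "s i X = entry (fm n d X * H i X * H i X * tp (fm n d X)) i i / n"
definition T :: "(nat \<times> nat \<Rightarrow> real) \<Rightarrow> real" where "T X = tr (G X) / n"
definition T2 :: "(nat \<times> nat \<Rightarrow> real) \<Rightarrow> real" where "T2 X = tr (G X * G X) / n"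

lemma l_pos: "l > 0" and n_pos: "n > 0"
  using res[of undefined] by (auto simp: resolvent_def)

sublocale X: prob_space M
  unfolding iid_mat_law_def by (rule prob_space_PiM) (rule prob_space_axioms)

lemma fm_zero_row: "fm n d (zero_row i X) = fm n d X - unit_diag i * fm n d X"
proof (rule fmat_eqI)
  fix a b
  have "entry (unit_diag i * fm n d X) a b = (if a = i then entry (fm n d X) i b else 0)"
    using entry_mult_unit_diag[of "unit_diag i" i "fm n d X" a b] by (simp add: entry_unit_diag)
  then show "entry (fm n d (zero_row i X)) a b = entry (fm n d X - unit_diag i * fm n d X) a b"
    by (simp add: zero_row_def)
qed

lemma leave: "leave_one_out P (G X) (H i X) (fm n d X) n l i"
  using res[of X] res[of "zero_row i X"]
  by (simp add: leave_one_out_def fm_zero_row H_def)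

lemma q_eq: "q i X = leave_one_out.q (H i X) (fm n d X) n i"
  using leave_one_out.q_def[OF leave] by (simp add: q_def)

lemma s_eq: "s i X = leave_one_out.s (H i X) (fm n d X) n i"
  using leave_one_out.s_def[OF leave] by (simp add: s_def)

lemmas q_nonneg = leave_one_out.q_nonneg[OF leave, folded q_eq]
  and s_nonneg = leave_one_out.s_nonneg[OF leave, folded s_eq]
  and s_over_le = leave_one_out.s_over_le[OF leave, folded q_eq s_eq]
  and entry_XGX = leave_one_out.entry_XGX[OF leave, folded q_eq]
  and entry_XGGX = leave_one_out.entry_XGGX[OF leave, folded q_eq s_eq]
  and col_G = leave_one_out.col_G[OF leave, folded q_eq]
  and tr_difference = leave_one_out.tr_difference[OF leave]
  and inner_difference = leave_one_out.inner_difference[OF leave]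
  and entry_off_diagonal = leave_one_out.entry_off_diagonal[OF leave, folded q_eq s_eq]

lemma res_H: "resolvent P (H i X) (fm n d (zero_row i X)) n l"
  unfolding H_def by (rule res)

lemma supp_G: "supp_in d d (G X)"
proof -
  interpret resolvent P "G X" "fm n d X" n l by (rule res)
  have "G X = P * G X * P" using GP PG by (simp add: mult.assoc)
  moreover obtain N where "supp_in N N (G X)" "supp_in N N P" by (rule obtain_supp_in2)
  ultimately show ?thesis by (metis supp_P supp_in_mult)
qed

lemma supp_H: "supp_in d d (H i X)"
  unfolding H_def by (rule supp_G)

lemma measurable_zero_row: "zero_row i \<in> measurable M M"
  unfolding zero_row_def iid_mat_law_def
proof (rule measurable_restrict)
  fix ab assume ab: "ab \<in> {..<n} \<times> {..<d}"
  show "(\<lambda>X. case ab of (a, b) \<Rightarrow> if a = i then 0 else X (a, b)) \<in> measurable (PiM ({..<n} \<times> {..<d}) (\<lambda>_. \<mu>)) \<mu>"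
  proof (cases "fst ab = i")
    case True
    then show ?thesis by (simp add: case_prod_beta)
  next
    case False
    then show ?thesis using ab by (simp add: case_prod_beta measurable_component_singleton)
  qed
qed

lemma meas_H: "fmat_measurable M (H i)"
  unfolding fmat_measurable_def H_def
  using measurable_compose[OF measurable_zero_row measurable_entry[OF meas_G]] by blast

lemma meas_X: "fmat_measurable M (fm n d)"
  unfolding iid_mat_law_def by (rule fmat_measurable_fm) (auto intro: measurable_component_singleton)

lemma meas_X': "fmat_measurable M (\<lambda>X. fm n d (zero_row i X))"
  unfolding fm_zero_row by (intro fmat_measurable_intros meas_X)

lemmas meas_intros = fmat_measurable_intros meas_G meas_H meas_X meas_X' borel_measurable_const
  borel_measurable_diff borel_measurable_add borel_measurable_times borel_measurable_power
  borel_measurable_divide borel_measurable_abs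

lemma meas_T: "T \<in> borel_measurable M" and meas_T2: "T2 \<in> borel_measurable M"
  and meas_q: "q i \<in> borel_measurable M" and meas_s: "s i \<in> borel_measurable M"
  unfolding T_def T2_def q_def s_def by (intro meas_intros)+

lemma H_dep:
  assumes "\<forall>a<n. \<forall>b<d. a \<noteq> i \<longrightarrow> X (a, b) = X' (a, b)"
  shows "zero_row i X = zero_row i X'" "H i X = H i X'"
proof -
  show "zero_row i X = zero_row i X'" unfolding zero_row_def using assms by auto
  then show "H i X = H i X'" by (simp add: H_def)
qed

lemma norm_H_le: "(norm (H i X))\<^sup>2 \<le> p / l\<^sup>2"
  using resolvent.norm_G_square_le[OF res_H, of i X] by (simp add: tr_P)

lemma T_nonneg: "0 \<le> T X" and T_le: "T X \<le> p / (l * n)"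
  using resolvent.tr_G_nonneg[OF res, of X] resolvent.tr_G_le[OF res, of X] n_pos l_pos
  by (simp_all add: T_def tr_P field_simps)

lemma T2_nonneg: "0 \<le> T2 X" and T2_le: "T2 X \<le> p / (l\<^sup>2 * n)"
proof -
  have "T2 X = (norm (G X))\<^sup>2 / n"
    using resolvent.norm_G_square[OF res, of X] by (simp add: T2_def)
  then show "0 \<le> T2 X" "T2 X \<le> p / (l\<^sup>2 * n)"
    using divide_right_mono[OF resolvent.norm_G_square_le[OF res, of X], of "real n"]
    by (simp_all add: tr_P)
qed

lemma integrable_T: "integrable M T" and integrable_T2: "integrable M T2"
  using T_nonneg T_le X.integrable_const_bound[of T "p / (l * n)"] meas_T
    T2_nonneg T2_le X.integrable_const_bound[of T2 "p / (l\<^sup>2 * n)"] meas_T2 by auto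

lemma integrable_bounded:
  fixes f :: "_ \<Rightarrow> real"
  assumes "f \<in> borel_measurable M" "\<And>X. \<bar>f X\<bar> \<le> c"
  shows "integrable M f"
  using assms by (auto intro!: X.integrable_const_bound[of _ c])

text \<open>The bound \<open>g\<close> is allowed to be random because the matrices
  \<open>QSH\<close> met later are controlled only through the norm of \<open>X\<close>.\<close>

lemma quadratic_concentration:
  assumes i: "i < n" and supp: "\<And>X. supp_in d d (B X)"
    and dep: "\<And>X X'. \<forall>a<n. \<forall>b<d. a \<noteq> i \<longrightarrow> X (a, b) = X' (a, b) \<Longrightarrow> B X = B X'"
    and meas: "fmat_measurable M B"
    and bound: "\<And>X. (norm (B X))\<^sup>2 \<le> g X" and int: "integrable M g"
  defines "Z \<equiv> \<lambda>X. entry (fm n d X * B X * tp (fm n d X)) i i - tr (B X)"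
  shows "integrable M (\<lambda>X. (Z X)\<^sup>2)" "(\<integral>X. (Z X)\<^sup>2 \<partial>M) \<le> quad_const * (\<integral>X. g X \<partial>M)"
    "Z \<in> borel_measurable M"
proof -
  have int': "integrable M (\<lambda>X. (norm (B X))\<^sup>2)"
  proof (rule Bochner_Integration.integrable_bound[OF int])
    show "(\<lambda>X. (norm (B X))\<^sup>2) \<in> borel_measurable M" by (intro meas_intros meas)
    show "AE X in M. norm ((norm (B X))\<^sup>2) \<le> norm (g X)"
      using bound order_trans[OF _ abs_ge_self] by (intro AE_I2) force
  qed
  note r = row_quadratic_form_variance[of i n d B, OF i supp dep meas int']
  show "integrable M (\<lambda>X. (Z X)\<^sup>2)" unfolding Z_def by (rule r(1))
  show "(\<integral>X. (Z X)\<^sup>2 \<partial>M) \<le> quad_const * (\<integral>X. g X \<partial>M)"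
    unfolding Z_def
  proof (rule order_trans[OF r(2)])
    show "quad_const * (\<integral>X. (norm (B X))\<^sup>2 \<partial>M) \<le> quad_const * (\<integral>X. g X \<partial>M)"
      using quad_const_ge by (intro mult_left_mono integral_mono int' int bound) auto
  qed
  show "Z \<in> borel_measurable M" unfolding Z_def by (intro meas_intros meas)
qed

section \<open>Concentration of the normalised trace\<close>

lemma q_concentration:
  assumes "i < n"
  shows "integrable M (\<lambda>X. (q i X - tr (H i X) / n)\<^sup>2)"
    and "(\<integral>X. (q i X - tr (H i X) / n)\<^sup>2 \<partial>M) \<le> quad_const * p / (l * n)\<^sup>2"
proof -
  have eq: "(q i X - tr (H i X) / n)\<^sup>2
      = (entry (fm n d X * H i X * tp (fm n d X)) i i - tr (H i X))\<^sup>2 / (real n)\<^sup>2" for X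
    by (simp add: q_def power_divide flip: diff_divide_distrib)
  note c = quadratic_concentration[OF assms, of "H i" "\<lambda>_. p / l\<^sup>2", OF supp_H H_dep(2) meas_H norm_H_le]
  show "integrable M (\<lambda>X. (q i X - tr (H i X) / n)\<^sup>2)" unfolding eq using c(1) by simp
  show "(\<integral>X. (q i X - tr (H i X) / n)\<^sup>2 \<partial>M) \<le> quad_const * p / (l * n)\<^sup>2"
    unfolding eq using divide_right_mono[OF c(2), of "(real n)\<^sup>2"]
    by (simp add: X.prob_space power_mult_distrib)
qed

text \<open>Twice the sum of the variance bound \<open>quad_const * p / (l * n)\<^sup>2\<close> for
  the quadratic form and of the squared cost 1 / (l n) of passing from \<open>H\<close> to
  \<open>G\<close>; of order 1 / n when p / n is bounded.\<close>

definition noise_T :: real where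
  "noise_T = 2 * (quad_const * p + 1) / (l * n)\<^sup>2"

lemma noise_T_nonneg: "0 \<le> noise_T"
  using quad_const_ge by (simp add: noise_T_def)

lemma q_near_T:
  assumes "i < n"
  shows "integrable M (\<lambda>X. (q i X - T X)\<^sup>2)" "(\<integral>X. (q i X - T X)\<^sup>2 \<partial>M) \<le> noise_T"
proof -
  have le: "(q i X - T X)\<^sup>2 \<le> 2 * (q i X - tr (H i X) / n)\<^sup>2 + 2 / (l * n)\<^sup>2" for X
  proof -
    have "\<bar>tr (H i X) / n - T X\<bar> = \<bar>tr (H i X) - tr (G X)\<bar> / n"
      by (simp add: T_def flip: diff_divide_distrib)
    also have "\<dots> \<le> 1 / (l * n)"
      using divide_right_mono[OF tr_difference[of i X], of "real n"] by simp
    finally have "(tr (H i X) / n - T X)\<^sup>2 \<le> (1 / (l * n))\<^sup>2"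
      using abs_le_square_iff[of "tr (H i X) / n - T X" "1 / (l * n)"] l_pos by simp
    moreover have "(q i X - T X)\<^sup>2 \<le> 2 * (q i X - tr (H i X) / n)\<^sup>2 + 2 * (tr (H i X) / n - T X)\<^sup>2"
      using square_sum_le[of "q i X - tr (H i X) / n" "tr (H i X) / n - T X"] by simp
    ultimately show ?thesis by (simp add: power_divide)
  qed
  have int: "integrable M (\<lambda>X. 2 * (q i X - tr (H i X) / n)\<^sup>2 + 2 / (l * n)\<^sup>2)"
    using q_concentration(1)[OF assms] by simp
  show int': "integrable M (\<lambda>X. (q i X - T X)\<^sup>2)"
  proof (rule Bochner_Integration.integrable_bound[OF int])
    show "(\<lambda>X. (q i X - T X)\<^sup>2) \<in> borel_measurable M" by (intro meas_intros meas_q meas_T)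
    show "AE X in M. norm ((q i X - T X)\<^sup>2) \<le> norm (2 * (q i X - tr (H i X) / n)\<^sup>2 + 2 / (l * n)\<^sup>2)"
      using le by (intro AE_I2) (simp add: order_trans[OF _ abs_ge_self])
  qed
  have "(\<integral>X. (q i X - T X)\<^sup>2 \<partial>M) \<le> (\<integral>X. 2 * (q i X - tr (H i X) / n)\<^sup>2 + 2 / (l * n)\<^sup>2 \<partial>M)"
    by (intro integral_mono int int' le)
  also have "\<dots> = 2 * (\<integral>X. (q i X - tr (H i X) / n)\<^sup>2 \<partial>M) + 2 / (l * n)\<^sup>2"
    using q_concentration(1)[OF assms] by (simp add: X.prob_space)
  also have "\<dots> \<le> noise_T"
    using q_concentration(2)[OF assms] by (simp add: noise_T_def add_divide_distrib)
  finally show "(\<integral>X. (q i X - T X)\<^sup>2 \<partial>M) \<le> noise_T" .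
qed

text \<open>The trace of G S is evaluated once by the resolvent equation and once row by row with
  Sherman--Morrison. The identity is exact for every \<open>X\<close>; putting \<open>T\<close> in
  place of all \<open>q i\<close> turns it into the fixed point equation.\<close>

lemma trace_identity: "l * T X + (\<Sum>i<n. q i X / (1 + q i X)) / n = p / n"
proof -
  have "tr (G X * gram n (fm n d X)) = tr (fm n d X * G X * tp (fm n d X)) / n"
    by (simp add: gram_def tr_scaleR) (metis mult.assoc tr_mult_commute)
  also have "\<dots> = (\<Sum>i<n. q i X / (1 + q i X))"
    by (simp add: entry_sum_rows[OF supp_in_fm] sum_divide_distrib entry_XGX)
  finally have "(\<Sum>i<n. q i X / (1 + q i X)) = p - l * tr (G X)"
    using resolvent.tr_G_gram[OF res, of X] by (simp add: tr_P)
  then show ?thesis using n_pos by (simp add: T_def field_simps)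
qed

context
  fixes t \<gamma> :: real
  assumes t_nonneg: "0 \<le> t" and t_eq: "l * t + t / (1 + t) = \<gamma>"
begin

definition err_T :: real where
  "err_T = 2 * (noise_T + (p / n - \<gamma>)\<^sup>2) / l\<^sup>2"

text \<open>The map \<open>x \<mapsto> l x + x / (1 + x)\<close> has slope at least \<open>l\<close>, so an approximate solution of the
  limiting equation is close to the exact one.\<close>
lemma T_deviation:
  "l\<^sup>2 * (T X - t)\<^sup>2 \<le> 2 * ((\<Sum>i<n. (q i X - T X)\<^sup>2) / n) + 2 * (p / n - \<gamma>)\<^sup>2"
proof -
  define e where "e = T X / (1 + T X) - (\<Sum>i<n. q i X / (1 + q i X)) / n"
  have diff: "l * (T X - t) + (T X / (1 + T X) - t / (1 + t)) = e + (p / n - \<gamma>)"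
    using trace_identity[of X] t_eq by (simp add: e_def algebra_simps)
  have same: "0 \<le> (T X - t) * (T X / (1 + T X) - t / (1 + t))"
  proof -
    have "(T X - t) * (T X / (1 + T X) - t / (1 + t)) = (T X - t)\<^sup>2 / ((1 + T X) * (1 + t))"
      using T_nonneg[of X] t_nonneg by (simp add: divide_simps) (simp add: power2_eq_square algebra_simps)
    then show ?thesis using T_nonneg[of X] t_nonneg by simp
  qed
  \<comment> \<open>Both summands have the same sign, since x / (1 + x) is increasing, so dropping
    the second one can only decrease the square.\<close>
  have "l\<^sup>2 * (T X - t)\<^sup>2 \<le> (l * (T X - t) + (T X / (1 + T X) - t / (1 + t)))\<^sup>2"
  proof -
    have "0 \<le> l * ((T X - t) * (T X / (1 + T X) - t / (1 + t)))" using same l_pos by simp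
    then show ?thesis
      using zero_le_power2[of "T X / (1 + T X) - t / (1 + t)"]
      unfolding power2_sum power_mult_distrib by (simp add: mult.assoc)
  qed
  also have "\<dots> \<le> 2 * e\<^sup>2 + 2 * (p / n - \<gamma>)\<^sup>2"
    unfolding diff by (rule square_sum_le)
  also have "e\<^sup>2 \<le> (\<Sum>i<n. (q i X - T X)\<^sup>2) / n"
  proof -
    have "e = (\<Sum>i<n. T X / (1 + T X) - q i X / (1 + q i X)) / n"
      using n_pos by (simp add: e_def sum_subtractf diff_divide_distrib)
    then have "e\<^sup>2 = (\<Sum>i<n. 1 * (T X / (1 + T X) - q i X / (1 + q i X)))\<^sup>2 / (real n)\<^sup>2"
      by (simp add: power_divide)
    also have "\<dots> \<le> (\<Sum>i<n. 1\<^sup>2) * (\<Sum>i<n. (T X / (1 + T X) - q i X / (1 + q i X))\<^sup>2) / (real n)\<^sup>2"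
      by (intro divide_right_mono Cauchy_Schwarz_ineq_sum) simp
    also have "\<dots> = (\<Sum>i<n. (T X / (1 + T X) - q i X / (1 + q i X))\<^sup>2) / n"
      using n_pos by (simp add: power2_eq_square)
    also have "\<dots> \<le> (\<Sum>i<n. (q i X - T X)\<^sup>2) / n"
    proof (intro divide_right_mono sum_mono)
      fix i
      have "\<bar>T X / (1 + T X) - q i X / (1 + q i X)\<bar> \<le> \<bar>q i X - T X\<bar>"
        using abs_fraction_diff_le[OF T_nonneg q_nonneg, of X i X] by (simp add: abs_minus_commute)
      then show "(T X / (1 + T X) - q i X / (1 + q i X))\<^sup>2 \<le> (q i X - T X)\<^sup>2"
        by (simp only: abs_le_square_iff)
    qed simp
    finally show ?thesis .
  qed
  finally show ?thesis by simp
qed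

lemma T_concentration:
  "integrable M (\<lambda>X. (T X - t)\<^sup>2)" "(\<integral>X. (T X - t)\<^sup>2 \<partial>M) \<le> err_T"
proof -
  have "\<bar>T X - t\<bar> \<le> p / (l * n) + t" for X using T_nonneg[of X] T_le[of X] t_nonneg by auto
  then have "\<bar>(T X - t)\<^sup>2\<bar> \<le> (p / (l * n) + t)\<^sup>2" for X
    using power_mono[of "\<bar>T X - t\<bar>" "p / (l * n) + t" 2] by simp
  then show int: "integrable M (\<lambda>X. (T X - t)\<^sup>2)"
    by (intro integrable_bounded) (intro meas_intros meas_T)
  have i: "integrable M (\<lambda>X. (\<Sum>i<n. (q i X - T X)\<^sup>2) / n)"
    using q_near_T(1) by (intro integrable_divide integrable_sum) auto
  have "l\<^sup>2 * (\<integral>X. (T X - t)\<^sup>2 \<partial>M) = (\<integral>X. l\<^sup>2 * (T X - t)\<^sup>2 \<partial>M)" by simp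
  also have "\<dots> \<le> (\<integral>X. 2 * ((\<Sum>i<n. (q i X - T X)\<^sup>2) / n) + 2 * (p / n - \<gamma>)\<^sup>2 \<partial>M)"
    using i by (intro integral_mono T_deviation integrable_mult_right[OF int] Bochner_Integration.integrable_add
        integrable_mult_right[OF i]) auto
  also have "\<dots> = 2 * (\<integral>X. (\<Sum>i<n. (q i X - T X)\<^sup>2) / n \<partial>M) + 2 * (p / n - \<gamma>)\<^sup>2"
    unfolding Bochner_Integration.integral_add[OF integrable_mult_right[OF i] X.integrable_const] integral_mult_right_zero
    by (simp add: X.prob_space)
  also have "(\<integral>X. (\<Sum>i<n. (q i X - T X)\<^sup>2) / n \<partial>M) = (\<Sum>i<n. (\<integral>X. (q i X - T X)\<^sup>2 \<partial>M)) / n"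
    using q_near_T(1) by simp
  also have "\<dots> \<le> (\<Sum>i<n. noise_T) / n"
    by (intro divide_right_mono sum_mono q_near_T) auto
  also have "\<dots> = noise_T" using n_pos by simp
  finally have "l\<^sup>2 * (\<integral>X. (T X - t)\<^sup>2 \<partial>M) \<le> l\<^sup>2 * err_T"
    using l_pos by (simp add: err_T_def)
  then show "(\<integral>X. (T X - t)\<^sup>2 \<partial>M) \<le> err_T" using l_pos by simp
qed

definition err_q :: real where "err_q = 2 * noise_T + 2 * err_T"

lemma q_near_t:
  assumes "i < n"
  shows "integrable M (\<lambda>X. (q i X - t)\<^sup>2)" "(\<integral>X. (q i X - t)\<^sup>2 \<partial>M) \<le> err_q"
proof -
  have le: "(q i X - t)\<^sup>2 \<le> 2 * (q i X - T X)\<^sup>2 + 2 * (T X - t)\<^sup>2" for X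
    using square_sum_le[of "q i X - T X" "T X - t"] by simp
  have int: "integrable M (\<lambda>X. 2 * (q i X - T X)\<^sup>2 + 2 * (T X - t)\<^sup>2)"
    using q_near_T(1)[OF assms] T_concentration(1) by simp
  show int': "integrable M (\<lambda>X. (q i X - t)\<^sup>2)"
  proof (rule Bochner_Integration.integrable_bound[OF int])
    show "(\<lambda>X. (q i X - t)\<^sup>2) \<in> borel_measurable M" by (intro meas_intros meas_q)
    show "AE X in M. norm ((q i X - t)\<^sup>2) \<le> norm (2 * (q i X - T X)\<^sup>2 + 2 * (T X - t)\<^sup>2)"
      using le by (intro AE_I2) (simp add: order_trans[OF _ abs_ge_self])
  qed
  have "(\<integral>X. (q i X - t)\<^sup>2 \<partial>M) \<le> (\<integral>X. 2 * (q i X - T X)\<^sup>2 + 2 * (T X - t)\<^sup>2 \<partial>M)"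
    by (intro integral_mono int int' le)
  also have "\<dots> = 2 * (\<integral>X. (q i X - T X)\<^sup>2 \<partial>M) + 2 * (\<integral>X. (T X - t)\<^sup>2 \<partial>M)"
    using q_near_T(1)[OF assms] T_concentration(1) by simp
  also have "\<dots> \<le> err_q"
    unfolding err_q_def using q_near_T(2)[OF assms] T_concentration(2) by simp
  finally show "(\<integral>X. (q i X - t)\<^sup>2 \<partial>M) \<le> err_q" .
qed

end

end

section \<open>The mean of G S for a fixed projection\<close>

lemma norm_mult_projection:
  assumes "E * E = E" "tp E = E"
  shows "norm (D * E) \<le> norm D" "norm (E * D) \<le> norm D"
proof -
  show *: "norm (D * E) \<le> norm D" for D
  proof (cases "norm (D * E) = 0")
    case False
    have "(norm (D * E))\<^sup>2 = inner D (D * E)"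
      unfolding power2_norm_fmat inner_mult_right using assms by (simp add: mult.assoc)
    also have "\<dots> \<le> norm D * norm (D * E)" by (rule norm_cauchy_schwarz)
    finally show ?thesis using False by (simp add: power2_eq_square)
  qed simp
  show "norm (E * D) \<le> norm D"
    using *[of "tp D"] by (metis assms(2) norm_tp tp_mult)
qed

context ridge
begin

abbreviation "S X \<equiv> gram n (fm n d X)"

lemma norm_X_square: "(norm (fm n d X))\<^sup>2 = (\<Sum>i<n. \<Sum>a<d. (X (i, a))\<^sup>2)"
  by (simp add: power2_norm_supp_in[OF supp_in_fm])

lemma norm_X_expectation:
  "integrable M (\<lambda>X. (norm (fm n d X))\<^sup>2)" "(\<integral>X. (norm (fm n d X))\<^sup>2 \<partial>M) = real n * real d"
proof -
  have i: "integrable M (\<lambda>X. \<Sum>a<d. (X (i, a))\<^sup>2)" if "i < n" for i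
    by (intro Bochner_Integration.integrable_sum component_function(1)) (use that integrable_power[of 2] in auto)
  show "integrable M (\<lambda>X. (norm (fm n d X))\<^sup>2)"
    unfolding norm_X_square by (intro Bochner_Integration.integrable_sum i) auto
  have "(\<integral>X. (norm (fm n d X))\<^sup>2 \<partial>M) = (\<Sum>i<n. \<integral>X. (\<Sum>a<d. (X (i, a))\<^sup>2) \<partial>M)"
    unfolding norm_X_square by (intro Bochner_Integration.integral_sum i) auto
  also have "\<dots> = (\<Sum>i<n. \<Sum>a<d. \<integral>X. (X (i, a))\<^sup>2 \<partial>M)"
    by (intro sum.cong refl Bochner_Integration.integral_sum component_function(1)) (use integrable_power[of 2] in auto)
  also have "\<dots> = real n * real d"
    using component_function(2)[where f = "\<lambda>t. t\<^sup>2"] integrable_power[of 2] by (simp add: second)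
  finally show "(\<integral>X. (norm (fm n d X))\<^sup>2 \<partial>M) = real n * real d" .
qed

lemma norm_GS_square_le: "(norm (G X * S X))\<^sup>2 \<le> (norm (fm n d X))\<^sup>2 / (n * l)"
  by (rule resolvent.norm_G_gram_square[OF res])

lemma supp_GS: "supp_in d d (G X * S X)"
  by (rule supp_in_mult[OF supp_G supp_in_gram[OF supp_in_fm]])

lemma integrable_norm_GS: "integrable M (\<lambda>X. (norm (G X * S X))\<^sup>2)"
proof (rule Bochner_Integration.integrable_bound)
  show "integrable M (\<lambda>X. (norm (fm n d X))\<^sup>2 / (n * l))" using norm_X_expectation(1) by simp
  show "(\<lambda>X. (norm (G X * S X))\<^sup>2) \<in> borel_measurable M" by (intro meas_intros)
  show "AE X in M. norm ((norm (G X * S X))\<^sup>2) \<le> norm ((norm (fm n d X))\<^sup>2 / (n * l))"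
    using norm_GS_square_le l_pos by (intro AE_I2) simp
qed

lemma integrable_entry_GS: "integrable M (\<lambda>X. (entry (G X * S X) a b)\<^sup>2)" "integrable M (\<lambda>X. entry (G X * S X) a b)"
proof -
  show 1: "integrable M (\<lambda>X. (entry (G X * S X) a b)\<^sup>2)"
  proof (rule Bochner_Integration.integrable_bound[OF integrable_norm_GS])
    show "(\<lambda>X. (entry (G X * S X) a b)\<^sup>2) \<in> borel_measurable M" by (intro meas_intros)
    show "AE X in M. norm ((entry (G X * S X) a b)\<^sup>2) \<le> norm ((norm (G X * S X))\<^sup>2)"
      using power_mono[OF abs_entry_le_norm abs_ge_zero, of _ a b 2] by (intro AE_I2) simp
  qed
  show "integrable M (\<lambda>X. entry (G X * S X) a b)"
    by (rule X.expectation_abs_le(1)[OF _ 1]) (intro meas_intros)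
qed

lemma integrable_inner:
  assumes "supp_in d d D"
  shows "integrable M (\<lambda>X. inner D (G X * S X))"
    and "(\<integral>X. inner D (G X * S X) \<partial>M) = inner D (fm d d (\<lambda>(a, b). \<integral>X. entry (G X * S X) a b \<partial>M))"
  unfolding inner_fmat_eq[OF assms] using integrable_entry_GS(2)
  by (auto intro!: Bochner_Integration.integrable_sum integrable_mult_right simp: Bochner_Integration.integral_sum)

text \<open>Writing S as an average of x_i x_i^T and removing row i from \<open>G\<close> exposes
  the weights 1 / (1 + q), which are close to the constant 1 / (1 + t).\<close>

lemma inner_gram_rows:
  "inner D (G X * S X) = (\<Sum>i<n. entry (fm n d X * (tp D * H i X) * tp (fm n d X)) i i / (1 + q i X)) / n"
proof -
  have "inner D (G X * S X) = tr (fm n d X * (tp D * G X) * tp (fm n d X)) / n"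
    by (simp add: gram_def inner_tr tr_scaleR) (metis mult.assoc tr_mult_commute)
  also have "tr (fm n d X * (tp D * G X) * tp (fm n d X))
      = (\<Sum>i<n. entry (fm n d X * (tp D * H i X) * tp (fm n d X)) i i / (1 + q i X))"
    unfolding entry_sum_rows[OF supp_in_fm] using col_G[of "fm n d _ * tp D"]
    by (intro sum.cong refl) (simp add: mult.assoc)
  finally show ?thesis .
qed

lemma G_measurable_inner: "integrable M (\<lambda>X. inner D (G X))" "integrable M (\<lambda>X. inner D (H i X))"
proof -
  have b: "\<bar>inner D (G X)\<bar> \<le> norm D * norm P / l" for X by (rule resolvent.inner_G_le[OF res])
  show "integrable M (\<lambda>X. inner D (G X))"
    by (rule integrable_bounded[OF _ b]) (intro meas_intros)
  show "integrable M (\<lambda>X. inner D (H i X))"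
    by (rule integrable_bounded[OF _ b[of "zero_row i _", folded H_def]]) (intro meas_intros)
qed

lemma norm_P: "norm P = sqrt p"
  using resolvent.norm_P_square[OF res] by (simp add: tr_P real_sqrt_unique)

context
  fixes t \<gamma> :: real
  assumes t_nonneg: "0 \<le> t" and t_eq: "l * t + t / (1 + t) = \<gamma>"
begin

text \<open>Per unit of \<open>norm D\<close>, the three summands are the costs of replacing 1 / (1
  + q) by 1 / (1 + t), the quadratic form by its trace, and \<open>H\<close> by \<open>G\<close>.
  The first one is only o(sqrt p), which is still small against Frobenius norms of order sqrt
  p.\<close>

definition err_D :: real where
  "err_D = (sqrt ((2 * quad_const + 2 * p) * err_q \<gamma>) + sqrt quad_const + 1) / l"

lemma err_q_nonneg: "0 \<le> err_q \<gamma>"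
proof -
  have "0 \<le> err_T \<gamma>" using noise_T_nonneg by (simp add: err_T_def[OF t_nonneg t_eq])
  then show ?thesis using noise_T_nonneg by (simp add: err_q_def[OF t_nonneg t_eq])
qed

lemma test_row:
  assumes i: "i < n" and D: "supp_in d d D"
  shows "integrable M (\<lambda>X. entry (fm n d X * (tp D * H i X) * tp (fm n d X)) i i / (1 + q i X))"
    and "\<bar>(\<integral>X. entry (fm n d X * (tp D * H i X) * tp (fm n d X)) i i / (1 + q i X) \<partial>M)
        - (\<integral>X. inner D (G X) \<partial>M) / (1 + t)\<bar> \<le> err_D * norm D"
proof -
  define r where "r X = entry (fm n d X * (tp D * H i X) * tp (fm n d X)) i i" for X
  define Z where "Z X = r X - inner D (H i X)" for X
  have r_meas: "r \<in> borel_measurable M" unfolding r_def by (intro meas_intros)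
  have Z_eq: "Z X = r X - tr (tp D * H i X)" for X by (simp add: Z_def inner_tr)
  note c = quadratic_concentration[OF i, of "\<lambda>X. tp D * H i X" "\<lambda>_. (norm D / l)\<^sup>2", folded r_def, folded Z_eq]
  have n1: "(norm (tp D * H i X))\<^sup>2 \<le> (norm D / l)\<^sup>2" for X
    using power_mono[OF resolvent.norm_mult_G[OF res_H, of "tp D" i X], of 2] by simp
  have c1: "integrable M (\<lambda>X. (Z X)\<^sup>2)" "(\<integral>X. (Z X)\<^sup>2 \<partial>M) \<le> quad_const * (norm D / l)\<^sup>2" "Z \<in> borel_measurable M"
  proof -
    have dep: "tp D * H i X = tp D * H i X'" if "\<forall>a<n. \<forall>b<d. a \<noteq> i \<longrightarrow> X (a, b) = X' (a, b)" for X X'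
      using H_dep(2)[OF that] by simp
    have meas: "fmat_measurable M (\<lambda>X. tp D * H i X)" by (intro meas_intros)
    note c' = c[OF supp_in_mult[OF supp_in_tp[OF D] supp_H] dep meas n1 X.integrable_const]
    show "integrable M (\<lambda>X. (Z X)\<^sup>2)" by (rule c'(1))
    show "Z \<in> borel_measurable M" unfolding Z_def by (intro meas_intros r_meas)
    show "(\<integral>X. (Z X)\<^sup>2 \<partial>M) \<le> quad_const * (norm D / l)\<^sup>2"
      using c'(2) by (simp add: X.prob_space)
  qed
  have ZZ: "integrable M Z" "(\<integral>X. \<bar>Z X\<bar> \<partial>M) \<le> sqrt quad_const * (norm D / l)"
  proof -
    show "integrable M Z" by (rule X.expectation_abs_le(1)[OF c1(3,1)])
    have "(\<integral>X. \<bar>Z X\<bar> \<partial>M) \<le> sqrt (\<integral>X. (Z X)\<^sup>2 \<partial>M)"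
      by (rule X.expectation_abs_le(2)[OF c1(3,1)])
    also have "\<dots> \<le> sqrt (quad_const * (norm D / l)\<^sup>2)" using c1(2) by simp
    also have "\<dots> = sqrt quad_const * (norm D / l)" using l_pos by (simp add: real_sqrt_mult)
    finally show "(\<integral>X. \<bar>Z X\<bar> \<partial>M) \<le> sqrt quad_const * (norm D / l)" .
  qed
  \<comment> \<open>The trace part of the form can be as large as sqrt p times the norm of
    \<open>D\<close>; this puts the factor p into the first summand of \<open>err_D\<close>.\<close>
  have inner_H: "(inner D (H i X))\<^sup>2 \<le> p * (norm D / l)\<^sup>2" for X
  proof -
    have "\<bar>inner D (H i X)\<bar> \<le> norm D * norm P / l"
      by (rule resolvent.inner_G_le[OF res_H])
    then have "(inner D (H i X))\<^sup>2 \<le> (norm D * norm P / l)\<^sup>2"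
      using abs_le_square_iff[of "inner D (H i X)" "norm D * norm P / l"] l_pos by simp
    then show ?thesis by (simp add: norm_P power_mult_distrib power_divide mult.commute)
  qed
  have r_le: "(r X)\<^sup>2 \<le> 2 * (Z X)\<^sup>2 + 2 * (p * (norm D / l)\<^sup>2)" for X
    using square_sum_le[of "Z X" "inner D (H i X)"] inner_H[of X] by (simp add: Z_def)
  have r_int: "integrable M (\<lambda>X. (r X)\<^sup>2)"
  proof (rule Bochner_Integration.integrable_bound)
    show "integrable M (\<lambda>X. 2 * (Z X)\<^sup>2 + 2 * (p * (norm D / l)\<^sup>2))" using c1(1) by simp
    show "(\<lambda>X. (r X)\<^sup>2) \<in> borel_measurable M" by (intro meas_intros r_meas)
    show "AE X in M. norm ((r X)\<^sup>2) \<le> norm (2 * (Z X)\<^sup>2 + 2 * (p * (norm D / l)\<^sup>2))"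
      using r_le by (intro AE_I2) (simp add: order_trans[OF _ abs_ge_self])
  qed
  have r_E: "(\<integral>X. (r X)\<^sup>2 \<partial>M) \<le> (2 * quad_const + 2 * p) * (norm D / l)\<^sup>2"
  proof -
    have "(\<integral>X. (r X)\<^sup>2 \<partial>M) \<le> (\<integral>X. 2 * (Z X)\<^sup>2 + 2 * (p * (norm D / l)\<^sup>2) \<partial>M)"
      using c1(1) by (intro integral_mono r_int r_le) auto
    also have "\<dots> = 2 * (\<integral>X. (Z X)\<^sup>2 \<partial>M) + 2 * (p * (norm D / l)\<^sup>2)"
      using c1(1) by (simp add: X.prob_space)
    finally show ?thesis using c1(2) by (simp add: algebra_simps)
  qed
  have w_le: "\<bar>1 / (1 + q i X) - 1 / (1 + t)\<bar> \<le> \<bar>q i X - t\<bar>" for X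
    by (rule abs_inverse_diff_le[OF q_nonneg t_nonneg])
  note rq = integral_abs_mult_le[of r M "\<lambda>X. q i X - t", OF r_meas _ r_int q_near_t(1)[OF t_nonneg t_eq i]]
  have q_meas: "(\<lambda>X. q i X - t) \<in> borel_measurable M" by (intro meas_intros meas_q)
  have d_meas: "(\<lambda>X. r X * (1 / (1 + q i X) - 1 / (1 + t))) \<in> borel_measurable M"
    by (intro meas_intros meas_q r_meas)
  have d_int: "integrable M (\<lambda>X. r X * (1 / (1 + q i X) - 1 / (1 + t)))"
  proof (rule Bochner_Integration.integrable_bound[OF rq(1)[OF q_meas] d_meas])
    show "AE X in M. norm (r X * (1 / (1 + q i X) - 1 / (1 + t))) \<le> norm (r X * (q i X - t))"
      using w_le by (intro AE_I2) (simp add: abs_mult mult_left_mono)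
  qed
  have d_E: "(\<integral>X. \<bar>r X * (1 / (1 + q i X) - 1 / (1 + t))\<bar> \<partial>M) \<le> sqrt ((2 * quad_const + 2 * p) * err_q \<gamma>) * (norm D / l)"
  proof -
    have "(\<integral>X. \<bar>r X * (1 / (1 + q i X) - 1 / (1 + t))\<bar> \<partial>M) \<le> (\<integral>X. \<bar>r X * (q i X - t)\<bar> \<partial>M)"
      using w_le by (intro integral_mono integrable_abs d_int rq(1)[OF q_meas]) (simp add: abs_mult mult_left_mono)
    also have "\<dots> \<le> sqrt (\<integral>X. (r X)\<^sup>2 \<partial>M) * sqrt (\<integral>X. (q i X - t)\<^sup>2 \<partial>M)" by (rule rq(2)[OF q_meas])
    also have "\<dots> \<le> sqrt ((2 * quad_const + 2 * p) * (norm D / l)\<^sup>2) * sqrt (err_q \<gamma>)"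
    proof (intro mult_mono real_sqrt_le_mono r_E q_near_t(2)[OF t_nonneg t_eq i] real_sqrt_ge_zero)
      show "0 \<le> (2 * quad_const + 2 * p) * (norm D / l)\<^sup>2" using quad_const_ge by simp
    qed (simp add: integral_nonneg_AE)
    also have "\<dots> = sqrt ((2 * quad_const + 2 * p) * err_q \<gamma>) * (norm D / l)"
      using l_pos by (simp add: real_sqrt_mult)
    finally show ?thesis .
  qed
  have split: "r X / (1 + q i X) = r X * (1 / (1 + q i X) - 1 / (1 + t)) + Z X / (1 + t) + inner D (H i X) / (1 + t)" for X
    by (simp add: Z_def algebra_simps add_divide_distrib[symmetric] diff_divide_distrib)
  have "integrable M (\<lambda>X. r X / (1 + q i X))"
    unfolding split using d_int ZZ(1) G_measurable_inner(2)
    by (intro Bochner_Integration.integrable_add integrable_divide) auto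
  then show "integrable M (\<lambda>X. entry (fm n d X * (tp D * H i X) * tp (fm n d X)) i i / (1 + q i X))"
    by (simp add: r_def)
  have E: "(\<integral>X. r X / (1 + q i X) \<partial>M) = (\<integral>X. r X * (1 / (1 + q i X) - 1 / (1 + t)) \<partial>M)
      + (\<integral>X. Z X \<partial>M) / (1 + t) + (\<integral>X. inner D (H i X) \<partial>M) / (1 + t)"
    unfolding split using d_int ZZ(1) G_measurable_inner(2)[of D i]
    by (simp only: Bochner_Integration.integral_add Bochner_Integration.integrable_add integrable_divide integral_divide_zero)
  have a1: "\<bar>\<integral>X. r X * (1 / (1 + q i X) - 1 / (1 + t)) \<partial>M\<bar> \<le> sqrt ((2 * quad_const + 2 * p) * err_q \<gamma>) * (norm D / l)"
    by (rule order_trans[OF integral_abs_bound d_E])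
  have small: "\<bar>x / (1 + t)\<bar> \<le> y" if "\<bar>x\<bar> \<le> y" for x y
  proof -
    have "\<bar>x / (1 + t)\<bar> = \<bar>x\<bar> / (1 + t)" using t_nonneg by simp
    also have "\<dots> \<le> \<bar>x\<bar> / 1" using t_nonneg by (intro divide_left_mono) auto
    finally show ?thesis using that by simp
  qed
  have a2: "\<bar>(\<integral>X. Z X \<partial>M) / (1 + t)\<bar> \<le> sqrt quad_const * (norm D / l)"
    by (rule small) (rule order_trans[OF integral_abs_bound ZZ(2)])
  have "\<bar>(\<integral>X. inner D (H i X) \<partial>M) - (\<integral>X. inner D (G X) \<partial>M)\<bar> = \<bar>\<integral>X. inner D (H i X) - inner D (G X) \<partial>M\<bar>"
    by (simp add: Bochner_Integration.integral_diff G_measurable_inner)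
  also have "\<dots> \<le> (\<integral>X. \<bar>inner D (H i X) - inner D (G X)\<bar> \<partial>M)" by (rule integral_abs_bound)
  also have "\<dots> \<le> (\<integral>X. norm D / l \<partial>M)"
    by (intro integral_mono integrable_abs Bochner_Integration.integrable_diff G_measurable_inner inner_difference) auto
  finally have "\<bar>(\<integral>X. inner D (H i X) \<partial>M) - (\<integral>X. inner D (G X) \<partial>M)\<bar> \<le> norm D / l"
    by (simp add: X.prob_space)
  from small[OF this]
  have a3: "\<bar>(\<integral>X. inner D (H i X) \<partial>M) / (1 + t) - (\<integral>X. inner D (G X) \<partial>M) / (1 + t)\<bar> \<le> norm D / l"
    by (simp add: diff_divide_distrib)
  have "\<bar>(\<integral>X. r X / (1 + q i X) \<partial>M) - (\<integral>X. inner D (G X) \<partial>M) / (1 + t)\<bar>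
      \<le> sqrt ((2 * quad_const + 2 * p) * err_q \<gamma>) * (norm D / l) + sqrt quad_const * (norm D / l) + norm D / l"
    unfolding E using a1 a2 a3 by linarith
  also have "\<dots> = err_D * norm D" by (simp add: err_D_def add_divide_distrib distrib_right)
  finally show "\<bar>(\<integral>X. entry (fm n d X * (tp D * H i X) * tp (fm n d X)) i i / (1 + q i X) \<partial>M)
        - (\<integral>X. inner D (G X) \<partial>M) / (1 + t)\<bar> \<le> err_D * norm D"
    by (simp add: r_def)
qed

lemma test_matrix:
  assumes D: "supp_in d d D"
  shows "\<bar>(\<integral>X. inner D (G X * S X) \<partial>M) - (\<integral>X. inner D (G X) \<partial>M) / (1 + t)\<bar> \<le> err_D * norm D"
proof -
  let ?f = "\<lambda>i X. entry (fm n d X * (tp D * H i X) * tp (fm n d X)) i i / (1 + q i X)"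
  let ?c = "(\<integral>X. inner D (G X) \<partial>M) / (1 + t)"
  have "(\<integral>X. inner D (G X * S X) \<partial>M) = (\<Sum>i<n. \<integral>X. ?f i X \<partial>M) / n"
    unfolding inner_gram_rows using test_row(1)[OF _ D] by simp
  then have "(\<integral>X. inner D (G X * S X) \<partial>M) - ?c = (\<Sum>i<n. (\<integral>X. ?f i X \<partial>M) - ?c) / n"
    using n_pos by (simp add: sum_subtractf diff_divide_distrib)
  then have "\<bar>(\<integral>X. inner D (G X * S X) \<partial>M) - ?c\<bar> = \<bar>\<Sum>i<n. (\<integral>X. ?f i X \<partial>M) - ?c\<bar> / n" by simp
  also have "\<dots> \<le> (\<Sum>i<n. \<bar>(\<integral>X. ?f i X \<partial>M) - ?c\<bar>) / n"
    by (intro divide_right_mono sum_abs) simp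
  also have "\<dots> \<le> (\<Sum>i<n. err_D * norm D) / n"
    using test_row(2)[OF _ D] by (intro divide_right_mono sum_mono) auto
  finally show ?thesis using n_pos by simp
qed

text \<open>For t = \<gamma> \<open>theta1\<close> this is 1 - l \<open>theta1\<close>, because then
  \<open>theta1\<close> = 1 / (l + 1 / (1 + t)). It is expressed by \<open>t\<close> since only the
  fixed point equation is available here.\<close>

definition kap :: real where "kap = 1 / (1 + t) / (l + 1 / (1 + t))"

lemma kap_bounds: "0 \<le> kap" "kap \<le> 1"
proof -
  have w: "0 < 1 / (1 + t)" using t_nonneg by simp
  have "x / (l + x) \<le> 1 \<and> 0 \<le> x / (l + x)" if "0 < x" for x using that l_pos by simp
  from this[OF w] show "0 \<le> kap" "kap \<le> 1" unfolding kap_def by blast+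
qed

lemma err_D_nonneg: "0 \<le> err_D"
  using quad_const_ge err_q_nonneg l_pos by (simp add: err_D_def)

lemma norm_mult_P: "norm (D * P) \<le> norm D"
  using res[of undefined] by (intro norm_mult_projection) (auto simp: resolvent_def)

text \<open>Tested against \<open>D * P\<close>, the matrix G S is exactly P - l G, so
  \<open>test_matrix\<close> becomes a linear equation for the mean a of inner D G, namely (l + 1 /
  (1 + t)) a \<approx> inner D P. Inserting its solution into \<open>test_matrix\<close> for
  \<open>D\<close> itself gives the claim; the two uses account for the factor 2.\<close>

lemma inner_mean:
  assumes D: "supp_in d d D"
  shows "\<bar>(\<integral>X. inner D (G X * S X) \<partial>M) - kap * inner D P\<bar> \<le> 2 * err_D * norm D"
proof -
  let ?a = "\<integral>X. inner D (G X) \<partial>M" and ?w = "1 / (1 + t)"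
  have w: "0 < ?w" using t_nonneg by simp
  have G1: "inner (D * P) (G X) = inner D (G X)" for X
    using resolvent.GP[OF res, of X] resolvent.tpP[OF res] by (simp add: inner_mult_right)
  have G2: "inner (D * P) (G X * S X) = inner D P - l * inner D (G X)" for X
  proof -
    have "inner (D * P) (G X * S X) = inner D (G X * S X * P)"
      using resolvent.tpP[OF res] by (simp add: inner_mult_right)
    also have "G X * S X * P = P - l *\<^sub>R G X" using resolvent.right[OF res, of X] by (simp add: algebra_simps)
    finally show ?thesis by (simp add: inner_diff_right)
  qed
  have "\<bar>(\<integral>X. inner (D * P) (G X * S X) \<partial>M) - (\<integral>X. inner (D * P) (G X) \<partial>M) / (1 + t)\<bar> \<le> err_D * norm (D * P)"
    by (rule test_matrix[OF supp_in_mult[OF D supp_P]])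
  also have "\<dots> \<le> err_D * norm D" by (intro mult_left_mono norm_mult_P err_D_nonneg)
  finally have "\<bar>(inner D P - l * ?a) - ?w * ?a\<bar> \<le> err_D * norm D"
    unfolding G1 G2 using G_measurable_inner(1)[of D] by (simp add: X.prob_space)
  then have "\<bar>inner D P - (l + ?w) * ?a\<bar> \<le> err_D * norm D" by (simp add: algebra_simps)
  then have "kap * \<bar>inner D P - (l + ?w) * ?a\<bar> \<le> 1 * (err_D * norm D)"
    using kap_bounds err_D_nonneg by (intro mult_mono) auto
  moreover have "kap * \<bar>inner D P - (l + ?w) * ?a\<bar> = \<bar>kap * inner D P - ?w * ?a\<bar>"
  proof -
    have "kap * (inner D P - (l + ?w) * ?a) = kap * inner D P - ?w * ?a"
    proof -
      have "y / z * (x - z * b) = y / z * x - y * b" if "0 < z" for x y z b :: real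
        using that by (simp add: right_diff_distrib)
      then show ?thesis unfolding kap_def using w l_pos by (metis add_pos_pos)
    qed
    then show ?thesis using kap_bounds(1) by (metis abs_mult abs_of_nonneg)
  qed
  ultimately have "\<bar>kap * inner D P - ?w * ?a\<bar> \<le> err_D * norm D" by simp
  with test_matrix[OF D] show ?thesis by (simp add: abs_le_iff)
qed

definition mean_GS :: fmat where
  "mean_GS = fm d d (\<lambda>(a, b). \<integral>X. entry (G X * S X) a b \<partial>M)"

text \<open>Duality: the bound of \<open>inner_mean\<close> is linear in the norm of the test matrix
  and uniform over test matrices, so the deviation itself, which is deterministic, may serve as
  \<open>D\<close>.\<close>

lemma mean_GS_deviation: "norm (mean_GS - kap *\<^sub>R P) \<le> 2 * err_D"
proof (cases "norm (mean_GS - kap *\<^sub>R P) = 0")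
  case False
  let ?D = "mean_GS - kap *\<^sub>R P"
  have D: "supp_in d d ?D"
    by (intro supp_in_diff supp_in_scaleR supp_P) (simp add: mean_GS_def)
  have "(norm ?D)\<^sup>2 = (\<integral>X. inner ?D (G X * S X) \<partial>M) - kap * inner ?D P"
    unfolding power2_norm_fmat integrable_inner(2)[OF D] mean_GS_def[symmetric]
    by (simp add: inner_diff_right)
  also have "\<dots> \<le> 2 * err_D * norm ?D" using inner_mean[OF D] by simp
  finally show ?thesis using False by (simp add: power2_eq_square)
qed (use err_D_nonneg in simp)

end

section \<open>The part of G S outside the range of the projection\<close>

definition Q :: fmat where "Q = idm d - P"

lemma QQ: "Q * Q = Q" and tp_Q: "tp Q = Q" and supp_Q: "supp_in d d Q" and PQ: "P * Q = 0" and QP: "Q * P = 0"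
    and tr_Q: "tr Q = real d - real p"
  using resolvent.PP[OF res] resolvent.tpP[OF res] idm_mult[OF supp_P] mult_idm[OF supp_P] idm_mult[OF supp_in_idm]
  by (simp_all add: Q_def algebra_simps supp_in_diff supp_P tr_diff tr_P)

lemma HQ: "H i X * Q = 0"
  using resolvent.GP[OF res_H, of i X] PQ by (metis mult.assoc mult_zero_right)

lemma norm_Q: "(norm Q)\<^sup>2 = real d - real p"
  by (simp add: power2_norm_fmat inner_tr QQ tp_Q tr_Q)

definition F :: "(nat \<times> nat \<Rightarrow> real) \<Rightarrow> real" where
  "F X = (norm (G X * S X * Q))\<^sup>2"

lemma F_rows: "F X = (\<Sum>i<n. entry (fm n d X * Q * S X * G X * G X * tp (fm n d X)) i i) / n"
proof -
  have "F X = tr (Q * (S X * (G X * (G X * (S X * Q)))))"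
    unfolding F_def power2_norm_fmat inner_tr
    using resolvent.tp_G[OF res, of X] by (simp add: tp_Q mult.assoc)
  also have "\<dots> = tr (S X * (G X * (G X * (S X * Q))) * Q)" by (rule tr_mult_commute)
  also have "\<dots> = tr (S X * (G X * (G X * (S X * Q))))" by (simp add: mult.assoc QQ)
  also have "\<dots> = tr (S X * G X * G X * (tp (fm n d X) * (fm n d X * Q))) / n"
    by (simp add: gram_def[of _ "fm n d X"] mult.assoc tr_scaleR)
  also have "\<dots> = tr (fm n d X * Q * S X * G X * G X * tp (fm n d X)) / n"
    by (metis mult.assoc tr_mult_commute)
  also have "tr (fm n d X * Q * S X * G X * G X * tp (fm n d X)) =
      (\<Sum>i<n. entry (fm n d X * Q * S X * G X * G X * tp (fm n d X)) i i)"
    using entry_sum_rows[OF supp_in_fm, of n d X "Q * S X * G X * G X"] by (simp add: mult.assoc)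
  finally show ?thesis .
qed

text \<open>The left side is the average weight of the main term in
  \<open>entry_off_diagonal\<close>; the identity expresses it exactly by the first two
  traces.\<close>

lemma second_trace_identity: "(\<Sum>i<n. s i X / (1 + q i X)\<^sup>2) / n = T X - l * T2 X"
proof -
  have "tr (G X * G X * S X) = tr (fm n d X * (G X * G X) * tp (fm n d X)) / n"
    by (simp add: gram_def tr_scaleR) (metis mult.assoc tr_mult_commute)
  also have "\<dots> = (\<Sum>i<n. s i X / (1 + q i X)\<^sup>2)"
    unfolding entry_sum_rows[OF supp_in_fm] using entry_XGGX by (simp add: sum_divide_distrib mult.assoc)
  finally have "(\<Sum>i<n. s i X / (1 + q i X)\<^sup>2) = tr (G X) - l * tr (G X * G X)"
    using resolvent.tr_GG_gram[OF res, of X] by simp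
  then show ?thesis unfolding T_def T2_def by (simp only:) (simp add: diff_divide_distrib)
qed

text \<open>The common factor of the remainder matrices in \<open>entry_off_diagonal\<close>. It is
  a function of the rows other than i alone.\<close>

definition QSH :: "nat \<Rightarrow> (nat \<times> nat \<Rightarrow> real) \<Rightarrow> fmat" where
  "QSH i X = Q * S (zero_row i X) * H i X"

definition quad :: "nat \<Rightarrow> fmat \<Rightarrow> (nat \<times> nat \<Rightarrow> real) \<Rightarrow> real" where
  "quad i B X = entry (fm n d X * B * tp (fm n d X)) i i"

lemma norm_QSH: "(norm (QSH i X))\<^sup>2 \<le> (norm (fm n d X))\<^sup>2 / (n * l)"
proof -
  have "norm (QSH i X) \<le> norm (S (zero_row i X) * H i X)"
    unfolding QSH_def mult.assoc by (intro norm_mult_projection QQ tp_Q)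
  also have "\<dots> = norm (H i X * S (zero_row i X))"
    using resolvent.tp_G[OF res_H, of i X] by (metis norm_tp tp_gram tp_mult)
  finally have "(norm (QSH i X))\<^sup>2 \<le> (norm (H i X * S (zero_row i X)))\<^sup>2" by (intro power_mono) auto
  also have "\<dots> \<le> (norm (fm n d (zero_row i X)))\<^sup>2 / (n * l)"
    by (rule resolvent.norm_G_gram_square[OF res_H])
  also have "\<dots> \<le> (norm (fm n d X))\<^sup>2 / (n * l)"
    unfolding norm_X_square using l_pos
    by (intro divide_right_mono sum_mono) (auto simp: zero_row_def)
  finally show ?thesis .
qed

lemma quad_expectation:
  assumes i: "i < n" and supp: "\<And>X. supp_in d d (B X)"
    and dep: "\<And>X X'. \<forall>a<n. \<forall>b<d. a \<noteq> i \<longrightarrow> X (a, b) = X' (a, b) \<Longrightarrow> B X = B X'"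
    and meas: "fmat_measurable M B"
    and bound: "\<And>X. (norm (B X))\<^sup>2 \<le> g X" and int: "integrable M g"
  shows "integrable M (\<lambda>X. quad i (B X) X - tr (B X))"
    "(\<integral>X. \<bar>quad i (B X) X - tr (B X)\<bar> \<partial>M) \<le> sqrt (quad_const * (\<integral>X. g X \<partial>M))"
proof -
  note c = quadratic_concentration[OF i supp dep meas bound int]
  show "integrable M (\<lambda>X. quad i (B X) X - tr (B X))"
    unfolding quad_def by (rule X.expectation_abs_le(1)[OF c(3,1)])
  show "(\<integral>X. \<bar>quad i (B X) X - tr (B X)\<bar> \<partial>M) \<le> sqrt (quad_const * (\<integral>X. g X \<partial>M))"
    unfolding quad_def using X.expectation_abs_le(2)[OF c(3,1)] c(2) by (meson order_trans real_sqrt_le_mono)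
qed

text \<open>Of order sqrt d, while \<open>F\<close> is divided by d in the risk.\<close>

definition err_F :: real where
  "err_F = sqrt (quad_const * d) / l + 2 * sqrt (quad_const * (d / l)) / l"

text \<open>In \<open>entry_off_diagonal\<close> the form in \<open>Q\<close> is split into its
  trace and a fluctuation. The trace parts add up to tr Q times
  \<open>second_trace_identity\<close>. The random weights of everything else are bounded by
  constants through \<open>s_over_le\<close>.\<close>

lemma F_deviation:
  "\<bar>F X - (real d - real p) * (T X - l * T2 X)\<bar>
    \<le> (\<Sum>i<n. \<bar>quad i Q X - tr Q\<bar> / l + \<bar>quad i (QSH i X * H i X) X\<bar> + \<bar>quad i (QSH i X) X\<bar> / l) / n"
proof -
  let ?e = "\<lambda>i. (quad i Q X - tr Q) * (s i X / (1 + q i X)\<^sup>2) +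
     (quad i (QSH i X * H i X) X - s i X / (1 + q i X) * quad i (QSH i X) X) / (1 + q i X)"
  have row: "entry (fm n d X * Q * S X * G X * G X * tp (fm n d X)) i i = tr Q * (s i X / (1 + q i X)\<^sup>2) + ?e i" for i
    unfolding quad_def QSH_def
    using entry_off_diagonal[of X Q i] by (simp add: fm_zero_row algebra_simps add_divide_distrib)
  have "F X - (real d - real p) * (T X - l * T2 X) = (\<Sum>i<n. ?e i) / n"
    unfolding F_rows second_trace_identity[symmetric] row tr_Q[symmetric]
    by (simp add: sum.distrib sum_distrib_left add_divide_distrib)
  then have "\<bar>F X - (real d - real p) * (T X - l * T2 X)\<bar> = \<bar>\<Sum>i<n. ?e i\<bar> / n" by simp
  also have "\<dots> \<le> (\<Sum>i<n. \<bar>?e i\<bar>) / n" by (intro divide_right_mono sum_abs) simp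
  also have "\<dots> \<le> (\<Sum>i<n. \<bar>quad i Q X - tr Q\<bar> / l + \<bar>quad i (QSH i X * H i X) X\<bar> + \<bar>quad i (QSH i X) X\<bar> / l) / n"
  proof (intro divide_right_mono sum_mono)
    fix i
    have small: "\<bar>x / (1 + q i X)\<bar> \<le> \<bar>x\<bar>" for x
      using divide_left_mono[of 1 "1 + q i X" "\<bar>x\<bar>"] q_nonneg[of i X] by simp
    have "\<bar>(quad i Q X - tr Q) * (s i X / (1 + q i X)\<^sup>2)\<bar> \<le> \<bar>quad i Q X - tr Q\<bar> * (1 / l)"
      unfolding abs_mult using s_over_le[of i X] s_nonneg[of i X] by (intro mult_left_mono) auto
    moreover have "\<bar>s i X / (1 + q i X) * quad i (QSH i X) X\<bar> \<le> 1 / l * \<bar>quad i (QSH i X) X\<bar>"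
      unfolding abs_mult abs_of_nonneg[OF s_over_le(3)] by (intro mult_right_mono s_over_le(1)) auto
    ultimately show "\<bar>?e i\<bar> \<le> \<bar>quad i Q X - tr Q\<bar> / l + \<bar>quad i (QSH i X * H i X) X\<bar> + \<bar>quad i (QSH i X) X\<bar> / l"
      using small[of "quad i (QSH i X * H i X) X - s i X / (1 + q i X) * quad i (QSH i X) X"]
      unfolding times_divide_eq_left times_divide_eq_right mult_1 mult_1_right by linarith
  qed simp
  finally show ?thesis .
qed

lemma integrable_F: "integrable M F"
proof (rule Bochner_Integration.integrable_bound[OF integrable_norm_GS])
  show "F \<in> borel_measurable M" unfolding F_def by (intro meas_intros)
  have "F X \<le> (norm (G X * S X))\<^sup>2" for X
    unfolding F_def by (intro power_mono norm_mult_projection QQ tp_Q) simp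
  then show "AE X in M. norm (F X) \<le> norm ((norm (G X * S X))\<^sup>2)"
    by (intro AE_I2) (simp add: F_def)
qed

lemma F_expectation:
  "\<bar>(\<integral>X. F X \<partial>M) - (real d - real p) * (\<integral>X. T X - l * T2 X \<partial>M)\<bar> \<le> err_F"
proof -
  let ?g = "\<lambda>X. (norm (fm n d X))\<^sup>2 / (n * l)"
  have g: "integrable M ?g" "(\<integral>X. ?g X \<partial>M) = d / l"
    using norm_X_expectation n_pos by simp_all
  have supp: "supp_in d d (QSH i X)" for i X
    unfolding QSH_def by (rule supp_in_mult[OF supp_in_mult[OF supp_Q supp_in_gram[OF supp_in_fm]] supp_H])
  have dep: "QSH i X = QSH i X'" if "\<forall>a<n. \<forall>b<d. a \<noteq> i \<longrightarrow> X (a, b) = X' (a, b)" for i X X'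
  proof -
    have "zero_row i X = zero_row i X'" by (rule H_dep(1)) (rule that)
    then show ?thesis by (simp add: QSH_def H_def)
  qed
  have meas: "fmat_measurable M (QSH i)" for i
    unfolding QSH_def by (intro meas_intros)
  \<comment> \<open>By cyclicity \<open>Q\<close> moves to the right of \<open>H i X\<close> and
    annihilates it; the forms therefore concentrate around 0.\<close>
  have tr0: "tr (QSH i X) = 0" "tr (QSH i X * H i X) = 0" for i X
    unfolding QSH_def using tr_mult_commute[of Q] HQ[of i X] by (metis mult.assoc mult_zero_right tr_scaleR mult_zero_left scaleR_zero_left)+
  have norm2: "(norm (QSH i X * H i X))\<^sup>2 \<le> ?g X / l\<^sup>2" for i X
  proof -
    have "(norm (QSH i X * H i X))\<^sup>2 \<le> (norm (QSH i X) / l)\<^sup>2"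
      by (intro power_mono resolvent.norm_mult_G[OF res_H]) simp
    also have "\<dots> \<le> ?g X / l\<^sup>2" unfolding power_divide by (intro divide_right_mono norm_QSH) simp
    finally show ?thesis .
  qed
  have q1: "integrable M (\<lambda>X. \<bar>quad i Q X - tr Q\<bar>)" "(\<integral>X. \<bar>quad i Q X - tr Q\<bar> \<partial>M) \<le> sqrt (quad_const * d)" if "i < n" for i
  proof -
    note c = quad_expectation[of i "\<lambda>_. Q" "\<lambda>_. real d - real p", OF that supp_Q refl fmat_measurable_const _ X.integrable_const]
    show "integrable M (\<lambda>X. \<bar>quad i Q X - tr Q\<bar>)" using c(1) norm_Q by (intro integrable_abs) simp
    have "(\<integral>X. \<bar>quad i Q X - tr Q\<bar> \<partial>M) \<le> sqrt (quad_const * (real d - real p))"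
      using c(2) norm_Q by (simp add: X.prob_space)
    also have "\<dots> \<le> sqrt (quad_const * d)"
      using quad_const_ge by (intro real_sqrt_le_mono mult_left_mono) auto
    finally show "(\<integral>X. \<bar>quad i Q X - tr Q\<bar> \<partial>M) \<le> sqrt (quad_const * d)" .
  qed
  have q2: "integrable M (\<lambda>X. \<bar>quad i (QSH i X) X\<bar>)" "(\<integral>X. \<bar>quad i (QSH i X) X\<bar> \<partial>M) \<le> sqrt (quad_const * (d / l))" if "i < n" for i
  proof -
    note c = quad_expectation[of i "QSH i" ?g, OF that supp dep meas norm_QSH g(1)]
    show "integrable M (\<lambda>X. \<bar>quad i (QSH i X) X\<bar>)" using c(1) by (simp add: tr0)
    show "(\<integral>X. \<bar>quad i (QSH i X) X\<bar> \<partial>M) \<le> sqrt (quad_const * (d / l))"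
      using c(2) unfolding g(2) tr0 diff_0_right .
  qed
  have q3: "integrable M (\<lambda>X. \<bar>quad i (QSH i X * H i X) X\<bar>)" "(\<integral>X. \<bar>quad i (QSH i X * H i X) X\<bar> \<partial>M) \<le> sqrt (quad_const * (d / l)) / l" if "i < n" for i
  proof -
    have dep2: "QSH i X * H i X = QSH i X' * H i X'" if "\<forall>a<n. \<forall>b<d. a \<noteq> i \<longrightarrow> X (a, b) = X' (a, b)" for X X'
    proof -
      have "QSH i X = QSH i X'" by (rule dep) (rule that)
      moreover have "H i X = H i X'" by (rule H_dep(2)) (rule that)
      ultimately show ?thesis by simp
    qed
    have gl: "integrable M (\<lambda>X. ?g X / l\<^sup>2)" using g(1) by (rule integrable_divide)
    note c = quad_expectation[of i "\<lambda>X. QSH i X * H i X" "\<lambda>X. ?g X / l\<^sup>2", OF that supp_in_mult[OF supp supp_H] dep2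
        fmat_measurable_mult[OF meas meas_H] norm2 gl]
    show "integrable M (\<lambda>X. \<bar>quad i (QSH i X * H i X) X\<bar>)" using c(1) by (simp add: tr0)
    have "(\<integral>X. \<bar>quad i (QSH i X * H i X) X\<bar> \<partial>M) \<le> sqrt (quad_const * ((\<integral>X. ?g X \<partial>M) / l\<^sup>2))"
      using c(2) unfolding tr0 integral_divide_zero diff_0_right .
    also have "\<dots> = sqrt (quad_const * (d / l)) / l"
      unfolding g(2) using l_pos by (simp add: real_sqrt_divide real_sqrt_mult)
    finally show "(\<integral>X. \<bar>quad i (QSH i X * H i X) X\<bar> \<partial>M) \<le> sqrt (quad_const * (d / l)) / l" .
  qed
  let ?h = "\<lambda>i X. \<bar>quad i Q X - tr Q\<bar> / l + \<bar>quad i (QSH i X * H i X) X\<bar> + \<bar>quad i (QSH i X) X\<bar> / l"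
  have h: "integrable M (?h i)" "(\<integral>X. ?h i X \<partial>M) \<le> err_F" if "i < n" for i
  proof -
    show "integrable M (?h i)"
      by (intro Bochner_Integration.integrable_add integrable_divide q1 q2 q3 that)
    have "(\<integral>X. ?h i X \<partial>M) = (\<integral>X. \<bar>quad i Q X - tr Q\<bar> \<partial>M) / l
        + (\<integral>X. \<bar>quad i (QSH i X * H i X) X\<bar> \<partial>M) + (\<integral>X. \<bar>quad i (QSH i X) X\<bar> \<partial>M) / l"
      using q1(1)[OF that] q2(1)[OF that] q3(1)[OF that] by simp
    also have "\<dots> \<le> sqrt (quad_const * d) / l + sqrt (quad_const * (d / l)) / l + sqrt (quad_const * (d / l)) / l"
      using l_pos by (intro add_mono divide_right_mono q1 q2 q3 that) auto
    finally show "(\<integral>X. ?h i X \<partial>M) \<le> err_F" by (simp add: err_F_def)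
  qed
  have int_TT: "integrable M (\<lambda>X. T X - l * T2 X)"
    using integrable_T integrable_T2 by simp
  have "\<bar>(\<integral>X. F X \<partial>M) - (real d - real p) * (\<integral>X. T X - l * T2 X \<partial>M)\<bar>
      = \<bar>\<integral>X. F X - (real d - real p) * (T X - l * T2 X) \<partial>M\<bar>"
    unfolding Bochner_Integration.integral_diff[OF integrable_F integrable_mult_right[OF int_TT]] integral_mult_right_zero ..
  also have "\<dots> \<le> (\<integral>X. \<bar>F X - (real d - real p) * (T X - l * T2 X)\<bar> \<partial>M)"
    by (rule integral_abs_bound)
  also have "\<dots> \<le> (\<integral>X. (\<Sum>i<n. ?h i X) / n \<partial>M)"
    by (intro integral_mono integrable_abs Bochner_Integration.integrable_diff[OF integrable_F integrable_mult_right[OF int_TT]]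
        integrable_divide Bochner_Integration.integrable_sum h(1) F_deviation) auto
  also have "\<dots> = (\<Sum>i<n. \<integral>X. ?h i X \<partial>M) / n"
    unfolding integral_divide_zero using h(1) by (subst Bochner_Integration.integral_sum) auto
  also have "\<dots> \<le> (\<Sum>i<n. err_F) / n"
    by (intro divide_right_mono sum_mono h(2)) auto
  finally show ?thesis using n_pos by simp
qed

text \<open>Pythagoras for the decomposition of the source space by P + Q = 1. On the range of
  \<open>P\<close> the matrix G S is P - l G, whose norm is given by traces, so \<open>F\<close> is
  the only contribution that requires probability.\<close>

lemma norm_GS_split: "(norm (G X * S X))\<^sup>2 = p - 2 * l * n * T X + l\<^sup>2 * n * T2 X + F X"
proof -
  interpret R: resolvent P "G X" "fm n d X" n l by (rule res)
  have GSP: "G X * S X * P = P - l *\<^sub>R G X" using R.right by (simp add: algebra_simps)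
  have "supp_in d d (G X * S X)" by (rule supp_GS)
  from mult_idm[OF this] have sum: "G X * S X = (P - l *\<^sub>R G X) + G X * S X * Q"
    unfolding GSP[symmetric] Q_def by (simp add: algebra_simps)
  have orth: "inner (P - l *\<^sub>R G X) (G X * S X * Q) = 0"
    unfolding GSP[symmetric] inner_mult_right R.tpP by (simp add: mult.assoc QP)
  have PG: "inner P (G X) = tr (G X)" by (simp add: inner_tr R.tpP R.PG)
  have GG: "inner (G X) (G X) = tr (G X * G X)" by (simp add: inner_tr R.tp_G)
  have "(norm (G X * S X))\<^sup>2 = (norm (P - l *\<^sub>R G X))\<^sup>2 + F X"
    unfolding F_def power2_norm_fmat
    by (subst (1 2) sum) (simp only: inner_add_left inner_add_right orth inner_commute[of "G X * S X * Q" "P - l *\<^sub>R G X"])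
  also have "(norm (P - l *\<^sub>R G X))\<^sup>2 = p - 2 * l * tr (G X) + l\<^sup>2 * tr (G X * G X)"
    using R.norm_P_square
    by (simp add: power2_norm_fmat inner_diff_left inner_diff_right inner_commute[of "G X" P] PG GG tr_P)
      (simp add: power2_eq_square algebra_simps)
  finally show ?thesis using n_pos by (simp add: T_def T2_def)
qed

lemma norm_noise_operator: "(norm ((1 / n) *\<^sub>R (G X * tp (fm n d X))))\<^sup>2 = T X - l * T2 X"
proof -
  interpret R: resolvent P "G X" "fm n d X" n l by (rule res)
  have "(norm ((1 / n) *\<^sub>R (G X * tp (fm n d X))))\<^sup>2 = inner (G X * tp (fm n d X)) (G X * tp (fm n d X)) / (real n)\<^sup>2"
    unfolding power2_norm_fmat by (simp add: power2_eq_square)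
  also have "inner (G X * tp (fm n d X)) (G X * tp (fm n d X)) = tr (fm n d X * (G X * G X * tp (fm n d X)))"
    by (simp add: inner_tr R.tp_G mult.assoc)
  also have "\<dots> = tr (G X * G X * (tp (fm n d X) * fm n d X))"
    by (subst tr_mult_commute) (simp add: mult.assoc)
  also have "\<dots> / (real n)\<^sup>2 = tr (G X * G X * S X) / n"
    by (simp add: gram_def tr_scaleR power2_eq_square)
  finally show ?thesis
    by (simp add: R.tr_GG_gram T_def T2_def diff_divide_distrib)
qed

lemma tr_GS: "tr (G X * S X) = p - l * n * T X"
  using resolvent.tr_G_gram[OF res, of X] n_pos by (simp add: T_def tr_P)

end

section \<open>The Marchenko--Pastur law\<close>

text \<open>With c = 0 this gives the mass of the density, and after partial fractions the cases c =
  0 and c = l together give its Stieltjes transform. The proof uses an explicit antiderivative in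
  the variable y = x + c.\<close>

lemma semicircle_over_linear_integral:
  fixes a b c :: real
  assumes ab: "a < b" and A: "0 \<le> a + c"
  shows "((\<lambda>x. sqrt ((b - x) * (x - a)) / (x + c)) has_integral
     pi * ((a + b) / 2 + c - sqrt ((a + c) * (b + c)))) {a..b}"
proof -
  define A B where "A = a + c" and "B = b + c"
  define h where "h = B - A"
  have h: "h > 0" and A0: "0 \<le> A" and B0: "0 < B" using assms by (auto simp: A_def B_def h_def)
  \<comment> \<open>For A = 0 this summand vanishes together with its coefficient. Separating that
    case keeps the quotient by y away from the endpoint y = 0 in the continuity argument. It occurs
    when the lower edge of the support is 0 and c = 0.\<close>
  define u where "u y = (if A = 0 then 0 else sqrt (A * B) * arcsin (((A + B) * y - 2 * A * B) / (y * h)))" for y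
  define \<Phi> where "\<Phi> y = sqrt ((B - y) * (y - A)) + (A + B) / 2 * arcsin ((2 * y - A - B) / h) - u y" for y
  have v_bounds: "-1 \<le> (2 * y - A - B) / h \<and> (2 * y - A - B) / h \<le> 1" if "y \<in> {A..B}" for y
    using that h by (auto simp: h_def field_simps)
  have w_bounds: "-1 \<le> ((A + B) * y - 2 * A * B) / (y * h) \<and> ((A + B) * y - 2 * A * B) / (y * h) \<le> 1"
    if "y \<in> {A..B}" "A \<noteq> 0" for y
  proof -
    have y: "0 < y" "A \<le> y" "y \<le> B" using that A0 by auto
    have "0 \<le> B * (y - A)" "0 \<le> A * (B - y)" using y A0 B0 by auto
    then show ?thesis using y h by (auto simp: h_def divide_simps algebra_simps)
  qed
  have cont: "continuous_on {A..B} \<Phi>"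
  proof -
    have "continuous_on {A..B} u"
    proof (cases "A = 0")
      case False
      have "continuous_on {A..B} (\<lambda>y. sqrt (A * B) * arcsin (((A + B) * y - 2 * A * B) / (y * h)))"
        using w_bounds False A0 h by (intro continuous_intros continuous_on_arcsin) auto
      then show ?thesis using False by (simp add: u_def[abs_def])
    qed (simp add: u_def[abs_def])
    then show ?thesis
      unfolding \<Phi>_def[abs_def] using v_bounds h by (intro continuous_intros continuous_on_arcsin) auto
  qed
  have deriv: "(\<Phi> has_real_derivative sqrt ((B - y) * (y - A)) / y) (at y)" if y: "A < y" "y < B" for y
  proof -
    define R where "R = (B - y) * (y - A)"
    have R: "R > 0" and y0: "y > 0" using y A0 by (auto simp: R_def)
    have d1: "((\<lambda>y. sqrt ((B - y) * (y - A))) has_real_derivative (A + B - 2 * y) / (2 * sqrt R)) (at y)"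
      using R by (auto intro!: derivative_eq_intros simp: R_def field_simps)
    have v2: "1 - ((2 * y - A - B) / h)\<^sup>2 = 4 * R / h\<^sup>2"
      using h by (simp add: field_simps R_def power2_eq_square) (simp add: h_def algebra_simps)
    have v: "-1 < (2 * y - A - B) / h" "(2 * y - A - B) / h < 1"
      using y h by (auto simp: h_def field_simps)
    have "((\<lambda>y. arcsin ((2 * y - A - B) / h)) has_real_derivative
        inverse (sqrt (1 - ((2 * y - A - B) / h)\<^sup>2)) * (2 / h)) (at y)"
      using h by (intro DERIV_chain2[where f = arcsin and g = "\<lambda>y. (2 * y - A - B) / h", OF DERIV_arcsin[OF v]]) (auto intro!: derivative_eq_intros)
    also have "inverse (sqrt (1 - ((2 * y - A - B) / h)\<^sup>2)) * (2 / h) = 1 / sqrt R"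
      unfolding v2 using h R by (simp add: real_sqrt_divide real_sqrt_mult field_simps)
    finally have d2: "((\<lambda>y. arcsin ((2 * y - A - B) / h)) has_real_derivative 1 / sqrt R) (at y)" .
    have d3: "(u has_real_derivative A * B / (y * sqrt R)) (at y)"
    proof (cases "A = 0")
      case False
      let ?w = "((A + B) * y - 2 * A * B) / (y * h)"
      have AB: "A * B > 0" using False A0 B0 by simp
      have w2: "1 - ?w\<^sup>2 = 4 * (A * B) * R / (y * h)\<^sup>2"
        using h y0 by (simp add: field_simps R_def power2_eq_square) (simp add: h_def algebra_simps)
      have "0 < 4 * (A * B) * R / (y * h)\<^sup>2" using AB R y0 h by simp
      then have "?w\<^sup>2 < 1\<^sup>2" using w2 by simp
      moreover have "-1 < x \<and> x < 1" if "x\<^sup>2 < 1\<^sup>2" for x :: real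
        using that abs_square_less_1[of x] by auto
      ultimately have w: "-1 < ?w" "?w < 1" by blast+
      have "((\<lambda>y. ((A + B) * y - 2 * A * B) / (y * h)) has_real_derivative 2 * (A * B) / (y\<^sup>2 * h)) (at y)"
        using y0 h by (auto intro!: derivative_eq_intros simp: power2_eq_square field_simps)
      from DERIV_chain2[where f = arcsin and g = "\<lambda>y. ((A + B) * y - 2 * A * B) / (y * h)", OF DERIV_arcsin[OF w] this]
      have "((\<lambda>y. arcsin (((A + B) * y - 2 * A * B) / (y * h))) has_real_derivative
          inverse (sqrt (1 - ?w\<^sup>2)) * (2 * (A * B) / (y\<^sup>2 * h))) (at y)" .
      from DERIV_cmult[OF this, of "sqrt (A * B)"]
      have "(u has_real_derivative sqrt (A * B) * (inverse (sqrt (1 - ?w\<^sup>2)) * (2 * (A * B) / (y\<^sup>2 * h)))) (at y)"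
        using False by (simp add: u_def[abs_def])
      also have "sqrt (A * B) * (inverse (sqrt (1 - ?w\<^sup>2)) * (2 * (A * B) / (y\<^sup>2 * h))) = A * B / (y * sqrt R)"
      proof -
        have "sqrt (1 - ?w\<^sup>2) = 2 * sqrt (A * B) * sqrt R / (y * h)"
          unfolding w2 using h y0 by (simp add: real_sqrt_divide real_sqrt_mult)
        moreover have "sqrt (A * B) > 0" using AB by simp
        ultimately show ?thesis using h y0 R by (simp add: field_simps power2_eq_square)
      qed
      finally show ?thesis .
    qed (simp add: u_def[abs_def])
    have "(\<Phi> has_real_derivative (A + B - 2 * y) / (2 * sqrt R) + (A + B) / 2 * (1 / sqrt R) - A * B / (y * sqrt R)) (at y)"
      unfolding \<Phi>_def[abs_def] by (intro DERIV_add DERIV_diff DERIV_cmult d1 d2 d3)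
    also have "(A + B - 2 * y) / (2 * sqrt R) + (A + B) / 2 * (1 / sqrt R) - A * B / (y * sqrt R) = R / (y * sqrt R)"
      using R y0 by (simp add: field_simps) (simp add: R_def algebra_simps)
    also have "\<dots> = sqrt R / y"
      using R y0 real_sqrt_mult_self[of R] by (simp add: field_simps)
    finally show ?thesis by (simp add: R_def)
  qed
  have "((\<lambda>x. sqrt ((b - x) * (x - a)) / (x + c)) has_integral (\<Phi> (b + c) - \<Phi> (a + c))) {a..b}"
  \<comment> \<open>The interior version is used because the square root and the arcsines are not
    differentiable at the edges.\<close>
  proof (rule fundamental_theorem_of_calculus_interior)
    show "continuous_on {a..b} (\<lambda>x. \<Phi> (x + c))"
      by (rule continuous_on_compose2[OF cont]) (auto intro!: continuous_intros simp: A_def B_def)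
    fix x assume "x \<in> {a<..<b}"
    then have "(\<Phi> has_real_derivative sqrt ((B - (x + c)) * (x + c - A)) / (x + c)) (at (x + c))"
      by (intro deriv) (auto simp: A_def B_def)
    then show "((\<lambda>x. \<Phi> (x + c)) has_vector_derivative sqrt ((b - x) * (x - a)) / (x + c)) (at x)"
      by (simp add: DERIV_shift has_real_derivative_iff_has_vector_derivative[symmetric] A_def B_def)
  qed (use ab in simp)
  moreover have "\<Phi> (b + c) - \<Phi> (a + c) = pi * ((a + b) / 2 + c - sqrt ((a + c) * (b + c)))"
  proof -
    have v: "(2 * B - A - B) / h = 1" "(2 * A - A - B) / h = -1" using h by (auto simp: h_def field_simps)
    have u: "u B = sqrt (A * B) * (pi / 2)" "u A = - (sqrt (A * B) * (pi / 2))"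
    proof -
      have "(A + B) * B - 2 * A * B = B * h" "(A + B) * A - 2 * A * B = - (A * h)" by (simp_all add: h_def algebra_simps)
      note e = this
      have wB: "((A + B) * B - 2 * A * B) / (B * h) = 1" unfolding e using h B0 by simp
      show "u B = sqrt (A * B) * (pi / 2)" unfolding u_def wB by simp
      have wA: "((A + B) * A - 2 * A * B) / (A * h) = -1" if "A \<noteq> 0" unfolding e using h that by simp
      show "u A = - (sqrt (A * B) * (pi / 2))"
      proof (cases "A = 0")
        case False
        show ?thesis unfolding u_def wA[OF False] by simp
      qed (simp add: u_def)
    qed
    have "\<Phi> B - \<Phi> A = pi * ((A + B) / 2 - sqrt (A * B))"
      unfolding \<Phi>_def v u by (simp add: field_simps)
    then show ?thesis by (simp add: A_def B_def add_divide_distrib algebra_simps)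
  qed
  ultimately show ?thesis by simp
qed

text \<open>The law is specified by its values on sets, so integrals are computed by the standard
  induction over indicators, multiples, sums and increasing limits.\<close>

lemma nn_integral_mp_law:
  assumes "f \<in> borel_measurable borel"
  shows "(\<integral>\<^sup>+x. f x \<partial>mp_law \<gamma>) = ennreal (max 0 (1 - 1 / \<gamma>)) * f 0 + (\<integral>\<^sup>+x. ennreal (mp_density \<gamma> x) * f x \<partial>lborel)"
  using assms
proof (induction rule: borel_measurable_induct)
  case (cong f g)
  then have "f = g" by auto
  with cong show ?case by simp
next
  case (set A)
  then show ?case by (simp add: emeasure_mp_law)
next
  case (mult u c)
  have "(\<integral>\<^sup>+x. ennreal (mp_density \<gamma> x) * (c * u x) \<partial>lborel) = c * (\<integral>\<^sup>+x. ennreal (mp_density \<gamma> x) * u x \<partial>lborel)"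
    using mult by (subst nn_integral_cmult[symmetric]) (auto simp: ac_simps)
  moreover have "(\<integral>\<^sup>+x. c * u x \<partial>mp_law \<gamma>) = c * (\<integral>\<^sup>+x. u x \<partial>mp_law \<gamma>)"
    using mult by (intro nn_integral_cmult) auto
  ultimately show ?case using mult by (simp add: distrib_left ac_simps)
next
  case (add u v)
  have A: "(\<integral>\<^sup>+x. ennreal (mp_density \<gamma> x) * (v x + u x) \<partial>lborel)
      = (\<integral>\<^sup>+x. ennreal (mp_density \<gamma> x) * v x \<partial>lborel) + (\<integral>\<^sup>+x. ennreal (mp_density \<gamma> x) * u x \<partial>lborel)"
    using add by (subst nn_integral_add[symmetric]) (auto simp: distrib_left)
  have B: "(\<integral>\<^sup>+x. v x + u x \<partial>mp_law \<gamma>) = (\<integral>\<^sup>+x. v x \<partial>mp_law \<gamma>) + (\<integral>\<^sup>+x. u x \<partial>mp_law \<gamma>)"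
    using add by (intro nn_integral_add) auto
  have C: "ennreal (max 0 (1 - 1 / \<gamma>)) * (v 0 + u 0) = ennreal (max 0 (1 - 1 / \<gamma>)) * v 0 + ennreal (max 0 (1 - 1 / \<gamma>)) * u 0"
    by (rule distrib_left)
  show ?case unfolding A B add C by (simp only: ac_simps)
next
  case (seq U)
  have [measurable]: "U i \<in> borel_measurable borel" for i using seq by auto
  have "(\<integral>\<^sup>+x. (SUP i. U i) x \<partial>mp_law \<gamma>) = (SUP i. \<integral>\<^sup>+x. U i x \<partial>mp_law \<gamma>)"
    unfolding SUP_apply using seq by (intro nn_integral_monotone_convergence_SUP) auto
  also have "\<dots> = (SUP i. ennreal (max 0 (1 - 1 / \<gamma>)) * U i 0 + (\<integral>\<^sup>+x. ennreal (mp_density \<gamma> x) * U i x \<partial>lborel))"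
    using seq by simp
  also have "\<dots> = (SUP i. ennreal (max 0 (1 - 1 / \<gamma>)) * U i 0) + (SUP i. \<integral>\<^sup>+x. ennreal (mp_density \<gamma> x) * U i x \<partial>lborel)"
    using seq(3) by (intro ennreal_SUP_add) (auto simp: incseq_def le_fun_def intro!: nn_integral_mono mult_left_mono)
  also have "(SUP i. \<integral>\<^sup>+x. ennreal (mp_density \<gamma> x) * U i x \<partial>lborel) = (\<integral>\<^sup>+x. (SUP i. ennreal (mp_density \<gamma> x) * U i x) \<partial>lborel)"
    using seq(3) by (intro nn_integral_monotone_convergence_SUP[symmetric]) (auto simp: incseq_def le_fun_def intro!: mult_left_mono)
  finally show ?case by (simp only: SUP_apply SUP_mult_left_ennreal)
qed

section \<open>Support, finiteness and Stieltjes transform of the law\<close>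

lemma mp_density_zero: "x \<le> 0 \<Longrightarrow> mp_density \<gamma> x = 0"
proof -
  assume "x \<le> 0"
  then have "\<not> (1 - sqrt \<gamma>)\<^sup>2 < x" using zero_le_power2[of "1 - sqrt \<gamma>"] by linarith
  then show ?thesis by (simp add: mp_density_def Let_def)
qed

lemma mp_density_nonneg:
  assumes "0 < \<gamma>"
  shows "0 \<le> mp_density \<gamma> x"
proof (cases "(1 - sqrt \<gamma>)\<^sup>2 < x \<and> x < (1 + sqrt \<gamma>)\<^sup>2")
  case True
  then have "0 < x" using zero_le_power2[of "1 - sqrt \<gamma>"] by linarith
  then have "0 \<le> sqrt (((1 + sqrt \<gamma>)\<^sup>2 - x) * (x - (1 - sqrt \<gamma>)\<^sup>2)) / (2 * pi * \<gamma> * x)"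
    using True assms by (intro divide_nonneg_pos real_sqrt_ge_zero mult_nonneg_nonneg mult_pos_pos) auto
  then show ?thesis using True by (simp add: mp_density_def Let_def)
qed (auto simp: mp_density_def Let_def)

lemma AE_mp_law_nonneg: "AE x in mp_law \<gamma>. 0 \<le> x"
proof (rule AE_I)
  show "{x \<in> space (mp_law \<gamma>). \<not> 0 \<le> x} \<subseteq> {..<0}" by auto
  have eq: "(\<lambda>x. ennreal (mp_density \<gamma> x) * indicator {..<0} x) = (\<lambda>_. 0)"
  proof
    fix x show "ennreal (mp_density \<gamma> x) * indicator {..<0} x = 0"
      by (cases "x < 0") (simp_all add: mp_density_zero)
  qed
  show "emeasure (mp_law \<gamma>) {..<0} = 0"
    by (subst emeasure_mp_law, simp, subst eq) simp
qed simp

context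
  fixes \<gamma> :: real
  assumes gamma_pos: "0 < \<gamma>"
begin

abbreviation "lower \<equiv> (1 - sqrt \<gamma>)\<^sup>2"
abbreviation "upper \<equiv> (1 + sqrt \<gamma>)\<^sup>2"

lemma lower_less_upper: "lower < upper"
  using gamma_pos by (simp add: power2_eq_square algebra_simps)

text \<open>For c = l the right side is the discriminant of the quadratic equation in
  \<open>theta1_quadratic\<close>.\<close>

lemma edge_product: "(lower + c) * (upper + c) = c\<^sup>2 + 2 * (1 + \<gamma>) * c + (1 - \<gamma>)\<^sup>2"
proof -
  have "sqrt \<gamma> * sqrt \<gamma> = \<gamma>" using gamma_pos by simp
  then have "lower = 1 + \<gamma> - 2 * sqrt \<gamma>" "upper = 1 + \<gamma> + 2 * sqrt \<gamma>"
    by (simp_all add: power2_eq_square algebra_simps)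
  moreover have "(2 * sqrt \<gamma>)\<^sup>2 = 4 * \<gamma>" using gamma_pos by (simp add: power_mult_distrib)
  ultimately show ?thesis
    by (simp add: power2_eq_square) (simp add: algebra_simps)
qed

lemma nn_integral_density:
  assumes "(\<lambda>x. ennreal (g x)) \<in> borel_measurable borel" "(\<lambda>x. mp_density \<gamma> x * g x) \<in> borel_measurable borel"
    "\<And>x. 0 < x \<Longrightarrow> 0 \<le> g x"
    "((\<lambda>x. mp_density \<gamma> x * g x) has_integral I) {lower..upper}"
  shows "(\<integral>\<^sup>+x. ennreal (mp_density \<gamma> x) * ennreal (g x) \<partial>lborel) = ennreal I"
proof -
  have zero: "mp_density \<gamma> x = 0" if "\<not> 0 < x" for x
    using that mp_density_zero by simp
  have "((\<lambda>x. if x \<in> {lower..upper} then mp_density \<gamma> x * g x else 0) has_integral I) UNIV"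
    using assms(4) by (simp only: has_integral_restrict_UNIV)
  also have "(\<lambda>x. if x \<in> {lower..upper} then mp_density \<gamma> x * g x else 0) = (\<lambda>x. mp_density \<gamma> x * g x)"
    by (auto simp: mp_density_def Let_def)
  finally have "(\<integral>\<^sup>+x. ennreal (mp_density \<gamma> x * g x) \<partial>lborel) = ennreal I"
    using assms(2,3) zero mp_density_nonneg[OF gamma_pos]
    by (intro nn_integral_has_integral_lborel) (auto, metis mult_nonneg_nonneg mult_zero_left order_refl)
  moreover have "ennreal (mp_density \<gamma> x) * ennreal (g x) = ennreal (mp_density \<gamma> x * g x)" for x
    using zero mp_density_nonneg[OF gamma_pos, of x] assms(3)[of x]
    by (cases "0 < x") (auto simp: ennreal_mult)
  ultimately show ?thesis by simp
qed

lemma finite_mp_law: "finite_measure (mp_law \<gamma>)"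
proof (rule finite_measureI)
  have "((\<lambda>x. 1 / (2 * pi * \<gamma>) * (sqrt ((upper - x) * (x - lower)) / (x + 0))) has_integral
      1 / (2 * pi * \<gamma>) * (pi * ((lower + upper) / 2 + 0 - sqrt ((lower + 0) * (upper + 0))))) {lower..upper}"
    by (intro has_integral_mult_right semicircle_over_linear_integral lower_less_upper) simp
  then have "((\<lambda>x. mp_density \<gamma> x * 1) has_integral
      1 / (2 * pi * \<gamma>) * (pi * ((lower + upper) / 2 + 0 - sqrt ((lower + 0) * (upper + 0))))) {lower..upper}"
    by (rule has_integral_eq[rotated]) (auto simp: mp_density_def Let_def)
  then have "(\<integral>\<^sup>+x. ennreal (mp_density \<gamma> x) * ennreal 1 \<partial>lborel) < \<top>"
    by (subst nn_integral_density) auto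
  then show "emeasure (mp_law \<gamma>) (space (mp_law \<gamma>)) \<noteq> \<infinity>"
    by (simp add: emeasure_mp_law less_top[symmetric] ennreal_add_eq_top)
qed

text \<open>Partial fractions of 1 / (x (x + l)) reduce the density part to two semicircle
  integrals, and the one with c = 0 leaves an absolute value |1 - \<gamma>|. For \<gamma> > 1 the
  atom at 0 adds exactly what turns this into the expression valid for \<gamma> \<le> 1, so a single
  formula covers both regimes.\<close>

lemma theta1_formula:
  assumes l: "0 < l"
  shows "theta1 \<gamma> l = (sqrt (l\<^sup>2 + 2 * (1 + \<gamma>) * l + (1 - \<gamma>)\<^sup>2) - l - 1 + \<gamma>) / (2 * \<gamma> * l)"
proof -
  let ?D = "sqrt (l\<^sup>2 + 2 * (1 + \<gamma>) * l + (1 - \<gamma>)\<^sup>2)"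
  let ?f = "\<lambda>x c. sqrt ((upper - x) * (x - lower)) / (x + c)"
  let ?J = "\<lambda>c. pi * ((lower + upper) / 2 + c - sqrt ((lower + c) * (upper + c)))"
  have "((\<lambda>x. 1 / (2 * pi * \<gamma> * l) * (?f x 0 - ?f x l)) has_integral 1 / (2 * pi * \<gamma> * l) * (?J 0 - ?J l)) {lower..upper}"
    by (intro has_integral_mult_right has_integral_diff semicircle_over_linear_integral lower_less_upper)
      (use l in simp_all)
  moreover have "1 / (2 * pi * \<gamma> * l) * (?f x 0 - ?f x l) = mp_density \<gamma> x * (1 / (x + l))" if "x \<in> {lower..upper}" for x
  proof (cases "lower < x \<and> x < upper")
    case True
    then have "0 < x" using zero_le_power2[of "1 - sqrt \<gamma>"] by linarith
    then show ?thesis using True l gamma_pos by (simp add: mp_density_def Let_def field_simps)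
  next
    case False
    with that have "x = lower \<or> x = upper" by auto
    then show ?thesis by (auto simp: mp_density_def Let_def)
  qed
  ultimately have "((\<lambda>x. mp_density \<gamma> x * (1 / (x + l))) has_integral 1 / (2 * pi * \<gamma> * l) * (?J 0 - ?J l)) {lower..upper}"
    by (rule has_integral_eq[rotated])
  then have nn: "(\<integral>\<^sup>+x. ennreal (mp_density \<gamma> x) * ennreal (1 / (x + l)) \<partial>lborel) = ennreal (1 / (2 * pi * \<gamma> * l) * (?J 0 - ?J l))"
    by (intro nn_integral_density) (use l in auto)
  have J_diff: "1 / (2 * pi * \<gamma> * l) * (?J 0 - ?J l) = (?D - l - \<bar>1 - \<gamma>\<bar>) / (2 * \<gamma> * l)"
  proof -
    have "?J 0 - ?J l = pi * (?D - l - \<bar>1 - \<gamma>\<bar>)"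
      unfolding edge_product by (simp add: algebra_simps)
    moreover have "1 / (2 * pi * \<gamma> * l) * (pi * x) = x / (2 * \<gamma> * l)" for x
      using l gamma_pos by (simp add: field_simps)
    ultimately show ?thesis by simp
  qed
  have D_ge: "?D - l - \<bar>1 - \<gamma>\<bar> \<ge> 0"
  proof -
    have "(l + \<bar>1 - \<gamma>\<bar>)\<^sup>2 \<le> l\<^sup>2 + 2 * (1 + \<gamma>) * l + (1 - \<gamma>)\<^sup>2"
    proof -
      have "\<bar>1 - \<gamma>\<bar> * l \<le> (1 + \<gamma>) * l" using l gamma_pos by (intro mult_right_mono) auto
      then show ?thesis by (simp add: power2_sum algebra_simps)
    qed
    then have "l + \<bar>1 - \<gamma>\<bar> \<le> ?D" by (rule real_le_rsqrt)
    then show ?thesis by simp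
  qed
  have "theta1 \<gamma> l = enn2real (\<integral>\<^sup>+x. ennreal (1 / (x + l)) \<partial>mp_law \<gamma>)"
    unfolding theta1_def
  proof (rule integral_eq_nn_integral)
    show "AE x in mp_law \<gamma>. 0 \<le> 1 / (x + l)" using AE_mp_law_nonneg by eventually_elim (use l in simp)
  qed simp
  also have "(\<integral>\<^sup>+x. ennreal (1 / (x + l)) \<partial>mp_law \<gamma>)
      = ennreal (max 0 (1 - 1 / \<gamma>)) * ennreal (1 / l) + ennreal ((?D - l - \<bar>1 - \<gamma>\<bar>) / (2 * \<gamma> * l))"
  proof -
    have m: "(\<lambda>x. ennreal (1 / (x + l))) \<in> borel_measurable borel" by simp
    show ?thesis unfolding nn_integral_mp_law[OF m] nn J_diff by simp
  qed
  also have "\<dots> = ennreal (max 0 (1 - 1 / \<gamma>) * (1 / l) + (?D - l - \<bar>1 - \<gamma>\<bar>) / (2 * \<gamma> * l))"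
  proof -
    have "ennreal x * ennreal y + ennreal z = ennreal (x * y + z)" if "0 \<le> x" "0 \<le> y" "0 \<le> z" for x y z
      using that by (simp add: ennreal_mult ennreal_plus)
    moreover have "0 \<le> (?D - l - \<bar>1 - \<gamma>\<bar>) / (2 * \<gamma> * l)" using D_ge l gamma_pos by simp
    ultimately show ?thesis using l by (metis max.cobounded1 zero_le_divide_1_iff less_imp_le)
  qed
  also have "max 0 (1 - 1 / \<gamma>) * (1 / l) + (?D - l - \<bar>1 - \<gamma>\<bar>) / (2 * \<gamma> * l) = (?D - l - 1 + \<gamma>) / (2 * \<gamma> * l)"
  proof (cases "\<gamma> \<le> 1")
    case True
    then have "max 0 (1 - 1 / \<gamma>) = 0" "\<bar>1 - \<gamma>\<bar> = 1 - \<gamma>" using gamma_pos by (auto simp: field_simps)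
    then show ?thesis by (simp add: algebra_simps)
  next
    case False
    then have "max 0 (1 - 1 / \<gamma>) = 1 - 1 / \<gamma>" "\<bar>1 - \<gamma>\<bar> = \<gamma> - 1" by auto
    then show ?thesis using l gamma_pos by (simp add: divide_simps)
  qed
  finally show ?thesis using D_ge l gamma_pos by simp
qed

lemma theta1_quadratic:
  assumes l: "0 < l"
  shows "\<gamma> * l * (theta1 \<gamma> l)\<^sup>2 + (l + 1 - \<gamma>) * theta1 \<gamma> l = 1" "0 \<le> theta1 \<gamma> l"
proof -
  let ?D = "sqrt (l\<^sup>2 + 2 * (1 + \<gamma>) * l + (1 - \<gamma>)\<^sup>2)"
  define m where "m = theta1 \<gamma> l"
  have m: "2 * \<gamma> * l * m = ?D - (l + 1 - \<gamma>)"
    unfolding m_def theta1_formula[OF l] using l gamma_pos by (simp add: field_simps)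
  have "?D\<^sup>2 = l\<^sup>2 + 2 * (1 + \<gamma>) * l + (1 - \<gamma>)\<^sup>2" using l gamma_pos by simp
  then have "(2 * \<gamma> * l * m + (l + 1 - \<gamma>))\<^sup>2 = l\<^sup>2 + 2 * (1 + \<gamma>) * l + (1 - \<gamma>)\<^sup>2"
    using m by simp
  then have "4 * \<gamma> * l * (\<gamma> * l * m\<^sup>2 + (l + 1 - \<gamma>) * m - 1) = 0"
    by (simp add: power2_eq_square algebra_simps)
  then have "\<gamma> * l * m\<^sup>2 + (l + 1 - \<gamma>) * m - 1 = 0" using l gamma_pos by simp
  then show "\<gamma> * l * (theta1 \<gamma> l)\<^sup>2 + (l + 1 - \<gamma>) * theta1 \<gamma> l = 1" by (simp add: m_def)
  show "0 \<le> theta1 \<gamma> l"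
    unfolding theta1_def
  proof (rule integral_nonneg_AE)
    show "AE x in mp_law \<gamma>. 0 \<le> 1 / (x + l)" using AE_mp_law_nonneg by eventually_elim (use l in simp)
  qed
qed

text \<open>This rewrites the Marchenko--Pastur quadratic as the equation that the row removal
  argument produces for the normalised trace; it identifies the limit of that trace as \<gamma>
  \<open>theta1\<close>.\<close>

lemma theta1_fixed_point:
  assumes l: "0 < l"
  defines "t \<equiv> \<gamma> * theta1 \<gamma> l"
  shows "0 \<le> t" "l * t + t / (1 + t) = \<gamma>" "theta1 \<gamma> l = 1 / (l + 1 / (1 + t))"
proof -
  define m where "m = theta1 \<gamma> l"
  have q: "\<gamma> * l * m\<^sup>2 + (l + 1 - \<gamma>) * m = 1" "0 \<le> m" using theta1_quadratic[OF l] by (simp_all add: m_def)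
  have t: "t = \<gamma> * m" by (simp add: t_def m_def)
  show t0: "0 \<le> t" using q(2) gamma_pos by (simp add: t)
  then have t1: "0 < 1 + t" by simp
  have "m * (l * (1 + t) + 1) = 1 + t" using q(1) by (simp add: t power2_eq_square algebra_simps)
  then have "m * (l + 1 / (1 + t)) = 1" using t1 by (simp add: field_simps)
  moreover have "0 < l + 1 / (1 + t)" using l t1 by (simp add: add_pos_pos)
  ultimately show th: "theta1 \<gamma> l = 1 / (l + 1 / (1 + t))" by (simp add: m_def field_simps)
  have "l * t + t / (1 + t) = \<gamma> * (m * (l + 1 / (1 + t)))" by (simp add: t algebra_simps)
  then show "l * t + t / (1 + t) = \<gamma>" using \<open>m * (l + 1 / (1 + t)) = 1\<close> by simp
qed

section \<open>Difference quotients in the ridge parameter\<close>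

lemma integrable_mp_law_inverse:
  assumes "0 < l" "0 < l'"
  shows "integrable (mp_law \<gamma>) (\<lambda>x. 1 / ((x + l) * (x + l')))" "integrable (mp_law \<gamma>) (\<lambda>x. 1 / (x + l))"
    "integrable (mp_law \<gamma>) (\<lambda>x. 1 / (x + l)\<^sup>2)"
proof -
  interpret finite_measure "mp_law \<gamma>" by (rule finite_mp_law)
  have "AE x in mp_law \<gamma>. norm (1 / ((x + l) * (x + l'))) \<le> 1 / (l * l')"
    using AE_mp_law_nonneg by eventually_elim (use assms in \<open>auto intro!: frac_le mult_mono\<close>)
  then show "integrable (mp_law \<gamma>) (\<lambda>x. 1 / ((x + l) * (x + l')))"
    by (rule integrable_const_bound) simp
  have "AE x in mp_law \<gamma>. norm (1 / (x + l)) \<le> 1 / l"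
    using AE_mp_law_nonneg by eventually_elim (use assms in \<open>auto intro!: frac_le\<close>)
  then show "integrable (mp_law \<gamma>) (\<lambda>x. 1 / (x + l))"
    by (rule integrable_const_bound) simp
  have "AE x in mp_law \<gamma>. norm (1 / (x + l)\<^sup>2) \<le> 1 / l\<^sup>2"
    using AE_mp_law_nonneg by eventually_elim (use assms in \<open>auto intro!: frac_le power_mono\<close>)
  then show "integrable (mp_law \<gamma>) (\<lambda>x. 1 / (x + l)\<^sup>2)"
    by (rule integrable_const_bound) simp
qed

text \<open>The counterpart of \<open>resolvent_trace_difference\<close> for the limit law.\<close>

lemma theta1_difference:
  assumes "0 < l" "l < l'"
  shows "theta2 \<gamma> l' \<le> (theta1 \<gamma> l - theta1 \<gamma> l') / (l' - l)" "(theta1 \<gamma> l - theta1 \<gamma> l') / (l' - l) \<le> theta2 \<gamma> l"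
proof -
  note i = integrable_mp_law_inverse
  have l': "0 < l'" using assms by simp
  have "theta1 \<gamma> l - theta1 \<gamma> l' = (\<integral>x. 1 / (x + l) - 1 / (x + l') \<partial>mp_law \<gamma>)"
    unfolding theta1_def using i(2)[OF assms(1) l'] i(2)[OF l' l'] by simp
  also have "\<dots> = (\<integral>x. (l' - l) * (1 / ((x + l) * (x + l'))) \<partial>mp_law \<gamma>)"
  proof (rule integral_cong_AE)
    show "AE x in mp_law \<gamma>. 1 / (x + l) - 1 / (x + l') = (l' - l) * (1 / ((x + l) * (x + l')))"
      using AE_mp_law_nonneg by eventually_elim (use assms in \<open>simp add: divide_simps\<close>)
  qed simp_all
  also have "\<dots> = (l' - l) * (\<integral>x. 1 / ((x + l) * (x + l')) \<partial>mp_law \<gamma>)" by (rule integral_mult_right_zero)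
  finally have eq: "(theta1 \<gamma> l - theta1 \<gamma> l') / (l' - l) = (\<integral>x. 1 / ((x + l) * (x + l')) \<partial>mp_law \<gamma>)"
    using assms by simp
  show "theta2 \<gamma> l' \<le> (theta1 \<gamma> l - theta1 \<gamma> l') / (l' - l)"
    unfolding eq theta2_def
  proof (rule integral_mono_AE[OF i(3)[OF l' l'] i(1)[OF assms(1) l']])
    show "AE x in mp_law \<gamma>. 1 / (x + l')\<^sup>2 \<le> 1 / ((x + l) * (x + l'))"
      using AE_mp_law_nonneg
      by eventually_elim (use assms in \<open>auto intro!: frac_le mult_mono simp: power2_eq_square\<close>)
  qed
  show "(theta1 \<gamma> l - theta1 \<gamma> l') / (l' - l) \<le> theta2 \<gamma> l"
    unfolding eq theta2_def
  proof (rule integral_mono_AE[OF i(1)[OF assms(1) l'] i(3)[OF assms(1) l']])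
    show "AE x in mp_law \<gamma>. 1 / ((x + l) * (x + l')) \<le> 1 / (x + l)\<^sup>2"
      using AE_mp_law_nonneg
      by eventually_elim (use assms in \<open>auto intro!: frac_le mult_mono simp: power2_eq_square\<close>)
  qed
qed

end

text \<open>The hypotheses make \<open>f d\<close> behave like a convex function with derivative -
  \<open>h d\<close>, and pointwise limits of convex functions carry their derivatives along
  wherever the limit is differentiable. Lower bounds for \<open>h d l\<close> come from points to
  the right of l, upper bounds from points to the left.\<close>

lemma difference_quotient_squeeze:
  fixes f h :: "nat \<Rightarrow> real \<Rightarrow> real"
  assumes lim: "\<And>l. 0 < l \<Longrightarrow> (\<lambda>d. f d l) \<longlonglongrightarrow> \<tau> l"
    and squeeze: "\<And>l l'. 0 < l \<Longrightarrow> l < l' \<Longrightarrow>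
      \<forall>\<^sub>F d in sequentially. h d l' \<le> (f d l - f d l') / (l' - l) \<and> (f d l - f d l') / (l' - l) \<le> h d l"
    and deriv: "(\<tau> has_real_derivative - v) (at l)" and l: "0 < l"
  shows "(\<lambda>d. h d l) \<longlonglongrightarrow> v"
proof (rule order_tendstoI)
  have slope: "((\<lambda>k. (\<tau> l - \<tau> k) / (k - l)) \<longlongrightarrow> v) (at l)"
  proof -
    have "((\<lambda>k. (\<tau> k - \<tau> l) / (k - l)) \<longlongrightarrow> - v) (at l)" using deriv by (simp add: has_field_derivative_iff)
    from tendsto_minus[OF this] show ?thesis by (simp add: minus_divide_left)
  qed
  fix a assume a: "a < v"
  have "\<forall>\<^sub>F k in at_right l. a < (\<tau> l - \<tau> k) / (k - l)"
    using order_tendstoD(1)[OF slope a] by (rule filter_leD[OF at_le[OF subset_UNIV]])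
  then obtain l' where l': "l < l'" "a < (\<tau> l - \<tau> l') / (l' - l)"
    using eventually_happens'[OF _ eventually_conj[OF _ eventually_at_right_less[of l]]] by force
  have "(\<lambda>d. (f d l - f d l') / (l' - l)) \<longlonglongrightarrow> (\<tau> l - \<tau> l') / (l' - l)"
    using l l' by (intro tendsto_intros lim) auto
  from order_tendstoD(1)[OF this l'(2)] squeeze[OF l l'(1)]
  show "\<forall>\<^sub>F d in sequentially. a < h d l" by eventually_elim linarith
next
  have slope: "((\<lambda>k. (\<tau> k - \<tau> l) / (l - k)) \<longlongrightarrow> v) (at l)"
  proof -
    have "((\<lambda>k. (\<tau> k - \<tau> l) / (k - l)) \<longlongrightarrow> - v) (at l)" using deriv by (simp add: has_field_derivative_iff)
    from tendsto_minus[OF this] show ?thesis by (simp add: minus_divide_right)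
  qed
  fix a assume a: "v < a"
  have "\<forall>\<^sub>F k in at_left l. (\<tau> k - \<tau> l) / (l - k) < a"
    using order_tendstoD(2)[OF slope a] by (rule filter_leD[OF at_le[OF subset_UNIV]])
  moreover have "\<forall>\<^sub>F k in at_left l. 0 < k \<and> k < l"
    using eventually_at_left_real[OF l] by simp
  ultimately have "\<forall>\<^sub>F k in at_left l. (\<tau> k - \<tau> l) / (l - k) < a \<and> 0 < k \<and> k < l"
    by eventually_elim simp
  then obtain l' where l': "0 < l'" "l' < l" "(\<tau> l' - \<tau> l) / (l - l') < a"
    using eventually_happens'[of "at_left l"] by force
  have "(\<lambda>d. (f d l' - f d l) / (l - l')) \<longlonglongrightarrow> (\<tau> l' - \<tau> l) / (l - l')"
    using l l' by (intro tendsto_intros lim) auto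
  from order_tendstoD(2)[OF this l'(3)] squeeze[OF l'(1,2)]
  show "\<forall>\<^sub>F d in sequentially. h d l < a" by eventually_elim linarith
qed

text \<open>The closed formula provides differentiability but an unwieldy derivative. Its value is
  recognised by applying \<open>difference_quotient_squeeze\<close> to constant sequences.\<close>

lemma theta1_derivative:
  assumes g: "0 < \<gamma>" and l: "0 < l"
  shows "(theta1 \<gamma> has_real_derivative - theta2 \<gamma> l) (at l)"
proof -
  let ?f = "\<lambda>l. (sqrt (l\<^sup>2 + 2 * (1 + \<gamma>) * l + (1 - \<gamma>)\<^sup>2) - l - 1 + \<gamma>) / (2 * \<gamma> * l)"
  have pos: "0 < l\<^sup>2 + 2 * (1 + \<gamma>) * l + (1 - \<gamma>)\<^sup>2"
    using l g by (intro add_pos_nonneg add_pos_pos) auto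
  have p: "((\<lambda>l. l\<^sup>2 + 2 * (1 + \<gamma>) * l + (1 - \<gamma>)\<^sup>2) has_real_derivative 2 * l + 2 * (1 + \<gamma>)) (at l)"
    by (auto intro!: derivative_eq_intros)
  note s = DERIV_chain2[where f = sqrt and g = "\<lambda>l. l\<^sup>2 + 2 * (1 + \<gamma>) * l + (1 - \<gamma>)\<^sup>2", OF DERIV_real_sqrt[OF pos] p]
  have nz: "2 * \<gamma> * l \<noteq> 0" using l g by simp
  obtain D where "(?f has_real_derivative D) (at l)"
    using DERIV_divide[OF DERIV_add[OF DERIV_diff[OF DERIV_diff[OF s DERIV_ident] DERIV_const] DERIV_const]
        DERIV_cmult[OF DERIV_ident] nz] by blast
  then have D: "(theta1 \<gamma> has_real_derivative - (- D)) (at l)"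
    using has_field_derivative_transform_within_open[of ?f D l "{0<..}" "theta1 \<gamma>"] theta1_formula[OF g] l by simp
  have "(\<lambda>d::nat. theta2 \<gamma> l) \<longlonglongrightarrow> - D"
    by (rule difference_quotient_squeeze[of "\<lambda>_. theta1 \<gamma>" "theta1 \<gamma>" "\<lambda>_. theta2 \<gamma>", OF _ _ D l])
      (auto simp: theta1_difference[OF g])
  then have "theta2 \<gamma> l = - D" by (rule LIMSEQ_const_iff[THEN iffD1])
  then show ?thesis using D by simp
qed

text \<open>Excluding \<pi> = 1 with \<sigma> = 0 is what makes c positive. Relative to l = c the
  integrand exceeds by x (k - c)^2 / ((x + c) (x + k)^2), which vanishes only at x = 0; strictness
  therefore amounts to the law not being concentrated at 0.\<close>

lemma limit_MSE_minimum:
  fixes \<alpha> \<sigma> \<pi> \<delta> :: real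
  assumes "0 < \<alpha>" "0 \<le> \<sigma>" "0 < \<pi>" "\<pi> \<le> 1" "0 < \<delta>" "\<not> (\<pi> = 1 \<and> \<sigma> = 0)"
  shows "is_arg_min (limit_MSE \<alpha> \<sigma> \<pi> \<delta>) (\<lambda>l. l > 0) l \<longleftrightarrow> l = \<delta> * (1 - \<pi> + \<sigma>\<^sup>2 / \<alpha>\<^sup>2)"
proof -
  define \<gamma> where "\<gamma> = \<pi> * \<delta>"
  define c where "c = \<delta> * (1 - \<pi> + \<sigma>\<^sup>2 / \<alpha>\<^sup>2)"
  have g: "0 < \<gamma>" using assms by (simp add: \<gamma>_def)
  have "0 < 1 - \<pi> + \<sigma>\<^sup>2 / \<alpha>\<^sup>2"
  proof (cases "\<pi> = 1")
    case True
    then have "\<sigma> \<noteq> 0" using assms by auto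
    then show ?thesis using True assms by simp
  next
    case False
    then show ?thesis using assms by (intro add_pos_nonneg) auto
  qed
  then have c: "0 < c" using assms by (simp add: c_def)
  note i = integrable_mp_law_inverse[OF g]
  have less: "limit_MSE \<alpha> \<sigma> \<pi> \<delta> c < limit_MSE \<alpha> \<sigma> \<pi> \<delta> k" if k: "0 < k" "k \<noteq> c" for k
  proof -
    \<comment> \<open>The difference of the integrands at \<open>k\<close> and \<open>c\<close>; at
      \<open>c\<close> the coefficient of \<open>theta2\<close> is zero, so only one term is
      subtracted.\<close>
    let ?h = "\<lambda>x. c * (1 / (x + k)) + (k - c) * k * (1 / (x + k)\<^sup>2) - c * (1 / (x + c))"
    note i1 = integrable_mult_right[OF i(2)[OF k(1) c], of c]
      and i2 = integrable_mult_right[OF i(3)[OF k(1) c], of "(k - c) * k"]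
      and i3 = integrable_mult_right[OF i(2)[OF c c], of c]
    have int: "integrable (mp_law \<gamma>) ?h"
      by (intro Bochner_Integration.integrable_diff Bochner_Integration.integrable_add i1 i2 i3)
    have h_eq: "AE x in mp_law \<gamma>. ?h x = x * (k - c)\<^sup>2 / ((x + c) * (x + k)\<^sup>2)"
      using AE_mp_law_nonneg
    proof eventually_elim
      fix x :: real assume "0 \<le> x"
      then have "x + k \<noteq> 0" "x + c \<noteq> 0" using k c by auto
      then show "?h x = x * (k - c)\<^sup>2 / ((x + c) * (x + k)\<^sup>2)"
        by (simp add: divide_simps) (simp add: power2_eq_square algebra_simps)
    qed
    have nonneg: "AE x in mp_law \<gamma>. 0 \<le> ?h x"
      using h_eq AE_mp_law_nonneg by eventually_elim (use k c in simp)
    have "integral\<^sup>L (mp_law \<gamma>) ?h \<noteq> 0"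
    proof
      assume "integral\<^sup>L (mp_law \<gamma>) ?h = 0"
      then have "AE x in mp_law \<gamma>. ?h x = 0" using integral_nonneg_eq_0_iff_AE[OF int nonneg] by simp
      then have zero: "AE x in mp_law \<gamma>. x = 0"
        using h_eq AE_mp_law_nonneg
      proof eventually_elim
        fix x assume "?h x = 0" "?h x = x * (k - c)\<^sup>2 / ((x + c) * (x + k)\<^sup>2)" "0 \<le> x"
        then have "x * (k - c)\<^sup>2 / ((x + c) * (x + k)\<^sup>2) = 0" by metis
        then show "x = 0" using k c \<open>0 \<le> x\<close> by (auto simp: add_eq_0_iff)
      qed
      have *: "theta1 \<gamma> t = Sigma_Algebra.measure (mp_law \<gamma>) UNIV / t" if "0 < t" for t
      proof -
        have "theta1 \<gamma> t = (\<integral>x. 1 / t \<partial>mp_law \<gamma>)"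
          unfolding theta1_def
        proof (rule integral_cong_AE)
          show "AE x in mp_law \<gamma>. 1 / (x + t) = 1 / t" using zero by eventually_elim simp
        qed simp_all
        then show ?thesis by simp
      qed
      \<comment> \<open>If all mass w sat at 0, then \<open>theta1\<close> would be w / t. The
        quadratic equation at t = 1 and t = 2 forces w = 1 by subtraction, and this contradicts the
        equation at t = 1.\<close>
      define w where "w = Sigma_Algebra.measure (mp_law \<gamma>) UNIV"
      have "\<gamma> * t * (w / t)\<^sup>2 + (t + 1 - \<gamma>) * (w / t) = 1" if "0 < t" for t
        using theta1_quadratic(1)[OF g that] unfolding *[OF that] w_def .
      from this[of 1] this[of 2] have "w = 1" "\<gamma> * w\<^sup>2 + (2 - \<gamma>) * w = 1"
        by (simp_all add: power_divide field_simps power2_eq_square)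
      then show False by simp
    qed
    then have pos: "0 < integral\<^sup>L (mp_law \<gamma>) ?h" using integral_nonneg_AE[OF nonneg] by linarith
    have "integral\<^sup>L (mp_law \<gamma>) ?h = c * theta1 \<gamma> k + (k - c) * k * theta2 \<gamma> k - c * theta1 \<gamma> c"
      unfolding theta1_def theta2_def Bochner_Integration.integral_diff[OF Bochner_Integration.integrable_add[OF i1 i2] i3]
        Bochner_Integration.integral_add[OF i1 i2] integral_mult_right_zero ..
    moreover have "limit_MSE \<alpha> \<sigma> \<pi> \<delta> k - limit_MSE \<alpha> \<sigma> \<pi> \<delta> c
        = \<alpha>\<^sup>2 * \<pi> * (c * theta1 \<gamma> k + (k - c) * k * theta2 \<gamma> k - c * theta1 \<gamma> c)"
    proof -
      have "limit_MSE \<alpha> \<sigma> \<pi> \<delta> t = \<alpha>\<^sup>2 * (1 - \<pi> + \<pi> * c * theta1 \<gamma> t + (t - c) * t * \<pi> * theta2 \<gamma> t) + \<sigma>\<^sup>2" for t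
        unfolding limit_MSE_def c_def \<gamma>_def by (simp only: mult.assoc)
      then show ?thesis by (simp only:) (simp add: algebra_simps)
    qed
    moreover have "0 < \<alpha>\<^sup>2 * \<pi>" using assms by simp
    ultimately show ?thesis using pos by (metis diff_gt_0_iff_gt mult_pos_pos)
  qed
  show ?thesis
    unfolding is_arg_min_def c_def[symmetric]
    using less c by (metis less_asym less_irrefl)
qed

section \<open>The predictor in terms of the projected resolvent\<close>

definition fmat_of :: "real mat \<Rightarrow> fmat" where
  "fmat_of A = fm (dim_row A) (dim_col A) (\<lambda>ij. A $$ ij)"

definition column_of :: "real Matrix.vec \<Rightarrow> fmat" where
  "column_of v = fm (dim_vec v) 1 (\<lambda>(i, j). v $ i)"

lemma entry_fmat_of [simp]:
  "entry (fmat_of A) i j = (if i < dim_row A \<and> j < dim_col A then A $$ (i, j) else 0)"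
  by (simp add: fmat_of_def)

lemma supp_in_fmat_of: "supp_in (dim_row A) (dim_col A) (fmat_of A)"
  by (simp add: fmat_of_def)

lemma fmat_of_mat [simp]: "fmat_of (Matrix.mat m k f) = fm m k f"
  by (rule fmat_eqI) auto

lemma fmat_of_mult:
  assumes "dim_col A = dim_row B"
  shows "fmat_of (A * B) = fmat_of A * fmat_of B"
  by (rule fmat_eqI)
    (auto simp: entry_mult[OF supp_in_fmat_of] assms scalar_prod_def atLeast0LessThan intro!: sum.cong)

lemma fmat_of_transpose [simp]: "fmat_of (transpose_mat A) = tp (fmat_of A)"
  by (rule fmat_eqI) auto

lemma fmat_of_add:
  assumes "dim_row A = dim_row B" "dim_col A = dim_col B"
  shows "fmat_of (A + B) = fmat_of A + fmat_of B"
  by (rule fmat_eqI) (auto simp: assms)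

lemma fmat_of_smult [simp]: "fmat_of (c \<cdot>\<^sub>m A) = c *\<^sub>R fmat_of A"
  by (rule fmat_eqI) auto

lemma fmat_of_one [simp]: "fmat_of (1\<^sub>m k) = idm k"
  by (rule fmat_eqI) (auto simp: entry_idm)

lemma column_of_mult:
  assumes "dim_col A = dim_vec v"
  shows "column_of (A *\<^sub>v v) = fmat_of A * column_of v"
  by (rule fmat_eqI)
    (auto simp: column_of_def entry_mult[OF supp_in_fmat_of] assms scalar_prod_def atLeast0LessThan intro!: sum.cong)

lemma column_of_add: "dim_vec u = dim_vec v \<Longrightarrow> column_of (u + v) = column_of u + column_of v"
  by (rule fmat_eqI) (auto simp: column_of_def)

lemma column_of_smult: "column_of (c \<cdot>\<^sub>v v) = c *\<^sub>R column_of v"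
  by (rule fmat_eqI) (auto simp: column_of_def)

lemma column_of_vec: "column_of (Matrix.vec k f) = fm k 1 (\<lambda>(i, j). f i)"
  by (rule fmat_eqI) (auto simp: column_of_def)

lemma scalar_prod_column_of:
  assumes "dim_vec u = dim_vec v"
  shows "scalar_prod u v = entry (tp (column_of u) * column_of v) 0 0"
proof -
  have "supp_in 1 (dim_vec v) (tp (column_of u))"
    using assms by (intro supp_in_tp) (simp add: column_of_def)
  from entry_mult[OF this] show ?thesis
    using assms by (simp add: column_of_def scalar_prod_def atLeast0LessThan)
qed

section \<open>Invertibility of the ridge matrix\<close>

definition ridge_gram :: "nat \<Rightarrow> nat \<Rightarrow> nat \<Rightarrow> real \<Rightarrow> (nat \<times> nat \<Rightarrow> real) \<Rightarrow> (nat \<times> nat \<Rightarrow> real) \<Rightarrow> real mat" where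
  "ridge_gram n p d l X W = (1 / real n) \<cdot>\<^sub>m (Matrix.mat p d W * (Matrix.mat n d X)\<^sup>T * Matrix.mat n d X * (Matrix.mat p d W)\<^sup>T) + l \<cdot>\<^sub>m 1\<^sub>m p"

lemma ridge_gram_carrier: "ridge_gram n p d l X W \<in> carrier_mat p p"
  by (simp add: ridge_gram_def)

lemma fmat_of_ridge_gram:
  "fmat_of (ridge_gram n p d l X W) = gram n (fm n d X * tp (fm p d W)) + l *\<^sub>R idm p"
  unfolding ridge_gram_def
  by (subst fmat_of_add) (simp_all add: fmat_of_mult gram_def mult.assoc)

text \<open>A kernel vector would have norm zero because the matrix is a Gram matrix plus a positive
  multiple of the identity. The adjugate form of the inverse is recorded for the sake of
  measurability.\<close>

lemma ridge_gram_inverse: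
  assumes l: "0 < l"
  shows "det (ridge_gram n p d l X W) \<noteq> 0"
    "\<exists>R. mat_inverse (ridge_gram n p d l X W) = Some R \<and> R \<in> carrier_mat p p \<and>
      ridge_gram n p d l X W * R = 1\<^sub>m p \<and> R * ridge_gram n p d l X W = 1\<^sub>m p \<and>
      R = (1 / det (ridge_gram n p d l X W)) \<cdot>\<^sub>m adj_mat (ridge_gram n p d l X W)"
proof -
  let ?A = "ridge_gram n p d l X W"
  note C = ridge_gram_carrier[of n p d l X W]
  let ?Z = "fm n d X * tp (fm p d W)"
  show det: "det ?A \<noteq> 0"
  proof
    assume "det ?A = 0"
    then obtain v where v: "v \<in> carrier_vec p" "v \<noteq> 0\<^sub>v p" "?A *\<^sub>v v = 0\<^sub>v p"
      using det_0_iff_vec_prod_zero[OF C] by blast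
    let ?V = "column_of v"
    have "supp_in p 1 ?V" using v(1) by (auto simp: column_of_def)
    then have idV: "idm p * ?V = ?V" by (rule idm_mult)
    have "fmat_of ?A * ?V = column_of (0\<^sub>v p)"
      using C v by (subst column_of_mult[symmetric]) auto
    also have "\<dots> = 0" by (rule fmat_eqI) (simp add: column_of_def)
    finally have "inner ?V ((gram n ?Z + l *\<^sub>R idm p) * ?V) = 0" by (simp add: fmat_of_ridge_gram)
    moreover have "inner ?V ((gram n ?Z + l *\<^sub>R idm p) * ?V) = (norm (?Z * ?V))\<^sup>2 / n + l * (norm ?V)\<^sup>2"
    proof -
      have "inner ?V ((gram n ?Z + l *\<^sub>R idm p) * ?V) = inner ?V (tp ?Z * (?Z * ?V)) / n + l * inner ?V ?V"
        by (simp add: gram_def distrib_right inner_add_right idV mult.assoc)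
      also have "inner ?V (tp ?Z * (?Z * ?V)) = inner (?Z * ?V) (?Z * ?V)"
        by (rule inner_mult_left[symmetric])
      finally show ?thesis unfolding power2_norm_fmat by simp
    qed
    moreover have "0 \<le> (norm (?Z * ?V))\<^sup>2 / n" by simp
    ultimately have "l * (norm ?V)\<^sup>2 \<le> 0" by linarith
    then have "?V = 0" using l by (simp add: mult_le_0_iff)
    then have V0: "entry ?V i 0 = 0" for i by simp
    have "v $ i = 0" if "i < p" for i using V0[of i] v(1) that by (auto simp: column_of_def)
    then have "v = 0\<^sub>v p"
      using v(1) by (intro eq_vecI) auto
    with v(2) show False by simp
  qed
  let ?B = "(1 / det ?A) \<cdot>\<^sub>m adj_mat ?A"
  note adj = adj_mat[OF C]
  have B: "?B \<in> carrier_mat p p" "?A * ?B = 1\<^sub>m p" "?B * ?A = 1\<^sub>m p"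
    using adj det C by (auto simp: mult_smult_distrib[OF C adj(1)] mult_smult_assoc_mat[OF adj(1) C])
  \<comment> \<open>\<open>mat_inverse\<close> returns \<open>None\<close> only on non-units, so the
    adjugate inverse guarantees a result; uniqueness of inverses then identifies it.\<close>
  then have "?A \<in> Units (ring_mat TYPE(real) p undefined)"
    using C by (auto simp: Units_def ring_mat_def)
  then obtain R where R: "mat_inverse ?A = Some R"
    using mat_inverse(1)[OF C, of undefined] by (cases "mat_inverse ?A") auto
  note R' = mat_inverse(2)[OF C R]
  have "R = R * 1\<^sub>m p" by (rule right_mult_one_mat[symmetric]) (use R' in blast)
  also have "\<dots> = R * (?A * ?B)" by (simp only: B(2))
  also have "\<dots> = R * ?A * ?B" by (rule assoc_mult_mat[symmetric, OF _ C B(1)]) (use R' in blast)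
  also have "\<dots> = 1\<^sub>m p * ?B" using R' by simp
  also have "\<dots> = ?B" by (rule left_mult_one_mat[OF B(1)])
  finally show "\<exists>R. mat_inverse ?A = Some R \<and> R \<in> carrier_mat p p \<and>
      ?A * R = 1\<^sub>m p \<and> R * ?A = 1\<^sub>m p \<and> R = ?B"
    using R R' by blast
qed

definition ridge_inverse :: "nat \<Rightarrow> nat \<Rightarrow> nat \<Rightarrow> real \<Rightarrow> (nat \<times> nat \<Rightarrow> real) \<Rightarrow> (nat \<times> nat \<Rightarrow> real) \<Rightarrow> fmat" where
  "ridge_inverse n p d l X W = fmat_of (the (mat_inverse (ridge_gram n p d l X W)))"

lemma ridge_inverse_eq:
  assumes "0 < l"
  shows "ridge_inverse n p d l X W * (gram n (fm n d X * tp (fm p d W)) + l *\<^sub>R idm p) = idm p"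
    "(gram n (fm n d X * tp (fm p d W)) + l *\<^sub>R idm p) * ridge_inverse n p d l X W = idm p"
    "supp_in p p (ridge_inverse n p d l X W)"
proof -
  obtain R where R: "mat_inverse (ridge_gram n p d l X W) = Some R" "R \<in> carrier_mat p p"
      "ridge_gram n p d l X W * R = 1\<^sub>m p" "R * ridge_gram n p d l X W = 1\<^sub>m p"
    using ridge_gram_inverse(2)[OF assms] by metis
  note C = ridge_gram_carrier[of n p d l X W]
  have "fmat_of R * fmat_of (ridge_gram n p d l X W) = idm p" "fmat_of (ridge_gram n p d l X W) * fmat_of R = idm p"
    using R C by (simp_all flip: fmat_of_mult)
  then show "ridge_inverse n p d l X W * (gram n (fm n d X * tp (fm p d W)) + l *\<^sub>R idm p) = idm p"
    "(gram n (fm n d X * tp (fm p d W)) + l *\<^sub>R idm p) * ridge_inverse n p d l X W = idm p"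
    by (simp_all add: ridge_inverse_def R(1) fmat_of_ridge_gram)
  show "supp_in p p (ridge_inverse n p d l X W)"
    using supp_in_fmat_of[of R] R(2) by (simp add: ridge_inverse_def R(1))
qed

definition projected_resolvent :: "nat \<Rightarrow> nat \<Rightarrow> nat \<Rightarrow> real \<Rightarrow> (nat \<times> nat \<Rightarrow> real) \<Rightarrow> (nat \<times> nat \<Rightarrow> real) \<Rightarrow> fmat" where
  "projected_resolvent n p d l X W = tp (fm p d W) * ridge_inverse n p d l X W * fm p d W"

text \<open>The p-dimensional inverse is itself an instance of the locale, with the full identity as
  projection and design \<open>X * tp W\<close>. This supplies norm bounds for every
  \<open>W\<close>, including the null set where the rows are not orthonormal.\<close>

lemma resolvent_ridge_inverse:
  assumes "0 < l" "0 < n"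
  shows "resolvent (idm p) (ridge_inverse n p d l X W) (fm n d X * tp (fm p d W)) n l"
proof
  note e = ridge_inverse_eq[OF assms(1), where n = n and p = p and d = d and X = X and W = W]
  let ?R = "ridge_inverse n p d l X W" and ?S = "gram n (fm n d X * tp (fm p d W))"
  have S: "supp_in p p ?S" by (rule supp_in_gram[OF supp_in_mult[OF supp_in_fm supp_in_tp[OF supp_in_fm]]])
  show "idm p * idm p = idm p" by (rule idm_mult) (rule supp_in_idm)
  show "?R * idm p = ?R" "idm p * ?R = ?R" by (rule mult_idm[OF e(3)]) (rule idm_mult[OF e(3)])
  then show "?R * ?S * idm p + l *\<^sub>R ?R = idm p" "idm p * ?S * ?R + l *\<^sub>R ?R = idm p"
    using e(1,2) mult_idm[OF S] idm_mult[OF S] by (simp_all add: algebra_simps)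
qed (use assms in simp_all)

lemma resolvent_projected:
  assumes "0 < l" "0 < n" and orth: "fm p d W * tp (fm p d W) = idm p"
  shows "resolvent (tp (fm p d W) * fm p d W) (projected_resolvent n p d l X W) (fm n d X) n l"
proof
  let ?W = "fm p d W" and ?R = "ridge_inverse n p d l X W"
  interpret R: resolvent "idm p" ?R "fm n d X * tp ?W" n l by (rule resolvent_ridge_inverse[OF assms(1,2)])
  have W: "idm p * ?W = ?W" by (rule idm_mult[OF supp_in_fm])
  have W': "tp ?W * idm p = tp ?W" by (rule mult_idm[OF supp_in_tp[OF supp_in_fm]])
  \<comment> \<open>Orthonormality of the rows enters here: it makes \<open>W\<close> a partial
    isometry, so conjugation carries the p-dimensional equations to the range of
    \<open>tp W * W\<close>.\<close>
  have WW: "?W * (tp ?W * A) = idm p * A" for A by (simp only: orth flip: mult.assoc)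
  have g: "?W * (gram n (fm n d X) * tp ?W) = gram n (fm n d X * tp ?W)"
    by (simp add: gram_def mult.assoc)
  show "tp ?W * ?W * (tp ?W * ?W) = tp ?W * ?W" by (simp add: mult.assoc WW W)
  show "projected_resolvent n p d l X W * (tp ?W * ?W) = projected_resolvent n p d l X W"
    unfolding projected_resolvent_def by (simp add: mult.assoc WW W)
  show "tp ?W * ?W * projected_resolvent n p d l X W = projected_resolvent n p d l X W"
    unfolding projected_resolvent_def by (simp add: mult.assoc WW) (simp add: R.PG W' flip: mult.assoc)
  have "projected_resolvent n p d l X W * gram n (fm n d X) * (tp ?W * ?W) + l *\<^sub>R projected_resolvent n p d l X W
      = tp ?W * (?R * (?W * (gram n (fm n d X) * tp ?W)) + l *\<^sub>R ?R) * ?W"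
    unfolding projected_resolvent_def by (simp add: algebra_simps)
  also have "\<dots> = tp ?W * (?R * gram n (fm n d X * tp ?W) * idm p + l *\<^sub>R ?R) * ?W"
    unfolding g mult.assoc by (simp add: distrib_left distrib_right mult.assoc W)
  finally show "projected_resolvent n p d l X W * gram n (fm n d X) * (tp ?W * ?W) + l *\<^sub>R projected_resolvent n p d l X W = tp ?W * ?W"
    unfolding R.right by (simp add: mult.assoc W)
  have "tp ?W * ?W * gram n (fm n d X) * projected_resolvent n p d l X W + l *\<^sub>R projected_resolvent n p d l X W
      = tp ?W * (?W * (gram n (fm n d X) * tp ?W) * ?R + l *\<^sub>R ?R) * ?W"
    unfolding projected_resolvent_def by (simp add: algebra_simps)
  also have "\<dots> = tp ?W * (idm p * gram n (fm n d X * tp ?W) * ?R + l *\<^sub>R ?R) * ?W"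
    unfolding g by (simp add: distrib_left distrib_right mult.assoc[symmetric] W')
  finally show "tp ?W * ?W * gram n (fm n d X) * projected_resolvent n p d l X W + l *\<^sub>R projected_resolvent n p d l X W = tp ?W * ?W"
    unfolding R.left by (simp add: mult.assoc W)
qed (use assms in simp_all)

lemma fhat_expansion:
  assumes l: "0 < l"
  shows "fhat n p d l \<theta> x X e W =
    (\<Sum>a<d. \<Sum>b<d. x a * entry (projected_resolvent n p d l X W * gram n (fm n d X)) a b * \<theta> b) +
    (\<Sum>a<d. \<Sum>i<n. x a * entry ((1 / n) *\<^sub>R (projected_resolvent n p d l X W * tp (fm n d X))) a i * e i)"
proof -
  let ?W = "fm p d W" and ?X = "fm n d X" and ?R = "ridge_inverse n p d l X W"
  let ?x = "fm d 1 (\<lambda>(i, j). x i)" and ?t = "fm d 1 (\<lambda>(i, j). \<theta> i)" and ?e = "fm n 1 (\<lambda>(i, j). e i)"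
  let ?G = "projected_resolvent n p d l X W"
  define R where "R = the (mat_inverse (ridge_gram n p d l X W))"
  have R: "R \<in> carrier_mat p p"
    using ridge_gram_inverse(2)[OF l, of n p d X W] by (auto simp: R_def)
  have "fhat n p d l \<theta> x X e W = scalar_prod (Matrix.vec d x) ((Matrix.mat p d W)\<^sup>T *\<^sub>v (R *\<^sub>v ((1 / n) \<cdot>\<^sub>v
      (Matrix.mat p d W * (Matrix.mat n d X)\<^sup>T *\<^sub>v (Matrix.mat n d X *\<^sub>v Matrix.vec d \<theta> + Matrix.vec n e)))))"
    by (simp add: fhat_def predictor_def Let_def R_def ridge_gram_def)
  also have "\<dots> = entry (tp ?x * (tp ?W * (?R * ((1 / n) *\<^sub>R (?W * tp ?X * (?X * ?t + ?e)))))) 0 0"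
    using R by (simp add: scalar_prod_column_of column_of_mult column_of_add column_of_smult column_of_vec fmat_of_mult
        ridge_inverse_def R_def[symmetric])
  also have "\<dots> = entry (tp ?x * (?G * gram n ?X) * ?t + tp ?x * ((1 / n) *\<^sub>R (?G * tp ?X)) * ?e) 0 0"
    by (simp add: projected_resolvent_def gram_def algebra_simps scaleR_add_right)
  also have "\<dots> = entry (tp ?x * (?G * gram n ?X) * ?t) 0 0 + entry (tp ?x * ((1 / n) *\<^sub>R (?G * tp ?X)) * ?e) 0 0"
    by (rule plus_fmat.rep_eq[THEN fun_cong, THEN fun_cong])
  finally have expansion: "fhat n p d l \<theta> x X e W
      = entry (tp ?x * (?G * gram n ?X) * ?t) 0 0 + entry (tp ?x * ((1 / n) *\<^sub>R (?G * tp ?X)) * ?e) 0 0" .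
  have 1: "entry (tp ?x * A * ?t) 0 0 = (\<Sum>a<d. \<Sum>b<d. x a * entry A a b * \<theta> b)" if "supp_in d d A" for A
  proof -
    have sx: "supp_in 1 d (tp ?x)" by (intro supp_in_tp supp_in_fm)
    have "entry (tp ?x * A * ?t) 0 0 = (\<Sum>b<d. (\<Sum>a<d. x a * entry A a b) * \<theta> b)"
      unfolding entry_mult[OF supp_in_mult[OF sx that]] entry_mult[OF sx] by (intro sum.cong) auto
    then show ?thesis unfolding sum_distrib_right by (subst sum.swap) simp
  qed
  have 2: "supp_in d d (?G * gram n ?X)"
    unfolding projected_resolvent_def
    by (intro supp_in_mult[OF supp_in_mult[OF supp_in_mult[OF supp_in_tp[OF supp_in_fm] ridge_inverse_eq(3)[OF l]] supp_in_fm] supp_in_gram[OF supp_in_fm]])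
  have 3: "entry (tp ?x * A * ?e) 0 0 = (\<Sum>a<d. \<Sum>i<n. x a * entry A a i * e i)" if "supp_in d n A" for A
  proof -
    have sx: "supp_in 1 d (tp ?x)" by (intro supp_in_tp supp_in_fm)
    have "entry (tp ?x * A * ?e) 0 0 = (\<Sum>i<n. (\<Sum>a<d. x a * entry A a i) * e i)"
      unfolding entry_mult[OF supp_in_mult[OF sx that]] entry_mult[OF sx] by (intro sum.cong) auto
    then show ?thesis unfolding sum_distrib_right by (subst sum.swap) simp
  qed
  have 4: "supp_in d n ((1 / n) *\<^sub>R (?G * tp ?X))"
    unfolding projected_resolvent_def
    by (intro supp_in_scaleR supp_in_mult[OF supp_in_mult[OF supp_in_mult[OF supp_in_tp[OF supp_in_fm] ridge_inverse_eq(3)[OF l]] supp_in_fm] supp_in_tp[OF supp_in_fm]])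
  show ?thesis unfolding expansion 1[OF 2] 3[OF 4] ..
qed

section \<open>Measurability of the projected resolvent\<close>

lemma measurable_det:
  assumes "\<And>\<omega>. A \<omega> \<in> carrier_mat k k" "\<And>i j. i < k \<Longrightarrow> j < k \<Longrightarrow> (\<lambda>\<omega>. A \<omega> $$ (i, j)) \<in> borel_measurable N"
  shows "(\<lambda>\<omega>. det (A \<omega>) :: real) \<in> borel_measurable N"
  unfolding det_def'[OF assms(1)]
proof (intro borel_measurable_sum borel_measurable_times borel_measurable_const borel_measurable_prod)
  fix \<pi> i assume "\<pi> \<in> {\<pi>. \<pi> permutes {0..<k}}" "i \<in> {0..<k}"
  then show "(\<lambda>\<omega>. A \<omega> $$ (i, \<pi> i)) \<in> borel_measurable N"
    using permutes_in_image[of \<pi> "{0..<k}" i] by (intro assms(2)) auto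
qed

text \<open>By the adjugate formula every entry of the inverse is a quotient of polynomials in the
  entries of \<open>X\<close> and \<open>W\<close>.\<close>

lemma fmat_measurable_projected_resolvent:
  assumes l: "0 < l"
    and X: "\<And>i j. i < n \<Longrightarrow> j < d \<Longrightarrow> (\<lambda>\<omega>. X \<omega> (i, j)) \<in> borel_measurable N"
    and W: "\<And>i j. i < p \<Longrightarrow> j < d \<Longrightarrow> (\<lambda>\<omega>. W \<omega> (i, j)) \<in> borel_measurable N"
  shows "fmat_measurable N (\<lambda>\<omega>. projected_resolvent n p d l (X \<omega>) (W \<omega>))"
proof -
  let ?A = "\<lambda>\<omega>. ridge_gram n p d l (X \<omega>) (W \<omega>)"
  have fX: "fmat_measurable N (\<lambda>\<omega>. fm n d (X \<omega>))" by (intro fmat_measurable_fm X)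
  have fW: "fmat_measurable N (\<lambda>\<omega>. fm p d (W \<omega>))" by (intro fmat_measurable_fm W)
  have fA: "fmat_measurable N (\<lambda>\<omega>. fmat_of (?A \<omega>))"
    unfolding fmat_of_ridge_gram by (intro fmat_measurable_intros fX fW)
  have A: "(\<lambda>\<omega>. ?A \<omega> $$ (i, j)) \<in> borel_measurable N" if "i < p" "j < p" for i j
    using measurable_entry[OF fA, of i j] that carrier_matD[OF ridge_gram_carrier[of n p d l]] by simp
  have det: "(\<lambda>\<omega>. det (?A \<omega>)) \<in> borel_measurable N"
    by (rule measurable_det[OF ridge_gram_carrier A])
  have del: "(\<lambda>\<omega>. det (mat_delete (?A \<omega>) i j)) \<in> borel_measurable N" for i j
  proof (rule measurable_det[OF mat_delete_carrier[OF ridge_gram_carrier]])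
    fix a b assume "a < p - 1" "b < p - 1"
    then show "(\<lambda>\<omega>. mat_delete (?A \<omega>) i j $$ (a, b)) \<in> borel_measurable N"
      using carrier_matD[OF ridge_gram_carrier[of n p d l]] by (auto simp: mat_delete_def intro!: A)
  qed
  have "fmat_measurable N (\<lambda>\<omega>. ridge_inverse n p d l (X \<omega>) (W \<omega>))"
    unfolding fmat_measurable_def
  proof (intro allI)
    fix i j
    have eq: "entry (ridge_inverse n p d l (X \<omega>) (W \<omega>)) i j =
        (if i < p \<and> j < p then 1 / det (?A \<omega>) * ((-1) ^ (j + i) * det (mat_delete (?A \<omega>) j i)) else 0)" for \<omega>
    proof -
      obtain R where R: "mat_inverse (?A \<omega>) = Some R" "R \<in> carrier_mat p p" "R = (1 / det (?A \<omega>)) \<cdot>\<^sub>m adj_mat (?A \<omega>)"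
        using ridge_gram_inverse(2)[OF l, of n p d "X \<omega>" "W \<omega>"] by metis
      have "R $$ (i, j) = 1 / det (?A \<omega>) * ((-1) ^ (j + i) * det (mat_delete (?A \<omega>) j i))" if "i < p" "j < p"
        using that carrier_matD[OF ridge_gram_carrier[of n p d l]] by (simp add: R(3) adj_mat_def cofactor_def)
      then show ?thesis using R(2) by (simp add: ridge_inverse_def R(1))
    qed
    show "(\<lambda>\<omega>. entry (ridge_inverse n p d l (X \<omega>) (W \<omega>)) i j) \<in> borel_measurable N"
      unfolding eq using det del by (cases "i < p \<and> j < p") auto
  qed
  then show ?thesis
    unfolding projected_resolvent_def by (intro fmat_measurable_intros fW)
qed

section \<open>Second moments on product spaces\<close>

lemma (in pair_sigma_finite) product_of_functions:
  fixes u v :: "_ \<Rightarrow> real"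
  assumes u: "integrable M1 u" and v: "integrable M2 v"
  shows "integrable (M1 \<Otimes>\<^sub>M M2) (\<lambda>z. u (fst z) * v (snd z))"
    and "(\<integral>z. u (fst z) * v (snd z) \<partial>(M1 \<Otimes>\<^sub>M M2)) = (\<integral>x. u x \<partial>M1) * (\<integral>y. v y \<partial>M2)"
proof -
  have [measurable]: "u \<in> borel_measurable M1" "v \<in> borel_measurable M2" using u v by auto
  show int: "integrable (M1 \<Otimes>\<^sub>M M2) (\<lambda>z. u (fst z) * v (snd z))"
    by (rule Fubini_integrable) (use u v in \<open>auto simp: abs_mult\<close>)
  show "(\<integral>z. u (fst z) * v (snd z) \<partial>(M1 \<Otimes>\<^sub>M M2)) = (\<integral>x. u x \<partial>M1) * (\<integral>y. v y \<partial>M2)"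
    unfolding integral_fst'[OF int, symmetric] by simp
qed

text \<open>The common source of the exact risk formulas: when the first factors are orthogonal, all
  mixed terms of the square disappear. It is used for the products of coordinates of \<theta> and x
  and for the noise coordinates.\<close>

lemma (in pair_sigma_finite) orthogonal_sum:
  fixes f g :: "'k \<Rightarrow> _ \<Rightarrow> real"
  assumes K: "finite K"
    and f: "\<And>k k'. k \<in> K \<Longrightarrow> k' \<in> K \<Longrightarrow> integrable M1 (\<lambda>x. f k x * f k' x)"
      "\<And>k k'. k \<in> K \<Longrightarrow> k' \<in> K \<Longrightarrow> (\<integral>x. f k x * f k' x \<partial>M1) = (if k = k' then w k else 0)"
    and g: "\<And>k. k \<in> K \<Longrightarrow> g k \<in> borel_measurable M2" "\<And>k. k \<in> K \<Longrightarrow> integrable M2 (\<lambda>y. (g k y)\<^sup>2)"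
  shows "integrable (M1 \<Otimes>\<^sub>M M2) (\<lambda>z. (\<Sum>k\<in>K. f k (fst z) * g k (snd z))\<^sup>2)"
    and "(\<integral>z. (\<Sum>k\<in>K. f k (fst z) * g k (snd z))\<^sup>2 \<partial>(M1 \<Otimes>\<^sub>M M2)) = (\<Sum>k\<in>K. w k * (\<integral>y. (g k y)\<^sup>2 \<partial>M2))"
proof -
  have gg: "integrable M2 (\<lambda>y. g k y * g k' y)" if "k \<in> K" "k' \<in> K" for k k'
    using that g by (intro integral_abs_mult_le(1)) auto
  have sq: "(\<Sum>k\<in>K. f k (fst z) * g k (snd z))\<^sup>2
      = (\<Sum>k\<in>K. \<Sum>k'\<in>K. (f k (fst z) * f k' (fst z)) * (g k (snd z) * g k' (snd z)))" for z
    by (simp add: power2_eq_square sum_product mult_ac)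
  note p = product_of_functions[OF f(1) gg]
  show "integrable (M1 \<Otimes>\<^sub>M M2) (\<lambda>z. (\<Sum>k\<in>K. f k (fst z) * g k (snd z))\<^sup>2)"
    unfolding sq by (intro Bochner_Integration.integrable_sum p(1))
  have "(\<integral>z. (\<Sum>k\<in>K. f k (fst z) * g k (snd z))\<^sup>2 \<partial>(M1 \<Otimes>\<^sub>M M2))
      = (\<Sum>k\<in>K. \<Sum>k'\<in>K. (\<integral>x. f k x * f k' x \<partial>M1) * (\<integral>y. g k y * g k' y \<partial>M2))"
    unfolding sq by (simp add: Bochner_Integration.integral_sum Bochner_Integration.integrable_sum p)
  also have "\<dots> = (\<Sum>k\<in>K. \<Sum>k'\<in>K. if k' = k then w k * (\<integral>y. (g k y)\<^sup>2 \<partial>M2) else 0)"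
    by (intro sum.cong refl) (auto simp: f(2) power2_eq_square)
  also have "\<dots> = (\<Sum>k\<in>K. w k * (\<integral>y. (g k y)\<^sup>2 \<partial>M2))" using K by simp
  finally show "(\<integral>z. (\<Sum>k\<in>K. f k (fst z) * g k (snd z))\<^sup>2 \<partial>(M1 \<Otimes>\<^sub>M M2)) = (\<Sum>k\<in>K. w k * (\<integral>y. (g k y)\<^sup>2 \<partial>M2))" .
qed

lemma nn_integral_triple:
  assumes "prob_space A" "prob_space B" "prob_space C" "f \<in> borel_measurable (A \<Otimes>\<^sub>M (B \<Otimes>\<^sub>M C))"
  shows "(\<integral>\<^sup>+z. f z \<partial>(A \<Otimes>\<^sub>M (B \<Otimes>\<^sub>M C))) = (\<integral>\<^sup>+a. \<integral>\<^sup>+b. \<integral>\<^sup>+c. f (a, b, c) \<partial>C \<partial>B \<partial>A)"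
proof -
  interpret B: prob_space B by fact
  interpret C: prob_space C by fact
  interpret BC: pair_prob_space B C ..
  note [measurable] = assms(4)
  have "(\<integral>\<^sup>+z. f z \<partial>(A \<Otimes>\<^sub>M (B \<Otimes>\<^sub>M C))) = (\<integral>\<^sup>+a. \<integral>\<^sup>+w. f (a, w) \<partial>(B \<Otimes>\<^sub>M C) \<partial>A)"
    by (rule BC.nn_integral_fst[symmetric]) fact
  also have "\<dots> = (\<integral>\<^sup>+a. \<integral>\<^sup>+b. \<integral>\<^sup>+c. f (a, b, c) \<partial>C \<partial>B \<partial>A)"
  proof (rule nn_integral_cong)
    fix a assume [simp]: "a \<in> space A"
    show "(\<integral>\<^sup>+w. f (a, w) \<partial>(B \<Otimes>\<^sub>M C)) = (\<integral>\<^sup>+b. \<integral>\<^sup>+c. f (a, b, c) \<partial>C \<partial>B)"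
      by (rule C.nn_integral_fst[symmetric]) measurable
  qed
  finally show ?thesis .
qed

text \<open>The definitions list \<open>X\<close>, the noise and \<open>W\<close> in different
  orders. Bringing the noise to the front allows it to be integrated out against the joint law of
  \<open>X\<close> and \<open>W\<close>.\<close>

lemma distr_rotate:
  assumes "prob_space A" "prob_space B" "prob_space C"
  shows "distr (B \<Otimes>\<^sub>M (A \<Otimes>\<^sub>M C)) (A \<Otimes>\<^sub>M (B \<Otimes>\<^sub>M C)) (\<lambda>z. (fst (snd z), fst z, snd (snd z))) = A \<Otimes>\<^sub>M (B \<Otimes>\<^sub>M C)"
    and "distr (B \<Otimes>\<^sub>M (A \<Otimes>\<^sub>M C)) (A \<Otimes>\<^sub>M (C \<Otimes>\<^sub>M B)) (\<lambda>z. (fst (snd z), snd (snd z), fst z)) = A \<Otimes>\<^sub>M (C \<Otimes>\<^sub>M B)"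
proof -
  interpret A: prob_space A by fact
  interpret B: prob_space B by fact
  interpret C: prob_space C by fact
  interpret BA: pair_prob_space B A ..
  interpret AB: pair_prob_space A B ..
  interpret BC: pair_prob_space B C ..
  interpret CB: pair_prob_space C B ..
  let ?D = "distr (B \<Otimes>\<^sub>M (A \<Otimes>\<^sub>M C)) (A \<Otimes>\<^sub>M (B \<Otimes>\<^sub>M C)) (\<lambda>z. (fst (snd z), fst z, snd (snd z)))"
  let ?D' = "distr (B \<Otimes>\<^sub>M (A \<Otimes>\<^sub>M C)) (A \<Otimes>\<^sub>M (C \<Otimes>\<^sub>M B)) (\<lambda>z. (fst (snd z), snd (snd z), fst z))"
  show "?D = A \<Otimes>\<^sub>M (B \<Otimes>\<^sub>M C)"
  proof (rule measure_eqI)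
    fix S assume "S \<in> sets ?D"
    then have [measurable]: "S \<in> sets (A \<Otimes>\<^sub>M (B \<Otimes>\<^sub>M C))" by simp
    have "emeasure ?D S = (\<integral>\<^sup>+z. indicator S z \<partial>?D)"
      by (rule nn_integral_indicator[symmetric]) simp
    also have "\<dots> = (\<integral>\<^sup>+z. indicator S (fst (snd z), fst z, snd (snd z)) \<partial>(B \<Otimes>\<^sub>M (A \<Otimes>\<^sub>M C)))"
      by (rule nn_integral_distr) measurable
    also have "\<dots> = (\<integral>\<^sup>+b. \<integral>\<^sup>+a. \<integral>\<^sup>+c. indicator S (a, b, c) \<partial>C \<partial>A \<partial>B)"
      by (subst nn_integral_triple[OF assms(2,1,3)]) simp_all
    also have "\<dots> = (\<integral>\<^sup>+a. \<integral>\<^sup>+b. \<integral>\<^sup>+c. indicator S (a, b, c) \<partial>C \<partial>B \<partial>A)"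
      by (rule AB.Fubini') measurable
    also have "\<dots> = (\<integral>\<^sup>+z. indicator S z \<partial>(A \<Otimes>\<^sub>M (B \<Otimes>\<^sub>M C)))"
      by (rule nn_integral_triple[OF assms, symmetric]) simp
    finally show "emeasure ?D S = emeasure (A \<Otimes>\<^sub>M (B \<Otimes>\<^sub>M C)) S" by simp
  qed simp
  show "?D' = A \<Otimes>\<^sub>M (C \<Otimes>\<^sub>M B)"
  proof (rule measure_eqI)
    fix S assume "S \<in> sets ?D'"
    then have [measurable]: "S \<in> sets (A \<Otimes>\<^sub>M (C \<Otimes>\<^sub>M B))" by simp
    have "emeasure ?D' S = (\<integral>\<^sup>+z. indicator S z \<partial>?D')"
      by (rule nn_integral_indicator[symmetric]) simp
    also have "\<dots> = (\<integral>\<^sup>+z. indicator S (fst (snd z), snd (snd z), fst z) \<partial>(B \<Otimes>\<^sub>M (A \<Otimes>\<^sub>M C)))"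
      by (rule nn_integral_distr) measurable
    also have "\<dots> = (\<integral>\<^sup>+b. \<integral>\<^sup>+a. \<integral>\<^sup>+c. indicator S (a, c, b) \<partial>C \<partial>A \<partial>B)"
      by (subst nn_integral_triple[OF assms(2,1,3)]) simp_all
    also have "\<dots> = (\<integral>\<^sup>+a. \<integral>\<^sup>+b. \<integral>\<^sup>+c. indicator S (a, c, b) \<partial>C \<partial>B \<partial>A)"
      by (rule AB.Fubini') measurable
    also have "\<dots> = (\<integral>\<^sup>+a. \<integral>\<^sup>+c. \<integral>\<^sup>+b. indicator S (a, c, b) \<partial>B \<partial>C \<partial>A)"
    proof (rule nn_integral_cong)
      fix a assume [simp]: "a \<in> space A"
      show "(\<integral>\<^sup>+b. \<integral>\<^sup>+c. indicator S (a, c, b) \<partial>C \<partial>B) = (\<integral>\<^sup>+c. \<integral>\<^sup>+b. indicator S (a, c, b) \<partial>B \<partial>C)"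
        by (rule CB.Fubini') measurable
    qed
    also have "\<dots> = (\<integral>\<^sup>+z. indicator S z \<partial>(A \<Otimes>\<^sub>M (C \<Otimes>\<^sub>M B)))"
      by (rule nn_integral_triple[OF assms(1,3,2), symmetric]) simp
    finally show "emeasure ?D' S = emeasure (A \<Otimes>\<^sub>M (C \<Otimes>\<^sub>M B)) S" by simp
  qed simp
qed

section \<open>Moments of independent coordinates and of normal laws\<close>

lemma iid_second_moments:
  fixes \<kappa> :: "real measure"
  assumes "prob_space \<kappa>" and sets: "sets \<kappa> = sets borel"
    and sq: "integrable \<kappa> (\<lambda>t. t\<^sup>2)" and mean: "(\<integral>t. t \<partial>\<kappa>) = 0"
    and I: "finite I" "i \<in> I" "j \<in> I"
  shows "integrable (PiM I (\<lambda>_. \<kappa>)) (\<lambda>x. x i * x j)"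
    and "(\<integral>x. x i * x j \<partial>PiM I (\<lambda>_. \<kappa>)) = (if i = j then \<integral>t. t\<^sup>2 \<partial>\<kappa> else 0)"
    and "integrable (PiM I (\<lambda>_. \<kappa>)) (\<lambda>x. x i)" and "(\<integral>x. x i \<partial>PiM I (\<lambda>_. \<kappa>)) = 0"
proof -
  interpret prob_space \<kappa> by fact
  interpret P: product_sigma_finite "\<lambda>_. \<kappa>" by standard
  have [measurable]: "(\<lambda>t. t) \<in> borel_measurable \<kappa>" by (subst measurable_cong_sets[OF sets refl]) simp
  have int: "integrable \<kappa> (\<lambda>t. t)" by (rule square_integrable_imp_integrable) (use sq in auto)
  have one: "Sigma_Algebra.measure \<kappa> (space \<kappa>) = 1" by (rule prob_space)
  \<comment> \<open>The two factors are kept separate so that one product covers both cases: at i =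
    j they multiply to t squared, otherwise a single t stands at each of i and j.\<close>
  let ?f = "\<lambda>k t. (if k = i then t else 1) * (if k = j then t else 1)"
  have prod: "(\<Prod>k\<in>I. ?f k (x k)) = x i * x j" for x :: "_ \<Rightarrow> real"
    using I by (simp add: prod.distrib)
  have intf: "integrable \<kappa> (?f k)" for k
    using sq[unfolded power2_eq_square] int by (cases "k = i"; cases "k = j") simp_all
  show "integrable (PiM I (\<lambda>_. \<kappa>)) (\<lambda>x. x i * x j)"
    using P.product_integrable_prod[OF I(1), of ?f, OF intf] by (simp add: prod)
  have "(\<integral>x. x i * x j \<partial>PiM I (\<lambda>_. \<kappa>)) = (\<Prod>k\<in>I. \<integral>t. ?f k t \<partial>\<kappa>)"
    using P.product_integral_prod[OF I(1), of ?f, OF intf] by (simp add: prod)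
  also have "\<dots> = (if i = j then \<integral>t. t\<^sup>2 \<partial>\<kappa> else 0)"
  proof (cases "i = j")
    case True
    then have "(\<Prod>k\<in>I. \<integral>t. ?f k t \<partial>\<kappa>) = (\<Prod>k\<in>I. if k = i then \<integral>t. t\<^sup>2 \<partial>\<kappa> else 1)"
      by (intro prod.cong) (auto simp: power2_eq_square one)
    then show ?thesis using True I by simp
  next
    case False
    then have "(\<integral>t. ?f i t \<partial>\<kappa>) = 0" using mean by simp
    then have "(\<Prod>k\<in>I. \<integral>t. ?f k t \<partial>\<kappa>) = 0" using I by (intro prod_zero) blast+
    then show ?thesis using False by simp
  qed
  finally show "(\<integral>x. x i * x j \<partial>PiM I (\<lambda>_. \<kappa>)) = (if i = j then \<integral>t. t\<^sup>2 \<partial>\<kappa> else 0)" .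
  have D: "distr (PiM I (\<lambda>_. \<kappa>)) \<kappa> (\<lambda>x. x i) = \<kappa>"
    using I prob_space_axioms by (intro distr_PiM_component) auto
  have m: "(\<lambda>x. x i) \<in> measurable (PiM I (\<lambda>_. \<kappa>)) \<kappa>" using I by simp
  show "integrable (PiM I (\<lambda>_. \<kappa>)) (\<lambda>x. x i)"
    using integrable_distr[OF m, of "\<lambda>t. t"] int unfolding D by simp
  have "(\<integral>t. t \<partial>distr (PiM I (\<lambda>_. \<kappa>)) \<kappa> (\<lambda>x. x i)) = (\<integral>x. x i \<partial>PiM I (\<lambda>_. \<kappa>))"
    by (rule integral_distr[OF m]) simp
  then show "(\<integral>x. x i \<partial>PiM I (\<lambda>_. \<kappa>)) = 0" unfolding D mean by simp
qed

lemma centred_normal: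
  shows "prob_space (centred_normal c)" and sets_centred_normal [measurable_cong, simp]: "sets (centred_normal c) = sets borel"
    and "integrable (centred_normal c) (\<lambda>t. t\<^sup>2)" "(\<integral>t. t \<partial>centred_normal c) = 0" "(\<integral>t. t\<^sup>2 \<partial>centred_normal c) = c\<^sup>2"
proof -
  interpret N: prob_space "density lborel std_normal_density" by (rule prob_space_normal_density) simp
  show "prob_space (centred_normal c)"
    unfolding centred_normal_def by (rule N.prob_space_distr) simp
  show "sets (centred_normal c) = sets borel" by (simp add: centred_normal_def)
  have int: "integrable (density lborel std_normal_density) (\<lambda>z. z ^ k)" for k
    using integrable_std_normal_moment[of k] by (subst integrable_density) auto
  have val: "(\<integral>z. z ^ k \<partial>density lborel std_normal_density) = (\<integral>z. std_normal_density z * z ^ k \<partial>lborel)" for k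
    by (subst integral_density) auto
  show "integrable (centred_normal c) (\<lambda>t. t\<^sup>2)"
    unfolding centred_normal_def using int[of 2] by (subst integrable_distr_eq) (auto simp: power_mult_distrib)
  show "(\<integral>t. t \<partial>centred_normal c) = 0"
    unfolding centred_normal_def using val[of 1] integral_std_normal_moment_odd[of 0]
    by (subst integral_distr) auto
  show "(\<integral>t. t\<^sup>2 \<partial>centred_normal c) = c\<^sup>2"
    unfolding centred_normal_def using val[of 2] integral_std_normal_moment_even[of 1]
    by (subst integral_distr) (auto simp: power_mult_distrib)
qed

section \<open>Conditional second moments\<close>

lemma (in prob_space) integral_square_diff:
  fixes f :: "_ \<Rightarrow> real"
  assumes "f \<in> borel_measurable M" "integrable M (\<lambda>x. (f x)\<^sup>2)"
  shows "integrable M (\<lambda>x. (f x - c)\<^sup>2)" "(\<integral>x. (f x - c)\<^sup>2 \<partial>M) = (\<integral>x. (f x)\<^sup>2 \<partial>M) - 2 * c * (\<integral>x. f x \<partial>M) + c\<^sup>2"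
proof -
  have i: "integrable M f" by (rule square_integrable_imp_integrable[OF assms])
  have eq: "(f x - c)\<^sup>2 = (f x)\<^sup>2 - 2 * c * f x + c\<^sup>2" for x by (simp add: power2_diff)
  show "integrable M (\<lambda>x. (f x - c)\<^sup>2)" unfolding eq using i assms(2) by simp
  show "(\<integral>x. (f x - c)\<^sup>2 \<partial>M) = (\<integral>x. (f x)\<^sup>2 \<partial>M) - 2 * c * (\<integral>x. f x \<partial>M) + c\<^sup>2"
    unfolding eq using i assms(2) by (simp add: prob_space)
qed

lemma (in prob_space) square_integral_le:
  fixes f :: "_ \<Rightarrow> real"
  assumes "f \<in> borel_measurable M" "integrable M (\<lambda>x. (f x)\<^sup>2)"
  shows "(\<integral>x. f x \<partial>M)\<^sup>2 \<le> (\<integral>x. (f x)\<^sup>2 \<partial>M)"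
proof -
  have "0 \<le> (\<integral>x. (f x - (\<integral>x. f x \<partial>M))\<^sup>2 \<partial>M)" by (intro integral_nonneg_AE) simp
  then show ?thesis unfolding integral_square_diff(2)[OF assms] by (simp add: power2_eq_square)
qed

text \<open>Pythagoras for the conditional mean given the second coordinate, here a partial
  integral: the cross term equals the second moment of \<open>h\<close>. With \<open>h\<close> in
  place of f, \<open>integral_square_diff\<close> handles the remaining centring.\<close>

lemma (in pair_prob_space) conditional_second_moment:
  fixes f :: "_ \<Rightarrow> real"
  assumes f [measurable]: "f \<in> borel_measurable (M1 \<Otimes>\<^sub>M M2)" and sq: "integrable (M1 \<Otimes>\<^sub>M M2) (\<lambda>z. (f z)\<^sup>2)"
  defines "h \<equiv> \<lambda>y. \<integral>x. f (x, y) \<partial>M1"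
  shows "h \<in> borel_measurable M2" "integrable M2 (\<lambda>y. (h y)\<^sup>2)" "(\<integral>y. h y \<partial>M2) = (\<integral>z. f z \<partial>(M1 \<Otimes>\<^sub>M M2))"
    "integrable (M1 \<Otimes>\<^sub>M M2) (\<lambda>z. (f z - h (snd z))\<^sup>2)"
    "(\<integral>z. (f z - h (snd z))\<^sup>2 \<partial>(M1 \<Otimes>\<^sub>M M2)) = (\<integral>z. (f z)\<^sup>2 \<partial>(M1 \<Otimes>\<^sub>M M2)) - (\<integral>y. (h y)\<^sup>2 \<partial>M2)"
proof -
  have int: "integrable (M1 \<Otimes>\<^sub>M M2) (case_prod (\<lambda>x y. f (x, y)))"
    using square_integrable_imp_integrable[OF f sq] by simp
  have int2: "integrable (M1 \<Otimes>\<^sub>M M2) (case_prod (\<lambda>x y. (f (x, y))\<^sup>2))"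
    using sq by (simp add: case_prod_beta')
  show hm [measurable]: "h \<in> borel_measurable M2"
    using integrable_snd[OF int] by (auto simp: h_def)
  show "(\<integral>y. h y \<partial>M2) = (\<integral>z. f z \<partial>(M1 \<Otimes>\<^sub>M M2))"
    using integral_snd[OF int] by (simp add: h_def)
  have le: "AE y in M2. (h y)\<^sup>2 \<le> (\<integral>x. (f (x, y))\<^sup>2 \<partial>M1)"
    using AE_integrable_snd[OF int2] AE_space
  proof eventually_elim
    fix y assume y: "integrable M1 (\<lambda>x. (f (x, y))\<^sup>2)" "y \<in> space M2"
    then have "(\<lambda>x. f (x, y)) \<in> borel_measurable M1" by measurable
    from M1.square_integral_le[OF this y(1)] show "(h y)\<^sup>2 \<le> (\<integral>x. (f (x, y))\<^sup>2 \<partial>M1)" by (simp add: h_def)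
  qed
  show h2: "integrable M2 (\<lambda>y. (h y)\<^sup>2)"
  proof (rule Bochner_Integration.integrable_bound[OF integrable_snd[OF int2]])
    show "AE y in M2. norm ((h y)\<^sup>2) \<le> norm (\<integral>x. (f (x, y))\<^sup>2 \<partial>M1)"
      using le by eventually_elim (simp add: order_trans[OF _ abs_ge_self])
  qed simp
  have p: "integrable (M1 \<Otimes>\<^sub>M M2) (\<lambda>z. 1 * (h (snd z))\<^sup>2)" "(\<integral>z. 1 * (h (snd z))\<^sup>2 \<partial>(M1 \<Otimes>\<^sub>M M2)) = (\<integral>y. (h y)\<^sup>2 \<partial>M2)"
    using product_of_functions[OF M1.integrable_const[of 1] h2] by (simp_all add: M1.prob_space)
  have fh: "integrable (M1 \<Otimes>\<^sub>M M2) (\<lambda>z. f z * h (snd z))"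
    using p(1) by (intro integral_abs_mult_le(1) sq) auto
  have "(\<integral>z. f z * h (snd z) \<partial>(M1 \<Otimes>\<^sub>M M2)) = (\<integral>y. (\<integral>x. f (x, y) * h y \<partial>M1) \<partial>M2)"
    using integral_snd[of "\<lambda>x y. f (x, y) * h y"] fh by (simp add: case_prod_beta')
  also have "\<dots> = (\<integral>y. (h y)\<^sup>2 \<partial>M2)" by (simp add: h_def power2_eq_square)
  finally have fh_val: "(\<integral>z. f z * h (snd z) \<partial>(M1 \<Otimes>\<^sub>M M2)) = (\<integral>y. (h y)\<^sup>2 \<partial>M2)" .
  have eq: "(f z - h (snd z))\<^sup>2 = (f z)\<^sup>2 - 2 * (f z * h (snd z)) + 1 * (h (snd z))\<^sup>2" for z
    by (simp add: power2_diff)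
  show "integrable (M1 \<Otimes>\<^sub>M M2) (\<lambda>z. (f z - h (snd z))\<^sup>2)"
    unfolding eq by (intro Bochner_Integration.integrable_add Bochner_Integration.integrable_diff sq integrable_mult_right fh p(1))
  show "(\<integral>z. (f z - h (snd z))\<^sup>2 \<partial>(M1 \<Otimes>\<^sub>M M2)) = (\<integral>z. (f z)\<^sup>2 \<partial>(M1 \<Otimes>\<^sub>M M2)) - (\<integral>y. (h y)\<^sup>2 \<partial>M2)"
    unfolding eq Bochner_Integration.integral_add[OF Bochner_Integration.integrable_diff[OF sq integrable_mult_right[OF fh]] p(1)]
      Bochner_Integration.integral_diff[OF sq integrable_mult_right[OF fh]] integral_mult_right_zero p(2) fh_val using p(2) by simp
qed

lemma power4_square: "(x::real) ^ 4 = (x\<^sup>2)\<^sup>2"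
  by (simp add: power4_eq_xxxx power2_eq_square)

lemma (in standard_law) integrable_norm_powers:
  "integrable (iid_mat_law \<mu> n d) (\<lambda>X. (norm (fm n d X)) ^ 4)"
  "integrable (iid_mat_law \<mu> n d) (\<lambda>X. (norm (fm n d X))\<^sup>2)"
proof -
  let ?M = "iid_mat_law \<mu> n d" and ?I = "{..<n} \<times> {..<d}"
  have meas: "fmat_measurable ?M (fm n d)"
    unfolding iid_mat_law_def by (rule fmat_measurable_fm) (auto intro: measurable_component_singleton)
  have [measurable]: "(\<lambda>X. norm (fm n d X)) \<in> borel_measurable ?M" by (intro measurable_norm_fmat meas)
  have sq: "(norm (fm n d X))\<^sup>2 = (\<Sum>ij\<in>?I. (X ij)\<^sup>2)" for X
    by (simp add: power2_norm_supp_in[OF supp_in_fm] sum.cartesian_product)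
  show "integrable ?M (\<lambda>X. (norm (fm n d X))\<^sup>2)"
    unfolding sq using component_function(1)[where f = "\<lambda>t. t\<^sup>2"] integrable_power[of 2]
    by (intro Bochner_Integration.integrable_sum) auto
  show "integrable ?M (\<lambda>X. (norm (fm n d X)) ^ 4)"
  proof (rule Bochner_Integration.integrable_bound)
    show "integrable ?M (\<lambda>X. (\<Sum>ij\<in>?I. (X ij) ^ 4) * card ?I)"
      using component_function(1)[where f = "\<lambda>t. t ^ 4"] integrable_power[of 4]
      by (intro integrable_mult_left Bochner_Integration.integrable_sum) auto
    have "(norm (fm n d X)) ^ 4 \<le> (\<Sum>ij\<in>?I. (X ij) ^ 4) * card ?I" for X
    proof -
      have "(norm (fm n d X)) ^ 4 = (\<Sum>ij\<in>?I. (X ij)\<^sup>2)\<^sup>2" unfolding sq[symmetric] by (rule power4_square)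
      also have "\<dots> \<le> (\<Sum>ij\<in>?I. ((X ij)\<^sup>2)\<^sup>2) * card ?I" by (rule sum_squared_le_sum_of_squares)
      finally show ?thesis unfolding power4_square .
    qed
    then show "AE X in ?M. norm ((norm (fm n d X)) ^ 4) \<le> norm ((\<Sum>ij\<in>?I. (X ij) ^ 4) * card ?I)"
      by (intro AE_I2) (simp add: order_trans[OF _ abs_ge_self])
  qed simp
qed

section \<open>Exact formulas for the risk\<close>

locale ridge_model = standard_law \<mu> for \<mu> :: "real measure" +
  fixes \<nu> :: "(nat \<times> nat \<Rightarrow> real) measure" and n d p :: nat and l :: real
  assumes l_pos: "0 < l" and n_pos: "0 < n" and d_pos: "0 < d" and p_le_d: "p \<le> d"
    and uniform: "uniform_orthonormal_rows p d \<nu>"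
begin

abbreviation "MX \<equiv> iid_mat_law \<mu> n d"
abbreviation "N \<equiv> MX \<Otimes>\<^sub>M \<nu>"

text \<open>With \<open>K\<close> below, the predictor is x^T A \<theta> + x^T K e: \<open>A\<close>
  carries the signal and \<open>K\<close> the label noise.\<close>

definition A :: "(nat \<times> nat \<Rightarrow> real) \<Rightarrow> (nat \<times> nat \<Rightarrow> real) \<Rightarrow> fmat" where
  "A X W = projected_resolvent n p d l X W * gram n (fm n d X)"
definition K :: "(nat \<times> nat \<Rightarrow> real) \<Rightarrow> (nat \<times> nat \<Rightarrow> real) \<Rightarrow> fmat" where
  "K X W = (1 / n) *\<^sub>R (projected_resolvent n p d l X W * tp (fm n d X))"

lemma prob_space_nu: "prob_space \<nu>"
  and sets_nu: "sets \<nu> = sets (PiM ({..<p} \<times> {..<d}) (\<lambda>_. borel))"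
  using uniform by (simp_all add: uniform_orthonormal_rows_def)

sublocale W: prob_space \<nu> by (rule prob_space_nu)

sublocale X: prob_space MX
  unfolding iid_mat_law_def by (rule prob_space_PiM) (rule prob_space_axioms)

sublocale XW: pair_prob_space MX \<nu> ..

lemma orthonormal: "AE W in \<nu>. fm p d W * tp (fm p d W) = idm p"
proof -
  have "AE W in \<nu>. Matrix.mat p d W * (Matrix.mat p d W)\<^sup>T = 1\<^sub>m p"
    using uniform by (simp add: uniform_orthonormal_rows_def)
  then show ?thesis
  proof eventually_elim
    fix W :: "nat \<times> nat \<Rightarrow> real"
    assume "Matrix.mat p d W * (Matrix.mat p d W)\<^sup>T = 1\<^sub>m p"
    from arg_cong[OF this, of fmat_of] show "fm p d W * tp (fm p d W) = idm p"
      by (simp add: fmat_of_mult)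
  qed
qed

lemma norm_orthonormal: "fm p d W * tp (fm p d W) = idm p \<Longrightarrow> (norm (fm p d W))\<^sup>2 = p"
  by (simp add: power2_norm_fmat inner_tr tr_mult_commute[of "tp (fm p d W)"])

lemma measurable_W: "i < p \<Longrightarrow> j < d \<Longrightarrow> (\<lambda>W. W (i, j)) \<in> borel_measurable \<nu>"
  using sets_nu by (subst measurable_cong_sets[OF sets_nu refl]) (auto intro: measurable_component_singleton)

lemma measurable_X: "i < n \<Longrightarrow> j < d \<Longrightarrow> (\<lambda>X. X (i, j)) \<in> borel_measurable MX"
  unfolding iid_mat_law_def by (auto intro: measurable_component_singleton)

lemma fmat_measurable_AK:
  assumes "f \<in> measurable L MX" "g \<in> measurable L \<nu>"
  shows "fmat_measurable L (\<lambda>z. projected_resolvent n p d l (f z) (g z))" "fmat_measurable L (\<lambda>z. A (f z) (g z))" "fmat_measurable L (\<lambda>z. K (f z) (g z))"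
proof -
  show R: "fmat_measurable L (\<lambda>z. projected_resolvent n p d l (f z) (g z))"
    using measurable_compose[OF assms(1) measurable_X] measurable_compose[OF assms(2) measurable_W]
    by (intro fmat_measurable_projected_resolvent l_pos)
  have F: "fmat_measurable L (\<lambda>z. fm n d (f z))"
    using measurable_compose[OF assms(1) measurable_X] by (intro fmat_measurable_fm)
  show "fmat_measurable L (\<lambda>z. A (f z) (g z))" "fmat_measurable L (\<lambda>z. K (f z) (g z))"
    unfolding A_def K_def by (intro fmat_measurable_intros R F)+
qed

lemma supp_resolvent: "supp_in d d (projected_resolvent n p d l X W)"
  unfolding projected_resolvent_def
  by (rule supp_in_mult[OF supp_in_mult[OF supp_in_tp[OF supp_in_fm] ridge_inverse_eq(3)[OF l_pos]] supp_in_fm])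

lemma supp_A: "supp_in d d (A X W)"
  unfolding A_def by (rule supp_in_mult[OF supp_resolvent supp_in_gram[OF supp_in_fm]])

lemma supp_K: "supp_in d n (K X W)"
  unfolding K_def by (rule supp_in_scaleR[OF supp_in_mult[OF supp_resolvent supp_in_tp[OF supp_in_fm]]])

lemma norm_projected_resolvent: "norm (projected_resolvent n p d l X W) \<le> sqrt p / l * (norm (fm p d W))\<^sup>2"
proof -
  interpret R: resolvent "idm p" "ridge_inverse n p d l X W" "fm n d X * tp (fm p d W)" n l
    by (rule resolvent_ridge_inverse[OF l_pos n_pos])
  have "norm (idm p) = sqrt p" using R.norm_P_square by (simp add: real_sqrt_unique)
  then have R: "norm (ridge_inverse n p d l X W) \<le> sqrt p / l" using R.norm_G by simp
  have "norm (projected_resolvent n p d l X W) \<le> norm (tp (fm p d W) * ridge_inverse n p d l X W) * norm (fm p d W)"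
    unfolding projected_resolvent_def by (rule norm_mult_ineq)
  also have "\<dots> \<le> (norm (fm p d W) * (sqrt p / l)) * norm (fm p d W)"
    using norm_mult_ineq[of "tp (fm p d W)" "ridge_inverse n p d l X W"] mult_left_mono[OF R, of "norm (fm p d W)"]
    by (intro mult_right_mono) auto
  finally show ?thesis by (simp add: power2_eq_square mult_ac)
qed

text \<open>This envelope is valid for every \<open>W\<close> and is constant on the orthonormal
  set, where the squared norm of \<open>W\<close> is p. Its companion is the fourth power of the
  norm of \<open>X\<close>, integrable by the fourth moment.\<close>

definition "cW W = (sqrt p / (l * n))\<^sup>2 * (norm (fm p d W)) ^ 4"

lemma entry_A_le: "(entry (A X W) a b)\<^sup>2 \<le> (norm (fm n d X)) ^ 4 * cW W"
  and entry_K_le: "(entry (K X W) a b)\<^sup>2 \<le> (norm (fm n d X))\<^sup>2 * cW W"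
proof -
  have square: "(c * w\<^sup>2 * x\<^sup>2)\<^sup>2 = x ^ 4 * (c\<^sup>2 * w ^ 4)" "(c * w\<^sup>2 * x)\<^sup>2 = x\<^sup>2 * (c\<^sup>2 * w ^ 4)" for c w x :: real
    unfolding power4_square by (simp_all only: power_mult_distrib mult_ac)
  have "norm (A X W) \<le> norm (projected_resolvent n p d l X W) * norm (gram n (fm n d X))"
    unfolding A_def by (rule norm_mult_ineq)
  also have "\<dots> \<le> (sqrt p / l * (norm (fm p d W))\<^sup>2) * ((norm (fm n d X))\<^sup>2 / n)"
    using norm_mult_ineq[of "tp (fm n d X)" "fm n d X"] l_pos
    by (intro mult_mono norm_projected_resolvent) (auto simp: gram_def power2_eq_square divide_right_mono)
  finally have "norm (A X W) \<le> sqrt p / (l * n) * (norm (fm p d W))\<^sup>2 * (norm (fm n d X))\<^sup>2" by simp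
  with abs_entry_le_norm[of "A X W" a b]
  have "\<bar>entry (A X W) a b\<bar> \<le> sqrt p / (l * n) * (norm (fm p d W))\<^sup>2 * (norm (fm n d X))\<^sup>2" by linarith
  from power_mono[OF this, of 2]
  show "(entry (A X W) a b)\<^sup>2 \<le> (norm (fm n d X)) ^ 4 * cW W"
    by (simp only: cW_def power2_abs abs_ge_zero simp_thms square(1))
  have "norm (K X W) \<le> norm (projected_resolvent n p d l X W) * norm (fm n d X) / n"
    using norm_mult_ineq[of "projected_resolvent n p d l X W" "tp (fm n d X)"]
    by (simp add: K_def divide_right_mono)
  also have "\<dots> \<le> (sqrt p / l * (norm (fm p d W))\<^sup>2) * norm (fm n d X) / n"
    by (intro divide_right_mono mult_right_mono norm_projected_resolvent) auto
  finally have "norm (K X W) \<le> sqrt p / (l * n) * (norm (fm p d W))\<^sup>2 * norm (fm n d X)" by simp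
  with abs_entry_le_norm[of "K X W" a b]
  have "\<bar>entry (K X W) a b\<bar> \<le> sqrt p / (l * n) * (norm (fm p d W))\<^sup>2 * norm (fm n d X)" by linarith
  from power_mono[OF this, of 2]
  show "(entry (K X W) a b)\<^sup>2 \<le> (norm (fm n d X))\<^sup>2 * cW W"
    by (simp only: cW_def power2_abs abs_ge_zero simp_thms square(2))
qed

lemma integrable_cW: "integrable \<nu> cW"
proof (rule W.integrable_const_bound)
  have "fmat_measurable \<nu> (fm p d)" by (intro fmat_measurable_fm measurable_W)
  then have [measurable]: "(\<lambda>W. norm (fm p d W)) \<in> borel_measurable \<nu>" by (rule measurable_norm_fmat)
  show "cW \<in> borel_measurable \<nu>" unfolding cW_def[abs_def] by measurable
  show "AE W in \<nu>. norm (cW W) \<le> (sqrt p / (l * n))\<^sup>2 * (real p)\<^sup>2"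
    using orthonormal
  proof eventually_elim
    fix W assume "fm p d W * tp (fm p d W) = idm p"
    then have "(norm (fm p d W))\<^sup>2 = p" by (rule norm_orthonormal)
    then have "(norm (fm p d W)) ^ 4 = (real p)\<^sup>2" by (simp only: power4_square)
    then show "norm (cW W) \<le> (sqrt p / (l * n))\<^sup>2 * (real p)\<^sup>2" by (simp add: cW_def)
  qed
qed

lemma A_square_integrable:
  "(\<lambda>z. entry (A (fst z) (snd z)) a b) \<in> borel_measurable N"
  "integrable N (\<lambda>z. (entry (A (fst z) (snd z)) a b)\<^sup>2)"
  "integrable N (\<lambda>z. entry (A (fst z) (snd z)) a b)"
  "(\<lambda>z. entry (K (fst z) (snd z)) a b) \<in> borel_measurable N"
  "integrable N (\<lambda>z. (entry (K (fst z) (snd z)) a b)\<^sup>2)"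
  "integrable N (\<lambda>z. entry (K (fst z) (snd z)) a b)"
proof -
  show A [measurable]: "(\<lambda>z. entry (A (fst z) (snd z)) a b) \<in> borel_measurable N"
    by (rule measurable_entry, rule fmat_measurable_AK) simp_all
  show K [measurable]: "(\<lambda>z. entry (K (fst z) (snd z)) a b) \<in> borel_measurable N"
    by (rule measurable_entry, rule fmat_measurable_AK) simp_all
  show A2: "integrable N (\<lambda>z. (entry (A (fst z) (snd z)) a b)\<^sup>2)"
  proof (rule Bochner_Integration.integrable_bound[OF XW.product_of_functions(1)[OF integrable_norm_powers(1) integrable_cW]])
    show "AE z in N. norm ((entry (A (fst z) (snd z)) a b)\<^sup>2) \<le> norm ((norm (fm n d (fst z))) ^ 4 * cW (snd z))"
      using entry_A_le by (intro AE_I2) (simp add: order_trans[OF _ abs_ge_self])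
  qed simp
  show K2: "integrable N (\<lambda>z. (entry (K (fst z) (snd z)) a b)\<^sup>2)"
  proof (rule Bochner_Integration.integrable_bound[OF XW.product_of_functions(1)[OF integrable_norm_powers(2) integrable_cW]])
    show "AE z in N. norm ((entry (K (fst z) (snd z)) a b)\<^sup>2) \<le> norm ((norm (fm n d (fst z)))\<^sup>2 * cW (snd z))"
      using entry_K_le by (intro AE_I2) (simp add: order_trans[OF _ abs_ge_self])
  qed simp
  show "integrable N (\<lambda>z. entry (A (fst z) (snd z)) a b)" by (rule XW.square_integrable_imp_integrable[OF A A2])
  show "integrable N (\<lambda>z. entry (K (fst z) (snd z)) a b)" by (rule XW.square_integrable_imp_integrable[OF K K2])
qed

lemma AK_integrable_X:
  assumes "W \<in> space \<nu>"
  shows "integrable MX (\<lambda>X. entry (A X W) a b)" "integrable MX (\<lambda>X. entry (K X W) a b)"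
proof -
  have m: "(\<lambda>X. entry (A X W) a b) \<in> borel_measurable MX" "(\<lambda>X. entry (K X W) a b) \<in> borel_measurable MX"
    using assms by (auto intro!: measurable_entry fmat_measurable_AK)
  have "integrable MX (\<lambda>X. (entry (A X W) a b)\<^sup>2)"
    by (rule Bochner_Integration.integrable_bound[OF integrable_mult_left[OF integrable_norm_powers(1), where c = "cW W"]])
      (use m entry_A_le in \<open>auto intro!: AE_I2 simp: order_trans[OF _ abs_ge_self]\<close>)
  then show "integrable MX (\<lambda>X. entry (A X W) a b)" by (rule X.square_integrable_imp_integrable[OF m(1)])
  have "integrable MX (\<lambda>X. (entry (K X W) a b)\<^sup>2)"
    by (rule Bochner_Integration.integrable_bound[OF integrable_mult_left[OF integrable_norm_powers(2), where c = "cW W"]])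
      (use m entry_K_le in \<open>auto intro!: AE_I2 simp: order_trans[OF _ abs_ge_self]\<close>)
  then show "integrable MX (\<lambda>X. entry (K X W) a b)" by (rule X.square_integrable_imp_integrable[OF m(2)])
qed

end

lemma prob_space_iid_vec_law: "prob_space \<kappa> \<Longrightarrow> prob_space (iid_vec_law \<kappa> k)"
  unfolding iid_vec_law_def by (rule prob_space_PiM)

lemma measurable_iid_vec_law: "sets \<kappa> = sets borel \<Longrightarrow> i < k \<Longrightarrow> (\<lambda>x. x i) \<in> borel_measurable (iid_vec_law \<kappa> k)"
  unfolding iid_vec_law_def
  using measurable_component_singleton[of i "{..<k}" "\<lambda>_. \<kappa>"] measurable_cong_sets[OF refl, of \<kappa> borel] by auto

section \<open>Conditional means and the constants of the risk\<close>

context ridge_model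
begin

definition mean_given_W :: "nat \<Rightarrow> nat \<Rightarrow> (nat \<times> nat \<Rightarrow> real) \<Rightarrow> real" where
  "mean_given_W a b W = (\<integral>X. entry (A X W) a b \<partial>MX)"
definition mean_A :: "nat \<Rightarrow> nat \<Rightarrow> real" where
  "mean_A a b = (\<integral>z. entry (A (fst z) (snd z)) a b \<partial>N)"
text \<open>\<open>SA\<close>, \<open>SW\<close> and \<open>SM\<close> are the expected squared
  Frobenius norms of A, of its mean given \<open>W\<close> and of its full mean, so their successive
  differences are the sampling and the initialisation variance up to a factor. \<open>SK\<close> is
  the analogue for the noise operator, and \<open>TM\<close> is the pairing of the mean with the
  identity.\<close>

definition SA :: real where "SA = (\<Sum>a<d. \<Sum>b<d. \<integral>z. (entry (A (fst z) (snd z)) a b)\<^sup>2 \<partial>N)"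
definition SW :: real where "SW = (\<Sum>a<d. \<Sum>b<d. \<integral>W. (mean_given_W a b W)\<^sup>2 \<partial>\<nu>)"
definition SM :: real where "SM = (\<Sum>a<d. \<Sum>b<d. (mean_A a b)\<^sup>2)"
definition SK :: real where "SK = (\<Sum>a<d. \<Sum>i<n. \<integral>z. (entry (K (fst z) (snd z)) a i)\<^sup>2 \<partial>N)"
definition TM :: real where "TM = (\<Sum>a<d. mean_A a a)"

lemmas A_conditional = XW.conditional_second_moment[OF A_square_integrable(1,2), unfolded fst_conv snd_conv,
    folded mean_given_W_def mean_A_def]

lemma fhat_eq:
  "fhat n p d l \<theta> x X e W = (\<Sum>a<d. \<Sum>b<d. x a * entry (A X W) a b * \<theta> b)
    + (\<Sum>a<d. x a * (\<Sum>i<n. entry (K X W) a i * e i))"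
  unfolding fhat_expansion[OF l_pos] A_def[symmetric] K_def[symmetric] by (simp add: sum_distrib_left mult.assoc)

lemma signal_eq: "signal d \<theta> x = (\<Sum>a<d. \<Sum>b<d. x a * (if a = b then 1 else 0) * \<theta> b)"
  by (simp add: signal_def scalar_prod_def atLeast0LessThan if_distrib[of "\<lambda>t. _ * t * _"] cong: if_cong)

context
  fixes \<alpha> \<sigma> :: real
begin

abbreviation "MT \<equiv> theta_x_law \<mu> \<alpha> d"
abbreviation "ME \<equiv> noise_law \<sigma> n"

lemma prob_space_ME: "prob_space ME"
  unfolding noise_law_def by (intro prob_space_iid_vec_law centred_normal)

lemma prob_space_MT: "prob_space MT"
proof -
  interpret T1: prob_space "iid_vec_law (centred_normal (\<alpha> / sqrt d)) d" by (intro prob_space_iid_vec_law centred_normal)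
  interpret T2: prob_space "iid_vec_law \<mu> d" by (intro prob_space_iid_vec_law prob_space_axioms)
  interpret pair_prob_space "iid_vec_law (centred_normal (\<alpha> / sqrt d)) d" "iid_vec_law \<mu> d" ..
  show ?thesis unfolding theta_x_law_def by unfold_locales
qed

lemma noise_moments:
  assumes "i < n" "j < n"
  shows "integrable ME (\<lambda>e. e i * e j)" "(\<integral>e. e i * e j \<partial>ME) = (if i = j then \<sigma>\<^sup>2 else 0)"
    "integrable ME (\<lambda>e. e i)" "(\<integral>e. e i \<partial>ME) = 0"
  using iid_second_moments[OF centred_normal(1,2,3,4), of "{..<n}" i j \<sigma>] assms
  unfolding noise_law_def iid_vec_law_def by (simp_all add: centred_normal(5))

lemma measurable_noise: "i < n \<Longrightarrow> (\<lambda>e. e i) \<in> borel_measurable ME"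
  unfolding noise_law_def by (rule measurable_iid_vec_law) simp_all

text \<open>The functions x_a \<theta>_b and x_a form one orthogonal family under the law of
  \<theta> and x, with second moments \<alpha>^2 / d and 1; a sum type indexes both kinds. Every
  risk quantity is an instance with suitable \<open>C\<close> and \<open>D\<close>.\<close>

lemma bilinear_form_expectation:
  assumes "prob_space B"
    and C: "\<And>a b. a < d \<Longrightarrow> b < d \<Longrightarrow> C a b \<in> borel_measurable B" "\<And>a b. a < d \<Longrightarrow> b < d \<Longrightarrow> integrable B (\<lambda>y. (C a b y)\<^sup>2)"
    and D: "\<And>a. a < d \<Longrightarrow> D a \<in> borel_measurable B" "\<And>a. a < d \<Longrightarrow> integrable B (\<lambda>y. (D a y)\<^sup>2)"
  defines "\<Phi> \<equiv> \<lambda>z. ((\<Sum>a<d. \<Sum>b<d. snd (fst z) a * C a b (snd z) * fst (fst z) b) + (\<Sum>a<d. snd (fst z) a * D a (snd z)))\<^sup>2"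
  shows "integrable (MT \<Otimes>\<^sub>M B) \<Phi>"
    and "(\<integral>z. \<Phi> z \<partial>(MT \<Otimes>\<^sub>M B)) = \<alpha>\<^sup>2 / d * (\<Sum>a<d. \<Sum>b<d. \<integral>y. (C a b y)\<^sup>2 \<partial>B) + (\<Sum>a<d. \<integral>y. (D a y)\<^sup>2 \<partial>B)"
proof -
  let ?T1 = "iid_vec_law (centred_normal (\<alpha> / sqrt d)) d" and ?T2 = "iid_vec_law \<mu> d"
  interpret T1: prob_space ?T1 by (intro prob_space_iid_vec_law centred_normal)
  interpret T2: prob_space ?T2 by (intro prob_space_iid_vec_law prob_space_axioms)
  interpret T: pair_prob_space ?T1 ?T2 ..
  interpret B: prob_space B by fact
  interpret MT: prob_space MT by (rule prob_space_MT)
  interpret TB: pair_prob_space MT B ..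
  have var: "(\<alpha> / sqrt d)\<^sup>2 = \<alpha>\<^sup>2 / d" by (simp add: power_divide)
  have m1: "integrable ?T1 (\<lambda>t. t b * t b')" "(\<integral>t. t b * t b' \<partial>?T1) = (if b = b' then \<alpha>\<^sup>2 / d else 0)"
      "integrable ?T1 (\<lambda>t. t b)" "(\<integral>t. t b \<partial>?T1) = 0" if "b < d" "b' < d" for b b'
    using iid_second_moments[OF centred_normal(1,2,3,4), of "{..<d}" b b' "\<alpha> / sqrt d"] that
    unfolding iid_vec_law_def by (simp_all add: centred_normal(5) var)
  have m2: "integrable ?T2 (\<lambda>t. t a * t a')" "(\<integral>t. t a * t a' \<partial>?T2) = (if a = a' then 1 else 0)"
    if "a < d" "a' < d" for a a'
    using iid_second_moments[OF prob_space_axioms sets_mu integrable_power[of 2] mean, of "{..<d}" a a'] that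
    unfolding iid_vec_law_def by (simp_all add: second)
  define f where "f k t = (case k of Inl (a, b) \<Rightarrow> snd t a * fst t b | Inr a \<Rightarrow> snd t a)"
    for k :: "nat \<times> nat + nat" and t :: "(nat \<Rightarrow> real) \<times> (nat \<Rightarrow> real)"
  define g where "g k y = (case k of Inl (a, b) \<Rightarrow> C a b y | Inr a \<Rightarrow> D a y)" for k :: "nat \<times> nat + nat" and y
  define w where "w k = (case k of Inl _ \<Rightarrow> \<alpha>\<^sup>2 / d | Inr _ \<Rightarrow> 1)" for k :: "nat \<times> nat + nat"
  let ?K = "({..<d} \<times> {..<d}) <+> {..<d}"
  have LL: "integrable MT (\<lambda>t. (snd t a * fst t b) * (snd t a' * fst t b'))"
      "(\<integral>t. (snd t a * fst t b) * (snd t a' * fst t b') \<partial>MT) = (if a = a' \<and> b = b' then \<alpha>\<^sup>2 / d else 0)"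
    if "a < d" "b < d" "a' < d" "b' < d" for a b a' b'
    using T.product_of_functions[OF m1(1)[OF that(2,4)] m2(1)[OF that(1,3)]] m1(2)[OF that(2,4)] m2(2)[OF that(1,3)]
    unfolding theta_x_law_def by (simp_all add: mult_ac)
  have LR: "integrable MT (\<lambda>t. (snd t a * fst t b) * snd t a')" "(\<integral>t. (snd t a * fst t b) * snd t a' \<partial>MT) = 0"
    if "a < d" "b < d" "a' < d" for a b a'
    using T.product_of_functions[OF m1(3)[OF that(2,2)] m2(1)[OF that(1,3)]] m1(4)[OF that(2,2)]
    unfolding theta_x_law_def by (simp_all add: mult_ac)
  have RR: "integrable MT (\<lambda>t. snd t a * snd t a')" "(\<integral>t. snd t a * snd t a' \<partial>MT) = (if a = a' then 1 else 0)"
    if "a < d" "a' < d" for a a'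
    using T.product_of_functions[OF T1.integrable_const[of 1] m2(1)[OF that]] m2(2)[OF that]
    unfolding theta_x_law_def by (simp_all add: T1.prob_space)
  have f1: "integrable MT (\<lambda>t. f k t * f k' t)" if "k \<in> ?K" "k' \<in> ?K" for k k'
    using that LL(1) LR(1) RR(1) by (auto simp: f_def mult.commute)
  have f2: "(\<integral>t. f k t * f k' t \<partial>MT) = (if k = k' then w k else 0)" if "k \<in> ?K" "k' \<in> ?K" for k k'
    using that LL(2) LR(2) RR(2) by (auto simp: f_def w_def mult.commute split: if_splits)
  have g: "g k \<in> borel_measurable B" "integrable B (\<lambda>y. (g k y)\<^sup>2)" if "k \<in> ?K" for k
    using that C D by (auto simp: g_def[abs_def])
  have sumK: "(\<Sum>k\<in>?K. r k) = (\<Sum>a<d. \<Sum>b<d. r (Inl (a, b))) + (\<Sum>a<d. r (Inr a))" for r :: "_ \<Rightarrow> real"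
    by (subst sum.Plus) (simp_all add: sum.cartesian_product case_prod_beta')
  have \<Phi>: "\<Phi> z = (\<Sum>k\<in>?K. f k (fst z) * g k (snd z))\<^sup>2" for z
    unfolding sumK \<Phi>_def f_def g_def by (simp add: mult_ac)
  have finK: "finite ?K" by simp
  note o = TB.orthogonal_sum[OF finK f1 f2 g]
  show "integrable (MT \<Otimes>\<^sub>M B) \<Phi>" unfolding \<Phi> by (rule o(1))
  have "(\<integral>z. \<Phi> z \<partial>(MT \<Otimes>\<^sub>M B)) = (\<Sum>k\<in>?K. w k * (\<integral>y. (g k y)\<^sup>2 \<partial>B))"
    unfolding \<Phi> by (rule o(2))
  also have "\<dots> = \<alpha>\<^sup>2 / d * (\<Sum>a<d. \<Sum>b<d. \<integral>y. (C a b y)\<^sup>2 \<partial>B) + (\<Sum>a<d. \<integral>y. (D a y)\<^sup>2 \<partial>B)"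
    unfolding sumK by (simp add: w_def g_def sum_distrib_left)
  finally show "(\<integral>z. \<Phi> z \<partial>(MT \<Otimes>\<^sub>M B)) = \<alpha>\<^sup>2 / d * (\<Sum>a<d. \<Sum>b<d. \<integral>y. (C a b y)\<^sup>2 \<partial>B) + (\<Sum>a<d. \<integral>y. (D a y)\<^sup>2 \<partial>B)" .
qed

lemma iterated_bilinear_form_expectation:
  assumes "prob_space B"
    and C: "\<And>a b. a < d \<Longrightarrow> b < d \<Longrightarrow> C a b \<in> borel_measurable B" "\<And>a b. a < d \<Longrightarrow> b < d \<Longrightarrow> integrable B (\<lambda>y. (C a b y)\<^sup>2)"
    and D: "\<And>a. a < d \<Longrightarrow> D a \<in> borel_measurable B" "\<And>a. a < d \<Longrightarrow> integrable B (\<lambda>y. (D a y)\<^sup>2)"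
  shows "(\<integral>t. (\<integral>y. ((\<Sum>a<d. \<Sum>b<d. snd t a * C a b y * fst t b) + (\<Sum>a<d. snd t a * D a y))\<^sup>2 \<partial>B) \<partial>MT)
    = \<alpha>\<^sup>2 / d * (\<Sum>a<d. \<Sum>b<d. \<integral>y. (C a b y)\<^sup>2 \<partial>B) + (\<Sum>a<d. \<integral>y. (D a y)\<^sup>2 \<partial>B)"
proof -
  interpret B: prob_space B by fact
  interpret MT: prob_space MT by (rule prob_space_MT)
  interpret TB: pair_prob_space MT B ..
  note b = bilinear_form_expectation[OF assms]
  show ?thesis using TB.integral_fst'[OF b(1)] b(2) by simp
qed

section \<open>The noise part of the predictor\<close>

definition noise_term :: "nat \<Rightarrow> (nat \<times> nat \<Rightarrow> real) \<Rightarrow> (nat \<Rightarrow> real) \<Rightarrow> (nat \<times> nat \<Rightarrow> real) \<Rightarrow> real" where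
  "noise_term a X e W = (\<Sum>i<n. entry (K X W) a i * e i)"

lemma noise_term_moments:
  "integrable (ME \<Otimes>\<^sub>M N) (\<lambda>z. (noise_term a (fst (snd z)) (fst z) (snd (snd z)))\<^sup>2)"
  "(\<integral>z. (noise_term a (fst (snd z)) (fst z) (snd (snd z)))\<^sup>2 \<partial>(ME \<Otimes>\<^sub>M N)) = \<sigma>\<^sup>2 * (\<Sum>i<n. \<integral>z. (entry (K (fst z) (snd z)) a i)\<^sup>2 \<partial>N)"
  "integrable (ME \<Otimes>\<^sub>M N) (\<lambda>z. noise_term a (fst (snd z)) (fst z) (snd (snd z)))"
  "(\<integral>z. noise_term a (fst (snd z)) (fst z) (snd (snd z)) \<partial>(ME \<Otimes>\<^sub>M N)) = 0"
proof -
  interpret E: prob_space ME by (rule prob_space_ME)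
  interpret EN: pair_prob_space ME N ..
  have eq: "noise_term a (fst (snd z)) (fst z) (snd (snd z)) = (\<Sum>i<n. fst z i * entry (K (fst (snd z)) (snd (snd z))) a i)" for z
    unfolding noise_term_def by (simp add: mult.commute)
  have f1: "integrable ME (\<lambda>e. e i * e j)" if "i \<in> {..<n}" "j \<in> {..<n}" for i j using noise_moments(1) that by simp
  have f2: "(\<integral>e. e i * e j \<partial>ME) = (if i = j then \<sigma>\<^sup>2 else 0)" if "i \<in> {..<n}" "j \<in> {..<n}" for i j
    using noise_moments(2) that by simp
  note o = EN.orthogonal_sum[of "{..<n}" "\<lambda>i e. e i" "\<lambda>_. \<sigma>\<^sup>2" "\<lambda>i z. entry (K (fst z) (snd z)) a i", OF finite_lessThan f1 f2
      A_square_integrable(4,5)]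
  show "integrable (ME \<Otimes>\<^sub>M N) (\<lambda>z. (noise_term a (fst (snd z)) (fst z) (snd (snd z)))\<^sup>2)" unfolding eq using o(1) by simp
  show "(\<integral>z. (noise_term a (fst (snd z)) (fst z) (snd (snd z)))\<^sup>2 \<partial>(ME \<Otimes>\<^sub>M N)) = \<sigma>\<^sup>2 * (\<Sum>i<n. \<integral>z. (entry (K (fst z) (snd z)) a i)\<^sup>2 \<partial>N)"
    unfolding eq using o(2) by (simp add: sum_distrib_left)
  have p: "integrable (ME \<Otimes>\<^sub>M N) (\<lambda>z. fst z i * entry (K (fst (snd z)) (snd (snd z))) a i)"
    "(\<integral>z. fst z i * entry (K (fst (snd z)) (snd (snd z))) a i \<partial>(ME \<Otimes>\<^sub>M N)) = 0" if "i < n" for i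
    using EN.product_of_functions[OF noise_moments(3)[OF that that] A_square_integrable(6)[of a i]] noise_moments(4)[OF that that]
    by simp_all
  show "integrable (ME \<Otimes>\<^sub>M N) (\<lambda>z. noise_term a (fst (snd z)) (fst z) (snd (snd z)))"
    unfolding eq using p(1) by (intro Bochner_Integration.integrable_sum) auto
  show "(\<integral>z. noise_term a (fst (snd z)) (fst z) (snd (snd z)) \<partial>(ME \<Otimes>\<^sub>M N)) = 0"
    unfolding eq using p by (subst Bochner_Integration.integral_sum) auto
qed

lemma rotate_integrals:
  fixes \<phi> :: "_ \<Rightarrow> real" and \<psi> :: "_ \<Rightarrow> real"
  shows "\<phi> \<in> borel_measurable (MX \<Otimes>\<^sub>M (ME \<Otimes>\<^sub>M \<nu>)) \<Longrightarrow>
      integrable (ME \<Otimes>\<^sub>M N) (\<lambda>z. \<phi> (fst (snd z), fst z, snd (snd z))) \<Longrightarrow>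
      integrable (MX \<Otimes>\<^sub>M (ME \<Otimes>\<^sub>M \<nu>)) \<phi> \<and>
      (\<integral>z. \<phi> z \<partial>(MX \<Otimes>\<^sub>M (ME \<Otimes>\<^sub>M \<nu>))) = (\<integral>z. \<phi> (fst (snd z), fst z, snd (snd z)) \<partial>(ME \<Otimes>\<^sub>M N))"
    and "\<psi> \<in> borel_measurable (MX \<Otimes>\<^sub>M (\<nu> \<Otimes>\<^sub>M ME)) \<Longrightarrow>
      integrable (ME \<Otimes>\<^sub>M N) (\<lambda>z. \<psi> (fst (snd z), snd (snd z), fst z)) \<Longrightarrow>
      integrable (MX \<Otimes>\<^sub>M (\<nu> \<Otimes>\<^sub>M ME)) \<psi> \<and>
      (\<integral>z. \<psi> z \<partial>(MX \<Otimes>\<^sub>M (\<nu> \<Otimes>\<^sub>M ME))) = (\<integral>z. \<psi> (fst (snd z), snd (snd z), fst z) \<partial>(ME \<Otimes>\<^sub>M N))"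
proof -
  note d = distr_rotate[OF X.prob_space_axioms prob_space_ME W.prob_space_axioms]
  have m1: "(\<lambda>z. (fst (snd z), fst z, snd (snd z))) \<in> measurable (ME \<Otimes>\<^sub>M N) (MX \<Otimes>\<^sub>M (ME \<Otimes>\<^sub>M \<nu>))"
    and m2: "(\<lambda>z. (fst (snd z), snd (snd z), fst z)) \<in> measurable (ME \<Otimes>\<^sub>M N) (MX \<Otimes>\<^sub>M (\<nu> \<Otimes>\<^sub>M ME))" by measurable
  show "\<phi> \<in> borel_measurable (MX \<Otimes>\<^sub>M (ME \<Otimes>\<^sub>M \<nu>)) \<Longrightarrow>
      integrable (ME \<Otimes>\<^sub>M N) (\<lambda>z. \<phi> (fst (snd z), fst z, snd (snd z))) \<Longrightarrow>
      integrable (MX \<Otimes>\<^sub>M (ME \<Otimes>\<^sub>M \<nu>)) \<phi> \<and>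
      (\<integral>z. \<phi> z \<partial>(MX \<Otimes>\<^sub>M (ME \<Otimes>\<^sub>M \<nu>))) = (\<integral>z. \<phi> (fst (snd z), fst z, snd (snd z)) \<partial>(ME \<Otimes>\<^sub>M N))"
    using integrable_distr_eq[OF m1, of \<phi>] integral_distr[OF m1, of \<phi>] unfolding d(1) by simp
  show "\<psi> \<in> borel_measurable (MX \<Otimes>\<^sub>M (\<nu> \<Otimes>\<^sub>M ME)) \<Longrightarrow>
      integrable (ME \<Otimes>\<^sub>M N) (\<lambda>z. \<psi> (fst (snd z), snd (snd z), fst z)) \<Longrightarrow>
      integrable (MX \<Otimes>\<^sub>M (\<nu> \<Otimes>\<^sub>M ME)) \<psi> \<and>
      (\<integral>z. \<psi> z \<partial>(MX \<Otimes>\<^sub>M (\<nu> \<Otimes>\<^sub>M ME))) = (\<integral>z. \<psi> (fst (snd z), snd (snd z), fst z) \<partial>(ME \<Otimes>\<^sub>M N))"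
    using integrable_distr_eq[OF m2, of \<psi>] integral_distr[OF m2, of \<psi>] unfolding d(2) by simp
qed

abbreviation "XEW \<equiv> MX \<Otimes>\<^sub>M (ME \<Otimes>\<^sub>M \<nu>)"
abbreviation "XWE \<equiv> MX \<Otimes>\<^sub>M (\<nu> \<Otimes>\<^sub>M ME)"

lemma prob_space_XEW: "prob_space XEW" and prob_space_XWE: "prob_space XWE"
proof -
  interpret E: prob_space ME by (rule prob_space_ME)
  interpret EW: pair_prob_space ME \<nu> ..
  interpret WE: pair_prob_space \<nu> ME ..
  interpret 1: pair_prob_space MX "ME \<Otimes>\<^sub>M \<nu>" ..
  interpret 2: pair_prob_space MX "\<nu> \<Otimes>\<^sub>M ME" ..
  show "prob_space XEW" "prob_space XWE" by unfold_locales
qed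

lemma measurable_noise_term:
  assumes [measurable]: "f \<in> measurable L MX" "g \<in> measurable L ME" "k \<in> measurable L \<nu>"
  shows "(\<lambda>z. noise_term a (f z) (g z) (k z)) \<in> borel_measurable L"
  unfolding noise_term_def
proof (intro borel_measurable_sum borel_measurable_times)
  fix i assume i: "i \<in> {..<n}"
  show "(\<lambda>z. entry (K (f z) (k z)) a i) \<in> borel_measurable L"
    by (intro measurable_entry fmat_measurable_AK assms)
  show "(\<lambda>z. g z i) \<in> borel_measurable L"
    using measurable_compose[OF assms(2) measurable_noise] i by simp
qed

lemma XEW_integrals:
  shows "(\<lambda>y. entry (A (fst y) (snd (snd y))) a b) \<in> borel_measurable XEW"
    "integrable XEW (\<lambda>y. (entry (A (fst y) (snd (snd y))) a b)\<^sup>2)"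
    "(\<integral>y. (entry (A (fst y) (snd (snd y))) a b)\<^sup>2 \<partial>XEW) = (\<integral>z. (entry (A (fst z) (snd z)) a b)\<^sup>2 \<partial>N)"
    "integrable XEW (\<lambda>y. entry (A (fst y) (snd (snd y))) a b)"
    "(\<integral>y. entry (A (fst y) (snd (snd y))) a b \<partial>XEW) = mean_A a b"
    "(\<lambda>y. noise_term a (fst y) (fst (snd y)) (snd (snd y))) \<in> borel_measurable XEW"
    "integrable XEW (\<lambda>y. (noise_term a (fst y) (fst (snd y)) (snd (snd y)))\<^sup>2)"
    "(\<integral>y. (noise_term a (fst y) (fst (snd y)) (snd (snd y)))\<^sup>2 \<partial>XEW) = \<sigma>\<^sup>2 * (\<Sum>i<n. \<integral>z. (entry (K (fst z) (snd z)) a i)\<^sup>2 \<partial>N)"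
    "integrable XEW (\<lambda>y. noise_term a (fst y) (fst (snd y)) (snd (snd y)))"
    "(\<integral>y. noise_term a (fst y) (fst (snd y)) (snd (snd y)) \<partial>XEW) = 0"
proof -
  interpret E: prob_space ME by (rule prob_space_ME)
  interpret EN: pair_prob_space ME N ..
  show mA [measurable]: "(\<lambda>y. entry (A (fst y) (snd (snd y))) a b) \<in> borel_measurable XEW"
    by (rule measurable_entry, rule fmat_measurable_AK) simp_all
  show mD [measurable]: "(\<lambda>y. noise_term a (fst y) (fst (snd y)) (snd (snd y))) \<in> borel_measurable XEW"
    by (rule measurable_noise_term) simp_all
  note one = E.integrable_const[of "1::real"]
  note p2 = EN.product_of_functions[OF one A_square_integrable(2)[of a b]]
  note p1 = EN.product_of_functions[OF one A_square_integrable(3)[of a b]]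
  note r2 = rotate_integrals(1)[of "\<lambda>y. (entry (A (fst y) (snd (snd y))) a b)\<^sup>2"]
  note r1 = rotate_integrals(1)[of "\<lambda>y. entry (A (fst y) (snd (snd y))) a b"]
  show "integrable XEW (\<lambda>y. (entry (A (fst y) (snd (snd y))) a b)\<^sup>2)"
    "(\<integral>y. (entry (A (fst y) (snd (snd y))) a b)\<^sup>2 \<partial>XEW) = (\<integral>z. (entry (A (fst z) (snd z)) a b)\<^sup>2 \<partial>N)"
    using r2 p2 by (simp_all add: E.prob_space)
  show "integrable XEW (\<lambda>y. entry (A (fst y) (snd (snd y))) a b)"
    "(\<integral>y. entry (A (fst y) (snd (snd y))) a b \<partial>XEW) = mean_A a b"
    using r1 p1 by (simp_all add: E.prob_space mean_A_def)
  note s2 = rotate_integrals(1)[of "\<lambda>y. (noise_term a (fst y) (fst (snd y)) (snd (snd y)))\<^sup>2"]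
  note s1 = rotate_integrals(1)[of "\<lambda>y. noise_term a (fst y) (fst (snd y)) (snd (snd y))"]
  show "integrable XEW (\<lambda>y. (noise_term a (fst y) (fst (snd y)) (snd (snd y)))\<^sup>2)"
    "(\<integral>y. (noise_term a (fst y) (fst (snd y)) (snd (snd y)))\<^sup>2 \<partial>XEW) = \<sigma>\<^sup>2 * (\<Sum>i<n. \<integral>z. (entry (K (fst z) (snd z)) a i)\<^sup>2 \<partial>N)"
    using s2 noise_term_moments(1,2)[of a] by simp_all
  show "integrable XEW (\<lambda>y. noise_term a (fst y) (fst (snd y)) (snd (snd y)))"
    "(\<integral>y. noise_term a (fst y) (fst (snd y)) (snd (snd y)) \<partial>XEW) = 0"
    using s1 noise_term_moments(3,4)[of a] by simp_all
qed

lemma fhat_noise_term: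
  "fhat n p d l \<theta> x X e W = (\<Sum>a<d. \<Sum>b<d. x a * entry (A X W) a b * \<theta> b) + (\<Sum>a<d. x a * noise_term a X e W)"
  unfolding fhat_eq noise_term_def ..

section \<open>Averages of the predictor\<close>

lemma mean_all_eq: "mean_all \<mu> \<nu> \<sigma> n p d l \<theta> x = (\<Sum>a<d. \<Sum>b<d. x a * mean_A a b * \<theta> b)"
proof -
  have "mean_all \<mu> \<nu> \<sigma> n p d l \<theta> x = (\<integral>y. (\<Sum>a<d. \<Sum>b<d. x a * entry (A (fst y) (snd (snd y))) a b * \<theta> b)
      + (\<Sum>a<d. x a * noise_term a (fst y) (fst (snd y)) (snd (snd y))) \<partial>XEW)"
    unfolding mean_all_def case_prod_beta' fhat_noise_term ..
  also have "\<dots> = (\<Sum>a<d. \<Sum>b<d. x a * mean_A a b * \<theta> b)"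
    using XEW_integrals(4,5,9,10)
    by (subst Bochner_Integration.integral_add)
      (simp_all add: Bochner_Integration.integral_sum Bochner_Integration.integrable_sum)
  finally show ?thesis .
qed

lemma mean_noise_eq: "mean_noise \<sigma> n p d l \<theta> x X W = (\<Sum>a<d. \<Sum>b<d. x a * entry (A X W) a b * \<theta> b)"
proof -
  interpret E: prob_space ME by (rule prob_space_ME)
  have i: "integrable ME (\<lambda>e. noise_term a X e W)" "(\<integral>e. noise_term a X e W \<partial>ME) = 0" for a
    unfolding noise_term_def using noise_moments(3,4)
    by (auto simp: Bochner_Integration.integral_sum intro!: Bochner_Integration.integrable_sum)
  show ?thesis
    unfolding mean_noise_def fhat_noise_term using i
    by (subst Bochner_Integration.integral_add)
      (auto simp: Bochner_Integration.integral_sum E.prob_space intro!: Bochner_Integration.integrable_sum)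
qed

lemma mean_sample_noise_eq:
  assumes W: "W \<in> space \<nu>"
  shows "mean_sample_noise \<mu> \<sigma> n p d l \<theta> x W = (\<Sum>a<d. \<Sum>b<d. x a * mean_given_W a b W * \<theta> b)"
proof -
  interpret E: prob_space ME by (rule prob_space_ME)
  interpret XE: pair_prob_space MX ME ..
  have a: "integrable (MX \<Otimes>\<^sub>M ME) (\<lambda>y. entry (A (fst y) W) a b)"
    "(\<integral>y. entry (A (fst y) W) a b \<partial>(MX \<Otimes>\<^sub>M ME)) = mean_given_W a b W" for a b
    using XE.product_of_functions[OF AK_integrable_X(1)[OF W, of a b] E.integrable_const[of 1]]
    by (simp_all add: E.prob_space mean_given_W_def)
  have k: "integrable (MX \<Otimes>\<^sub>M ME) (\<lambda>y. entry (K (fst y) W) a i * snd y i)"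
    "(\<integral>y. entry (K (fst y) W) a i * snd y i \<partial>(MX \<Otimes>\<^sub>M ME)) = 0" if "i < n" for a i
    using XE.product_of_functions[OF AK_integrable_X(2)[OF W, of a i] noise_moments(3)[OF that that]] noise_moments(4)[OF that that]
    by simp_all
  have n: "integrable (MX \<Otimes>\<^sub>M ME) (\<lambda>y. noise_term a (fst y) (snd y) W)" "(\<integral>y. noise_term a (fst y) (snd y) W \<partial>(MX \<Otimes>\<^sub>M ME)) = 0" for a
    unfolding noise_term_def using k
    by (auto simp: Bochner_Integration.integral_sum intro!: Bochner_Integration.integrable_sum)
  have "mean_sample_noise \<mu> \<sigma> n p d l \<theta> x W = (\<integral>y. (\<Sum>a<d. \<Sum>b<d. x a * entry (A (fst y) W) a b * \<theta> b)
      + (\<Sum>a<d. x a * noise_term a (fst y) (snd y) W) \<partial>(MX \<Otimes>\<^sub>M ME))"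
    unfolding mean_sample_noise_def case_prod_beta' fhat_noise_term ..
  also have "\<dots> = (\<Sum>a<d. \<Sum>b<d. x a * mean_given_W a b W * \<theta> b)"
    using a n
    by (subst Bochner_Integration.integral_add)
      (simp_all add: Bochner_Integration.integral_sum Bochner_Integration.integrable_sum)
  finally show ?thesis .
qed

end

end

section \<open>The six risk quantities as second moments\<close>

context ridge_model
begin

context
  fixes \<alpha> \<sigma> :: real
begin

lemma XWE_noise:
  "(\<lambda>y. noise_term a (fst y) (snd (snd y)) (fst (snd y))) \<in> borel_measurable (MX \<Otimes>\<^sub>M (\<nu> \<Otimes>\<^sub>M noise_law \<sigma> n))"
  "integrable (MX \<Otimes>\<^sub>M (\<nu> \<Otimes>\<^sub>M noise_law \<sigma> n)) (\<lambda>y. (noise_term a (fst y) (snd (snd y)) (fst (snd y)))\<^sup>2)"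
  "(\<integral>y. (noise_term a (fst y) (snd (snd y)) (fst (snd y)))\<^sup>2 \<partial>(MX \<Otimes>\<^sub>M (\<nu> \<Otimes>\<^sub>M noise_law \<sigma> n)))
    = \<sigma>\<^sup>2 * (\<Sum>i<n. \<integral>z. (entry (K (fst z) (snd z)) a i)\<^sup>2 \<partial>N)"
proof -
  show m [measurable]: "(\<lambda>y. noise_term a (fst y) (snd (snd y)) (fst (snd y))) \<in> borel_measurable (MX \<Otimes>\<^sub>M (\<nu> \<Otimes>\<^sub>M noise_law \<sigma> n))"
    by (rule measurable_noise_term[where \<sigma> = \<sigma>]) simp_all
  note r = rotate_integrals(2)[of "\<lambda>y. (noise_term a (fst y) (snd (snd y)) (fst (snd y)))\<^sup>2" \<sigma>]
  show "integrable (MX \<Otimes>\<^sub>M (\<nu> \<Otimes>\<^sub>M noise_law \<sigma> n)) (\<lambda>y. (noise_term a (fst y) (snd (snd y)) (fst (snd y)))\<^sup>2)"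
    "(\<integral>y. (noise_term a (fst y) (snd (snd y)) (fst (snd y)))\<^sup>2 \<partial>(MX \<Otimes>\<^sub>M (\<nu> \<Otimes>\<^sub>M noise_law \<sigma> n)))
      = \<sigma>\<^sup>2 * (\<Sum>i<n. \<integral>z. (entry (K (fst z) (snd z)) a i)\<^sup>2 \<partial>N)"
    using r noise_term_moments(1,2)[of \<sigma> a] by simp_all
qed

lemma Sigma_label_eq: "Sigma_label \<mu> \<nu> \<alpha> \<sigma> n p d l = \<sigma>\<^sup>2 * SK"
proof -
  let ?B = "MX \<Otimes>\<^sub>M (\<nu> \<Otimes>\<^sub>M noise_law \<sigma> n)"
  have "Sigma_label \<mu> \<nu> \<alpha> \<sigma> n p d l = (\<integral>t. (\<integral>y. ((\<Sum>a<d. \<Sum>b<d. snd t a * 0 * fst t b)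
      + (\<Sum>a<d. snd t a * noise_term a (fst y) (snd (snd y)) (fst (snd y))))\<^sup>2 \<partial>?B) \<partial>theta_x_law \<mu> \<alpha> d)"
    unfolding Sigma_label_def case_prod_beta' fhat_noise_term mean_noise_eq by simp
  also have "\<dots> = \<alpha>\<^sup>2 / d * (\<Sum>a<d. \<Sum>b<d. \<integral>y. 0\<^sup>2 \<partial>?B) + (\<Sum>a<d. \<integral>y. (noise_term a (fst y) (snd (snd y)) (fst (snd y)))\<^sup>2 \<partial>?B)"
    by (rule iterated_bilinear_form_expectation[OF prob_space_XWE]) (simp_all add: XWE_noise)
  finally show ?thesis by (simp add: XWE_noise SK_def sum_distrib_left)
qed

lemma Sigma_sample_eq: "Sigma_sample \<mu> \<nu> \<alpha> \<sigma> n p d l = \<alpha>\<^sup>2 / d * (SA - SW)"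
proof -
  have diff: "mean_noise \<sigma> n p d l (fst t) (snd t) (fst z) (snd z) - mean_sample_noise \<mu> \<sigma> n p d l (fst t) (snd t) (snd z)
     = (\<Sum>a<d. \<Sum>b<d. snd t a * (entry (A (fst z) (snd z)) a b - mean_given_W a b (snd z)) * fst t b) + (\<Sum>a<d. snd t a * 0)"
    if "z \<in> space N" for t z
  proof -
    have W: "snd z \<in> space \<nu>" using that by (auto simp: space_pair_measure)
    show ?thesis
      unfolding mean_noise_eq mean_sample_noise_eq[OF W] by (simp add: algebra_simps sum_subtractf)
  qed
  have "Sigma_sample \<mu> \<nu> \<alpha> \<sigma> n p d l = (\<integral>t. (\<integral>z. ((\<Sum>a<d. \<Sum>b<d. snd t a * (entry (A (fst z) (snd z)) a b - mean_given_W a b (snd z)) * fst t b)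
      + (\<Sum>a<d. snd t a * 0))\<^sup>2 \<partial>N) \<partial>theta_x_law \<mu> \<alpha> d)"
    unfolding Sigma_sample_def case_prod_beta'
    by (intro Bochner_Integration.integral_cong refl) (simp only: diff)
  also have "\<dots> = \<alpha>\<^sup>2 / d * (\<Sum>a<d. \<Sum>b<d. \<integral>z. (entry (A (fst z) (snd z)) a b - mean_given_W a b (snd z))\<^sup>2 \<partial>N) + (\<Sum>a<d. \<integral>z. 0\<^sup>2 \<partial>N)"
    by (rule iterated_bilinear_form_expectation[OF XW.prob_space_axioms])
      (use A_conditional(1,4) A_square_integrable(1) in \<open>auto intro!: borel_measurable_diff measurable_compose[OF measurable_snd]\<close>)
  finally show ?thesis by (simp add: A_conditional(5) SA_def SW_def sum_subtractf)
qed

lemma Sigma_init_eq: "Sigma_init \<mu> \<nu> \<alpha> \<sigma> n p d l = \<alpha>\<^sup>2 / d * (SW - SM)"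
proof -
  have diff: "mean_sample_noise \<mu> \<sigma> n p d l (fst t) (snd t) W - mean_all \<mu> \<nu> \<sigma> n p d l (fst t) (snd t)
     = (\<Sum>a<d. \<Sum>b<d. snd t a * (mean_given_W a b W - mean_A a b) * fst t b) + (\<Sum>a<d. snd t a * 0)"
    if "W \<in> space \<nu>" for t W
    using that by (simp add: mean_sample_noise_eq mean_all_eq algebra_simps sum_subtractf)
  have "Sigma_init \<mu> \<nu> \<alpha> \<sigma> n p d l = (\<integral>t. (\<integral>W. ((\<Sum>a<d. \<Sum>b<d. snd t a * (mean_given_W a b W - mean_A a b) * fst t b)
      + (\<Sum>a<d. snd t a * 0))\<^sup>2 \<partial>\<nu>) \<partial>theta_x_law \<mu> \<alpha> d)"
    unfolding Sigma_init_def case_prod_beta'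
    by (intro Bochner_Integration.integral_cong refl) (simp only: diff)
  also have "\<dots> = \<alpha>\<^sup>2 / d * (\<Sum>a<d. \<Sum>b<d. \<integral>W. (mean_given_W a b W - mean_A a b)\<^sup>2 \<partial>\<nu>) + (\<Sum>a<d. \<integral>W. 0\<^sup>2 \<partial>\<nu>)"
    by (rule iterated_bilinear_form_expectation[OF W.prob_space_axioms])
      (use A_conditional(1,2) W.integral_square_diff(1)[OF A_conditional(1,2)] in auto)
  also have "(\<Sum>a<d. \<Sum>b<d. \<integral>W. (mean_given_W a b W - mean_A a b)\<^sup>2 \<partial>\<nu>) = SW - SM"
    unfolding W.integral_square_diff(2)[OF A_conditional(1,2)] A_conditional(3) SW_def SM_def
    by (simp add: power2_eq_square sum_subtractf)
  finally show ?thesis by simp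
qed

text \<open>Expands squared deviations from the identity matrix, which is the coefficient matrix of
  the signal in \<open>signal_eq\<close>; only the diagonal of the mean survives in the cross
  term.\<close>

lemma mean_square_deviation:
  "(\<Sum>a<d. \<Sum>b<d. (f a b - 2 * (if a = b then 1 else 0) * mean_A a b + (if a = b then 1 else 0)\<^sup>2)) = (\<Sum>a<d. \<Sum>b<d. f a b) - 2 * TM + d"
proof -
  have "(\<Sum>b<d. (f a b - 2 * (if a = b then 1 else 0) * mean_A a b + (if a = b then 1 else 0)\<^sup>2))
      = (\<Sum>b<d. f a b) - 2 * mean_A a a + 1" if "a < d" for a
  proof -
    have "(\<Sum>b<d. (f a b - 2 * (if a = b then 1 else 0) * mean_A a b + (if a = b then 1 else 0)\<^sup>2))
        = (\<Sum>b<d. f a b) - (\<Sum>b<d. if b = a then 2 * mean_A a a else 0) + (\<Sum>b<d. if b = a then 1 else 0)"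
      unfolding sum_subtractf[symmetric] sum.distrib[symmetric] by (intro sum.cong) auto
    then show ?thesis using that by simp
  qed
  then have "(\<Sum>a<d. \<Sum>b<d. (f a b - 2 * (if a = b then 1 else 0) * mean_A a b + (if a = b then 1 else 0)\<^sup>2))
      = (\<Sum>a<d. (\<Sum>b<d. f a b) - 2 * mean_A a a + 1)" by simp
  also have "\<dots> = (\<Sum>a<d. \<Sum>b<d. f a b) - 2 * TM + d"
    by (simp add: sum.distrib sum_subtractf TM_def sum_distrib_left)
  finally show ?thesis .
qed

lemma Bias2_eq: "Bias2 \<mu> \<nu> \<alpha> \<sigma> n p d l = \<alpha>\<^sup>2 / d * (SM - 2 * TM + d)"
proof -
  let ?c = "\<lambda>a b. mean_A a b - (if a = b then 1 else 0)"
  have diff: "mean_all \<mu> \<nu> \<sigma> n p d l (fst t) (snd t) - signal d (fst t) (snd t)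
     = (\<Sum>a<d. \<Sum>b<d. snd t a * ?c a b * fst t b) + (\<Sum>a<d. snd t a * 0)" for t
    unfolding mean_all_eq signal_eq sum_subtractf[symmetric] by (simp add: left_diff_distrib right_diff_distrib)
  \<comment> \<open>The dummy integral over \<open>W\<close> brings the deterministic coefficients
    into the form of \<open>iterated_bilinear_form_expectation\<close>.\<close>
  have "Bias2 \<mu> \<nu> \<alpha> \<sigma> n p d l = (\<integral>t. (\<integral>W. ((\<Sum>a<d. \<Sum>b<d. snd t a * ?c a b * fst t b)
      + (\<Sum>a<d. snd t a * 0))\<^sup>2 \<partial>\<nu>) \<partial>theta_x_law \<mu> \<alpha> d)"
    unfolding Bias2_def case_prod_beta' diff by (simp add: W.prob_space)
  also have "\<dots> = \<alpha>\<^sup>2 / d * (\<Sum>a<d. \<Sum>b<d. \<integral>W. (?c a b)\<^sup>2 \<partial>\<nu>) + (\<Sum>a<d. \<integral>W. 0\<^sup>2 \<partial>\<nu>)"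
    by (rule iterated_bilinear_form_expectation[OF W.prob_space_axioms]) simp_all
  also have "(\<Sum>a<d. \<Sum>b<d. \<integral>W. (?c a b)\<^sup>2 \<partial>\<nu>) = SM - 2 * TM + d"
    unfolding SM_def mean_square_deviation[symmetric]
    by (intro sum.cong refl) (simp add: W.prob_space power2_diff)
  finally show ?thesis by simp
qed

lemma Var_eq: "Var \<mu> \<nu> \<alpha> \<sigma> n p d l = \<alpha>\<^sup>2 / d * (SA - SM) + \<sigma>\<^sup>2 * SK"
proof -
  let ?B = "MX \<Otimes>\<^sub>M (noise_law \<sigma> n \<Otimes>\<^sub>M \<nu>)"
  let ?C = "\<lambda>a b y. entry (A (fst y) (snd (snd y))) a b - mean_A a b"
  let ?D = "\<lambda>a y. noise_term a (fst y) (fst (snd y)) (snd (snd y))"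
  interpret B: prob_space ?B by (rule prob_space_XEW)
  note X = XEW_integrals[where \<sigma> = \<sigma>]
  have diff: "fhat n p d l (fst t) (snd t) (fst y) (fst (snd y)) (snd (snd y)) - mean_all \<mu> \<nu> \<sigma> n p d l (fst t) (snd t)
     = (\<Sum>a<d. \<Sum>b<d. snd t a * ?C a b y * fst t b) + (\<Sum>a<d. snd t a * ?D a y)" for t y
    unfolding mean_all_eq fhat_noise_term by (simp add: left_diff_distrib right_diff_distrib sum_subtractf)
  have "Var \<mu> \<nu> \<alpha> \<sigma> n p d l = (\<integral>t. (\<integral>y. ((\<Sum>a<d. \<Sum>b<d. snd t a * ?C a b y * fst t b)
      + (\<Sum>a<d. snd t a * ?D a y))\<^sup>2 \<partial>?B) \<partial>theta_x_law \<mu> \<alpha> d)"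
    unfolding Var_def case_prod_beta' diff ..
  also have "\<dots> = \<alpha>\<^sup>2 / d * (\<Sum>a<d. \<Sum>b<d. \<integral>y. (?C a b y)\<^sup>2 \<partial>?B) + (\<Sum>a<d. \<integral>y. (?D a y)\<^sup>2 \<partial>?B)"
    by (rule iterated_bilinear_form_expectation[OF prob_space_XEW])
      (use X(1,6,7) B.integral_square_diff(1)[OF X(1,2)] in auto)
  also have "(\<Sum>a<d. \<Sum>b<d. \<integral>y. (?C a b y)\<^sup>2 \<partial>?B) = SA - SM"
    unfolding B.integral_square_diff(2)[OF X(1,2)] X(3,5) SA_def SM_def
    by (simp add: power2_eq_square sum_subtractf)
  finally show ?thesis by (simp add: X(8) SK_def sum_distrib_left)
qed

lemma MSE_eq: "MSE \<mu> \<nu> \<alpha> \<sigma> n p d l = \<alpha>\<^sup>2 / d * (SA - 2 * TM + d) + \<sigma>\<^sup>2 * SK + \<sigma>\<^sup>2"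
proof -
  let ?B = "MX \<Otimes>\<^sub>M (noise_law \<sigma> n \<Otimes>\<^sub>M \<nu>)"
  let ?C = "\<lambda>a b y. entry (A (fst y) (snd (snd y))) a b - (if a = b then 1 else 0)"
  let ?D = "\<lambda>a y. noise_term a (fst y) (fst (snd y)) (snd (snd y))"
  interpret B: prob_space ?B by (rule prob_space_XEW)
  note X = XEW_integrals[where \<sigma> = \<sigma>]
  have diff: "fhat n p d l (fst t) (snd t) (fst y) (fst (snd y)) (snd (snd y)) - signal d (fst t) (snd t)
     = (\<Sum>a<d. \<Sum>b<d. snd t a * ?C a b y * fst t b) + (\<Sum>a<d. snd t a * ?D a y)" for t y
    unfolding signal_eq fhat_noise_term by (simp add: left_diff_distrib right_diff_distrib sum_subtractf)
  have "MSE \<mu> \<nu> \<alpha> \<sigma> n p d l = (\<integral>z. ((\<Sum>a<d. \<Sum>b<d. snd (fst z) a * ?C a b (snd z) * fst (fst z) b)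
      + (\<Sum>a<d. snd (fst z) a * ?D a (snd z)))\<^sup>2 \<partial>(theta_x_law \<mu> \<alpha> d \<Otimes>\<^sub>M ?B)) + \<sigma>\<^sup>2"
    unfolding MSE_def case_prod_beta' diff ..
  also have "(\<integral>z. ((\<Sum>a<d. \<Sum>b<d. snd (fst z) a * ?C a b (snd z) * fst (fst z) b)
      + (\<Sum>a<d. snd (fst z) a * ?D a (snd z)))\<^sup>2 \<partial>(theta_x_law \<mu> \<alpha> d \<Otimes>\<^sub>M ?B))
      = \<alpha>\<^sup>2 / d * (\<Sum>a<d. \<Sum>b<d. \<integral>y. (?C a b y)\<^sup>2 \<partial>?B) + (\<Sum>a<d. \<integral>y. (?D a y)\<^sup>2 \<partial>?B)"
    by (rule bilinear_form_expectation[OF prob_space_XEW])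
      (use X(1,6,7) B.integral_square_diff(1)[OF X(1,2)] in auto)
  also have "(\<Sum>a<d. \<Sum>b<d. \<integral>y. (?C a b y)\<^sup>2 \<partial>?B) = SA - 2 * TM + d"
    unfolding B.integral_square_diff(2)[OF X(1,2)] X(3,5) SA_def mean_square_deviation ..
  finally show ?thesis by (simp add: X(8) SK_def sum_distrib_left)
qed

end

end

section \<open>Approximation of the risk\<close>

text \<open>Global functions of the ridge parameter, so that different values of \<open>l\<close>
  can be compared and limits taken for all of them.\<close>

definition trace1 :: "real measure \<Rightarrow> (nat \<times> nat \<Rightarrow> real) measure \<Rightarrow> nat \<Rightarrow> nat \<Rightarrow> nat \<Rightarrow> real \<Rightarrow> real" where
  "trace1 \<mu> \<nu> n d p l = (\<integral>z. tr (projected_resolvent n p d l (fst z) (snd z)) / n \<partial>(iid_mat_law \<mu> n d \<Otimes>\<^sub>M \<nu>))"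

definition trace2 :: "real measure \<Rightarrow> (nat \<times> nat \<Rightarrow> real) measure \<Rightarrow> nat \<Rightarrow> nat \<Rightarrow> nat \<Rightarrow> real \<Rightarrow> real" where
  "trace2 \<mu> \<nu> n d p l = (\<integral>z. tr (projected_resolvent n p d l (fst z) (snd z) * projected_resolvent n p d l (fst z) (snd z)) / n
     \<partial>(iid_mat_law \<mu> n d \<Otimes>\<^sub>M \<nu>))"

section \<open>Trace formulas and the approximation of the full second moment\<close>

context ridge_model
begin

abbreviation "R X W \<equiv> projected_resolvent n p d l X W"
abbreviation "orth W \<equiv> fm p d W * tp (fm p d W) = idm p"
abbreviation "proj W \<equiv> tp (fm p d W) * fm p d W"

lemma AE_orth: "AE z in N. orth (snd z)"
proof -
  obtain S where S: "{W \<in> space \<nu>. \<not> orth W} \<subseteq> S" "emeasure \<nu> S = 0" "S \<in> sets \<nu>"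
    using AE_E[OF orthonormal] by blast
  show ?thesis
  proof (rule AE_I)
    show "{z \<in> space N. \<not> orth (snd z)} \<subseteq> space MX \<times> S" using S(1) by (auto simp: space_pair_measure)
    show "emeasure N (space MX \<times> S) = 0" using S by (simp add: W.emeasure_pair_measure_Times)
    show "space MX \<times> S \<in> sets N" using S by simp
  qed
qed

text \<open>The passage from the conditional model to the joint law: a bound on conditional means
  that is uniform over orthonormal \<open>W\<close> survives averaging.\<close>

lemma integral_bound_W:
  fixes f :: "_ \<Rightarrow> real"
  assumes "integrable N f" "\<And>W. orth W \<Longrightarrow> W \<in> space \<nu> \<Longrightarrow> \<bar>\<integral>X. f (X, W) \<partial>MX\<bar> \<le> c"
  shows "\<bar>\<integral>z. f z \<partial>N\<bar> \<le> c"
proof -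
  have i: "integrable N (case_prod (\<lambda>X W. f (X, W)))" using assms(1) by simp
  have "(\<integral>z. f z \<partial>N) = (\<integral>W. (\<integral>X. f (X, W) \<partial>MX) \<partial>\<nu>)"
    using XW.integral_snd[OF i] by simp
  moreover have "\<bar>\<integral>W. (\<integral>X. f (X, W) \<partial>MX) \<partial>\<nu>\<bar> \<le> (\<integral>W. \<bar>\<integral>X. f (X, W) \<partial>MX\<bar> \<partial>\<nu>)" by (rule integral_abs_bound)
  moreover have "(\<integral>W. \<bar>\<integral>X. f (X, W) \<partial>MX\<bar> \<partial>\<nu>) \<le> (\<integral>W. c \<partial>\<nu>)"
  proof (rule integral_mono_AE)
    show "integrable \<nu> (\<lambda>W. \<bar>\<integral>X. f (X, W) \<partial>MX\<bar>)" using XW.integrable_snd[OF i] by simp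
    show "AE W in \<nu>. \<bar>\<integral>X. f (X, W) \<partial>MX\<bar> \<le> c"
      using orthonormal AE_space by eventually_elim (rule assms(2))
  qed simp
  ultimately have "\<bar>\<integral>z. f z \<partial>N\<bar> \<le> (\<integral>W. c \<partial>\<nu>)" by linarith
  then show ?thesis by (simp add: W.prob_space)
qed

lemma ridge_instance:
  assumes "orth W" "W \<in> space \<nu>"
  shows "ridge \<mu> n d p l (proj W) (\<lambda>X. R X W)"
proof (intro ridge.intro ridge_axioms.intro standard_law_axioms)
  show "resolvent (proj W) (R X W) (fm n d X) n l" for X by (rule resolvent_projected[OF l_pos n_pos assms(1)])
  show "supp_in d d (proj W)" by (rule supp_in_mult[OF supp_in_tp[OF supp_in_fm] supp_in_fm])
  show "tr (proj W) = p" by (subst tr_mult_commute) (simp add: assms(1))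
  show "p \<le> d" by (rule p_le_d)
  show "R X W = R X' W" if "fm n d X = fm n d X'" for X X'
  proof -
    have "X (i, j) = X' (i, j)" if "i < n" "j < d" for i j
      using arg_cong[OF \<open>fm n d X = fm n d X'\<close>, of "\<lambda>A. entry A i j"] that by simp
    then have "Matrix.mat n d X = Matrix.mat n d X'" by (intro eq_matI) auto
    then show ?thesis by (simp add: projected_resolvent_def ridge_inverse_def ridge_gram_def)
  qed
  show "fmat_measurable MX (\<lambda>X. R X W)" using assms(2) by (intro fmat_measurable_AK) simp_all
qed

lemma integrable_traces:
  "integrable N (\<lambda>z. tr (R (fst z) (snd z)) / n)"
  "integrable N (\<lambda>z. tr (R (fst z) (snd z) * R (fst z) (snd z)) / n)"
proof -
  have m: "fmat_measurable N (\<lambda>z. R (fst z) (snd z))" by (rule fmat_measurable_AK) simp_all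
  \<comment> \<open>The factor 1 is the trivial function of \<open>X\<close>, which gives the
    envelope the product form required by \<open>product_of_functions\<close>.\<close>
  have W2: "integrable N (\<lambda>z. 1 * (1 + cW (snd z)) * ((real n)\<^sup>2))"
    using XW.product_of_functions(1)[OF X.integrable_const[of 1] Bochner_Integration.integrable_add[OF W.integrable_const[of 1] integrable_cW]]
    by (rule integrable_mult_left)
  have nR: "(norm (R X W))\<^sup>2 \<le> cW W * (real n)\<^sup>2" for X W
  proof -
    have "(norm (R X W))\<^sup>2 \<le> (sqrt p / l * (norm (fm p d W))\<^sup>2)\<^sup>2"
      by (intro power_mono norm_projected_resolvent) simp
    also have "\<dots> = cW W * (real n)\<^sup>2"
      using n_pos unfolding cW_def power4_square by (simp only: power_mult_distrib power_divide) simp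
    finally show ?thesis .
  qed
  have e: "integrable N (\<lambda>z. entry (R (fst z) (snd z)) a a)" for a
  proof (rule XW.square_integrable_imp_integrable)
    show me: "(\<lambda>z. entry (R (fst z) (snd z)) a a) \<in> borel_measurable N" by (rule measurable_entry[OF m])
    show "integrable N (\<lambda>z. (entry (R (fst z) (snd z)) a a)\<^sup>2)"
    proof (rule Bochner_Integration.integrable_bound[OF W2])
      show "(\<lambda>z. (entry (R (fst z) (snd z)) a a)\<^sup>2) \<in> borel_measurable N" using me by simp
      have "(entry (R X W) a a)\<^sup>2 \<le> 1 * (1 + cW W) * (real n)\<^sup>2" for X W
      proof -
        have "(entry (R X W) a a)\<^sup>2 \<le> (norm (R X W))\<^sup>2"
          using power_mono[OF abs_entry_le_norm abs_ge_zero, of "R X W" a a 2] by simp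
        also note nR
        finally show ?thesis using zero_le_power2[of "real n"] unfolding distrib_right mult_1 by linarith
      qed
      then show "AE z in N. norm ((entry (R (fst z) (snd z)) a a)\<^sup>2) \<le> norm (1 * (1 + cW (snd z)) * (real n)\<^sup>2)"
        by (intro AE_I2) (simp add: order_trans[OF _ abs_ge_self] del: mult_1)
    qed
  qed
  show "integrable N (\<lambda>z. tr (R (fst z) (snd z)) / n)"
    unfolding tr_eq[OF supp_resolvent] using e by (intro integrable_divide Bochner_Integration.integrable_sum)
  show "integrable N (\<lambda>z. tr (R (fst z) (snd z) * R (fst z) (snd z)) / n)"
  proof (intro integrable_divide Bochner_Integration.integrable_bound[OF W2])
    show "(\<lambda>z. tr (R (fst z) (snd z) * R (fst z) (snd z))) \<in> borel_measurable N"
      by (intro fmat_measurable_intros m)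
    have "\<bar>tr (R X W * R X W)\<bar> \<le> 1 * (1 + cW W) * (real n)\<^sup>2" for X W
    proof -
      have "\<bar>tr (R X W * R X W)\<bar> = \<bar>inner (tp (R X W)) (R X W)\<bar>" by (simp add: inner_tr)
      also have "\<dots> \<le> norm (tp (R X W)) * norm (R X W)" by (rule Cauchy_Schwarz_ineq2)
      also have "\<dots> = (norm (R X W))\<^sup>2" by (simp add: power2_eq_square)
      also note nR
      finally show ?thesis using zero_le_power2[of "real n"] unfolding distrib_right mult_1 by linarith
    qed
    then show "AE z in N. norm (tr (R (fst z) (snd z) * R (fst z) (snd z))) \<le> norm (1 * (1 + cW (snd z)) * (real n)\<^sup>2)"
      by (intro AE_I2) (simp add: order_trans[OF _ abs_ge_self] del: mult_1)
  qed
qed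

abbreviation "t1 \<equiv> trace1 \<mu> \<nu> n d p l"
abbreviation "t2 \<equiv> trace2 \<mu> \<nu> n d p l"

lemma sum_norm_square: "supp_in d k B \<Longrightarrow> (\<Sum>a<d. \<Sum>b<k. (entry B a b)\<^sup>2) = (norm B)\<^sup>2"
  by (simp add: power2_norm_supp_in)

lemma SK_eq: "SK = t1 - l * t2"
proof -
  have "SK = (\<integral>z. (norm (K (fst z) (snd z)))\<^sup>2 \<partial>N)"
    unfolding SK_def sum_norm_square[OF supp_K, symmetric] using A_square_integrable(5)
    by (simp add: Bochner_Integration.integral_sum Bochner_Integration.integrable_sum)
  also have "\<dots> = (\<integral>z. tr (R (fst z) (snd z)) / n - l * (tr (R (fst z) (snd z) * R (fst z) (snd z)) / n) \<partial>N)"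
  proof (rule integral_cong_AE)
    have "fmat_measurable N (\<lambda>z. K (fst z) (snd z))" by (rule fmat_measurable_AK) simp_all
    from measurable_norm_fmat[OF this] show "(\<lambda>z. (norm (K (fst z) (snd z)))\<^sup>2) \<in> borel_measurable N" by simp
    show "(\<lambda>z. tr (R (fst z) (snd z)) / n - l * (tr (R (fst z) (snd z) * R (fst z) (snd z)) / n)) \<in> borel_measurable N"
      by (intro borel_measurable_diff borel_measurable_times borel_measurable_const
          borel_measurable_integrable[OF integrable_traces(1)] borel_measurable_integrable[OF integrable_traces(2)])
    show "AE z in N. (norm (K (fst z) (snd z)))\<^sup>2 = tr (R (fst z) (snd z)) / n - l * (tr (R (fst z) (snd z) * R (fst z) (snd z)) / n)"
      using AE_orth AE_space
    proof eventually_elim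
      fix z assume "orth (snd z)" "z \<in> space N"
      then interpret r: ridge \<mu> n d p l "proj (snd z)" "\<lambda>X. R X (snd z)"
        by (intro ridge_instance) (auto simp: space_pair_measure)
      show "(norm (K (fst z) (snd z)))\<^sup>2 = tr (R (fst z) (snd z)) / n - l * (tr (R (fst z) (snd z) * R (fst z) (snd z)) / n)"
        using r.norm_noise_operator[of "fst z"] by (simp add: K_def r.T_def r.T2_def)
    qed
  qed
  also have "\<dots> = t1 - l * t2"
    unfolding trace1_def trace2_def Bochner_Integration.integral_diff[OF integrable_traces(1) integrable_mult_right[OF integrable_traces(2)]]
      integral_mult_right_zero ..
  finally show ?thesis .
qed

lemma TM_eq: "TM = p - l * n * t1"
proof -
  have "TM = (\<integral>z. tr (A (fst z) (snd z)) \<partial>N)"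
    unfolding TM_def mean_A_def tr_eq[OF supp_A] using A_square_integrable(3)
    by (simp add: Bochner_Integration.integral_sum)
  also have "\<dots> = (\<integral>z. p - l * n * (tr (R (fst z) (snd z)) / n) \<partial>N)"
  proof (rule integral_cong_AE)
    have "fmat_measurable N (\<lambda>z. A (fst z) (snd z))" by (rule fmat_measurable_AK) simp_all
    from measurable_tr[OF this] show "(\<lambda>z. tr (A (fst z) (snd z))) \<in> borel_measurable N" .
    show "(\<lambda>z. p - l * n * (tr (R (fst z) (snd z)) / n)) \<in> borel_measurable N"
      by (intro borel_measurable_diff borel_measurable_times borel_measurable_const borel_measurable_integrable[OF integrable_traces(1)])
    show "AE z in N. tr (A (fst z) (snd z)) = p - l * n * (tr (R (fst z) (snd z)) / n)"
      using AE_orth AE_space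
    proof eventually_elim
      fix z assume "orth (snd z)" "z \<in> space N"
      then interpret r: ridge \<mu> n d p l "proj (snd z)" "\<lambda>X. R X (snd z)"
        by (intro ridge_instance) (auto simp: space_pair_measure)
      show "tr (A (fst z) (snd z)) = p - l * n * (tr (R (fst z) (snd z)) / n)"
        using r.tr_GS[of "fst z"] unfolding A_def r.T_def .
    qed
  qed
  also have "\<dots> = p - l * n * t1"
    unfolding trace1_def Bochner_Integration.integral_diff[OF XW.integrable_const integrable_mult_right[OF integrable_traces(1)]]
      integral_mult_right_zero by (simp add: XW.prob_space)
  finally show ?thesis .
qed

text \<open>The value of \<open>err_F\<close>, made available without reference to a particular
  \<open>W\<close>.\<close>

definition eF :: real where "eF = sqrt (quad_const * d) / l + 2 * sqrt (quad_const * (d / l)) / l"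

lemma SA_close: "\<bar>SA - (p - 2 * l * n * t1 + l\<^sup>2 * n * t2 + (real d - real p) * (t1 - l * t2))\<bar> \<le> eF"
proof -
  let ?T = "\<lambda>z. tr (R (fst z) (snd z)) / n" and ?T2 = "\<lambda>z. tr (R (fst z) (snd z) * R (fst z) (snd z)) / n"
  let ?nA = "\<lambda>z. (norm (A (fst z) (snd z)))\<^sup>2"
  have nA: "integrable N ?nA" "SA = (\<integral>z. ?nA z \<partial>N)"
    unfolding SA_def sum_norm_square[OF supp_A, symmetric] using A_square_integrable(2)
    by (auto simp: Bochner_Integration.integral_sum intro!: Bochner_Integration.integrable_sum)
  let ?f = "\<lambda>z. ?nA z - (p - 2 * l * n * ?T z + l\<^sup>2 * n * ?T2 z + (real d - real p) * (?T z - l * ?T2 z))"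
  note I = integrable_traces[THEN integrable_mult_right]
  have lin: "integrable N (\<lambda>z. c0 + c1 * ?T z + c2 * ?T2 z)" "(\<integral>z. c0 + c1 * ?T z + c2 * ?T2 z \<partial>N) = c0 + c1 * t1 + c2 * t2" for c0 c1 c2
  proof -
    have i1: "integrable N (\<lambda>z. c0 + c1 * ?T z)" by (intro Bochner_Integration.integrable_add XW.integrable_const I)
    show "integrable N (\<lambda>z. c0 + c1 * ?T z + c2 * ?T2 z)" by (intro Bochner_Integration.integrable_add i1 I)
    show "(\<integral>z. c0 + c1 * ?T z + c2 * ?T2 z \<partial>N) = c0 + c1 * t1 + c2 * t2"
      unfolding Bochner_Integration.integral_add[OF i1 I(2)] Bochner_Integration.integral_add[OF XW.integrable_const I(1)]
        integral_mult_right_zero trace1_def trace2_def by (simp add: XW.prob_space)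
  qed
  have f_eq: "?f = (\<lambda>z. ?nA z - (p + (real d - real p - 2 * l * n) * ?T z + (l\<^sup>2 * n - (real d - real p) * l) * ?T2 z))"
  proof
    fix z
    have "u - (p - 2 * l * n * x + l\<^sup>2 * n * y + (real d - real p) * (x - l * y))
        = u - (p + (real d - real p - 2 * l * n) * x + (l\<^sup>2 * n - (real d - real p) * l) * y)" for u x y
      by (simp add: algebra_simps)
    then show "?f z = ?nA z - (p + (real d - real p - 2 * l * n) * ?T z + (l\<^sup>2 * n - (real d - real p) * l) * ?T2 z)" .
  qed
  have f: "integrable N ?f" unfolding f_eq by (intro Bochner_Integration.integrable_diff nA(1) lin(1))
  have "(\<integral>z. ?f z \<partial>N) = SA - (p + (real d - real p - 2 * l * n) * t1 + (l\<^sup>2 * n - (real d - real p) * l) * t2)"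
    unfolding f_eq Bochner_Integration.integral_diff[OF nA(1) lin(1)] lin(2) nA(2) ..
  also have "\<dots> = SA - (p - 2 * l * n * t1 + l\<^sup>2 * n * t2 + (real d - real p) * (t1 - l * t2))"
    by (simp add: algebra_simps)
  finally have val: "(\<integral>z. ?f z \<partial>N) = SA - (p - 2 * l * n * t1 + l\<^sup>2 * n * t2 + (real d - real p) * (t1 - l * t2))" .
  have "\<bar>\<integral>z. ?f z \<partial>N\<bar> \<le> eF"
  proof (rule integral_bound_W[OF f])
    fix W assume W: "orth W" "W \<in> space \<nu>"
    interpret r: ridge \<mu> n d p l "proj W" "\<lambda>X. R X W" by (rule ridge_instance[OF W])
    have "?f (X, W) = r.F X - (real d - real p) * (r.T X - l * r.T2 X)" for X
      using r.norm_GS_split[of X] by (simp add: A_def r.T_def r.T2_def)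
    then have "(\<integral>X. ?f (X, W) \<partial>MX) = (\<integral>X. r.F X - (real d - real p) * (r.T X - l * r.T2 X) \<partial>MX)" by simp
    also have "\<dots> = (\<integral>X. r.F X \<partial>MX) - (real d - real p) * (\<integral>X. r.T X - l * r.T2 X \<partial>MX)"
      using r.integrable_T r.integrable_T2 r.integrable_F by simp
    finally show "\<bar>\<integral>X. ?f (X, W) \<partial>MX\<bar> \<le> eF" using r.F_expectation by (simp add: r.err_F_def eF_def)
  qed
  then show ?thesis unfolding val .
qed

text \<open>A sign change of one coordinate annihilates the off-diagonal means, transpositions make
  the diagonal ones equal, and the trace p fixes their value.\<close>

lemma mean_projection:
  assumes "a < d" "b < d"
  shows "integrable \<nu> (\<lambda>W. entry (proj W) a b)" "(\<integral>W. entry (proj W) a b \<partial>\<nu>) = (if a = b then p / d else 0)"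
proof -
  have mW: "fmat_measurable \<nu> (fm p d)" by (intro fmat_measurable_fm measurable_W)
  have mP: "(\<lambda>W. entry (proj W) a b) \<in> borel_measurable \<nu>" for a b by (intro fmat_measurable_intros mW)
  have intP: "integrable \<nu> (\<lambda>W. entry (proj W) a b)" for a b
  proof (rule W.integrable_const_bound[OF _ mP])
    show "AE W in \<nu>. norm (entry (proj W) a b) \<le> p"
      using orthonormal
    proof eventually_elim
      fix W assume "orth W"
      have "\<bar>entry (proj W) a b\<bar> \<le> norm (proj W)" by (rule abs_entry_le_norm)
      also have "\<dots> \<le> norm (tp (fm p d W)) * norm (fm p d W)" by (rule norm_mult_ineq)
      also have "\<dots> = p" using norm_orthonormal[OF \<open>orth W\<close>] by (simp add: power2_eq_square)
      finally show "norm (entry (proj W) a b) \<le> p" by simp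
    qed
  qed
  show "integrable \<nu> (\<lambda>W. entry (proj W) a b)" by (rule intP)
  \<comment> \<open>Taking \<tau> to be an involution makes it its own inverse in the orthogonality
    check; the identity and transpositions are the only cases used.\<close>
  have signed_permutation: "(\<integral>W. entry (proj W) a b \<partial>\<nu>) = s a * s b * (\<integral>W. entry (proj W) (\<tau> a) (\<tau> b) \<partial>\<nu>)"
    if ab: "a < d" "b < d" and \<tau>: "\<And>k. \<tau> (\<tau> k) = k" "\<And>k. k < d \<Longrightarrow> \<tau> k < d" and s: "\<And>k. s k * s k = (1::real)" for a b s \<tau>
  proof -
    define Q where "Q = Matrix.mat d d (\<lambda>(i, j). if i = \<tau> j then s j else 0)"
    have Q: "Q \<in> carrier_mat d d" by (simp add: Q_def)
    have "Q * Q\<^sup>T = 1\<^sub>m d"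
    proof (rule eq_matI)
      fix i j assume ij: "i < dim_row (1\<^sub>m d :: real mat)" "j < dim_col (1\<^sub>m d :: real mat)"
      then have "(Q * Q\<^sup>T) $$ (i, j) = (\<Sum>k<d. (if i = \<tau> k then s k else 0) * (if j = \<tau> k then s k else 0))"
        by (simp add: Q_def scalar_prod_def atLeast0LessThan)
      also have "\<dots> = (\<Sum>k<d. if k = \<tau> i then (if i = j then 1 else 0) else 0)"
      proof (intro sum.cong refl)
        fix k
        have "k = \<tau> i \<longleftrightarrow> i = \<tau> k" using \<tau>(1) by metis
        then show "(if i = \<tau> k then s k else 0) * (if j = \<tau> k then s k else 0) = (if k = \<tau> i then (if i = j then 1 else 0) else 0)"
          using s by auto
      qed
      finally show "(Q * Q\<^sup>T) $$ (i, j) = 1\<^sub>m d $$ (i, j)" using ij \<tau>(2)[of i] by simp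
    qed (simp_all add: Q_def)
    then have inv: "distr \<nu> \<nu> (\<lambda>W. mat_entries (Matrix.mat p d W * Q)) = \<nu>"
      using uniform Q by (auto simp: uniform_orthonormal_rows_def)
    have me: "mat_entries (Matrix.mat p d W * Q) = restrict (\<lambda>ij. W (fst ij, \<tau> (snd ij)) * s (snd ij)) ({..<p} \<times> {..<d})" for W
    proof -
      have "(Matrix.mat p d W * Q) $$ (i, j) = W (i, \<tau> j) * s j" if "i < p" "j < d" for i j
      proof -
        have "(Matrix.mat p d W * Q) $$ (i, j) = (\<Sum>k<d. W (i, k) * (if k = \<tau> j then s j else 0))"
          using that by (simp add: Q_def scalar_prod_def atLeast0LessThan)
        also have "\<dots> = (\<Sum>k<d. if k = \<tau> j then W (i, k) * s j else 0)" by (intro sum.cong) auto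
        finally show ?thesis using \<tau>(2)[OF that(2)] by simp
      qed
      then show ?thesis by (auto simp: mat_entries_def Q_def restrict_def fun_eq_iff)
    qed
    have meas: "(\<lambda>W. mat_entries (Matrix.mat p d W * Q)) \<in> measurable \<nu> \<nu>"
    proof (subst measurable_cong_sets[OF refl sets_nu], unfold me, rule measurable_restrict)
      fix ij assume "ij \<in> {..<p} \<times> {..<d}"
      then show "(\<lambda>W. W (fst ij, \<tau> (snd ij)) * s (snd ij)) \<in> borel_measurable \<nu>"
        using \<tau>(2) by (intro borel_measurable_times measurable_W) auto
    qed
    have ent: "entry (proj (mat_entries (Matrix.mat p d W * Q))) a b = s a * s b * entry (proj W) (\<tau> a) (\<tau> b)" for W
      unfolding entry_mult[OF supp_in_tp[OF supp_in_fm]] me sum_distrib_left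
      using ab \<tau>(2) by (intro sum.cong refl) (simp add: mult_ac)
    have "(\<integral>W. entry (proj W) a b \<partial>\<nu>) = (\<integral>W. entry (proj W) a b \<partial>distr \<nu> \<nu> (\<lambda>W. mat_entries (Matrix.mat p d W * Q)))"
      by (simp only: inv)
    also have "\<dots> = (\<integral>W. entry (proj (mat_entries (Matrix.mat p d W * Q))) a b \<partial>\<nu>)"
      by (rule integral_distr[OF meas mP])
    also have "\<dots> = s a * s b * (\<integral>W. entry (proj W) (\<tau> a) (\<tau> b) \<partial>\<nu>)"
      unfolding ent by (rule integral_mult_right_zero)
    finally show ?thesis .
  qed
  show "(\<integral>W. entry (proj W) a b \<partial>\<nu>) = (if a = b then p / d else 0)"
  proof (cases "a = b")
    case False
    have "(\<integral>W. entry (proj W) a b \<partial>\<nu>) = (if a = a then -1 else 1) * (if b = a then -1 else 1) * (\<integral>W. entry (proj W) a b \<partial>\<nu>)"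
      by (rule signed_permutation[OF assms, of "\<lambda>k. k" "\<lambda>k. if k = a then -1 else 1"]) auto
    then show ?thesis using False by simp
  next
    case True
    have diag: "(\<integral>W. entry (proj W) c c \<partial>\<nu>) = (\<integral>W. entry (proj W) a a \<partial>\<nu>)" if "c < d" for c
      using signed_permutation[OF that that, of "Transposition.transpose a c" "\<lambda>_. 1"] that assms(1)
      by (simp add: Transposition.transpose_def)
    have "(\<Sum>c<d. \<integral>W. entry (proj W) c c \<partial>\<nu>) = (\<integral>W. tr (proj W) \<partial>\<nu>)"
      unfolding tr_eq[OF supp_in_mult[OF supp_in_tp[OF supp_in_fm] supp_in_fm]] using intP
      by (simp add: Bochner_Integration.integral_sum)
    also have "\<dots> = (\<integral>W. p \<partial>\<nu>)"
    proof (rule integral_cong_AE)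
      show "(\<lambda>W. tr (proj W)) \<in> borel_measurable \<nu>" by (intro fmat_measurable_intros mW)
      show "AE W in \<nu>. tr (proj W) = p"
        using orthonormal by eventually_elim (subst tr_mult_commute, simp)
    qed simp
    finally have "(\<Sum>c<d. \<integral>W. entry (proj W) a a \<partial>\<nu>) = p" using diag by (simp add: W.prob_space)
    then show ?thesis using True d_pos by (simp add: field_simps)
  qed
qed

section \<open>Approximation of traces and conditional means, uniformly in \<open>W\<close>\<close>

context
  fixes t \<gamma> :: real
  assumes t_nonneg: "0 \<le> t" and t_eq: "l * t + t / (1 + t) = \<gamma>"
begin

text \<open>These are \<open>err_T\<close>, \<open>err_q\<close>, \<open>err_D\<close> and \<open>kap\<close>, restated here because there they formally depend on
  the projection, that is on \<open>W\<close>.\<close>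

definition eT :: real where
  "eT = 2 * (2 * (quad_const * p + 1) / (l * n)\<^sup>2 + (p / n - \<gamma>)\<^sup>2) / l\<^sup>2"
definition eQ :: real where "eQ = 2 * (2 * (quad_const * p + 1) / (l * n)\<^sup>2) + 2 * eT"
definition eD :: real where "eD = (sqrt ((2 * quad_const + 2 * p) * eQ) + sqrt quad_const + 1) / l"
definition kappa :: real where "kappa = 1 / (1 + t) / (l + 1 / (1 + t))"

lemma t1_close: "\<bar>t1 - t\<bar> \<le> sqrt eT"
proof -
  let ?T = "\<lambda>z. tr (R (fst z) (snd z)) / n"
  have "\<bar>\<integral>z. ?T z - t \<partial>N\<bar> \<le> sqrt eT"
  proof (rule integral_bound_W)
    show "integrable N (\<lambda>z. ?T z - t)" using integrable_traces(1) by simp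
    fix W assume W: "orth W" "W \<in> space \<nu>"
    interpret r: ridge \<mu> n d p l "proj W" "\<lambda>X. R X W" by (rule ridge_instance[OF W])
    note c = r.T_concentration[OF t_nonneg t_eq]
    have "(\<lambda>X. r.T X - t) \<in> borel_measurable MX" using r.meas_T by simp
    note e = X.expectation_abs_le[OF this c(1)]
    have "\<bar>\<integral>X. r.T X - t \<partial>MX\<bar> \<le> (\<integral>X. \<bar>r.T X - t\<bar> \<partial>MX)" by (rule integral_abs_bound)
    also have "\<dots> \<le> sqrt (\<integral>X. (r.T X - t)\<^sup>2 \<partial>MX)" by (rule e(2))
    also have "\<dots> \<le> sqrt (r.err_T \<gamma>)" using c(2) by simp
    also have "r.err_T \<gamma> = eT" by (simp add: r.err_T_def[OF t_nonneg t_eq] r.noise_T_def eT_def)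
    finally show "\<bar>\<integral>X. ?T (X, W) - t \<partial>MX\<bar> \<le> sqrt eT" by (simp add: r.T_def)
  qed
  moreover have "(\<integral>z. ?T z - t \<partial>N) = t1 - t"
    unfolding trace1_def Bochner_Integration.integral_diff[OF integrable_traces(1) XW.integrable_const] by (simp add: XW.prob_space)
  ultimately show ?thesis by simp
qed

lemma mean_given_W_close:
  assumes W: "orth W" "W \<in> space \<nu>"
  shows "norm (fm d d (\<lambda>(a, b). mean_given_W a b W) - kappa *\<^sub>R proj W) \<le> 2 * eD"
    and "norm (proj W) = sqrt p"
proof -
  interpret r: ridge \<mu> n d p l "proj W" "\<lambda>X. R X W" by (rule ridge_instance[OF W])
  have "r.err_D \<gamma> = eD"
    by (simp add: r.err_D_def[OF t_nonneg t_eq] r.err_q_def[OF t_nonneg t_eq] r.err_T_def[OF t_nonneg t_eq] r.noise_T_def eT_def eQ_def eD_def)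
  then show "norm (fm d d (\<lambda>(a, b). mean_given_W a b W) - kappa *\<^sub>R proj W) \<le> 2 * eD"
    using r.mean_GS_deviation[OF t_nonneg t_eq]
    by (simp add: r.mean_GS_def[OF t_nonneg t_eq] r.kap_def[OF t_nonneg t_eq] kappa_def mean_given_W_def A_def)
  show "norm (proj W) = sqrt p" by (rule r.norm_P)
qed

lemma kappa_bounds: "0 \<le> kappa" "kappa \<le> 1"
proof -
  have w: "0 < 1 / (1 + t)" using t_nonneg by simp
  have "x / (l + x) \<le> 1 \<and> 0 \<le> x / (l + x)" if "0 < x" for x using that l_pos by simp
  from this[OF w] show "0 \<le> kappa" "kappa \<le> 1" unfolding kappa_def by blast+
qed

lemma eD_nonneg: "0 \<le> eD"
proof -
  have "0 \<le> eT" using quad_const_ge by (simp add: eT_def)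
  then have "0 \<le> eQ" using quad_const_ge by (simp add: eQ_def)
  then show ?thesis using quad_const_ge l_pos by (simp add: eD_def)
qed

text \<open>A difference of squares: the error of the norms is at most 2 \<open>eD\<close>, which is
  o(sqrt d) in the limit, and the sum of the norms is of order sqrt d, so the product is
  o(d).\<close>

lemma SW_close: "\<bar>SW - kappa\<^sup>2 * p\<bar> \<le> 2 * eD * (2 * kappa * sqrt p + 2 * eD)"
proof -
  let ?m = "\<lambda>W. (norm (fm d d (\<lambda>(a, b). mean_given_W a b W)))\<^sup>2"
  have m: "?m W = (\<Sum>a<d. \<Sum>b<d. (mean_given_W a b W)\<^sup>2)" for W
    by (simp add: power2_norm_supp_in[OF supp_in_fm])
  have int: "integrable \<nu> ?m" unfolding m using A_conditional(2) by (intro Bochner_Integration.integrable_sum)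
  have SW: "SW = (\<integral>W. ?m W \<partial>\<nu>)"
    unfolding SW_def m using A_conditional(2) by (simp add: Bochner_Integration.integral_sum Bochner_Integration.integrable_sum)
  have "\<bar>SW - kappa\<^sup>2 * p\<bar> = \<bar>\<integral>W. ?m W - kappa\<^sup>2 * p \<partial>\<nu>\<bar>"
    unfolding SW using int by (simp add: W.prob_space)
  also have "\<dots> \<le> (\<integral>W. \<bar>?m W - kappa\<^sup>2 * p\<bar> \<partial>\<nu>)" by (rule integral_abs_bound)
  also have "\<dots> \<le> (\<integral>W. 2 * eD * (2 * kappa * sqrt p + 2 * eD) \<partial>\<nu>)"
  proof (rule integral_mono_AE)
    show "AE W in \<nu>. \<bar>?m W - kappa\<^sup>2 * p\<bar> \<le> 2 * eD * (2 * kappa * sqrt p + 2 * eD)"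
      using orthonormal AE_space
    proof eventually_elim
      fix W assume W: "orth W" "W \<in> space \<nu>"
      let ?B = "fm d d (\<lambda>(a, b). mean_given_W a b W)"
      note c = mean_given_W_close[OF W]
      have k: "norm (kappa *\<^sub>R proj W) = kappa * sqrt p" using kappa_bounds c(2) by simp
      have "\<bar>norm ?B - kappa * sqrt p\<bar> \<le> 2 * eD"
        using norm_triangle_ineq3[of ?B "kappa *\<^sub>R proj W"] c(1) unfolding k by linarith
      then have "\<bar>norm ?B - kappa * sqrt p\<bar> * \<bar>norm ?B + kappa * sqrt p\<bar> \<le> 2 * eD * (2 * kappa * sqrt p + 2 * eD)"
      proof (intro mult_mono)
        have "0 \<le> kappa * sqrt p" using kappa_bounds by simp
        with \<open>\<bar>norm ?B - kappa * sqrt p\<bar> \<le> 2 * eD\<close>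
        show "\<bar>norm ?B + kappa * sqrt p\<bar> \<le> 2 * kappa * sqrt p + 2 * eD" unfolding mult.assoc by linarith
      qed (use eD_nonneg in auto)
      moreover have "?m W - kappa\<^sup>2 * p = (norm ?B - kappa * sqrt p) * (norm ?B + kappa * sqrt p)"
        by (simp add: power2_eq_square algebra_simps)
      ultimately show "\<bar>?m W - kappa\<^sup>2 * p\<bar> \<le> 2 * eD * (2 * kappa * sqrt p + 2 * eD)" by (simp only: abs_mult)
    qed
  qed (use int in auto)
  finally show ?thesis by (simp add: W.prob_space)
qed

text \<open>Since \<open>proj W\<close> has mean (p / d) times the identity, the full mean is
  compared with kappa (p / d) times the identity, whose norm is kappa p / sqrt d. The square of a
  mean is at most the mean of the square, entry by entry, so the conditional error bound survives
  averaging. The square root appears because the error is one of norms.\<close>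

lemma SM_close: "\<bar>sqrt SM - kappa * (p / sqrt d)\<bar> \<le> 2 * eD"
proof -
  let ?MA = "fm d d (\<lambda>(a, b). mean_A a b)" and ?I = "(kappa * (p / d)) *\<^sub>R idm d"
  have SM: "sqrt SM = norm ?MA"
    unfolding SM_def using power2_norm_supp_in[OF supp_in_fm, of d d "\<lambda>(a, b). mean_A a b"]
    by (simp add: real_sqrt_unique)
  have "(norm (idm d))\<^sup>2 = d"
    using idm_mult[OF supp_in_idm] by (simp add: power2_norm_fmat inner_tr)
  then have "norm (idm d) = sqrt d" by (simp add: real_sqrt_unique)
  then have I: "norm ?I = kappa * (p / sqrt d)"
  proof -
    have "p / (x * x) * x = p / x" if "0 < x" for x :: real using that by simp
    from this[of "sqrt d"] have "p / d * sqrt d = p / sqrt d" using d_pos by simp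
    moreover have "norm ?I = kappa * (p / d * sqrt d)"
      using \<open>norm (idm d) = sqrt d\<close> kappa_bounds by simp
    ultimately show ?thesis by (simp only:)
  qed
  have "(norm (?MA - ?I))\<^sup>2 \<le> (2 * eD)\<^sup>2"
  proof -
    let ?e = "\<lambda>a b W. mean_given_W a b W - kappa * entry (proj W) a b"
    have mean_eq: "entry (?MA - ?I) a b = (\<integral>W. ?e a b W \<partial>\<nu>)" if "a < d" "b < d" for a b
      using that mean_projection[OF that] A_conditional(1,2)[of a b] W.square_integrable_imp_integrable[OF A_conditional(1,2)]
      by (simp add: A_conditional(3) entry_idm)
    have e2: "integrable \<nu> (\<lambda>W. (?e a b W)\<^sup>2)" "(\<lambda>W. ?e a b W) \<in> borel_measurable \<nu>" if "a < d" "b < d" for a b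
    proof -
      have mW: "fmat_measurable \<nu> (fm p d)" by (intro fmat_measurable_fm measurable_W)
      have mP [measurable]: "(\<lambda>W. entry (proj W) a b) \<in> borel_measurable \<nu>" by (intro fmat_measurable_intros mW)
      have mh [measurable]: "mean_given_W a b \<in> borel_measurable \<nu>" by (rule A_conditional(1))
      show "(\<lambda>W. ?e a b W) \<in> borel_measurable \<nu>" by measurable
      have P2: "integrable \<nu> (\<lambda>W. (entry (proj W) a b)\<^sup>2)"
      proof (rule W.integrable_const_bound)
        show "AE W in \<nu>. norm ((entry (proj W) a b)\<^sup>2) \<le> p"
          using orthonormal AE_space
        proof eventually_elim
          fix W assume "orth W" "W \<in> space \<nu>"
          then have "norm (proj W) = sqrt p" by (rule mean_given_W_close(2))
          then show "norm ((entry (proj W) a b)\<^sup>2) \<le> p"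
            using power_mono[OF abs_entry_le_norm[of "proj W" a b] abs_ge_zero, of 2] by simp
        qed
      qed simp
      show "integrable \<nu> (\<lambda>W. (?e a b W)\<^sup>2)"
      proof (rule Bochner_Integration.integrable_bound)
        show "integrable \<nu> (\<lambda>W. 2 * (mean_given_W a b W)\<^sup>2 + 2 * (kappa\<^sup>2 * (entry (proj W) a b)\<^sup>2))"
          using A_conditional(2)[of a b] P2 by simp
        have "(?e a b W)\<^sup>2 \<le> 2 * (mean_given_W a b W)\<^sup>2 + 2 * (kappa\<^sup>2 * (entry (proj W) a b)\<^sup>2)" for W
          using square_sum_le[of "mean_given_W a b W" "- (kappa * entry (proj W) a b)"] by (simp add: power_mult_distrib)
        then show "AE W in \<nu>. norm ((?e a b W)\<^sup>2) \<le> norm (2 * (mean_given_W a b W)\<^sup>2 + 2 * (kappa\<^sup>2 * (entry (proj W) a b)\<^sup>2))"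
          by (intro AE_I2) (simp add: order_trans[OF _ abs_ge_self])
      qed simp
    qed
    have supp: "supp_in d d (?MA - ?I)" by (intro supp_in_diff supp_in_fm supp_in_scaleR supp_in_idm)
    have "(norm (?MA - ?I))\<^sup>2 = (\<Sum>a<d. \<Sum>b<d. (\<integral>W. ?e a b W \<partial>\<nu>)\<^sup>2)"
      unfolding power2_norm_supp_in[OF supp] by (intro sum.cong refl) (simp only: mean_eq lessThan_iff)
    also have "\<dots> \<le> (\<Sum>a<d. \<Sum>b<d. (\<integral>W. (?e a b W)\<^sup>2 \<partial>\<nu>))"
      using e2 by (intro sum_mono W.square_integral_le) auto
    also have "\<dots> = (\<integral>W. (\<Sum>a<d. \<Sum>b<d. (?e a b W)\<^sup>2) \<partial>\<nu>)"
    proof -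
      have i: "integrable \<nu> (\<lambda>W. \<Sum>b<d. (?e a b W)\<^sup>2)" if "a < d" for a
        by (intro Bochner_Integration.integrable_sum e2(1)) (use that in auto)
      have "(\<integral>W. (\<Sum>a<d. \<Sum>b<d. (?e a b W)\<^sup>2) \<partial>\<nu>) = (\<Sum>a<d. \<integral>W. (\<Sum>b<d. (?e a b W)\<^sup>2) \<partial>\<nu>)"
        by (intro Bochner_Integration.integral_sum i) simp
      also have "\<dots> = (\<Sum>a<d. \<Sum>b<d. (\<integral>W. (?e a b W)\<^sup>2 \<partial>\<nu>))"
        by (intro sum.cong refl Bochner_Integration.integral_sum e2(1)) auto
      finally show ?thesis by simp
    qed
    also have "\<dots> \<le> (\<integral>W. (2 * eD)\<^sup>2 \<partial>\<nu>)"
    proof (rule integral_mono_AE)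
      show "integrable \<nu> (\<lambda>W. \<Sum>a<d. \<Sum>b<d. (?e a b W)\<^sup>2)" using e2(1) by (intro Bochner_Integration.integrable_sum) auto
      show "AE W in \<nu>. (\<Sum>a<d. \<Sum>b<d. (?e a b W)\<^sup>2) \<le> (2 * eD)\<^sup>2"
        using orthonormal AE_space
      proof eventually_elim
        fix W assume W: "orth W" "W \<in> space \<nu>"
        have supp': "supp_in d d (fm d d (\<lambda>(a, b). mean_given_W a b W) - kappa *\<^sub>R proj W)"
          by (intro supp_in_diff supp_in_fm supp_in_scaleR supp_in_mult[OF supp_in_tp[OF supp_in_fm] supp_in_fm])
        have "(\<Sum>a<d. \<Sum>b<d. (?e a b W)\<^sup>2) = (norm (fm d d (\<lambda>(a, b). mean_given_W a b W) - kappa *\<^sub>R proj W))\<^sup>2"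
          unfolding power2_norm_supp_in[OF supp'] by (intro sum.cong refl) simp
        also have "\<dots> \<le> (2 * eD)\<^sup>2" by (intro power_mono mean_given_W_close W) simp
        finally show "(\<Sum>a<d. \<Sum>b<d. (?e a b W)\<^sup>2) \<le> (2 * eD)\<^sup>2" .
      qed
    qed simp
    finally show ?thesis by (simp add: W.prob_space)
  qed
  then have "norm (?MA - ?I) \<le> 2 * eD" by (rule power2_le_imp_le) (use eD_nonneg in simp)
  then show ?thesis using norm_triangle_ineq3[of ?MA ?I] unfolding SM I by linarith
qed

end

end

lemma trace_squeeze:
  assumes "ridge_model \<mu> \<nu> n d p l" "ridge_model \<mu> \<nu> n d p l'" "l < l'"
  shows "trace2 \<mu> \<nu> n d p l' \<le> (trace1 \<mu> \<nu> n d p l - trace1 \<mu> \<nu> n d p l') / (l' - l)"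
    "(trace1 \<mu> \<nu> n d p l - trace1 \<mu> \<nu> n d p l') / (l' - l) \<le> trace2 \<mu> \<nu> n d p l"
proof -
  interpret A: ridge_model \<mu> \<nu> n d p l by fact
  interpret B: ridge_model \<mu> \<nu> n d p l' by fact
  let ?q = "\<lambda>z. (tr (A.R (fst z) (snd z)) / n - tr (B.R (fst z) (snd z)) / n) / (l' - l)"
  have q: "integrable A.N ?q" using A.integrable_traces(1) B.integrable_traces(1) by simp
  have "(\<integral>z. ?q z \<partial>A.N) = (trace1 \<mu> \<nu> n d p l - trace1 \<mu> \<nu> n d p l') / (l' - l)"
    unfolding trace1_def integral_divide_zero Bochner_Integration.integral_diff[OF A.integrable_traces(1) B.integrable_traces(1)] ..
  note val = this
  have bounds: "tr (B.R (fst z) (snd z) * B.R (fst z) (snd z)) / n \<le> ?q z \<and> ?q z \<le> tr (A.R (fst z) (snd z) * A.R (fst z) (snd z)) / n"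
    if "A.orth (snd z)" for z
  proof -
    note r = resolvent_trace_difference[OF resolvent_projected[OF A.l_pos A.n_pos that] resolvent_projected[OF B.l_pos A.n_pos that] less_imp_le[OF assms(3)],
        of "fst z"]
    have "?q z = tr (A.R (fst z) (snd z) * B.R (fst z) (snd z)) / n"
      using r(1) assms(3) by (simp flip: diff_divide_distrib)
    then show ?thesis using r(2,3) A.n_pos by (simp add: divide_right_mono)
  qed
  show "trace2 \<mu> \<nu> n d p l' \<le> (trace1 \<mu> \<nu> n d p l - trace1 \<mu> \<nu> n d p l') / (l' - l)"
    unfolding val[symmetric] trace2_def
    by (rule integral_mono_AE[OF B.integrable_traces(2) q]) (use A.AE_orth bounds in \<open>auto elim!: eventually_mono\<close>)
  show "(trace1 \<mu> \<nu> n d p l - trace1 \<mu> \<nu> n d p l') / (l' - l) \<le> trace2 \<mu> \<nu> n d p l"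
    unfolding val[symmetric] trace2_def
    by (rule integral_mono_AE[OF q A.integrable_traces(2)]) (use A.AE_orth bounds in \<open>auto elim!: eventually_mono\<close>)
qed

section \<open>Limits\<close>

lemma limit_cong:
  fixes f g :: "nat \<Rightarrow> real"
  assumes "f \<longlonglongrightarrow> L" "\<forall>\<^sub>F d in sequentially. f d = g d" "L = M"
  shows "g \<longlonglongrightarrow> M"
  using Lim_transform_eventually[OF assms(1,2)] assms(3) by simp

lemma vanishing_bound:
  fixes f g :: "nat \<Rightarrow> real"
  assumes "\<forall>\<^sub>F d in sequentially. \<bar>f d - c d\<bar> \<le> g d" "g \<longlonglongrightarrow> 0" "c \<longlonglongrightarrow> L"
  shows "f \<longlonglongrightarrow> L"
proof -
  have "(\<lambda>d. f d - c d) \<longlonglongrightarrow> 0"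
    by (rule Lim_null_comparison[OF _ assms(2)]) (use assms(1) in simp)
  from tendsto_add[OF this assms(3)] show ?thesis by simp
qed

section \<open>The proportional regime\<close>

locale ridge_asymptotics = standard_law \<mu> for \<mu> :: "real measure" +
  fixes \<pi> \<delta> :: real and p n :: "nat \<Rightarrow> nat" and \<nu> :: "nat \<Rightarrow> (nat \<times> nat \<Rightarrow> real) measure"
  assumes pi_pos: "0 < \<pi>" and delta_pos: "0 < \<delta>"
    and p_le: "\<And>d. p d \<le> d"
    and p_lim: "(\<lambda>d. real (p d) / real d) \<longlonglongrightarrow> \<pi>"
    and n_lim: "(\<lambda>d. real d / real (n d)) \<longlonglongrightarrow> \<delta>"
    and unif: "\<And>d. uniform_orthonormal_rows (p d) d (\<nu> d)"
begin

definition \<gamma> :: real where "\<gamma> = \<pi> * \<delta>"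

lemma gamma_pos: "0 < \<gamma>"
  using pi_pos delta_pos by (simp add: \<gamma>_def)

lemma eventually_pos: "\<forall>\<^sub>F d in sequentially. 0 < d \<and> 0 < n d"
  using order_tendstoD(1)[OF n_lim delta_pos]
  by eventually_elim (auto intro: gr0I)

lemma eventually_model:
  assumes "0 < l"
  shows "\<forall>\<^sub>F d in sequentially. ridge_model \<mu> (\<nu> d) (n d) d (p d) l"
  using eventually_pos
  by eventually_elim (use assms p_le unif in \<open>auto simp: ridge_model_def ridge_model_axioms_def standard_law_axioms\<close>)

lemma inverse_n: "(\<lambda>d. 1 / real (n d)) \<longlonglongrightarrow> 0"
proof -
  have "(\<lambda>d. real d / real (n d) * (1 / real d)) \<longlonglongrightarrow> \<delta> * 0" by (intro tendsto_mult n_lim lim_1_over_n)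
  moreover have "\<forall>\<^sub>F d in sequentially. real d / real (n d) * (1 / real d) = 1 / real (n d)"
    using eventually_gt_at_top[of 0] by eventually_elim simp
  ultimately show ?thesis by (rule limit_cong) simp
qed

lemma p_over_n: "(\<lambda>d. real (p d) / real (n d)) \<longlonglongrightarrow> \<gamma>"
proof -
  have "(\<lambda>d. real (p d) / real d * (real d / real (n d))) \<longlonglongrightarrow> \<pi> * \<delta>" by (intro tendsto_mult n_lim p_lim)
  moreover have "\<forall>\<^sub>F d in sequentially. real (p d) / real d * (real d / real (n d)) = real (p d) / real (n d)"
    using eventually_gt_at_top[of 0] by eventually_elim simp
  ultimately show ?thesis by (rule limit_cong) (simp add: \<gamma>_def)
qed

lemma n_over_d: "(\<lambda>d. real (n d) / real d) \<longlonglongrightarrow> 1 / \<delta>"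
  using tendsto_inverse[OF n_lim] delta_pos by (simp add: inverse_eq_divide)

context
  fixes l :: real
  assumes l: "0 < l"
begin

definition t :: real where "t = \<gamma> * theta1 \<gamma> l"
definition \<kappa> :: real where "\<kappa> = 1 - l * theta1 \<gamma> l"

lemma t_facts: "0 \<le> t" "l * t + t / (1 + t) = \<gamma>" and kappa_eq: "ridge_model.kappa l t = \<kappa>"
proof -
  note f = theta1_fixed_point[OF gamma_pos l, folded t_def]
  show 1: "0 \<le> t" "l * t + t / (1 + t) = \<gamma>" by (rule f)+
  \<comment> \<open>\<open>kappa\<close> depends on \<open>l\<close> and \<open>t\<close> only, but
    its defining equation is available only inside an instance of the model; any sufficiently large
    d supplies one.\<close>
  obtain d where "ridge_model \<mu> (\<nu> d) (n d) d (p d) l"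
    using eventually_happens'[OF _ eventually_model[OF l]] by auto
  then interpret r: ridge_model \<mu> "\<nu> d" "n d" d "p d" l .
  have "x / (l + x) = 1 - l * (1 / (l + x))" if "0 < x" for x
    using that l by (simp add: field_simps)
  moreover have "0 < 1 / (1 + t)" using 1 by simp
  ultimately show "ridge_model.kappa l t = \<kappa>"
    unfolding r.kappa_def[OF 1] \<kappa>_def f(3) by blast
qed

section \<open>Vanishing of the error terms\<close>

abbreviation "\<epsilon>T d \<equiv> ridge_model.eT \<mu> (n d) (p d) l \<gamma>"
abbreviation "\<epsilon>Q d \<equiv> ridge_model.eQ \<mu> (n d) (p d) l \<gamma>"
abbreviation "\<epsilon>D d \<equiv> ridge_model.eD \<mu> (n d) (p d) l \<gamma>"

lemma noise_limit: "(\<lambda>d. 2 * (quad_const * real (p d) + 1) / (l * real (n d))\<^sup>2) \<longlonglongrightarrow> 0"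
proof -
  have "(\<lambda>d. 2 / l\<^sup>2 * (quad_const * (real (p d) / real (n d)) * (1 / real (n d)) + (1 / real (n d))\<^sup>2)) \<longlonglongrightarrow> 2 / l\<^sup>2 * (quad_const * \<gamma> * 0 + 0\<^sup>2)"
    by (intro tendsto_intros p_over_n inverse_n)
  moreover have "2 / l\<^sup>2 * (c * (x / m) * (1 / m) + (1 / m)\<^sup>2) = 2 * (c * x + 1) / (l * m)\<^sup>2" for c x m :: real
    using l by (cases "m = 0") (simp_all add: field_simps power2_eq_square)
  ultimately show ?thesis by simp
qed

lemma eT_limit: "\<epsilon>T \<longlonglongrightarrow> 0"
proof -
  have "(\<lambda>d. 2 * (2 * (quad_const * real (p d) + 1) / (l * real (n d))\<^sup>2 + (real (p d) / real (n d) - \<gamma>)\<^sup>2) / l\<^sup>2) \<longlonglongrightarrow> 2 * (0 + (\<gamma> - \<gamma>)\<^sup>2) / l\<^sup>2"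
    using l by (intro tendsto_intros noise_limit p_over_n) auto
  moreover have "\<forall>\<^sub>F d in sequentially. 2 * (2 * (quad_const * real (p d) + 1) / (l * real (n d))\<^sup>2 + (real (p d) / real (n d) - \<gamma>)\<^sup>2) / l\<^sup>2 = \<epsilon>T d"
    using eventually_model[OF l] by eventually_elim (rule ridge_model.eT_def[OF _ t_facts(1,2), symmetric])
  ultimately show ?thesis by (rule limit_cong) simp
qed

lemma eQ_limit: "\<epsilon>Q \<longlonglongrightarrow> 0"
proof -
  have "(\<lambda>d. 2 * (2 * (quad_const * real (p d) + 1) / (l * real (n d))\<^sup>2) + 2 * \<epsilon>T d) \<longlonglongrightarrow> 2 * 0 + 2 * 0"
    by (intro tendsto_intros noise_limit eT_limit)
  moreover have "\<forall>\<^sub>F d in sequentially. 2 * (2 * (quad_const * real (p d) + 1) / (l * real (n d))\<^sup>2) + 2 * \<epsilon>T d = \<epsilon>Q d"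
    using eventually_model[OF l] by eventually_elim (rule ridge_model.eQ_def[OF _ t_facts(1,2), symmetric])
  ultimately show ?thesis by (rule limit_cong) simp
qed

text \<open>After division by d, the factor with p under the root stays bounded while the squared
  error of the quadratic forms tends to 0; the other two summands of \<open>eD\<close> are
  constants.\<close>

lemma eD_limit: "(\<lambda>d. \<epsilon>D d / sqrt d) \<longlonglongrightarrow> 0"
proof -
  let ?f = "\<lambda>d. (sqrt ((2 * quad_const * (1 / real d) + 2 * (real (p d) / real d)) * \<epsilon>Q d) + sqrt (quad_const * (1 / real d)) + sqrt (1 / real d)) / l"
  have "?f \<longlonglongrightarrow> (sqrt ((2 * quad_const * 0 + 2 * \<pi>) * 0) + sqrt (quad_const * 0) + sqrt 0) / l"
    using l by (intro tendsto_intros lim_1_over_n p_lim eQ_limit) auto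
  moreover have "\<forall>\<^sub>F d in sequentially. ?f d = \<epsilon>D d / sqrt d"
    using eventually_model[OF l]
  proof eventually_elim
    fix d assume m: "ridge_model \<mu> (\<nu> d) (n d) d (p d) l"
    have d: "0 < d" using m by (simp add: ridge_model_def ridge_model_axioms_def)
    have "(2 * quad_const * (1 / real d) + 2 * (real (p d) / real d)) * \<epsilon>Q d = (2 * quad_const + real (2 * p d)) * \<epsilon>Q d / d"
      by (simp add: add_divide_distrib distrib_right)
    then have "sqrt ((2 * quad_const * (1 / real d) + 2 * (real (p d) / real d)) * \<epsilon>Q d) = sqrt ((2 * quad_const + real (2 * p d)) * \<epsilon>Q d) / sqrt d"
      by (simp only: real_sqrt_divide)
    moreover have "sqrt (quad_const * (1 / real d)) = sqrt quad_const / sqrt d" "sqrt (1 / real d) = 1 / sqrt d"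
      by (simp_all add: real_sqrt_divide)
    ultimately show "?f d = \<epsilon>D d / sqrt d"
      unfolding ridge_model.eD_def[OF m t_facts(1,2)] by (simp add: add_divide_distrib mult.commute)
  qed
  ultimately show ?thesis by (rule limit_cong) simp
qed

lemma eF_limit: "(\<lambda>d. ridge_model.eF \<mu> d l / d) \<longlonglongrightarrow> 0"
proof -
  let ?f = "\<lambda>d. sqrt (quad_const * (1 / real d)) / l + 2 * sqrt (quad_const / l * (1 / real d)) / l"
  have "?f \<longlonglongrightarrow> sqrt (quad_const * 0) / l + 2 * sqrt (quad_const / l * 0) / l"
    using l by (intro tendsto_intros lim_1_over_n) auto
  moreover have "\<forall>\<^sub>F d in sequentially. ?f d = ridge_model.eF \<mu> d l / d"
    using eventually_model[OF l]
  proof eventually_elim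
    fix d assume m: "ridge_model \<mu> (\<nu> d) (n d) d (p d) l"
    have d: "0 < d" using m by (simp add: ridge_model_def ridge_model_axioms_def)
    have "sqrt (c * (1 / real d)) = sqrt (c * d) / d" for c
    proof -
      have "c * (1 / real d) = c * d / (real d)\<^sup>2" using d by (simp add: power2_eq_square)
      then show ?thesis using d by (simp add: real_sqrt_divide)
    qed
    from this[of quad_const] this[of "quad_const / l"]
    show "?f d = ridge_model.eF \<mu> d l / d"
      unfolding ridge_model.eF_def[OF m] by (simp add: add_divide_distrib mult.commute)
  qed
  ultimately show ?thesis by (rule limit_cong) simp
qed

lemma trace1_limit: "(\<lambda>d. trace1 \<mu> (\<nu> d) (n d) d (p d) l) \<longlonglongrightarrow> \<gamma> * theta1 \<gamma> l"
proof (rule vanishing_bound)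
  show "\<forall>\<^sub>F d in sequentially. \<bar>trace1 \<mu> (\<nu> d) (n d) d (p d) l - t\<bar> \<le> sqrt (\<epsilon>T d)"
    using eventually_model[OF l] by eventually_elim (rule ridge_model.t1_close[OF _ t_facts(1,2)])
  show "(\<lambda>d. sqrt (\<epsilon>T d)) \<longlonglongrightarrow> 0" using tendsto_real_sqrt[OF eT_limit] by simp
  show "(\<lambda>_. t) \<longlonglongrightarrow> \<gamma> * theta1 \<gamma> l" by (simp add: t_def)
qed

end

lemma trace2_limit:
  assumes l: "0 < l"
  shows "(\<lambda>d. trace2 \<mu> (\<nu> d) (n d) d (p d) l) \<longlonglongrightarrow> \<gamma> * theta2 \<gamma> l"
proof (rule difference_quotient_squeeze[where f = "\<lambda>d l. trace1 \<mu> (\<nu> d) (n d) d (p d) l" and \<tau> = "\<lambda>l. \<gamma> * theta1 \<gamma> l"])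
  show "(\<lambda>d. trace1 \<mu> (\<nu> d) (n d) d (p d) l) \<longlonglongrightarrow> \<gamma> * theta1 \<gamma> l" if "0 < l" for l by (rule trace1_limit[OF that])
  show "((\<lambda>l. \<gamma> * theta1 \<gamma> l) has_real_derivative - (\<gamma> * theta2 \<gamma> l)) (at l)"
    using DERIV_cmult[OF theta1_derivative[OF gamma_pos l], of \<gamma>] by simp
  fix k k' :: real assume k: "0 < k" "k < k'"
  show "\<forall>\<^sub>F d in sequentially. trace2 \<mu> (\<nu> d) (n d) d (p d) k'
        \<le> (trace1 \<mu> (\<nu> d) (n d) d (p d) k - trace1 \<mu> (\<nu> d) (n d) d (p d) k') / (k' - k) \<and>
      (trace1 \<mu> (\<nu> d) (n d) d (p d) k - trace1 \<mu> (\<nu> d) (n d) d (p d) k') / (k' - k) \<le> trace2 \<mu> (\<nu> d) (n d) d (p d) k"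
    using eventually_model[OF k(1)] eventually_model[OF less_trans[OF k]]
    by eventually_elim (use trace_squeeze k(2) in blast)
qed (rule l)

section \<open>Limits of the second moments and of the risk\<close>

context
  fixes l :: real
  assumes l: "0 < l"
begin

abbreviation "th1 \<equiv> theta1 \<gamma> l"
abbreviation "th2 \<equiv> theta2 \<gamma> l"

lemma SK_limit: "(\<lambda>d. ridge_model.SK \<mu> (\<nu> d) (n d) d (p d) l) \<longlonglongrightarrow> \<gamma> * (th1 - l * th2)"
proof -
  have "(\<lambda>d. trace1 \<mu> (\<nu> d) (n d) d (p d) l - l * trace2 \<mu> (\<nu> d) (n d) d (p d) l) \<longlonglongrightarrow> \<gamma> * th1 - l * (\<gamma> * th2)"
    by (intro tendsto_intros trace1_limit trace2_limit l)
  moreover have "\<forall>\<^sub>F d in sequentially. trace1 \<mu> (\<nu> d) (n d) d (p d) l - l * trace2 \<mu> (\<nu> d) (n d) d (p d) l = ridge_model.SK \<mu> (\<nu> d) (n d) d (p d) l"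
    using eventually_model[OF l] by eventually_elim (rule ridge_model.SK_eq[symmetric])
  ultimately have "(\<lambda>d. ridge_model.SK \<mu> (\<nu> d) (n d) d (p d) l) \<longlonglongrightarrow> \<gamma> * th1 - l * (\<gamma> * th2)" by (rule limit_cong) simp
  then show ?thesis by (simp add: algebra_simps)
qed

lemma TM_limit: "(\<lambda>d. ridge_model.TM \<mu> (\<nu> d) (n d) d (p d) l / d) \<longlonglongrightarrow> \<pi> * (1 - l * th1)"
proof -
  have "(\<lambda>d. real (p d) / real d - l * (real (n d) / real d) * trace1 \<mu> (\<nu> d) (n d) d (p d) l) \<longlonglongrightarrow> \<pi> - l * (1 / \<delta>) * (\<gamma> * th1)"
    by (intro tendsto_intros trace1_limit l p_lim n_over_d)
  moreover have "\<forall>\<^sub>F d in sequentially. real (p d) / real d - l * (real (n d) / real d) * trace1 \<mu> (\<nu> d) (n d) d (p d) l = ridge_model.TM \<mu> (\<nu> d) (n d) d (p d) l / d"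
    using eventually_model[OF l] by eventually_elim (simp add: ridge_model.TM_eq diff_divide_distrib)
  ultimately have "(\<lambda>d. ridge_model.TM \<mu> (\<nu> d) (n d) d (p d) l / d) \<longlonglongrightarrow> \<pi> - l * (1 / \<delta>) * (\<gamma> * th1)" by (rule limit_cong) simp
  then show ?thesis using delta_pos by (simp add: \<gamma>_def algebra_simps)
qed

lemma SA_limit: "(\<lambda>d. ridge_model.SA \<mu> (\<nu> d) (n d) d (p d) l / d)
    \<longlonglongrightarrow> \<pi> * (1 - 2 * l * th1 + l\<^sup>2 * th2) + (1 - \<pi>) * (\<gamma> * (th1 - l * th2))"
proof (rule vanishing_bound[OF _ eF_limit[OF l]])
  let ?t1 = "\<lambda>d. trace1 \<mu> (\<nu> d) (n d) d (p d) l" and ?t2 = "\<lambda>d. trace2 \<mu> (\<nu> d) (n d) d (p d) l"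
  let ?c = "\<lambda>d. real (p d) / real d - 2 * l * (real (n d) / real d) * ?t1 d + l\<^sup>2 * (real (n d) / real d) * ?t2 d
      + (1 - real (p d) / real d) * (?t1 d - l * ?t2 d)"
  show "\<forall>\<^sub>F d in sequentially. \<bar>ridge_model.SA \<mu> (\<nu> d) (n d) d (p d) l / d - ?c d\<bar> \<le> ridge_model.eF \<mu> d l / d"
    using eventually_model[OF l]
  proof eventually_elim
    fix d assume m: "ridge_model \<mu> (\<nu> d) (n d) d (p d) l"
    have d: "0 < real d" using m by (simp add: ridge_model_def ridge_model_axioms_def)
    have "?c d = (p d - 2 * l * n d * ?t1 d + l\<^sup>2 * n d * ?t2 d + (real d - real (p d)) * (?t1 d - l * ?t2 d)) / d"
      using d by (simp add: add_divide_distrib diff_divide_distrib left_diff_distrib)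
    then have "ridge_model.SA \<mu> (\<nu> d) (n d) d (p d) l / d - ?c d = (ridge_model.SA \<mu> (\<nu> d) (n d) d (p d) l
        - (p d - 2 * l * n d * ?t1 d + l\<^sup>2 * n d * ?t2 d + (real d - real (p d)) * (?t1 d - l * ?t2 d))) / d"
      by (simp only: diff_divide_distrib)
    then show "\<bar>ridge_model.SA \<mu> (\<nu> d) (n d) d (p d) l / d - ?c d\<bar> \<le> ridge_model.eF \<mu> d l / d"
      using divide_right_mono[OF ridge_model.SA_close[OF m], of "real d"] d by simp
  qed
  have "?c \<longlonglongrightarrow> \<pi> - 2 * l * (1 / \<delta>) * (\<gamma> * th1) + l\<^sup>2 * (1 / \<delta>) * (\<gamma> * th2) + (1 - \<pi>) * (\<gamma> * th1 - l * (\<gamma> * th2))"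
    by (intro tendsto_intros trace1_limit trace2_limit l p_lim n_over_d)
  \<comment> \<open>The factors n / d and \<gamma> combine to \<gamma> / \<delta> = \<pi>.\<close>
  then show "?c \<longlonglongrightarrow> \<pi> * (1 - 2 * l * th1 + l\<^sup>2 * th2) + (1 - \<pi>) * (\<gamma> * (th1 - l * th2))"
    using delta_pos by (simp add: \<gamma>_def algebra_simps)
qed

lemma SW_limit: "(\<lambda>d. ridge_model.SW \<mu> (\<nu> d) (n d) d (p d) l / d) \<longlonglongrightarrow> (1 - l * th1)\<^sup>2 * \<pi>"
proof (rule vanishing_bound)
  let ?k = "\<kappa> l" and ?e = "\<lambda>d. ridge_model.eD \<mu> (n d) (p d) l \<gamma>"
  let ?g = "\<lambda>d. 2 * (?e d / sqrt d) * (2 * ?k * sqrt (real (p d) / real d) + 2 * (?e d / sqrt d))"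
  show "\<forall>\<^sub>F d in sequentially. \<bar>ridge_model.SW \<mu> (\<nu> d) (n d) d (p d) l / d - ?k\<^sup>2 * (real (p d) / real d)\<bar> \<le> ?g d"
    using eventually_model[OF l]
  proof eventually_elim
    fix d assume m: "ridge_model \<mu> (\<nu> d) (n d) d (p d) l"
    have d: "0 < real d" using m by (simp add: ridge_model_def ridge_model_axioms_def)
    have "2 * a * (2 * k * b + 2 * a) / (c * c) = 2 * (a / c) * (2 * k * (b / c) + 2 * (a / c))" if "0 < c" for a b c k :: real
      using that by (simp add: field_simps)
    from this[of "sqrt d" "?e d" ?k "sqrt (p d)"]
    have "2 * ?e d * (2 * ?k * sqrt (p d) + 2 * ?e d) / d = ?g d" using d by (simp add: real_sqrt_divide)
    moreover have "\<bar>ridge_model.SW \<mu> (\<nu> d) (n d) d (p d) l - ?k\<^sup>2 * p d\<bar> / d \<le> 2 * ?e d * (2 * ?k * sqrt (p d) + 2 * ?e d) / d"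
      using divide_right_mono[OF ridge_model.SW_close[OF m t_facts(1,2)[OF l]], of "real d"] kappa_eq[OF l] d by simp
    moreover have "ridge_model.SW \<mu> (\<nu> d) (n d) d (p d) l / d - ?k\<^sup>2 * (real (p d) / real d) = (ridge_model.SW \<mu> (\<nu> d) (n d) d (p d) l - ?k\<^sup>2 * p d) / d"
      by (simp add: diff_divide_distrib)
    ultimately show "\<bar>ridge_model.SW \<mu> (\<nu> d) (n d) d (p d) l / d - ?k\<^sup>2 * (real (p d) / real d)\<bar> \<le> ?g d" using d by simp
  qed
  have "?g \<longlonglongrightarrow> 2 * 0 * (2 * ?k * sqrt \<pi> + 2 * 0)" by (intro tendsto_intros eD_limit l p_lim)
  then show "?g \<longlonglongrightarrow> 0" by simp
  show "(\<lambda>d. ?k\<^sup>2 * (real (p d) / real d)) \<longlonglongrightarrow> (1 - l * th1)\<^sup>2 * \<pi>"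
    unfolding \<kappa>_def[OF l] by (intro tendsto_intros p_lim)
qed

lemma SM_limit: "(\<lambda>d. ridge_model.SM \<mu> (\<nu> d) (n d) d (p d) l / d) \<longlonglongrightarrow> ((1 - l * th1) * \<pi>)\<^sup>2"
proof -
  let ?k = "\<kappa> l" and ?e = "\<lambda>d. ridge_model.eD \<mu> (n d) (p d) l \<gamma>" and ?SM = "\<lambda>d. ridge_model.SM \<mu> (\<nu> d) (n d) d (p d) l"
  have "(\<lambda>d. sqrt (?SM d) / sqrt d) \<longlonglongrightarrow> ?k * \<pi>"
  proof (rule vanishing_bound)
    show "\<forall>\<^sub>F d in sequentially. \<bar>sqrt (?SM d) / sqrt d - ?k * (real (p d) / real d)\<bar> \<le> 2 * (?e d / sqrt d)"
      using eventually_model[OF l]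
    proof eventually_elim
      fix d assume m: "ridge_model \<mu> (\<nu> d) (n d) d (p d) l"
      have d: "0 < real d" using m by (simp add: ridge_model_def ridge_model_axioms_def)
      have "\<bar>sqrt (?SM d) - ?k * (p d / sqrt d)\<bar> / sqrt d \<le> 2 * ?e d / sqrt d"
        using divide_right_mono[OF ridge_model.SM_close[OF m t_facts(1,2)[OF l]], of "sqrt d"] kappa_eq[OF l] d by simp
      moreover have "sqrt (?SM d) / sqrt d - ?k * (real (p d) / real d) = (sqrt (?SM d) - ?k * (p d / sqrt d)) / sqrt d"
        using d by (simp add: diff_divide_distrib)
      ultimately show "\<bar>sqrt (?SM d) / sqrt d - ?k * (real (p d) / real d)\<bar> \<le> 2 * (?e d / sqrt d)" by simp
    qed
    show "(\<lambda>d. 2 * (?e d / sqrt d)) \<longlonglongrightarrow> 0" using tendsto_mult_left[OF eD_limit[OF l], of 2] by simp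
    show "(\<lambda>d. ?k * (real (p d) / real d)) \<longlonglongrightarrow> ?k * \<pi>" by (intro tendsto_intros p_lim)
  qed
  from tendsto_power[OF this, of 2]
  have "(\<lambda>d. (sqrt (?SM d) / sqrt d)\<^sup>2) \<longlonglongrightarrow> ((1 - l * th1) * \<pi>)\<^sup>2" by (simp add: \<kappa>_def[OF l])
  moreover have "\<forall>\<^sub>F d in sequentially. (sqrt (?SM d) / sqrt d)\<^sup>2 = ?SM d / d"
    using eventually_model[OF l]
  proof eventually_elim
    fix d assume m: "ridge_model \<mu> (\<nu> d) (n d) d (p d) l"
    have "0 \<le> ?SM d" unfolding ridge_model.SM_def[OF m] by (intro sum_nonneg) simp
    then show "(sqrt (?SM d) / sqrt d)\<^sup>2 = ?SM d / d" by (simp add: power_divide)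
  qed
  ultimately show ?thesis by (rule limit_cong) simp
qed

text \<open>Apart from the squared bias, the limits are left in the shape in which the second
  moments combine; the published forms differ from them by polynomial identities in
  \<open>theta1\<close> and \<open>theta2\<close>.\<close>

lemma risk_limits:
  fixes \<alpha> \<sigma> :: real
  shows "(\<lambda>d. Bias2 \<mu> (\<nu> d) \<alpha> \<sigma> (n d) (p d) d l) \<longlonglongrightarrow> \<alpha>\<^sup>2 * (1 - \<pi> + l * \<pi> * th1)\<^sup>2"
    and "(\<lambda>d. Var \<mu> (\<nu> d) \<alpha> \<sigma> (n d) (p d) d l)
      \<longlonglongrightarrow> \<alpha>\<^sup>2 * (\<pi> * (1 - 2 * l * th1 + l\<^sup>2 * th2) + (1 - \<pi>) * (\<gamma> * (th1 - l * th2)) - ((1 - l * th1) * \<pi>)\<^sup>2)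
        + \<sigma>\<^sup>2 * (\<gamma> * (th1 - l * th2))"
    and "(\<lambda>d. Sigma_label \<mu> (\<nu> d) \<alpha> \<sigma> (n d) (p d) d l) \<longlonglongrightarrow> \<sigma>\<^sup>2 * (\<gamma> * (th1 - l * th2))"
    and "(\<lambda>d. Sigma_sample \<mu> (\<nu> d) \<alpha> \<sigma> (n d) (p d) d l)
      \<longlonglongrightarrow> \<alpha>\<^sup>2 * (\<pi> * (1 - 2 * l * th1 + l\<^sup>2 * th2) + (1 - \<pi>) * (\<gamma> * (th1 - l * th2)) - (1 - l * th1)\<^sup>2 * \<pi>)"
    and "(\<lambda>d. Sigma_init \<mu> (\<nu> d) \<alpha> \<sigma> (n d) (p d) d l) \<longlonglongrightarrow> \<alpha>\<^sup>2 * ((1 - l * th1)\<^sup>2 * \<pi> - ((1 - l * th1) * \<pi>)\<^sup>2)"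
    and "(\<lambda>d. MSE \<mu> (\<nu> d) \<alpha> \<sigma> (n d) (p d) d l)
      \<longlonglongrightarrow> \<alpha>\<^sup>2 * (\<pi> * (1 - 2 * l * th1 + l\<^sup>2 * th2) + (1 - \<pi>) * (\<gamma> * (th1 - l * th2)) - 2 * (\<pi> * (1 - l * th1)) + 1)
        + \<sigma>\<^sup>2 * (\<gamma> * (th1 - l * th2)) + \<sigma>\<^sup>2"
proof -
  let ?SA = "\<lambda>d. ridge_model.SA \<mu> (\<nu> d) (n d) d (p d) l" and ?SW = "\<lambda>d. ridge_model.SW \<mu> (\<nu> d) (n d) d (p d) l"
  let ?SM = "\<lambda>d. ridge_model.SM \<mu> (\<nu> d) (n d) d (p d) l" and ?SK = "\<lambda>d. ridge_model.SK \<mu> (\<nu> d) (n d) d (p d) l"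
  let ?TM = "\<lambda>d. ridge_model.TM \<mu> (\<nu> d) (n d) d (p d) l"
  note lims = SA_limit SW_limit SM_limit SK_limit TM_limit
  have transfer: "g \<longlonglongrightarrow> L" if "f \<longlonglongrightarrow> L" "\<And>d. ridge_model \<mu> (\<nu> d) (n d) d (p d) l \<Longrightarrow> f d = g d" for f g :: "nat \<Rightarrow> real" and L
  proof -
    have "\<forall>\<^sub>F d in sequentially. f d = g d" using eventually_model[OF l] by eventually_elim (rule that(2))
    with that(1) show ?thesis by (rule limit_cong) simp
  qed
  have scale: "c / d * (x - 2 * y + d) = c * (x / d - 2 * (y / d) + 1)"
    if "ridge_model \<mu> (\<nu> d) (n d) d (p d) l" for c x y :: real and d
    using that by (simp add: ridge_model_def ridge_model_axioms_def field_simps)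
  have "(\<lambda>d. \<alpha>\<^sup>2 * (?SM d / d - 2 * (?TM d / d) + 1)) \<longlonglongrightarrow> \<alpha>\<^sup>2 * (((1 - l * th1) * \<pi>)\<^sup>2 - 2 * (\<pi> * (1 - l * th1)) + 1)"
    by (intro tendsto_intros lims)
  then have "(\<lambda>d. Bias2 \<mu> (\<nu> d) \<alpha> \<sigma> (n d) (p d) d l) \<longlonglongrightarrow> \<alpha>\<^sup>2 * (((1 - l * th1) * \<pi>)\<^sup>2 - 2 * (\<pi> * (1 - l * th1)) + 1)"
    by (rule transfer) (use scale in \<open>simp add: ridge_model.Bias2_eq\<close>)
  moreover have "((1 - l * th1) * \<pi>)\<^sup>2 - 2 * (\<pi> * (1 - l * th1)) + 1 = (1 - \<pi> + l * \<pi> * th1)\<^sup>2"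
    by (simp add: power2_eq_square algebra_simps)
  ultimately show "(\<lambda>d. Bias2 \<mu> (\<nu> d) \<alpha> \<sigma> (n d) (p d) d l) \<longlonglongrightarrow> \<alpha>\<^sup>2 * (1 - \<pi> + l * \<pi> * th1)\<^sup>2" by simp
  have "(\<lambda>d. \<alpha>\<^sup>2 * (?SA d / d - ?SM d / d) + \<sigma>\<^sup>2 * ?SK d) \<longlonglongrightarrow> \<alpha>\<^sup>2 * (\<pi> * (1 - 2 * l * th1 + l\<^sup>2 * th2) + (1 - \<pi>) * (\<gamma> * (th1 - l * th2)) - ((1 - l * th1) * \<pi>)\<^sup>2)
        + \<sigma>\<^sup>2 * (\<gamma> * (th1 - l * th2))"
    by (intro tendsto_intros lims)
  then show "(\<lambda>d. Var \<mu> (\<nu> d) \<alpha> \<sigma> (n d) (p d) d l)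
      \<longlonglongrightarrow> \<alpha>\<^sup>2 * (\<pi> * (1 - 2 * l * th1 + l\<^sup>2 * th2) + (1 - \<pi>) * (\<gamma> * (th1 - l * th2)) - ((1 - l * th1) * \<pi>)\<^sup>2)
        + \<sigma>\<^sup>2 * (\<gamma> * (th1 - l * th2))"
    by (rule transfer) (simp add: ridge_model.Var_eq right_diff_distrib)
  have "(\<lambda>d. \<sigma>\<^sup>2 * ?SK d) \<longlonglongrightarrow> \<sigma>\<^sup>2 * (\<gamma> * (th1 - l * th2))" by (intro tendsto_intros lims)
  then show "(\<lambda>d. Sigma_label \<mu> (\<nu> d) \<alpha> \<sigma> (n d) (p d) d l) \<longlonglongrightarrow> \<sigma>\<^sup>2 * (\<gamma> * (th1 - l * th2))"
    by (rule transfer) (simp add: ridge_model.Sigma_label_eq)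
  have "(\<lambda>d. \<alpha>\<^sup>2 * (?SA d / d - ?SW d / d)) \<longlonglongrightarrow> \<alpha>\<^sup>2 * (\<pi> * (1 - 2 * l * th1 + l\<^sup>2 * th2) + (1 - \<pi>) * (\<gamma> * (th1 - l * th2)) - (1 - l * th1)\<^sup>2 * \<pi>)"
    by (intro tendsto_intros lims)
  then show "(\<lambda>d. Sigma_sample \<mu> (\<nu> d) \<alpha> \<sigma> (n d) (p d) d l)
      \<longlonglongrightarrow> \<alpha>\<^sup>2 * (\<pi> * (1 - 2 * l * th1 + l\<^sup>2 * th2) + (1 - \<pi>) * (\<gamma> * (th1 - l * th2)) - (1 - l * th1)\<^sup>2 * \<pi>)"
    by (rule transfer) (simp add: ridge_model.Sigma_sample_eq right_diff_distrib)
  have "(\<lambda>d. \<alpha>\<^sup>2 * (?SW d / d - ?SM d / d)) \<longlonglongrightarrow> \<alpha>\<^sup>2 * ((1 - l * th1)\<^sup>2 * \<pi> - ((1 - l * th1) * \<pi>)\<^sup>2)"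
    by (intro tendsto_intros lims)
  then show "(\<lambda>d. Sigma_init \<mu> (\<nu> d) \<alpha> \<sigma> (n d) (p d) d l) \<longlonglongrightarrow> \<alpha>\<^sup>2 * ((1 - l * th1)\<^sup>2 * \<pi> - ((1 - l * th1) * \<pi>)\<^sup>2)"
    by (rule transfer) (simp add: ridge_model.Sigma_init_eq right_diff_distrib)
  have "(\<lambda>d. \<alpha>\<^sup>2 * (?SA d / d - 2 * (?TM d / d) + 1) + \<sigma>\<^sup>2 * ?SK d + \<sigma>\<^sup>2)
      \<longlonglongrightarrow> \<alpha>\<^sup>2 * (\<pi> * (1 - 2 * l * th1 + l\<^sup>2 * th2) + (1 - \<pi>) * (\<gamma> * (th1 - l * th2)) - 2 * (\<pi> * (1 - l * th1)) + 1)
        + \<sigma>\<^sup>2 * (\<gamma> * (th1 - l * th2)) + \<sigma>\<^sup>2"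
    by (intro tendsto_intros lims)
  then show "(\<lambda>d. MSE \<mu> (\<nu> d) \<alpha> \<sigma> (n d) (p d) d l)
      \<longlonglongrightarrow> \<alpha>\<^sup>2 * (\<pi> * (1 - 2 * l * th1 + l\<^sup>2 * th2) + (1 - \<pi>) * (\<gamma> * (th1 - l * th2)) - 2 * (\<pi> * (1 - l * th1)) + 1)
        + \<sigma>\<^sup>2 * (\<gamma> * (th1 - l * th2)) + \<sigma>\<^sup>2"
    by (rule transfer) (use scale in \<open>simp add: ridge_model.MSE_eq\<close>)
qed

end

end

theorem corollary3:
  fixes \<alpha> \<sigma> \<pi> \<delta> \<eta> :: real
    and p n :: "nat \<Rightarrow> nat"
    and \<mu> :: "real measure"
    and \<nu> :: "nat \<Rightarrow> (nat \<times> nat \<Rightarrow> real) measure"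
  assumes "\<alpha> > 0" and "\<sigma> \<ge> 0"
    and "0 < \<pi>" and "\<pi> \<le> 1" and "\<delta> > 0"
    and "\<And>d. p d \<le> d"
    and "(\<lambda>d. real (p d) / real d) \<longlonglongrightarrow> \<pi>"
    and "(\<lambda>d. real d / real (n d)) \<longlonglongrightarrow> \<delta>"
    and "prob_space \<mu>" and "sets \<mu> = sets borel"
    and "(\<integral>t. t \<partial>\<mu>) = 0" and "(\<integral>t. t^2 \<partial>\<mu>) = 1"
    and "\<eta> > 0" and "integrable \<mu> (\<lambda>t. \<bar>t\<bar> powr (8 + \<eta>))"
    and "\<And>d. uniform_orthonormal_rows (p d) d (\<nu> d)"
  shows "(\<forall>l>0.
      (\<lambda>d. Bias2 \<mu> (\<nu> d) \<alpha> \<sigma> (n d) (p d) d l)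
        \<longlonglongrightarrow> \<alpha>^2 * (1 - \<pi> + l * \<pi> * theta1 (\<pi> * \<delta>) l)^2 \<and>
      (\<lambda>d. Var \<mu> (\<nu> d) \<alpha> \<sigma> (n d) (p d) d l)
        \<longlonglongrightarrow> \<alpha>^2 * \<pi> * (1 - \<pi> + (\<pi> - 1) * (2 * l - \<delta>) * theta1 (\<pi> * \<delta>) l
                        - \<pi> * l^2 * (theta1 (\<pi> * \<delta>) l)^2
                        + l * (l - \<delta> + \<pi> * \<delta>) * theta2 (\<pi> * \<delta>) l)
            + \<sigma>^2 * \<pi> * \<delta> * (theta1 (\<pi> * \<delta>) l - l * theta2 (\<pi> * \<delta>) l) \<and>
      (\<lambda>d. Sigma_label \<mu> (\<nu> d) \<alpha> \<sigma> (n d) (p d) d l)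
        \<longlonglongrightarrow> \<sigma>^2 * \<pi> * \<delta> * (theta1 (\<pi> * \<delta>) l - l * theta2 (\<pi> * \<delta>) l) \<and>
      (\<lambda>d. Sigma_sample \<mu> (\<nu> d) \<alpha> \<sigma> (n d) (p d) d l)
        \<longlonglongrightarrow> \<alpha>^2 * \<pi> * (- (l^2) * (theta1 (\<pi> * \<delta>) l)^2 + l^2 * theta2 (\<pi> * \<delta>) l
                        + (1 - \<pi>) * \<delta> * (theta1 (\<pi> * \<delta>) l - l * theta2 (\<pi> * \<delta>) l)) \<and>
      (\<lambda>d. Sigma_init \<mu> (\<nu> d) \<alpha> \<sigma> (n d) (p d) d l)
        \<longlonglongrightarrow> \<alpha>^2 * \<pi> * (1 - \<pi>) * (1 - l * theta1 (\<pi> * \<delta>) l)^2 \<and>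
      (\<lambda>d. MSE \<mu> (\<nu> d) \<alpha> \<sigma> (n d) (p d) d l) \<longlonglongrightarrow> limit_MSE \<alpha> \<sigma> \<pi> \<delta> l) \<and>
    (\<not> (\<pi> = 1 \<and> \<sigma> = 0) \<longrightarrow>
      (\<forall>l. is_arg_min (limit_MSE \<alpha> \<sigma> \<pi> \<delta>) (\<lambda>l. l > 0) l \<longleftrightarrow> l = \<delta> * (1 - \<pi> + \<sigma>^2 / \<alpha>^2)))"
proof -
  interpret prob_space \<mu> by fact
  \<comment> \<open>The moment of order 8 + \<eta> dominates the fourth power where |t| > 1, and the
    constant 1 does so elsewhere.\<close>
  have "integrable \<mu> (\<lambda>t. t ^ 4)"
  proof (rule Bochner_Integration.integrable_bound)
    show "integrable \<mu> (\<lambda>t. 1 + \<bar>t\<bar> powr (8 + \<eta>))" using assms(14) by simp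
    show "(\<lambda>t. t ^ 4) \<in> borel_measurable \<mu>" by (subst measurable_cong_sets[OF assms(10) refl]) simp
    show "AE t in \<mu>. norm (t ^ 4) \<le> norm (1 + \<bar>t\<bar> powr (8 + \<eta>))"
    proof (rule AE_I2)
      fix t :: real
      show "norm (t ^ 4) \<le> norm (1 + \<bar>t\<bar> powr (8 + \<eta>))"
      proof (cases "\<bar>t\<bar> \<le> 1")
        case True
        then have "\<bar>t\<bar> ^ 4 \<le> 1" by (intro power_le_one) auto
        then show ?thesis by (simp add: power_abs add_increasing2)
      next
        case False
        then have "\<bar>t\<bar> powr 4 \<le> \<bar>t\<bar> powr (8 + \<eta>)" using assms(13) by (intro powr_mono) auto
        moreover have "\<bar>t\<bar> powr 4 = \<bar>t\<bar> ^ 4" using False powr_realpow[of "\<bar>t\<bar>" 4] by simp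
        ultimately have "\<bar>t\<bar> ^ 4 \<le> 1 + \<bar>t\<bar> powr (8 + \<eta>)" by linarith
        then show ?thesis by (simp add: power_abs)
      qed
    qed
  qed
  then interpret ridge_asymptotics \<mu> \<pi> \<delta> p n \<nu>
    by unfold_locales (use assms in auto)
  have g: "\<gamma> = \<pi> * \<delta>" by (rule \<gamma>_def)
  have "(\<lambda>d. Bias2 \<mu> (\<nu> d) \<alpha> \<sigma> (n d) (p d) d l)
        \<longlonglongrightarrow> \<alpha>^2 * (1 - \<pi> + l * \<pi> * theta1 (\<pi> * \<delta>) l)^2 \<and>
      (\<lambda>d. Var \<mu> (\<nu> d) \<alpha> \<sigma> (n d) (p d) d l)
        \<longlonglongrightarrow> \<alpha>^2 * \<pi> * (1 - \<pi> + (\<pi> - 1) * (2 * l - \<delta>) * theta1 (\<pi> * \<delta>) l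
                        - \<pi> * l^2 * (theta1 (\<pi> * \<delta>) l)^2
                        + l * (l - \<delta> + \<pi> * \<delta>) * theta2 (\<pi> * \<delta>) l)
            + \<sigma>^2 * \<pi> * \<delta> * (theta1 (\<pi> * \<delta>) l - l * theta2 (\<pi> * \<delta>) l) \<and>
      (\<lambda>d. Sigma_label \<mu> (\<nu> d) \<alpha> \<sigma> (n d) (p d) d l)
        \<longlonglongrightarrow> \<sigma>^2 * \<pi> * \<delta> * (theta1 (\<pi> * \<delta>) l - l * theta2 (\<pi> * \<delta>) l) \<and>
      (\<lambda>d. Sigma_sample \<mu> (\<nu> d) \<alpha> \<sigma> (n d) (p d) d l)
        \<longlonglongrightarrow> \<alpha>^2 * \<pi> * (- (l^2) * (theta1 (\<pi> * \<delta>) l)^2 + l^2 * theta2 (\<pi> * \<delta>) l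
                        + (1 - \<pi>) * \<delta> * (theta1 (\<pi> * \<delta>) l - l * theta2 (\<pi> * \<delta>) l)) \<and>
      (\<lambda>d. Sigma_init \<mu> (\<nu> d) \<alpha> \<sigma> (n d) (p d) d l)
        \<longlonglongrightarrow> \<alpha>^2 * \<pi> * (1 - \<pi>) * (1 - l * theta1 (\<pi> * \<delta>) l)^2 \<and>
      (\<lambda>d. MSE \<mu> (\<nu> d) \<alpha> \<sigma> (n d) (p d) d l) \<longlonglongrightarrow> limit_MSE \<alpha> \<sigma> \<pi> \<delta> l"
    if l: "l > 0" for l
  proof -
    define x y where xy: "x = theta1 (\<pi> * \<delta>) l" "y = theta2 (\<pi> * \<delta>) l"
    note lim = risk_limits[OF l, of \<alpha> \<sigma>, unfolded g, folded xy]
    have eq: "f \<longlonglongrightarrow> M" if "f \<longlonglongrightarrow> L" "L = M" for f :: "nat \<Rightarrow> real" and L M using that by simp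
    show ?thesis unfolding xy[symmetric]
    proof (intro conjI)
    show "(\<lambda>d. Bias2 \<mu> (\<nu> d) \<alpha> \<sigma> (n d) (p d) d l) \<longlonglongrightarrow> \<alpha>^2 * (1 - \<pi> + l * \<pi> * x)^2"
      by (rule lim)
    show "(\<lambda>d. Var \<mu> (\<nu> d) \<alpha> \<sigma> (n d) (p d) d l)
        \<longlonglongrightarrow> \<alpha>^2 * \<pi> * (1 - \<pi> + (\<pi> - 1) * (2 * l - \<delta>) * x - \<pi> * l^2 * x^2 + l * (l - \<delta> + \<pi> * \<delta>) * y)
            + \<sigma>^2 * \<pi> * \<delta> * (x - l * y)"
      by (rule eq[OF lim(2)]) Groebner_Basis.algebra
    show "(\<lambda>d. Sigma_label \<mu> (\<nu> d) \<alpha> \<sigma> (n d) (p d) d l) \<longlonglongrightarrow> \<sigma>^2 * \<pi> * \<delta> * (x - l * y)"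
      by (rule eq[OF lim(3)]) (simp add: mult.assoc)
    show "(\<lambda>d. Sigma_sample \<mu> (\<nu> d) \<alpha> \<sigma> (n d) (p d) d l)
        \<longlonglongrightarrow> \<alpha>^2 * \<pi> * (- (l^2) * x^2 + l^2 * y + (1 - \<pi>) * \<delta> * (x - l * y))"
      by (rule eq[OF lim(4)]) Groebner_Basis.algebra
    show "(\<lambda>d. Sigma_init \<mu> (\<nu> d) \<alpha> \<sigma> (n d) (p d) d l) \<longlonglongrightarrow> \<alpha>^2 * \<pi> * (1 - \<pi>) * (1 - l * x)^2"
      by (rule eq[OF lim(5)]) Groebner_Basis.algebra
    have "limit_MSE \<alpha> \<sigma> \<pi> \<delta> l = \<alpha>\<^sup>2 * (\<pi> * (1 - 2 * l * x + l\<^sup>2 * y) + (1 - \<pi>) * (\<pi> * \<delta> * (x - l * y)) - 2 * (\<pi> * (1 - l * x)) + 1)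
        + \<sigma>\<^sup>2 * (\<pi> * \<delta> * (x - l * y)) + \<sigma>\<^sup>2"
    proof -
      \<comment> \<open>Writing \<sigma>^2 = \<alpha>^2 r clears the quotient in
        \<open>limit_MSE\<close>, so that a polynomial identity remains.\<close>
      define r where "r = \<sigma>\<^sup>2 / \<alpha>\<^sup>2"
      have s: "\<sigma>\<^sup>2 = \<alpha>\<^sup>2 * r" using assms(1) by (simp add: r_def)
      show ?thesis unfolding limit_MSE_def r_def[symmetric] xy[symmetric] unfolding s
        by Groebner_Basis.algebra
    qed
    then show "(\<lambda>d. MSE \<mu> (\<nu> d) \<alpha> \<sigma> (n d) (p d) d l) \<longlonglongrightarrow> limit_MSE \<alpha> \<sigma> \<pi> \<delta> l"
      using lim(6) by simp
    qed
  qed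
  then show ?thesis using limit_MSE_minimum[OF assms(1-5)] by blast
qed

end
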